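(* Let $\ell\ge 2$ be an integer, $c\in D(\ell,1)$, and let $F=F_{\ell,c}:Q\to Q$ be the map induced on $Q=\mathbb{C}/2\pi i\mathbb{Z}$ by $f_{\ell,c}(z)=c-(\ell-1)\log c+\ell z-e^z$. The Hausdorff dimension $\mathrm{HD}(\mathcal{J}_r(F))$ of the set $\mathcal{J}_r(F)$ is the unique zero of the pressure function $t\mapsto P(t)$, $t>1$.
   Context: $D(\ell,1)=\{c\in\mathbb{C}:|c-\ell|<1\}$ and $\log$ is the principal branch. Since $f_{\ell,c}(z+2\pi i k)=f_{\ell,c}(z)+2\pi i\ell k$ for $k\in\mathbb{Z}$, $f=f_{\ell,c}$ induces a unique holomorphic map $F:Q\to Q$ with $F\circ\Pi=\Pi\circ f$, where $\Pi:\mathbb{C}\to Q$ is the quotient map. $Q$ carries the flat metric induced from $\mathbb{C}$; $\operatorname{Re}$ is well defined on $Q$; $|F'|$ is defined by $|F'(\Pi(z))|=|f'(z)|=|\ell-e^z|$, and similarly for iterates. The Julia set $\mathcal{J}(f)$ is the complement in $\mathbb{C}$ of the set where the iterates of $f$ form a normal family, and $\mathcal{J}(F)=\Pi(\mathcal{J}(f))\subset Q$. Escaping set and radial (residual) Julia set: $I_\infty(F)=\{z\in\mathcal{J}(F):\lim_{n\to\infty}\operatorname{Re}(F^n(z))=+\infty\}$ and $\mathcal{J}_r(F)=\mathcal{J}(F)\setminus I_\infty(F)$. Pressure: for $t>1$ and $z\in\mathcal{J}(F)$, $P(t)=\lim_{n\to\infty}\frac1n\log\sum_{x\in F^{-n}(z)}|(F^n)'(x)|^{-t}$;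 for $t>1$ this limit exists, is finite, and does not depend on $z\in\mathcal{J}(F)$. *)

theory Defs
  imports "HOL-Complex_Analysis.Complex_Analysis"
begin

section \<open>Hausdorff dimension in metric spaces\<close>

text \<open>
  \<^const>\<open>diameter\<close> is meaningful only for bounded sets, hence the
  boundedness requirement on the covering sets; empty sets have diameter 0, so sequences also
  represent finite covers.
\<close>

definition hausdorff_premeasure :: "real \<Rightarrow> real \<Rightarrow> 'a::metric_space set \<Rightarrow> ennreal" where
  "hausdorff_premeasure s \<delta> A =
     Inf {(\<Sum>i. ennreal (diameter (U i) powr s)) | U :: nat \<Rightarrow> 'a set.
            A \<subseteq> (\<Union>i. U i) \<and> (\<forall>i. bounded (U i) \<and> diameter (U i) \<le> \<delta>)}"

definition hausdorff_measure :: "real \<Rightarrow> 'a::metric_space set \<Rightarrow> ennreal" where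
  "hausdorff_measure s A = (SUP \<delta>\<in>{0<..}. hausdorff_premeasure s \<delta> A)"

text \<open>
  The exponent 0 is left out because \<^term>\<open>0 powr 0 = (0::real)\<close> in HOL;
  this does not change the infimum.
\<close>

definition hausdorff_dim :: "'a::metric_space set \<Rightarrow> ereal" where
  "hausdorff_dim A = Inf {ereal s | s. 0 < s \<and> hausdorff_measure s A = 0}"


section \<open>The cylinder\<close>

definition cyl_rel :: "complex \<Rightarrow> complex \<Rightarrow> bool" where
  "cyl_rel z w \<longleftrightarrow> (\<exists>k::int. w = z + 2 * of_real pi * \<i> * of_int k)"

lemma cyl_rel_iff_exp: "cyl_rel z w \<longleftrightarrow> exp w = exp z"
  unfolding cyl_rel_def exp_eq by (simp add: algebra_simps)

quotient_type cylinder = complex / cyl_rel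
proof (rule equivpI)
  show "reflp cyl_rel" by (simp add: reflp_def cyl_rel_iff_exp)
  show "symp cyl_rel" by (simp add: symp_def cyl_rel_iff_exp)
  show "transp cyl_rel" by (simp add: transp_def cyl_rel_iff_exp)
qed

lift_definition to_cyl :: "complex \<Rightarrow> cylinder" is "\<lambda>z. z" .

lemma to_cyl_eq_iff: "to_cyl z = to_cyl w \<longleftrightarrow> (\<exists>k::int. w = z + 2 * of_real pi * \<i> * of_int k)"
  by transfer (simp add: cyl_rel_def)

lemma to_cyl_eq_iff_exp: "to_cyl z = to_cyl w \<longleftrightarrow> exp z = exp w"
  by transfer (auto simp: cyl_rel_iff_exp)

lemma to_cyl_surj: "\<exists>z. to_cyl z = q"
  by transfer (auto simp: cyl_rel_iff_exp)

text \<open>The flat metric: distance between two points is the distance between their fibres.\<close>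

instantiation cylinder :: metric_space
begin

definition dist_cylinder :: "cylinder \<Rightarrow> cylinder \<Rightarrow> real" where
  "dist_cylinder p q = setdist (to_cyl -` {p}) (to_cyl -` {q})"

definition uniformity_cylinder :: "(cylinder \<times> cylinder) filter" where
  "uniformity_cylinder = (INF e\<in>{0<..}. principal {(x, y). dist x y < e})"

definition open_cylinder :: "cylinder set \<Rightarrow> bool" where
  "open_cylinder U \<longleftrightarrow> (\<forall>x\<in>U. eventually (\<lambda>(x', y). x' = x \<longrightarrow> y \<in> U) uniformity)"

lemma cyl_fibre_nonempty: "to_cyl -` {p} \<noteq> {}"
  using to_cyl_surj[of p] by auto

lemma cyl_fibre_dist_less:
  assumes "dist p q < e" "to_cyl z = p"
  obtains w where "to_cyl w = q" "dist z w < e"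
proof -
  obtain a b where ab: "to_cyl a = p" "to_cyl b = q" "dist a b < e"
    using setdist_ltE[of "to_cyl -` {p}" "to_cyl -` {q}" e] assms(1) cyl_fibre_nonempty
    unfolding dist_cylinder_def by (metis vimage_singleton_eq)
  have "to_cyl a = to_cyl z" using ab assms by simp
  then obtain k :: int where k: "z = a + 2 * of_real pi * \<i> * of_int k"
    unfolding to_cyl_eq_iff by blast
  let ?w = "b + 2 * of_real pi * \<i> * of_int k"
  have "to_cyl b = to_cyl ?w" unfolding to_cyl_eq_iff by blast
  moreover have "dist z ?w = dist a b" unfolding k by (simp add: dist_norm)
  ultimately show thesis using that[of ?w] ab by simp
qed

instance
proof
  fix x y z :: cylinder
  show "(dist x y = 0) = (x = y)"
  proof
    assume xy: "dist x y = 0"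
    obtain a where a: "to_cyl a = x" using to_cyl_surj by blast
    obtain b where b: "to_cyl b = y" using to_cyl_surj by blast
    have S: "to_cyl -` {y} = {w. exp w = exp b}"
      using b by (auto simp: to_cyl_eq_iff_exp[symmetric])
    have "closed {w. exp w = exp b}"
      by (intro closed_Collect_eq continuous_intros)
    hence cl: "closed (to_cyl -` {y})" using S by simp
    have "a \<in> closure (to_cyl -` {y})"
      unfolding closure_approachable
    proof (intro allI impI)
      fix e :: real assume "e > 0"
      then obtain w where "to_cyl w = y" "dist a w < e"
        using cyl_fibre_dist_less[of x y e a] xy a by auto
      thus "\<exists>w\<in>to_cyl -` {y}. dist w a < e" by (auto simp: dist_commute)
    qed
    thus "x = y" using cl a by (simp add: closure_closed)
  next
    assume "x = y"
    thus "dist x y = 0" by (simp add: dist_cylinder_def setdist_refl)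
  qed
  show "dist x y \<le> dist x z + dist y z"
  proof (rule field_le_epsilon)
    fix e :: real assume e: "e > 0"
    obtain c where c: "to_cyl c = z" using to_cyl_surj by blast
    have comm: "dist z x = dist x z" "dist z y = dist y z"
      by (simp_all add: dist_cylinder_def setdist_sym)
    obtain a where a: "to_cyl a = x" "dist c a < dist x z + e / 2"
      using cyl_fibre_dist_less[of z x "dist x z + e / 2" c] c e comm by auto
    obtain b where b: "to_cyl b = y" "dist c b < dist y z + e / 2"
      using cyl_fibre_dist_less[of z y "dist y z + e / 2" c] c e comm by auto
    have "dist x y \<le> dist a b"
      unfolding dist_cylinder_def using a b by (intro setdist_le_dist) auto
    also have "\<dots> \<le> dist c a + dist c b" by (rule dist_triangle3)
    finally show "dist x y \<le> dist x z + dist y z + e" using a b by simp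
  qed
qed (auto simp: uniformity_cylinder_def open_cylinder_def)

end

lift_definition Re_cyl :: "cylinder \<Rightarrow> real" is Re
  by (auto simp: cyl_rel_def)


section \<open>The maps\<close>

definition f_map :: "nat \<Rightarrow> complex \<Rightarrow> complex \<Rightarrow> complex" where
  "f_map l c z = c - (of_nat l - 1) * Ln c + of_nat l * z - exp z"

lemma f_map_shift:
  "f_map l c (z + 2 * of_real pi * \<i> * of_int k)
     = f_map l c z + 2 * of_real pi * \<i> * of_int (int l * k)"
proof -
  have "exp (z + 2 * of_real pi * \<i> * of_int k) = exp z"
    using cyl_rel_iff_exp cyl_rel_def by blast
  thus ?thesis by (simp add: f_map_def algebra_simps)
qed

lemma f_map_iter_shift:
  "(f_map l c ^^ n) (z + 2 * of_real pi * \<i> * of_int k)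
     = (f_map l c ^^ n) z + 2 * of_real pi * \<i> * of_int (int l ^ n * k)"
proof (induction n)
  case (Suc n)
  show ?case
    unfolding funpow.simps comp_apply Suc f_map_shift by (simp add: mult.assoc)
qed simp

lift_definition F_map :: "nat \<Rightarrow> complex \<Rightarrow> cylinder \<Rightarrow> cylinder" is f_map
  unfolding cyl_rel_def using f_map_shift by metis

lemma F_map_to_cyl: "F_map l c (to_cyl z) = to_cyl (f_map l c z)"
  by transfer (simp add: cyl_rel_iff_exp)

lemma f_map_has_field_derivative:
  "(f_map l c has_field_derivative (of_nat l - exp z)) (at z)"
  unfolding f_map_def [abs_def] by (auto intro!: derivative_eq_intros)

lemma f_map_iter_holomorphic: "(f_map l c ^^ n) holomorphic_on UNIV"
proof (induction n)
  case (Suc n)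
  have "f_map l c holomorphic_on UNIV"
    unfolding holomorphic_on_def field_differentiable_def
    using f_map_has_field_derivative by (metis DERIV_subset top_greatest)
  thus ?case using Suc holomorphic_on_compose_gen[of "f_map l c ^^ n" UNIV "f_map l c" UNIV]
    by (simp add: comp_def)
qed (simp add: id_def holomorphic_on_ident)

text \<open>\<open>F_deriv_norm l c n\<close> is \<open>\<bar>(F\<^sup>n)'\<bar>\<close>, read off from \<open>f\<^sup>n\<close> on any lift of the point.\<close>

lift_definition F_deriv_norm :: "nat \<Rightarrow> complex \<Rightarrow> nat \<Rightarrow> cylinder \<Rightarrow> real" is
  "\<lambda>l c n z. cmod (deriv (f_map l c ^^ n) z)"
proof -
  fix l :: nat and c :: complex and n :: nat and z w :: complex
  assume "cyl_rel z w"
  then obtain k :: int where k: "w = z + 2 * of_real pi * \<i> * of_int k"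
    unfolding cyl_rel_def by blast
  let ?g = "f_map l c ^^ n" and ?h = "2 * of_real pi * \<i> * of_int k :: complex"
  let ?C = "2 * of_real pi * \<i> * of_int (int l ^ n * k) :: complex"
  have D: "(?g has_field_derivative deriv ?g u) (at u)" for u
    using f_map_iter_holomorphic[where l = l and c = c and n = n] by (simp add: holomorphic_derivI)
  have "((\<lambda>u. ?g (u + ?h)) has_field_derivative deriv ?g w) (at z)"
    using DERIV_shift[of ?g "deriv ?g w" z ?h] D[of w] unfolding k by simp
  hence "((\<lambda>u. ?g u + ?C) has_field_derivative deriv ?g w) (at z)"
    unfolding f_map_iter_shift .
  moreover have "((\<lambda>u. ?g u + ?C) has_field_derivative deriv ?g z) (at z)"
    using D[of z] by (auto intro!: derivative_eq_intros)
  ultimately have "deriv ?g w = deriv ?g z" by (rule DERIV_unique)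
  thus "cmod (deriv ?g z) = cmod (deriv ?g w)" by simp
qed

lemma F_deriv_norm_1: "F_deriv_norm l c 1 (to_cyl z) = cmod (of_nat l - exp z)"
  by transfer (simp add: DERIV_imp_deriv[OF f_map_has_field_derivative])


section \<open>Julia sets\<close>

text \<open>
  Normality of a sequence of entire functions on a domain, with respect to the spherical metric:
  every sequence of members has a subsequence which, locally uniformly, converges to a finite
  function or tends to infinity.  This dichotomy describes spherical limits of holomorphic
  functions only on connected open sets; it is used below on discs.
\<close>

definition normal_family_on :: "complex set \<Rightarrow> (complex \<Rightarrow> complex) set \<Rightarrow> bool" where
  "normal_family_on D \<F> \<longleftrightarrow>
     (\<forall>g :: nat \<Rightarrow> complex \<Rightarrow> complex. range g \<subseteq> \<F> \<longrightarrow>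
        (\<exists>r :: nat \<Rightarrow> nat. strict_mono r \<and>
           ((\<exists>h. \<forall>K. compact K \<and> K \<subseteq> D \<longrightarrow> uniform_limit K (\<lambda>n. g (r n)) h sequentially) \<or>
            (\<forall>K. compact K \<and> K \<subseteq> D \<longrightarrow>
               (\<forall>M. eventually (\<lambda>n. \<forall>z\<in>K. M < cmod (g (r n) z)) sequentially)))))"

definition fatou_set :: "(complex \<Rightarrow> complex) \<Rightarrow> complex set" where
  "fatou_set f = {z. \<exists>\<epsilon>>0. normal_family_on (ball z \<epsilon>) (range (\<lambda>n. f ^^ n))}"

definition julia_set :: "(complex \<Rightarrow> complex) \<Rightarrow> complex set" where
  "julia_set f = - fatou_set f"

definition julia_F :: "nat \<Rightarrow> complex \<Rightarrow> cylinder set" where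
  "julia_F l c = to_cyl ` julia_set (f_map l c)"

definition escaping_F :: "nat \<Rightarrow> complex \<Rightarrow> cylinder set" where
  "escaping_F l c =
     {z \<in> julia_F l c. filterlim (\<lambda>n. Re_cyl ((F_map l c ^^ n) z)) at_top sequentially}"

definition radial_julia_F :: "nat \<Rightarrow> complex \<Rightarrow> cylinder set" where
  "radial_julia_F l c = julia_F l c - escaping_F l c"


section \<open>Topological pressure\<close>

definition ln_ennreal :: "ennreal \<Rightarrow> ereal" where
  "ln_ennreal x = (if x = 0 then - \<infinity> else if x = top then \<infinity> else ereal (ln (enn2real x)))"

text \<open>
  The summand is \<open>\<bar>(F\<^sup>n)'(x)\<bar> powr (-t)\<close>, written as an inverse in \<^typ>\<open>ennreal\<close> so that it is
  infinite, not 0, where the derivative vanishes.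
\<close>

definition partition_sum :: "nat \<Rightarrow> complex \<Rightarrow> real \<Rightarrow> nat \<Rightarrow> cylinder \<Rightarrow> ennreal" where
  "partition_sum l c t n z =
     (\<Sum>\<^sub>\<infinity>x\<in>(F_map l c ^^ n) -` {z}. inverse (ennreal (F_deriv_norm l c n x powr t)))"

text \<open>The common value, over all base points \<open>z\<close> in the Julia set, of the limit defining \<open>P(t)\<close>.\<close>

definition pressure :: "nat \<Rightarrow> complex \<Rightarrow> real \<Rightarrow> ereal" where
  "pressure l c t =
     (THE p. \<forall>z\<in>julia_F l c.
        (\<lambda>n. ln_ennreal (partition_sum l c t n z) / ereal (real n)) \<longlonglongrightarrow> p)"

end

theory Submission
  imports Defs "HOL-Real_Asymp.Real_Asymp"
begin

text \<open>
  The postcritical behaviour is trivial: a Koenigs-type argument shows that the critical value is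
  attracted to the fixed point \<open>Ln c\<close> of \<open>F\<close>, and far to the left \<open>f\<close> is close to an affine map.
  So the attracted points contain a set \<open>A\<close> that \<open>F\<close> maps well into itself and whose complement \<open>U\<close>
  contains no critical value. Discs in \<open>U\<close> lift through \<open>f\<close>, which makes \<open>f\<close> uniformly expanding on
  the set \<open>K\<close> of points whose orbits avoid \<open>A\<close>, and \<open>K\<close> is the Julia set. Expansion gives inverse
  branches with bounded distortion. Fix a fixed point \<open>p0\<close> of \<open>F\<close> far to the right; preimages of \<open>p0\<close>
  of one fixed generation are dense in \<open>K\<close> up to any given scale, so the partition sums at all points
  of \<open>K\<close> are comparable to those at \<open>p0\<close>, which are submultiplicative up to a constant. Hence the
  pressure exists and is strictly decreasing and convex; the harmonic series makes it positive near
  1, so it has a unique zero. If \<open>P(t) < 0\<close>, discs about the preimages of \<open>p0\<close>, of radius comparable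
  to the inverse derivative, cover the points that return infinitely often to a bounded region, and
  the \<open>t\<close>-th powers of the radii are summable. If \<open>P(t) > 0\<close>, finitely many inverse branches near
  \<open>p0\<close> form an iterated function system with \<open>t\<close>-th power sum at least 1, whose limit set lies in
  the radial Julia set.
\<close>

section \<open>Nonnegative sums and iterated function systems\<close>

text \<open>The obstacle is that \<open>Kset\<close> is unbounded to the right, so compactness alone
  gives no uniform constants. To the right \<open>f\<close> is dominated by \<open>- exp\<close>,
  which helps in two ways. Derivatives there have size about \<open>exp (Re x)\<close>, so
  linearisation errors are measured relative to the derivative and stay uniform. And a point has
  about \<open>exp X\<close> preimages with real part near \<open>X\<close>, each of weight about
  \<open>exp (- t * X)\<close>; hence the part of a partition sum beyond \<open>X\<close> is of
  order \<open>exp ((1 - t) * X)\<close>, uniformly in the base point, and becomes small since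
  \<open>t > 1\<close>. The yardstick for these tails is \<open>P0\<close>, which is its own
  preimage: one more generation loses at most the fixed factor \<open>q0 t\<close> in the partition
  sum at \<open>P0\<close>, so a tail below \<open>q0 t / 2\<close> can be absorbed in an induction
  or discarded. On the bounded part uniformity comes from Schottky's theorem. Shadowing is done in
  the truncated metric, where every single step expands.\<close>

lemma summable_ennreal [simp]: "(f :: 'a \<Rightarrow> ennreal) summable_on S"
  by (simp add: nonneg_summable_on_complete)

text \<open>Tonelli, from finite partial sums: a finite set of pairs is enclosed in the slices over
  its first coordinates.\<close>

lemma infsum_ennreal_Sigma:
  fixes f :: "'a \<times> 'b \<Rightarrow> ennreal"
  shows "infsum f (Sigma A B) = infsum (\<lambda>x. infsum (\<lambda>y. f (x, y)) (B x)) A"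
proof (rule antisym)
  have slice: "infsum f ({x} \<times> B x) = infsum (\<lambda>y. f (x, y)) (B x)" for x
  proof -
    have "{x} \<times> B x = Pair x ` B x" by auto
    then show ?thesis using infsum_reindex[of "Pair x" "B x" f] by (simp add: inj_on_def comp_def)
  qed
  have fin: "(\<Sum>x\<in>G. infsum (\<lambda>y. f (x, y)) (B x)) = infsum f (Sigma G B)" if "finite G" for G
  proof -
    have "(\<Sum>x\<in>G. infsum f ({x} \<times> B x)) = infsum f (\<Union>x\<in>G. {x} \<times> B x)"
      by (rule sum_infsum) (use that in auto)
    moreover have "(\<Union>x\<in>G. {x} \<times> B x) = Sigma G B" by auto
    ultimately show ?thesis by (simp add: slice)
  qed
  show "infsum (\<lambda>x. infsum (\<lambda>y. f (x, y)) (B x)) A \<le> infsum f (Sigma A B)"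
    unfolding nonneg_infsum_complete[of A "\<lambda>x. infsum (\<lambda>y. f (x, y)) (B x)", simplified]
    by (rule SUP_least) (auto simp: fin intro!: infsum_mono_neutral)
  show "infsum f (Sigma A B) \<le> infsum (\<lambda>x. infsum (\<lambda>y. f (x, y)) (B x)) A"
    unfolding nonneg_infsum_complete[of "Sigma A B" f, simplified]
  proof (rule SUP_least)
    fix F assume F: "F \<in> {F. finite F \<and> F \<subseteq> Sigma A B}"
    have "sum f F = infsum f F" using F by simp
    also have "\<dots> \<le> infsum f (Sigma (fst ` F) B)"
      by (rule infsum_mono_neutral) (use F in force)+
    also have "\<dots> = (\<Sum>x\<in>fst ` F. infsum (\<lambda>y. f (x, y)) (B x))" using F by (simp add: fin)
    also have "\<dots> = infsum (\<lambda>x. infsum (\<lambda>y. f (x, y)) (B x)) (fst ` F)" using F by simp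
    also have "\<dots> \<le> infsum (\<lambda>x. infsum (\<lambda>y. f (x, y)) (B x)) A"
      by (rule infsum_mono_neutral) (use F in force)+
    finally show "sum f F \<le> infsum (\<lambda>x. infsum (\<lambda>y. f (x, y)) (B x)) A" .
  qed
qed

lemma infsum_ennreal_mono:
  fixes f g :: "'a \<Rightarrow> ennreal"
  assumes "\<And>x. x \<in> A \<Longrightarrow> f x \<le> g x" "A \<subseteq> B"
  shows "infsum f A \<le> infsum g B"
  by (rule infsum_mono_neutral) (use assms in auto)

lemma infsum_ennreal_cmult:
  fixes f :: "'a \<Rightarrow> ennreal"
  shows "infsum (\<lambda>x. c * f x) A = c * infsum f A"
proof -
  have "infsum (\<lambda>x. c * f x) A = (SUP F\<in>{F. finite F \<and> F \<subseteq> A}. c * sum f F)"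
    by (subst nonneg_infsum_complete) (auto simp: sum_distrib_left)
  also have "\<dots> = c * (SUP F\<in>{F. finite F \<and> F \<subseteq> A}. sum f F)"
    by (rule SUP_mult_left_ennreal[symmetric])
  also have "\<dots> = c * infsum f A"
    by (subst nonneg_infsum_complete) auto
  finally show ?thesis .
qed

lemma infsum_ennreal_ge_finite:
  fixes f :: "'a \<Rightarrow> ennreal"
  assumes "finite F" "F \<subseteq> A"
  shows "sum f F \<le> infsum f A"
  using infsum_ennreal_mono[of F f f A] assms by simp

lemma infsum_ennreal_inj_le:
  fixes f :: "'a \<Rightarrow> ennreal" and g :: "'b \<Rightarrow> ennreal"
  assumes "inj_on \<phi> A" "\<phi> ` A \<subseteq> B" "\<And>x. x \<in> A \<Longrightarrow> f x \<le> g (\<phi> x)"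
  shows "infsum f A \<le> infsum g B"
proof -
  have "infsum f A \<le> infsum (g \<circ> \<phi>) A"
    by (rule infsum_ennreal_mono) (use assms in auto)
  also have "\<dots> = infsum g (\<phi> ` A)" by (rule infsum_reindex[OF assms(1), symmetric])
  also have "\<dots> \<le> infsum g B" by (rule infsum_ennreal_mono) (use assms in auto)
  finally show ?thesis .
qed

lemma infsum_ennreal_nat: "infsum f (UNIV :: nat set) = (\<Sum>n. f n :: ennreal)"
  using has_sum_imp_sums[OF has_sum_infsum[OF summable_ennreal]] by (simp add: sums_iff)

text \<open>Each element of \<open>A\<close> is charged to one chosen index; overlaps of the
  \<open>B i\<close> only increase the right side.\<close>

lemma infsum_ennreal_UN_le:
  fixes f :: "'a \<Rightarrow> ennreal"
  assumes "A \<subseteq> (\<Union>i\<in>I. B i)"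
  shows "infsum f A \<le> infsum (\<lambda>i. infsum f (B i)) I"
proof -
  have "\<forall>x\<in>A. \<exists>i\<in>I. x \<in> B i" using assms by auto
  then obtain i where i: "\<And>x. x \<in> A \<Longrightarrow> i x \<in> I" "\<And>x. x \<in> A \<Longrightarrow> x \<in> B (i x)"
    by metis
  have "infsum f A \<le> infsum (\<lambda>(i, x). f x) (Sigma I B)"
    by (rule infsum_ennreal_inj_le[where \<phi>="\<lambda>x. (i x, x)"]) (use i in \<open>auto simp: inj_on_def\<close>)
  then show ?thesis by (simp add: infsum_ennreal_Sigma)
qed

section \<open>Subadditive sequences and maps close to linear ones\<close>

text \<open>Fekete's lemma: the limit is the infimum of the quotients, which is finite by the linear
  lower bound. Division with remainder by a nearly optimal \<open>m\<close> gives the upper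
  estimate.\<close>

lemma subadditive_convergent:
  fixes u :: "nat \<Rightarrow> real"
  assumes sub: "\<And>m n. u (m + n) \<le> u m + u n" and low: "\<And>n. - B * real n \<le> u n"
  obtains L where "(\<lambda>n. u n / real n) \<longlonglongrightarrow> L"
proof -
  define S where "S = (\<lambda>n. u n / real n) ` {1..}"
  define L where "L = Inf S"
  have bdd: "bdd_below S"
    unfolding S_def by (rule bdd_belowI2[where m="-B"]) (use low in \<open>auto simp: field_simps\<close>)
  have mult: "u (q * m + r) \<le> real q * u m + u r" for q m r
  proof (induction q)
    case (Suc q)
    have "u (Suc q * m + r) \<le> u m + u (q * m + r)" using sub[of m "q * m + r"] by (simp add: add.assoc)
    then show ?case using Suc by (simp add: algebra_simps)
  qed simp
  have "(\<lambda>n. u n / real n) \<longlonglongrightarrow> L"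
  proof (rule LIMSEQ_I)
    fix e :: real assume e: "e > 0"
    have "\<exists>x\<in>S. x < L + e / 2" unfolding L_def
      using e by (intro cInf_lessD[of S]) (auto simp: S_def)
    then obtain m where m: "m \<ge> 1" "u m / real m < L + e / 2" by (auto simp: S_def)
    \<comment> \<open>Pays for the remainder term \<open>u r\<close> and for replacing
      \<open>q * m\<close> by \<open>n\<close>; neither cost depends on \<open>n\<close>.\<close>
    define C where "C = \<bar>u m\<bar> + Max ((\<lambda>r. \<bar>u r\<bar>) ` {..<m})"
    obtain N where N: "N \<ge> 1" "C / real N < e / 2"
    proof -
      obtain N where "real N > 2 * \<bar>C\<bar> / e" using reals_Archimedean2 by blast
      moreover have "2 * \<bar>C\<bar> / e \<ge> 0" using e by simp
      ultimately have "real N > 0" "C < real N * (e/2)" using e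
        by (linarith, auto simp: field_simps)
      then show ?thesis using that[of N] e by (auto simp: field_simps)
    qed
    have "\<bar>u 0\<bar> \<le> Max ((\<lambda>r. \<bar>u r\<bar>) ` {..<m})" using m by (intro Max_ge) auto
    then have C0: "C \<ge> 0" unfolding C_def by linarith
    show "\<exists>N. \<forall>n\<ge>N. norm (u n / real n - L) < e"
    proof (intro exI[of _ N] allI impI)
      fix n assume n: "n \<ge> N"
      have n1: "n \<ge> 1" using n N by simp
      define q r where "q = n div m" and "r = n mod m"
      have nqr: "n = q * m + r" by (simp add: q_def r_def)
      have r: "r < m" using m by (simp add: r_def)
      have "\<bar>u r\<bar> \<le> Max ((\<lambda>r. \<bar>u r\<bar>) ` {..<m})" using r by (intro Max_ge) auto
      have qm: "real q * u m = (real n - real r) * (u m / real m)" using nqr m by (simp add: field_simps)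
      have "- (real r * (u m / real m)) \<le> \<bar>u m\<bar>"
      proof -
        have "\<bar>real r * (u m / real m)\<bar> = (real r / real m) * \<bar>u m\<bar>" by (simp add: abs_mult)
        also have "\<dots> \<le> 1 * \<bar>u m\<bar>" using r by (intro mult_right_mono) auto
        finally show ?thesis by linarith
      qed
      then have "real q * u m \<le> real n * (u m / real m) + \<bar>u m\<bar>" unfolding qm left_diff_distrib by linarith
      then have "u n \<le> real n * (u m / real m) + C"
        using mult[of q m r] nqr \<open>\<bar>u r\<bar> \<le> _\<close> unfolding C_def by simp
      then have "u n / real n \<le> u m / real m + C / real n"
        using n1 by (simp add: field_simps)
      moreover have "C / real n \<le> C / real N" using n N C0 by (intro divide_left_mono) auto
      ultimately have up: "u n / real n < L + e" using m N by linarith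
      have "u n / real n \<in> S" using n1 by (auto simp: S_def)
      then have "L \<le> u n / real n" unfolding L_def by (rule cInf_lower[OF _ bdd])
      then show "norm (u n / real n - L) < e" using up by simp
    qed
  qed
  then show thesis by (rule that)
qed

text \<open>The mean value inequality for \<open>f u - a * u\<close> on a convex set.\<close>

lemma near_linear:
  fixes f :: "complex \<Rightarrow> complex"
  assumes "convex S" "\<And>u. u \<in> S \<Longrightarrow> (f has_field_derivative f' u) (at u)"
    and "\<And>u. u \<in> S \<Longrightarrow> cmod (f' u - a) \<le> B" and "u \<in> S" "v \<in> S"
  shows "cmod (f u - f v - a * (u - v)) \<le> B * cmod (u - v)"
proof -
  have "cmod ((f u - a * u) - (f v - a * v)) \<le> B * cmod (u - v)"
  proof (rule field_differentiable_bound[OF assms(1)])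
    fix z assume "z \<in> S"
    show "((\<lambda>u. f u - a * u) has_field_derivative f' z - a) (at z within S)"
      using has_field_derivative_at_within[OF assms(2)[OF \<open>z \<in> S\<close>]]
      by (auto intro!: derivative_eq_intros)
    show "cmod (f' z - a) \<le> B" using assms(3) \<open>z \<in> S\<close> .
  qed (use assms in auto)
  then show ?thesis by (simp add: algebra_simps)
qed

lemma near_linear_surj:
  fixes f :: "complex \<Rightarrow> complex"
  assumes lin: "\<And>u v. u \<in> ball y \<rho> \<Longrightarrow> v \<in> ball y \<rho> \<Longrightarrow> cmod (f u - f v - a * (u - v)) \<le> cmod a / 2 * cmod (u - v)"
    and a: "a \<noteq> 0" and w: "cmod (w - f y) < \<rho> * cmod a / 2"
  obtains u where "cmod (u - y) \<le> 2 * cmod (w - f y) / cmod a" "u \<in> ball y \<rho>" "f u = w"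
proof -
  define r where "r = 2 * cmod (w - f y) / cmod a"
  have r: "0 \<le> r" "r < \<rho>" using a w by (auto simp: r_def field_simps)
  have sub: "cball y r \<subseteq> ball y \<rho>" using r by auto
  define \<Phi> where "\<Phi> u = u - (f u - w) / a" for u
  have lip: "dist (\<Phi> u) (\<Phi> v) \<le> 1/2 * dist u v" if "u \<in> cball y r" "v \<in> cball y r" for u v
  proof -
    have "\<Phi> u - \<Phi> v = - (f u - f v - a * (u - v)) / a" using a by (simp add: \<Phi>_def field_simps)
    then have "cmod (\<Phi> u - \<Phi> v) = cmod (f u - f v - a * (u - v)) / cmod a"
      by (metis norm_divide norm_minus_cancel)
    also have "\<dots> \<le> (cmod a / 2 * cmod (u - v)) / cmod a"
      using that sub by (intro divide_right_mono lin) auto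
    finally show ?thesis using a by (simp add: dist_norm)
  qed
  have y: "y \<in> cball y r" using r by simp
  have "\<exists>!u\<in>cball y r. \<Phi> u = u"
  proof (rule Banach_fix[where c="1/2"])
    show "\<Phi> ` cball y r \<subseteq> cball y r"
    proof safe
      fix u assume u: "u \<in> cball y r"
      have "dist y (\<Phi> y) = r / 2" using a by (simp add: \<Phi>_def dist_norm norm_divide r_def norm_minus_commute)
      moreover have "dist (\<Phi> y) (\<Phi> u) \<le> 1/2 * dist y u" using lip[OF y u] .
      ultimately have "dist y (\<Phi> u) \<le> r / 2 + 1/2 * dist y u"
        using dist_triangle[of y "\<Phi> u" "\<Phi> y"] by linarith
      then show "\<Phi> u \<in> cball y r" using u by auto
    qed
  qed (use lip y in \<open>auto intro: complete_eq_closed[THEN iffD2]\<close>)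
  then obtain u where u: "u \<in> cball y r" "\<Phi> u = u" by blast
  show thesis
  proof (rule that[of u])
    show "f u = w" using u(2) a by (simp add: \<Phi>_def)
    show "cmod (u - y) \<le> 2 * cmod (w - f y) / cmod a" using u(1) by (simp add: r_def dist_norm norm_minus_commute)
  qed (use u sub in auto)
qed

section \<open>Mass of cylinders in sequence space and limit sets of iterated function
  systems\<close>

text \<open>Averaging: the mass of \<open>N\<close> is the mean, with weights \<open>p\<close>, of
  the masses that remain after each possible letter at place \<open>k\<close>; if it is below 1, so
  is one of them.\<close>

lemma infsum_prod_tail_step:
  fixes \<omega> :: "nat \<Rightarrow> nat \<Rightarrow> 'i" and n :: "nat \<Rightarrow> nat" and p :: "'i \<Rightarrow> real"
  assumes I: "finite I" "\<And>i k. \<omega> i k \<in> I" and p: "\<And>j. j \<in> I \<Longrightarrow> 0 \<le> p j" "(\<Sum>j\<in>I. p j) = 1"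
    and less: "(\<Sum>\<^sub>\<infinity>i\<in>N. ennreal (\<Prod>m\<in>{k..<n i}. p (\<omega> i m))) < 1"
  obtains j where "j \<in> I" "(\<Sum>\<^sub>\<infinity>i\<in>{i\<in>N. \<omega> i k = j}. ennreal (\<Prod>m\<in>{Suc k..<n i}. p (\<omega> i m))) < 1"
proof (rule ccontr)
  assume "\<not> thesis"
  with that have ge: "1 \<le> (\<Sum>\<^sub>\<infinity>i\<in>{i\<in>N. \<omega> i k = j}. ennreal (\<Prod>m\<in>{Suc k..<n i}. p (\<omega> i m)))" if "j \<in> I" for j
    using \<open>j \<in> I\<close> not_le by blast
  \<comment> \<open>A word that is already used up contributes the empty product 1, which the
    assumption excludes.\<close>
  have long: "k < n i" if "i \<in> N" for i
  proof (rule ccontr)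
    assume "\<not> k < n i"
    then have "ennreal (\<Prod>m\<in>{k..<n i}. p (\<omega> i m)) = 1" by simp
    moreover have "ennreal (\<Prod>m\<in>{k..<n i}. p (\<omega> i m)) \<le> (\<Sum>\<^sub>\<infinity>i\<in>N. ennreal (\<Prod>m\<in>{k..<n i}. p (\<omega> i m)))"
      using infsum_ennreal_ge_finite[of "{i}" N "\<lambda>i. ennreal (\<Prod>m\<in>{k..<n i}. p (\<omega> i m))"] that by simp
    ultimately show False using less by auto
  qed
  have step: "(\<Prod>m\<in>{k..<n i}. p (\<omega> i m)) = p (\<omega> i k) * (\<Prod>m\<in>{Suc k..<n i}. p (\<omega> i m))" if "i \<in> N" for i
    using prod.atLeast_Suc_lessThan[OF long[OF that]] by blast
  have "1 = ennreal (\<Sum>j\<in>I. p j)" using p by simp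
  also have "\<dots> = (\<Sum>j\<in>I. ennreal (p j) * 1)" using p(1) by (simp add: sum_ennreal)
  also have "\<dots> \<le> (\<Sum>j\<in>I. ennreal (p j) * (\<Sum>\<^sub>\<infinity>i\<in>{i\<in>N. \<omega> i k = j}. ennreal (\<Prod>m\<in>{Suc k..<n i}. p (\<omega> i m))))"
    by (intro sum_mono mult_left_mono ge) auto
  also have "\<dots> = (\<Sum>j\<in>I. \<Sum>\<^sub>\<infinity>i\<in>{i\<in>N. \<omega> i k = j}. ennreal (\<Prod>m\<in>{k..<n i}. p (\<omega> i m)))"
    unfolding infsum_ennreal_cmult[symmetric]
  proof (intro sum.cong infsum_cong refl)
    fix j i assume "j \<in> I" "i \<in> {i\<in>N. \<omega> i k = j}"
    then show "ennreal (p j) * ennreal (\<Prod>m\<in>{Suc k..<n i}. p (\<omega> i m)) = ennreal (\<Prod>m\<in>{k..<n i}. p (\<omega> i m))"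
      using step[of i] ennreal_mult'[OF p(1)[of j], of "\<Prod>m\<in>{Suc k..<n i}. p (\<omega> i m)"] by simp
  qed
  also have "\<dots> = (\<Sum>\<^sub>\<infinity>i\<in>(\<Union>j\<in>I. {i\<in>N. \<omega> i k = j}). ennreal (\<Prod>m\<in>{k..<n i}. p (\<omega> i m)))"
    by (rule sum_infsum) (use I in auto)
  also have "(\<Union>j\<in>I. {i\<in>N. \<omega> i k = j}) = N" using I(2) by auto
  finally show False using less by (simp add: not_le[symmetric])
qed

text \<open>Replaces the Bernoulli measure with weights \<open>p\<close>. If the total mass were
  below 1, letters could be chosen one after the other such that the words agreeing with them keep
  mass below 1. The sequence so obtained lies in no cylinder of the cover, since a word that has
  been read completely has mass 1.\<close>

lemma cylinders_cover_mass_ge_1: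
  fixes \<omega> :: "nat \<Rightarrow> nat \<Rightarrow> 'i" and n :: "nat \<Rightarrow> nat" and p :: "'i \<Rightarrow> real"
  assumes I: "finite I" "\<And>i k. \<omega> i k \<in> I" and p: "\<And>j. j \<in> I \<Longrightarrow> 0 \<le> p j" "(\<Sum>j\<in>I. p j) = 1"
    and cover: "\<And>\<xi>. (\<And>k. \<xi> k \<in> I) \<Longrightarrow> \<exists>i. \<forall>k<n i. \<xi> k = \<omega> i k"
  shows "1 \<le> (\<Sum>i. ennreal (\<Prod>m<n i. p (\<omega> i m)))"
proof (rule ccontr)
  define S where "S k N = (\<Sum>\<^sub>\<infinity>i\<in>N. ennreal (\<Prod>m\<in>{k..<n i}. p (\<omega> i m)))" for k N
  assume "\<not> ?thesis"
  then have S0: "S 0 UNIV < 1" by (simp add: S_def infsum_ennreal_nat not_le lessThan_atLeast0)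
  define A where "A k x \<longleftrightarrow> S k (fst x) < 1 \<and> (k = 0 \<longrightarrow> fst x = UNIV)" for k and x :: "nat set \<times> 'i"
  define B where "B k x y \<longleftrightarrow> snd y \<in> I \<and> fst y = {i\<in>fst x. \<omega> i k = snd y}" for k and x y :: "nat set \<times> 'i"
  have "\<exists>f. \<forall>k. A k (f k) \<and> B k (f k) (f (Suc k))"
  proof (rule dependent_nat_choice[where P=A and Q=B])
    show "\<exists>x. A 0 x" using S0 by (intro exI[of _ "(UNIV, undefined)"]) (simp add: A_def)
  next
    fix x k
    assume "A k x"
    then have "S k (fst x) < 1" by (simp add: A_def)
    then obtain j where "j \<in> I" "S (Suc k) {i\<in>fst x. \<omega> i k = j} < 1"
      unfolding S_def
      using infsum_prod_tail_step[where I=I and \<omega>=\<omega> and p=p and N="fst x" and k=k and n=n, OF I p] by blast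
    then show "\<exists>y. A (Suc k) y \<and> B k x y"
      by (intro exI[of _ "({i\<in>fst x. \<omega> i k = j}, j)"]) (simp add: A_def B_def)
  qed
  then obtain f where AB: "\<And>k. A k (f k)" "\<And>k. B k (f k) (f (Suc k))" by blast
  have f: "\<And>k. S k (fst (f k)) < 1" "\<And>k. snd (f (Suc k)) \<in> I" "fst (f 0) = UNIV"
      "\<And>k. fst (f (Suc k)) = {i\<in>fst (f k). \<omega> i k = snd (f (Suc k))}"
    using AB unfolding A_def B_def by blast+
  define \<xi> where "\<xi> k = snd (f (Suc k))" for k
  have N: "fst (f k) = {i. \<forall>m<k. \<omega> i m = \<xi> m}" for k
    by (induction k) (auto simp: f \<xi>_def less_Suc_eq)
  obtain i where i: "\<forall>k<n i. \<xi> k = \<omega> i k" using cover[of \<xi>] f(2) by (auto simp: \<xi>_def)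
  \<comment> \<open>The word that covers the chosen sequence is still present when all its letters
    are read.\<close>
  then have "i \<in> fst (f (n i))" by (simp add: N)
  then have "ennreal (\<Prod>m\<in>{n i..<n i}. p (\<omega> i m)) \<le> S (n i) (fst (f (n i)))"
    unfolding S_def using infsum_ennreal_ge_finite[of "{i}" "fst (f (n i))" "\<lambda>j. ennreal (\<Prod>m\<in>{n i..<n j}. p (\<omega> j m))"] by simp
  then show False using f(1)[of "n i"] by (simp add: not_le[symmetric])
qed

text \<open>The newest letter acts first, so that for maps of \<open>X\<close> into itself the
  images of \<open>X\<close> shrink as the word grows.\<close>

primrec word_map :: "('i \<Rightarrow> 'a \<Rightarrow> 'a) \<Rightarrow> (nat \<Rightarrow> 'i) \<Rightarrow> nat \<Rightarrow> 'a \<Rightarrow> 'a" where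
  "word_map h \<xi> 0 = id"
| "word_map h \<xi> (Suc n) = word_map h \<xi> n \<circ> h (\<xi> n)"

definition ifs_limit :: "'i set \<Rightarrow> ('i \<Rightarrow> 'a \<Rightarrow> 'a) \<Rightarrow> 'a set \<Rightarrow> 'a set" where
  "ifs_limit I h X = {u. \<exists>\<xi>. (\<forall>k. \<xi> k \<in> I) \<and> (\<forall>n. u \<in> word_map h \<xi> n ` X)}"

lemma word_map_cong: "(\<And>k. k < n \<Longrightarrow> \<xi> k = \<xi>' k) \<Longrightarrow> word_map h \<xi> n = word_map h \<xi>' n"
  by (induction n) auto

lemma word_map_in:
  assumes "\<And>i. i \<in> I \<Longrightarrow> h i ` X \<subseteq> X" "\<And>k. \<xi> k \<in> I" "u \<in> X"
  shows "word_map h \<xi> n u \<in> X"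
  using assms(3) by (induction n arbitrary: u) (use assms(1,2) in \<open>auto simp: image_subset_iff\<close>)

text \<open>
  Mass distribution without a measure: a set of the cover that meets two pieces of the last common
  generation has diameter comparable to the size of that generation; a set that meets the limit set
  in one coded point is charged with an arbitrarily deep cylinder.
\<close>

lemma ifs_cover_lower_bound:
  fixes h :: "'i \<Rightarrow> 'a::heine_borel \<Rightarrow> 'a" and \<rho> :: "'i \<Rightarrow> real"
  assumes I: "finite I" and X: "compact X" "X \<noteq> {}"
    and hX: "\<And>i. i \<in> I \<Longrightarrow> h i ` X \<subseteq> X" and cont: "\<And>i. i \<in> I \<Longrightarrow> continuous_on X (h i)"
    and low: "\<And>i u v. i \<in> I \<Longrightarrow> u \<in> X \<Longrightarrow> v \<in> X \<Longrightarrow> \<rho> i * dist u v \<le> dist (h i u) (h i v)"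
    and disj: "\<And>i j. i \<in> I \<Longrightarrow> j \<in> I \<Longrightarrow> i \<noteq> j \<Longrightarrow> h i ` X \<inter> h j ` X = {}"
    and \<rho>: "\<And>i. i \<in> I \<Longrightarrow> 0 < \<rho> i" "\<And>i. i \<in> I \<Longrightarrow> \<rho> i < 1"
    and t: "t > 0" and mass: "(\<Sum>i\<in>I. \<rho> i powr t) \<ge> 1"
  obtains \<kappa> where "\<kappa> > 0"
    "\<And>U :: nat \<Rightarrow> 'a set. ifs_limit I h X \<subseteq> (\<Union>i. U i) \<Longrightarrow> (\<And>i. bounded (U i)) \<Longrightarrow>
        ennreal \<kappa> \<le> (\<Sum>i. ennreal (diameter (U i) powr t))"
proof -
  have "I \<noteq> {}" using mass by auto
  \<comment> \<open>Dividing by the sum turns the weights into probabilities; as the sum is at least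
    1, they only become smaller.\<close>
  define S where "S = (\<Sum>i\<in>I. \<rho> i powr t)"
  define p where "p i = \<rho> i powr t / S" for i
  have S1: "S \<ge> 1" using mass by (simp add: S_def)
  have p: "(\<Sum>i\<in>I. p i) = 1" "0 < p i" "p i \<le> \<rho> i powr t" "p i < 1" if "i \<in> I" for i
  proof -
    show "(\<Sum>i\<in>I. p i) = 1" using S1 by (simp add: p_def sum_divide_distrib[symmetric] S_def)
    show "0 < p i" using S1 \<rho>[OF that] by (simp add: p_def)
    show le: "p i \<le> \<rho> i powr t" using S1 mult_left_mono[of 1 S "\<rho> i powr t"] by (simp add: p_def divide_le_eq)
    have "\<rho> i powr t < 1" using \<rho>[OF that] t by (metis powr_less_mono2 powr_one_eq_one less_imp_le)
    then show "p i < 1" using le by simp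
  qed
  have p1: "(\<Sum>i\<in>I. p i) = 1" using p(1) \<open>I \<noteq> {}\<close> by auto
  \<comment> \<open>Masses of words decay at least like \<open>\<theta> ^ n\<close>; this provides
    arbitrarily light cylinders.\<close>
  define \<theta> where "\<theta> = Max (p ` I)"
  have \<theta>: "\<theta> < 1" "\<And>i. i \<in> I \<Longrightarrow> p i \<le> \<theta>" using I \<open>I \<noteq> {}\<close> p(4) by (auto simp: \<theta>_def)
  have \<theta>0: "\<theta> > 0" using \<theta>(2) p(2) \<open>I \<noteq> {}\<close> by (meson all_not_in_conv less_le_trans)
  define P where "P \<xi> n = prod (\<lambda>k. p (\<xi> k)) {..<n::nat}" for \<xi> :: "nat \<Rightarrow> 'i" and n
  define R where "R \<xi> n = prod (\<lambda>k. \<rho> (\<xi> k)) {..<n::nat}" for \<xi> :: "nat \<Rightarrow> 'i" and n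
  define \<Xi> where "\<Xi> = {\<xi> :: nat \<Rightarrow> 'i. \<forall>k. \<xi> k \<in> I}"
  have R0: "R \<xi> n > 0" if "\<xi> \<in> \<Xi>" for \<xi> n
    unfolding R_def by (rule prod_pos) (use that \<rho> in \<open>auto simp: \<Xi>_def\<close>)
  have PR: "P \<xi> n \<le> R \<xi> n powr t" if "\<xi> \<in> \<Xi>" for \<xi> n
  proof -
    have "P \<xi> n \<le> (\<Prod>k<n. \<rho> (\<xi> k) powr t)"
      unfolding P_def by (rule prod_mono) (use that p(2,3) in \<open>auto simp: \<Xi>_def less_imp_le\<close>)
    also have "\<dots> = R \<xi> n powr t"
      unfolding R_def using that \<rho> by (induction n) (auto simp: \<Xi>_def powr_mult prod_nonneg less_imp_le)
    finally show ?thesis .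
  qed
  have P\<theta>: "P \<xi> n \<le> \<theta> ^ n" if "\<xi> \<in> \<Xi>" for \<xi> n
  proof -
    have "P \<xi> n \<le> (\<Prod>k<n. \<theta>)"
      unfolding P_def by (rule prod_mono) (use that p(2) \<theta>(2) in \<open>auto simp: \<Xi>_def less_imp_le\<close>)
    then show ?thesis by simp
  qed
  have inX: "word_map h \<xi> n u \<in> X" if "\<xi> \<in> \<Xi>" "u \<in> X" for \<xi> n u
    by (rule word_map_in[where I=I and h=h]) (use hX that in \<open>auto simp: \<Xi>_def\<close>)
  have wlow: "R \<xi> n * dist u v \<le> dist (word_map h \<xi> n u) (word_map h \<xi> n v)"
    if "\<xi> \<in> \<Xi>" "u \<in> X" "v \<in> X" for \<xi> n u v
    using that(2,3)
  proof (induction n arbitrary: u v)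
    case (Suc n)
    have i: "\<xi> n \<in> I" using that by (simp add: \<Xi>_def)
    have "R \<xi> (Suc n) * dist u v = R \<xi> n * (\<rho> (\<xi> n) * dist u v)" by (simp add: R_def)
    also have "\<dots> \<le> R \<xi> n * dist (h (\<xi> n) u) (h (\<xi> n) v)"
      using low[OF i] Suc.prems R0[OF that(1), of n] by (intro mult_left_mono) auto
    also have "\<dots> \<le> dist (word_map h \<xi> (Suc n) u) (word_map h \<xi> (Suc n) v)"
      using Suc.IH[of "h (\<xi> n) u" "h (\<xi> n) v"] Suc.prems hX[OF i] by auto
    finally show ?case .
  qed (simp add: R_def)
  have wcont: "continuous_on X (word_map h \<xi> n)" if "\<xi> \<in> \<Xi>" for \<xi> n
  proof (induction n)
    case (Suc n)
    have i: "\<xi> n \<in> I" using that by (simp add: \<Xi>_def)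
    show ?case unfolding word_map.simps
      by (rule continuous_on_compose[OF cont[OF i]]) (rule continuous_on_subset[OF Suc hX[OF i]])
  qed (simp add: id_def)
  have "\<exists>u. \<forall>n. u \<in> word_map h \<xi> n ` X" if "\<xi> \<in> \<Xi>" for \<xi>
  proof -
    have "\<Inter> (range (\<lambda>n. word_map h \<xi> n ` X)) \<noteq> {}"
    proof (rule compact_nest)
      show "compact (word_map h \<xi> n ` X)" for n by (rule compact_continuous_image[OF wcont[OF that] X(1)])
      show "word_map h \<xi> n ` X \<noteq> {}" for n using X by simp
      have Sc: "word_map h \<xi> (Suc n) ` X \<subseteq> word_map h \<xi> n ` X" for n
      proof -
        have "h (\<xi> n) ` X \<subseteq> X" using hX that by (simp add: \<Xi>_def)
        then show ?thesis by auto
      qed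
      show "word_map h \<xi> n ` X \<subseteq> word_map h \<xi> m ` X" if "m \<le> n" for m n
        using lift_Suc_antimono_le[of "\<lambda>n. word_map h \<xi> n ` X"] Sc that by blast
    qed
    then show ?thesis by auto
  qed
  \<comment> \<open>Distances are only bounded from below, so a nested intersection may contain
    several points; one of them is fixed for each code.\<close>
  then obtain x where x: "\<And>\<xi> n. \<xi> \<in> \<Xi> \<Longrightarrow> x \<xi> \<in> word_map h \<xi> n ` X" by metis
  \<comment> \<open>The gap between pieces of the first generation, positive by compactness.\<close>
  obtain g where g: "g > 0" "\<And>i j u v. i \<in> I \<Longrightarrow> j \<in> I \<Longrightarrow> i \<noteq> j \<Longrightarrow> u \<in> h i ` X \<Longrightarrow> v \<in> h j ` X \<Longrightarrow> g \<le> dist u v"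
  proof -
    have "\<exists>d>0. \<forall>u\<in>h i ` X. \<forall>v\<in>h j ` X. d \<le> dist u v" if "i \<in> I" "j \<in> I" "i \<noteq> j" for i j
    proof (rule separate_compact_closed)
      show "compact (h i ` X)" using compact_continuous_image[OF cont X(1)] that by blast
      show "closed (h j ` X)" using compact_imp_closed[OF compact_continuous_image[OF cont X(1)]] that by blast
    qed (use that disj in blast)
    then obtain d where d: "\<And>i j. i \<in> I \<Longrightarrow> j \<in> I \<Longrightarrow> i \<noteq> j \<Longrightarrow> d i j > 0 \<and> (\<forall>u\<in>h i ` X. \<forall>v\<in>h j ` X. d i j \<le> dist u v)"
      by metis
    define D where "D = insert 1 ((\<lambda>(i,j). d i j) ` {(i,j). i \<in> I \<and> j \<in> I \<and> i \<noteq> j})"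
    have fin: "finite D" unfolding D_def
      using finite_subset[of "{(i,j). i \<in> I \<and> j \<in> I \<and> i \<noteq> j}" "I \<times> I"] I by auto
    show thesis
    proof (rule that[of "Min D"])
      show "Min D > 0" using fin d by (subst Min_gr_iff) (auto simp: D_def)
      fix i j u v assume a: "i \<in> I" "j \<in> I" "i \<noteq> j" "u \<in> h i ` X" "v \<in> h j ` X"
      have "Min D \<le> d i j" using fin a by (intro Min_le) (auto simp: D_def)
      then show "Min D \<le> dist u v" using d a by (meson order_trans)
    qed
  qed
  have charge: "\<exists>\<omega>\<in>\<Xi>. \<exists>n. (\<forall>\<xi>\<in>\<Xi>. x \<xi> \<in> U \<longrightarrow> (\<forall>k<n. \<xi> k = \<omega> k)) \<and> P \<omega> n \<le> (diameter U / g) powr t + \<epsilon>"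
    if "bounded U" "\<epsilon> > 0" for U :: "'a set" and \<epsilon> :: real
  proof (cases "\<exists>\<xi>\<in>\<Xi>. \<exists>\<xi>'\<in>\<Xi>. x \<xi> \<in> U \<and> x \<xi>' \<in> U \<and> \<xi> \<noteq> \<xi>'")
    case True
    \<comment> \<open>Leads to the first place at which two codes of points in \<open>U\<close>
      differ. Up to there all such codes agree; there the two points come from different pieces, at
      distance at least \<open>g\<close> before the common word is applied.\<close>
    define D where "D = (\<lambda>n. \<exists>\<xi>\<in>\<Xi>. \<exists>\<xi>'\<in>\<Xi>. x \<xi> \<in> U \<and> x \<xi>' \<in> U \<and> \<xi> n \<noteq> \<xi>' n)"
    define n where "n = (LEAST n. D n)"
    have "\<exists>n. D n" using True unfolding D_def by (metis ext)
    then have "D n" unfolding n_def by (rule LeastI_ex)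
    then obtain \<xi> \<xi>' where xi: "\<xi> \<in> \<Xi>" "\<xi>' \<in> \<Xi>" "x \<xi> \<in> U" "x \<xi>' \<in> U" "\<xi> n \<noteq> \<xi>' n" by (auto simp: D_def)
    have same: "\<forall>k<n. \<zeta> k = \<xi> k" if "\<zeta> \<in> \<Xi>" "x \<zeta> \<in> U" for \<zeta>
    proof (intro allI impI)
      fix k assume "k < n"
      then have "\<not> D k" unfolding n_def by (rule not_less_Least)
      then show "\<zeta> k = \<xi> k" using that xi unfolding D_def by blast
    qed
    have "x \<xi> \<in> word_map h \<xi> (Suc n) ` X" "x \<xi>' \<in> word_map h \<xi>' (Suc n) ` X" using x xi by blast+
    then obtain u v where uv: "u \<in> X" "v \<in> X" "x \<xi> = word_map h \<xi> n (h (\<xi> n) u)" "x \<xi>' = word_map h \<xi>' n (h (\<xi>' n) v)"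
      by auto
    have eq: "word_map h \<xi>' n = word_map h \<xi> n" by (rule word_map_cong) (use same[OF xi(2,4)] in auto)
    have I2: "\<xi> n \<in> I" "\<xi>' n \<in> I" using xi by (auto simp: \<Xi>_def)
    have "R \<xi> n * g \<le> R \<xi> n * dist (h (\<xi> n) u) (h (\<xi>' n) v)"
      using R0[OF xi(1), of n] uv by (intro mult_left_mono g(2)[OF I2 xi(5)]) auto
    also have "\<dots> \<le> dist (x \<xi>) (x \<xi>')"
      unfolding uv eq by (rule wlow[OF xi(1)]) (use uv hX I2 in auto)
    also have "\<dots> \<le> diameter U" by (rule diameter_bounded_bound[OF that(1) xi(3,4)])
    finally have "R \<xi> n \<le> diameter U / g" using g by (simp add: field_simps)
    then have "R \<xi> n powr t \<le> (diameter U / g) powr t"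
      using R0[OF xi(1), of n] t by (intro powr_mono2) auto
    then have "P \<xi> n \<le> (diameter U / g) powr t + \<epsilon>" using PR[OF xi(1), of n] that by linarith
    then show ?thesis using same xi by blast
  next
    case False
    obtain \<omega> where \<omega>: "\<omega> \<in> \<Xi>" "\<forall>\<xi>\<in>\<Xi>. x \<xi> \<in> U \<longrightarrow> \<xi> = \<omega>"
    proof (cases "\<exists>\<xi>\<in>\<Xi>. x \<xi> \<in> U")
      case True then show thesis using False that by metis
    next
      case False
      obtain i where "i \<in> I" using \<open>I \<noteq> {}\<close> by auto
      then show thesis using that[of "\<lambda>_. i"] False by (auto simp: \<Xi>_def)
    qed
    obtain n where n: "\<theta> ^ n < \<epsilon>" using real_arch_pow_inv[OF \<open>\<epsilon> > 0\<close> \<theta>(1)] by blast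
    have "P \<omega> n \<le> (diameter U / g) powr t + \<epsilon>" using P\<theta>[OF \<omega>(1), of n] n powr_ge_zero[of "diameter U / g" t] by linarith
    then show ?thesis using \<omega> by blast
  qed
  \<comment> \<open>Half of the unit mass is reserved for the errors
    \<open>(1/4) * (1/2) ^ i\<close>, which sum to 1/2.\<close>
  define \<kappa> where "\<kappa> = g powr t / 2"
  show thesis
  proof (rule that[of \<kappa>])
    show "\<kappa> > 0" using g by (simp add: \<kappa>_def)
    fix U :: "nat \<Rightarrow> 'a set" assume U: "ifs_limit I h X \<subseteq> (\<Union>i. U i)" "\<And>i. bounded (U i)"
    have "\<exists>\<omega>\<in>\<Xi>. \<exists>n. (\<forall>\<xi>\<in>\<Xi>. x \<xi> \<in> U i \<longrightarrow> (\<forall>k<n. \<xi> k = \<omega> k)) \<and> P \<omega> n \<le> (diameter (U i) / g) powr t + (1/4) * (1/2) ^ i" for i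
      by (rule charge[OF U(2)]) simp
    then obtain \<omega> n where \<omega>: "\<And>i. \<omega> i \<in> \<Xi>" "\<And>i \<xi>. \<xi> \<in> \<Xi> \<Longrightarrow> x \<xi> \<in> U i \<Longrightarrow> \<forall>k<n i. \<xi> k = \<omega> i k"
        "\<And>i. P (\<omega> i) (n i) \<le> (diameter (U i) / g) powr t + (1/4) * (1/2) ^ i"
      by metis
    have "1 \<le> (\<Sum>i. ennreal (\<Prod>m<n i. p (\<omega> i m)))"
    proof (rule cylinders_cover_mass_ge_1[OF I])
      show "\<omega> i k \<in> I" for i k using \<omega>(1) by (simp add: \<Xi>_def)
      show "0 \<le> p j" if "j \<in> I" for j using p(2)[OF that] by simp
      show "(\<Sum>j\<in>I. p j) = 1" by (fact p1)
      fix \<xi> :: "nat \<Rightarrow> 'i" assume "\<And>k. \<xi> k \<in> I"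
      then have xi: "\<xi> \<in> \<Xi>" by (simp add: \<Xi>_def)
      have "x \<xi> \<in> ifs_limit I h X" using x[OF xi] xi unfolding ifs_limit_def \<Xi>_def by blast
      then obtain i where "x \<xi> \<in> U i" using U(1) by blast
      then show "\<exists>i. \<forall>k<n i. \<xi> k = \<omega> i k" using \<omega>(2)[OF xi] by blast
    qed
    also have "\<dots> \<le> (\<Sum>i. ennreal ((diameter (U i) / g) powr t) + ennreal ((1/4) * (1/2) ^ i))"
    proof (rule suminf_le)
      fix i
      have "ennreal (\<Prod>m<n i. p (\<omega> i m)) \<le> ennreal ((diameter (U i) / g) powr t + (1/4) * (1/2) ^ i)"
        using \<omega>(3)[of i] by (intro ennreal_leI) (simp add: P_def)
      also have "\<dots> = ennreal ((diameter (U i) / g) powr t) + ennreal ((1/4) * (1/2) ^ i)"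
        by (rule ennreal_plus) auto
      finally show "ennreal (\<Prod>m<n i. p (\<omega> i m)) \<le> ennreal ((diameter (U i) / g) powr t) + ennreal ((1/4) * (1/2) ^ i)" .
    qed auto
    also have "\<dots> = (\<Sum>i. ennreal ((diameter (U i) / g) powr t)) + (\<Sum>i. ennreal ((1/4) * (1/2) ^ i))"
      by (rule suminf_add[symmetric]) auto
    also have "(\<Sum>i. ennreal ((1/4) * (1/2) ^ i)) = ennreal (1/2)"
    proof -
      have e: "(1/4) * (1 / (1 - 1/2)) = (1/2 :: real)" by simp
      have "(\<lambda>i. (1/4) * (1/2) ^ i :: real) sums ((1/4) * (1 / (1 - 1/2)))"
        by (intro sums_mult geometric_sums) simp
      then have s: "(\<lambda>i. (1/4) * (1/2) ^ i :: real) sums (1/2)" unfolding e .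
      define q where "q i = (1/4) * (1/2 :: real) ^ i" for i :: nat
      have "(\<Sum>i. ennreal (q i)) = ennreal (\<Sum>i. q i)"
        by (rule suminf_ennreal2) (use s in \<open>auto simp: q_def intro: sums_summable\<close>)
      also have "(\<Sum>i. q i) = 1/2" using sums_unique[OF s] unfolding q_def by (rule sym)
      finally show ?thesis unfolding q_def .
    qed
    finally have one: "1 \<le> (\<Sum>i. ennreal ((diameter (U i) / g) powr t)) + ennreal (1/2)" .
    have half: "ennreal (1/2) \<le> (\<Sum>i. ennreal ((diameter (U i) / g) powr t))"
    proof (cases "\<Sum>i. ennreal ((diameter (U i) / g) powr t)")
      case (real r)
      then have "ennreal 1 \<le> ennreal (r + 1/2)" using one by (simp add: ennreal_plus)
      then have "1 \<le> r + 1/2" using real by (simp only: ennreal_le_iff)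
      then show ?thesis unfolding real by (intro ennreal_leI) simp
    qed simp
    have "ennreal \<kappa> = ennreal (g powr t * (1/2))" by (simp add: \<kappa>_def)
    also have "\<dots> = ennreal (g powr t) * ennreal (1/2)" by (rule ennreal_mult) auto
    also have "\<dots> \<le> ennreal (g powr t) * (\<Sum>i. ennreal ((diameter (U i) / g) powr t))"
      by (intro mult_left_mono half) auto
    also have "\<dots> = (\<Sum>i. ennreal (g powr t) * ennreal ((diameter (U i) / g) powr t))"
      by (rule ennreal_suminf_cmult[symmetric])
    also have "\<dots> = (\<Sum>i. ennreal (diameter (U i) powr t))"
    proof (rule suminf_cong)
      fix i
      have "g powr t * (diameter (U i) / g) powr t = (g * (diameter (U i) / g)) powr t"
        by (rule powr_mult[symmetric])
      then have "g powr t * (diameter (U i) / g) powr t = diameter (U i) powr t" using g by simp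
      then show "ennreal (g powr t) * ennreal ((diameter (U i) / g) powr t) = ennreal (diameter (U i) powr t)"
        using ennreal_mult[of "g powr t" "(diameter (U i) / g) powr t"] by simp
    qed
    finally show "ennreal \<kappa> \<le> (\<Sum>i. ennreal (diameter (U i) powr t))" .
  qed
qed

section \<open>Null sets of Hausdorff measures\<close>

lemma hausdorff_measure_eq_0I:
  assumes "\<And>\<delta> \<epsilon>. \<delta> > 0 \<Longrightarrow> \<epsilon> > 0 \<Longrightarrow> \<exists>U::nat \<Rightarrow> 'a::metric_space set. A \<subseteq> (\<Union>i. U i) \<and>
      (\<forall>i. bounded (U i) \<and> diameter (U i) \<le> \<delta>) \<and> (\<Sum>i. ennreal (diameter (U i) powr s)) \<le> ennreal \<epsilon>"
  shows "hausdorff_measure s A = 0"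
proof -
  have "hausdorff_premeasure s \<delta> A = 0" if "\<delta> > 0" for \<delta>
  proof -
    have "hausdorff_premeasure s \<delta> A \<le> 0"
    proof (rule ennreal_le_epsilon)
      fix e :: real assume "e > 0"
      obtain U :: "nat \<Rightarrow> 'a set" where "A \<subseteq> (\<Union>i. U i)" "\<forall>i. bounded (U i) \<and> diameter (U i) \<le> \<delta>"
        "(\<Sum>i. ennreal (diameter (U i) powr s)) \<le> ennreal e"
        using assms[OF \<open>\<delta> > 0\<close> \<open>e > 0\<close>] by blast
      note U = this
      have "hausdorff_premeasure s \<delta> A \<le> (\<Sum>i. ennreal (diameter (U i) powr s))"
        unfolding hausdorff_premeasure_def by (rule Inf_lower) (use U in blast)
      with U(3) show "hausdorff_premeasure s \<delta> A \<le> 0 + ennreal e" by simp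
    qed
    then show ?thesis by simp
  qed
  then show ?thesis by (simp add: hausdorff_measure_def)
qed

lemma hausdorff_measure_0D:
  fixes A :: "'a::metric_space set"
  assumes "hausdorff_measure s A = 0" "\<delta> > 0" "\<epsilon> > 0"
  shows "\<exists>U. A \<subseteq> (\<Union>i::nat. U i) \<and> (\<forall>i. bounded (U i)) \<and> (\<forall>i. diameter (U i) \<le> \<delta>) \<and>
    (\<Sum>i. ennreal (diameter (U i) powr s)) < ennreal \<epsilon>"
proof -
  have "hausdorff_premeasure s \<delta> A \<le> hausdorff_measure s A"
    unfolding hausdorff_measure_def using assms by (intro SUP_upper) auto
  then have "hausdorff_premeasure s \<delta> A < ennreal \<epsilon>" using assms by simp
  then obtain x where x: "x < ennreal \<epsilon>" "x \<in> {(\<Sum>i. ennreal (diameter (U i) powr s)) | U :: nat \<Rightarrow> 'a set.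
            A \<subseteq> (\<Union>i. U i) \<and> (\<forall>i. bounded (U i) \<and> diameter (U i) \<le> \<delta>)}"
    unfolding hausdorff_premeasure_def Inf_less_iff by blast
  from x(2) obtain U :: "nat \<Rightarrow> 'a set" where "x = (\<Sum>i. ennreal (diameter (U i) powr s))"
     "A \<subseteq> (\<Union>i. U i)" "\<forall>i. bounded (U i) \<and> diameter (U i) \<le> \<delta>" by blast
  with x(1) show ?thesis by blast
qed

lemma hausdorff_measure_0_mono:
  assumes "hausdorff_measure s A = 0" "s \<le> t"
  shows "hausdorff_measure t A = 0"
proof (rule hausdorff_measure_eq_0I)
  fix \<delta> \<epsilon> :: real assume de: "\<delta> > 0" "\<epsilon> > 0"
  \<comment> \<open>Diameters are kept at most 1, so that the larger exponent gives the smaller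
    power.\<close>
  have "0 < min \<delta> 1" using de by simp
  obtain U where U: "A \<subseteq> (\<Union>i::nat. U i)" "\<And>i. bounded (U i)" "\<And>i. diameter (U i) \<le> min \<delta> 1"
    "(\<Sum>i. ennreal (diameter (U i) powr s)) < ennreal \<epsilon>"
    using hausdorff_measure_0D[OF assms(1) \<open>0 < min \<delta> 1\<close> de(2)] by blast
  have "diameter (U i) powr t \<le> diameter (U i) powr s" for i
  proof (rule powr_mono')
    show "0 \<le> diameter (U i)" by (rule diameter_ge_0[OF U(2)])
    show "diameter (U i) \<le> 1" using U(3)[of i] by simp
  qed fact
  then have "(\<Sum>i. ennreal (diameter (U i) powr t)) \<le> (\<Sum>i. ennreal (diameter (U i) powr s))"
    by (intro suminf_le ennreal_leI) auto
  then have "(\<Sum>i. ennreal (diameter (U i) powr t)) \<le> ennreal \<epsilon>" using U(4) by simp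
  moreover have "\<forall>i. bounded (U i) \<and> diameter (U i) \<le> \<delta>" using U(2,3) by simp
  ultimately show "\<exists>U. A \<subseteq> (\<Union>i::nat. U i) \<and>
      (\<forall>i. bounded (U i) \<and> diameter (U i) \<le> \<delta>) \<and> (\<Sum>i. ennreal (diameter (U i) powr t)) \<le> ennreal \<epsilon>"
    using U(1) by blast
qed

lemma hausdorff_measure_0_UN:
  fixes A :: "nat \<Rightarrow> 'a::metric_space set"
  assumes "\<And>k. hausdorff_measure s (A k) = 0"
  shows "hausdorff_measure s (\<Union>k. A k) = 0"
proof (rule hausdorff_measure_eq_0I)
  fix \<delta> \<epsilon> :: real assume de: "\<delta> > 0" "\<epsilon> > 0"
  have "\<exists>U. A k \<subseteq> (\<Union>i::nat. U i) \<and> (\<forall>i. bounded (U i)) \<and> (\<forall>i. diameter (U i) \<le> \<delta>) \<and>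
      (\<Sum>i. ennreal (diameter (U i) powr s)) < ennreal (\<epsilon> * (1/2) ^ Suc k)" for k
  proof -
    have "0 < \<epsilon> * (1/2) ^ Suc k" using de by simp
    from hausdorff_measure_0D[OF assms[of k] de(1) this] show ?thesis .
  qed
  then obtain U where U: "\<And>k. A k \<subseteq> (\<Union>i::nat. U k i)" "\<And>k i. bounded (U k i)" "\<And>k i. diameter (U k i) \<le> \<delta>"
      "\<And>k. (\<Sum>i. ennreal (diameter (U k i) powr s)) < ennreal (\<epsilon> * (1/2) ^ Suc k)"
    by metis
  define V where "V n = case_prod U (prod_decode n)" for n
  have "(\<Sum>n. ennreal (diameter (V n) powr s)) = infsum (\<lambda>n. ennreal (diameter (V n) powr s)) UNIV"
    by (simp add: infsum_ennreal_nat)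
  also have "\<dots> = infsum (\<lambda>x. ennreal (diameter (case_prod U x) powr s)) (UNIV \<times> UNIV)"
    unfolding V_def UNIV_Times_UNIV
    using infsum_reindex_bij_betw[OF bij_prod_decode, of "\<lambda>x. ennreal (diameter (case_prod U x) powr s)"] .
  also have "\<dots> = (\<Sum>k. \<Sum>i. ennreal (diameter (U k i) powr s))"
    unfolding infsum_ennreal_Sigma infsum_ennreal_nat by simp
  also have "\<dots> \<le> (\<Sum>k. ennreal (\<epsilon> * (1/2) ^ Suc k))"
    using U(4) by (intro suminf_le) (auto intro: less_imp_le)
  also have "\<dots> = ennreal \<epsilon>"
  proof -
    have su: "(\<lambda>k. \<epsilon> * (1/2) ^ Suc k) sums (\<epsilon> * 1)" by (intro sums_mult power_half_series)
    have "(\<Sum>k. ennreal (\<epsilon> * (1/2) ^ Suc k)) = ennreal (\<Sum>k. \<epsilon> * (1/2) ^ Suc k)"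
      by (rule suminf_ennreal2[OF _ sums_summable[OF su]]) (use de in simp)
    also have "(\<Sum>k. \<epsilon> * (1/2) ^ Suc k) = \<epsilon>" using sums_unique[OF su] by (simp only: mult_1_right)
    finally show ?thesis .
  qed
  finally have "(\<Sum>n. ennreal (diameter (V n) powr s)) \<le> ennreal \<epsilon>" .
  moreover have "(\<Union>k. A k) \<subseteq> (\<Union>n. V n)"
  proof
    fix x assume "x \<in> (\<Union>k. A k)"
    then obtain k i where "x \<in> U k i" using U(1) by blast
    then show "x \<in> (\<Union>n. V n)" by (intro UN_I[of "prod_encode (k, i)"]) (auto simp: V_def)
  qed
  moreover have "\<forall>n. bounded (V n) \<and> diameter (V n) \<le> \<delta>" using U(2,3) by (simp add: V_def split: prod.split)
  ultimately show "\<exists>U. (\<Union>k. A k) \<subseteq> (\<Union>i::nat. U i) \<and>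
      (\<forall>i. bounded (U i) \<and> diameter (U i) \<le> \<delta>) \<and> (\<Sum>i. ennreal (diameter (U i) powr s)) \<le> ennreal \<epsilon>"
    by blast
qed

lemma diameter_cball_le:
  fixes y :: "'a::metric_space"
  assumes "0 \<le> r"
  shows "diameter (cball y r) \<le> 2 * r"
proof -
  have "(SUP (u, v)\<in>cball y r \<times> cball y r. dist u v) \<le> 2 * r"
  proof (rule cSUP_least)
    show "cball y r \<times> cball y r \<noteq> {}" using assms by auto
    fix x assume "x \<in> cball y r \<times> cball y r"
    then obtain u v where uv: "x = (u, v)" "dist y u \<le> r" "dist y v \<le> r" by auto
    then show "(case x of (u, v) \<Rightarrow> dist u v) \<le> 2 * r" using dist_triangle3[of u v y] by simp
  qed
  then show ?thesis using assms by (simp add: diameter_def)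
qed

text \<open>The covering argument of Borel and Cantelli: for every \<open>m\<close> the balls of
  generations \<open>n \<ge> m\<close> cover \<open>A\<close>, and their total is bounded by the
  tail of a convergent series.\<close>

lemma hausdorff_measure_0_limsup_cballs:
  fixes S :: "nat \<Rightarrow> 'a::metric_space set" and a :: "nat \<Rightarrow> real"
  assumes s: "s > 0" and S: "\<And>n. countable (S n)" and R: "\<And>n y. y \<in> S n \<Longrightarrow> 0 \<le> R n y"
    and sum: "\<And>n. (\<Sum>\<^sub>\<infinity>y\<in>S n. ennreal (R n y powr s)) \<le> ennreal (a n)"
    and a: "summable a" "\<And>n. 0 \<le> a n"
    and A: "\<And>x m. x \<in> A \<Longrightarrow> \<exists>n\<ge>m. \<exists>y\<in>S n. x \<in> cball y (R n y)"
  shows "hausdorff_measure s A = 0"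
proof (rule hausdorff_measure_eq_0I)
  fix \<delta> \<epsilon> :: real assume de: "\<delta> > 0" "\<epsilon> > 0"
  \<comment> \<open>The first bound pays for passing from radii to diameters. The second bounds each
    single radius by \<open>\<delta> / 2\<close>, since every term is at most the tail sum.\<close>
  define e where "e = min (\<epsilon> / 2 powr s) ((\<delta> / 2) powr s)"
  have e: "e > 0" using de by (simp add: e_def)
  obtain m where m: "\<And>n. n \<ge> m \<Longrightarrow> norm (\<Sum>k. a (k + n)) < e"
    using suminf_exist_split[OF e a(1)] by blast
  have suma: "summable (\<lambda>k. a (k + m))" using a(1) by (simp add: summable_iff_shift)
  have tail: "(\<Sum>k. a (k + m)) < e" using m[of m] by auto
  define J where "J = Sigma {m..} S"
  have cJ: "countable J" unfolding J_def using S by auto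
  define g where "g = to_nat_on J"
  have g: "inj_on g J" unfolding g_def using cJ by (rule inj_on_to_nat_on)
  define C where "C = (\<lambda>(n, y). cball y (R n y))"
  \<comment> \<open>Indices outside the enumeration get the empty set, whose diameter 0 contributes
    \<open>0 powr s = 0\<close>.\<close>
  define U where "U k = (if k \<in> g ` J then C (inv_into J g k) else {})" for k
  have Ug: "U (g j) = C j" if "j \<in> J" for j using g that by (simp add: U_def)
  have dC: "bounded (C j)" "diameter (C j) \<le> 2 * R (fst j) (snd j)" if "j \<in> J" for j
    using that R by (auto simp: C_def J_def intro!: diameter_cball_le)
  have Rsmall: "R (fst j) (snd j) powr s < e" if "j \<in> J" for j
  proof -
    obtain n y where j: "j = (n, y)" "n \<ge> m" "y \<in> S n" using \<open>j \<in> J\<close> by (auto simp: J_def)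
    have "ennreal (R n y powr s) \<le> (\<Sum>\<^sub>\<infinity>y\<in>S n. ennreal (R n y powr s))"
      using infsum_ennreal_ge_finite[of "{y}" "S n" "\<lambda>y. ennreal (R n y powr s)"] j by simp
    also have "\<dots> \<le> ennreal (a n)" by (rule sum)
    finally have "R n y powr s \<le> a n" using a(2) by simp
    also have "a n = a ((n - m) + m)" using j by simp
    also have "\<dots> \<le> (\<Sum>k. a (k + m))" using sum_le_suminf[OF suma, of "{n - m}"] a(2) by simp
    finally show ?thesis using tail j by simp
  qed
  have small: "diameter (C j) \<le> \<delta>" if "j \<in> J" for j
  proof -
    have "R (fst j) (snd j) powr s < (\<delta> / 2) powr s" using Rsmall[OF that] by (simp add: e_def)
    then have "R (fst j) (snd j) < \<delta> / 2"
      using powr_mono2[of s "\<delta> / 2" "R (fst j) (snd j)"] s de by linarith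
    then show ?thesis using dC(2)[OF that] by simp
  qed
  have "(\<Sum>k. ennreal (diameter (U k) powr s)) = infsum (\<lambda>k. ennreal (diameter (U k) powr s)) UNIV"
    by (simp add: infsum_ennreal_nat)
  also have "\<dots> = infsum (\<lambda>k. ennreal (diameter (U k) powr s)) (g ` J)"
    by (rule infsum_cong_neutral) (use s in \<open>auto simp: U_def\<close>)
  also have "\<dots> = infsum (\<lambda>j. ennreal (diameter (C j) powr s)) J"
    by (subst infsum_reindex[OF g]) (auto intro!: infsum_cong simp: Ug)
  also have "\<dots> \<le> infsum (\<lambda>(n, y). ennreal (2 powr s) * ennreal (R n y powr s)) J"
  proof (rule infsum_mono)
    fix j assume j: "j \<in> J"
    have "diameter (C j) powr s \<le> (2 * R (fst j) (snd j)) powr s"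
      using dC[OF j] s by (intro powr_mono2) (auto simp: diameter_ge_0)
    also have "\<dots> = 2 powr s * R (fst j) (snd j) powr s" using R j by (auto simp: powr_mult J_def)
    finally show "ennreal (diameter (C j) powr s) \<le> (case j of (n, y) \<Rightarrow> ennreal (2 powr s) * ennreal (R n y powr s))"
      by (auto simp: ennreal_mult[symmetric] split: prod.split)
  qed auto
  also have "\<dots> = (\<Sum>\<^sub>\<infinity>n\<in>{m..}. ennreal (2 powr s) * (\<Sum>\<^sub>\<infinity>y\<in>S n. ennreal (R n y powr s)))"
    unfolding J_def infsum_ennreal_Sigma by (simp add: infsum_ennreal_cmult)
  also have "\<dots> \<le> (\<Sum>\<^sub>\<infinity>n\<in>{m..}. ennreal (2 powr s) * ennreal (a n))"
    by (intro infsum_mono mult_left_mono sum) auto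
  also have "\<dots> = ennreal (2 powr s) * (\<Sum>\<^sub>\<infinity>n\<in>{m..}. ennreal (a n))" by (rule infsum_ennreal_cmult)
  also have "(\<Sum>\<^sub>\<infinity>n\<in>{m..}. ennreal (a n)) = (\<Sum>k. ennreal (a (k + m)))"
  proof -
    have "bij_betw (\<lambda>k. k + m) UNIV {m..}"
      by (rule bij_betwI[where g="\<lambda>k. k - m"]) auto
    from infsum_reindex_bij_betw[OF this, of "\<lambda>n. ennreal (a n)"] show ?thesis by (simp add: infsum_ennreal_nat)
  qed
  also have "\<dots> = ennreal (\<Sum>k. a (k + m))" by (rule suminf_ennreal2[OF _ suma]) (use a in auto)
  also have "ennreal (2 powr s) * \<dots> \<le> ennreal \<epsilon>"
  proof -
    have "2 powr s * (\<Sum>k. a (k + m)) \<le> 2 powr s * (\<epsilon> / 2 powr s)"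
      using tail by (intro mult_left_mono) (auto simp: e_def)
    then show ?thesis by (auto simp: ennreal_mult'[symmetric] intro!: ennreal_leI)
  qed
  finally have "(\<Sum>k. ennreal (diameter (U k) powr s)) \<le> ennreal \<epsilon>" .
  moreover have "A \<subseteq> (\<Union>k. U k)"
  proof
    fix x assume "x \<in> A"
    then obtain n y where "n \<ge> m" "y \<in> S n" "x \<in> cball y (R n y)" using A by blast
    then have "(n, y) \<in> J" "x \<in> C (n, y)" by (auto simp: J_def C_def)
    then show "x \<in> (\<Union>k. U k)" using Ug by blast
  qed
  moreover have "bounded (U k) \<and> diameter (U k) \<le> \<delta>" for k
    using dC small de Ug by (cases "k \<in> g ` J") (auto simp: U_def)
  ultimately show "\<exists>U. A \<subseteq> (\<Union>i::nat. U i) \<and>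
      (\<forall>i. bounded (U i) \<and> diameter (U i) \<le> \<delta>) \<and> (\<Sum>i. ennreal (diameter (U i) powr s)) \<le> ennreal \<epsilon>"
    by blast
qed

section \<open>Local branches and covering properties\<close>

lemma cmod_exp_minus_1_le:
  fixes d :: complex
  assumes "cmod d \<le> 1"
  shows "cmod (exp d - 1) \<le> 3 * cmod d"
proof -
  have "cmod (exp d - exp 0) \<le> 3 * cmod (d - 0)"
  proof (rule field_differentiable_bound[where S="cball 0 1" and f'=exp])
    fix z :: complex assume "z \<in> cball 0 1"
    show "(exp has_field_derivative exp z) (at z within cball 0 1)"
      by (rule has_field_derivative_at_within) (rule DERIV_exp)
    have "exp (Re z) \<le> exp (1::real)" using \<open>z \<in> cball 0 1\<close> abs_Re_le_cmod[of z] by auto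
    also have "\<dots> \<le> 3" using exp_le by simp
    finally show "cmod (exp z) \<le> 3" by simp
  qed (use assms in auto)
  then show ?thesis by simp
qed

lemma near_linear_inj:
  fixes a u v :: complex
  assumes lin: "cmod (f u - f v - a * (u - v)) \<le> cmod a / 2 * cmod (u - v)" and a: "a \<noteq> 0" and eq: "f u = f v"
  shows "u = v"
proof -
  have "cmod a * cmod (u - v) \<le> cmod a / 2 * cmod (u - v)"
    using lin unfolding eq by (simp add: norm_mult)
  then have "cmod a * cmod (u - v) \<le> 0" by linarith
  then have "cmod (u - v) \<le> 0" using a by (simp add: mult_le_0_iff)
  then show ?thesis by simp
qed

locale fatou_map =
  fixes l :: nat and c :: complex
  assumes l2: "2 \<le> l" and c_ball: "c \<in> ball (of_nat l) 1"
begin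

abbreviation f :: "complex \<Rightarrow> complex" where "f \<equiv> f_map l c"
abbreviation F :: "cylinder \<Rightarrow> cylinder" where "F \<equiv> F_map l c"

definition C where "C = c - (of_nat l - 1) * Ln c"
definition p where "p = Ln c"
definition v0 where "v0 = f (Ln (of_nat l))"
text \<open>The critical points are the translates of \<open>Ln (of_nat l)\<close> by periods, and
  \<open>f\<close> multiplies a period by \<open>l\<close>; so these are all critical values of
  \<open>f\<close>.\<close>

definition CV where "CV = range (\<lambda>k::int. v0 + 2 * of_real pi * \<i> * of_int (int l * k))"

abbreviation per :: "int \<Rightarrow> complex" where "per k \<equiv> 2 * of_real pi * \<i> * of_int k"

lemma f_eq: "f z = C + of_nat l * z - exp z"
  by (simp add: f_map_def C_def)

lemma f_per: "f (z + per k) = f z + per (int l * k)"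
  by (rule f_map_shift)

lemma exp_per [simp]: "exp (z + per k) = exp z"
  using cyl_rel_iff_exp cyl_rel_def by blast

lemma exp_eq_per: "exp z = exp w \<Longrightarrow> \<exists>k. z = w + per k"
  using cyl_rel_iff_exp[of w z] unfolding cyl_rel_def by auto

lemma cmod_per: "cmod (per k) = 2 * pi * \<bar>real_of_int k\<bar>"
  by (simp add: norm_mult)

lemma c_nz: "c \<noteq> 0"
  using c_ball l2 by (auto simp: dist_norm)

lemma exp_p: "exp p = c"
  using c_nz by (simp add: p_def)

lemma f_p: "f p = p"
  using exp_p by (simp add: f_eq C_def p_def[symmetric] algebra_simps)

lemma f_deriv: "(f has_field_derivative (of_nat l - exp z)) (at z)"
  by (rule f_map_has_field_derivative)

lemma f_cont: "continuous_on S f"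
  using f_deriv by (meson DERIV_continuous continuous_at_imp_continuous_on)

lemma mult_p: "cmod (of_nat l - c) < 1"
  using c_ball by (simp add: dist_norm)

lemma f_deriv_diff:
  assumes "cmod (u - x) \<le> 1"
  shows "cmod ((of_nat l - exp u) - (of_nat l - exp x)) \<le> 3 * cmod (exp x) * cmod (u - x)"
proof -
  have "exp u = exp x * exp (u - x)" by (simp add: exp_diff)
  then have "(of_nat l - exp u) - (of_nat l - exp x) = - exp x * (exp (u - x) - 1)" by (simp add: algebra_simps)
  then have "cmod ((of_nat l - exp u) - (of_nat l - exp x)) = cmod (exp x) * cmod (exp (u - x) - 1)"
    by (simp add: norm_mult)
  also have "\<dots> \<le> cmod (exp x) * (3 * cmod (u - x))"
    by (intro mult_left_mono cmod_exp_minus_1_le assms) auto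
  finally show ?thesis by simp
qed

text \<open>Where the derivative has modulus at least \<open>\<delta>\<close>,
  \<open>cmod (exp x)\<close> is at most \<open>1 + real l / \<delta>\<close> times that modulus;
  the 3 comes from \<open>cmod_exp_minus_1_le\<close>.\<close>

definition Lip :: "real \<Rightarrow> real" where "Lip \<delta> = 3 * (1 + real l / \<delta>)"

lemma Lip_ge: "\<delta> > 0 \<Longrightarrow> Lip \<delta> \<ge> 3"
  by (simp add: Lip_def)

text \<open>The variation of the derivative is bounded relative to the derivative itself. That keeps
  the constant uniform to the right, where both are of size \<open>exp (Re x)\<close>.\<close>

lemma f_deriv_rel:
  assumes "\<delta> > 0" "\<delta> \<le> cmod (of_nat l - exp x)" "cmod (u - x) \<le> 1"
  shows "cmod ((of_nat l - exp u) - (of_nat l - exp x)) \<le> Lip \<delta> * cmod (u - x) * cmod (of_nat l - exp x)"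
proof -
  let ?a = "cmod (of_nat l - exp x)"
  have "cmod (exp x) \<le> ?a + real l"
    using norm_triangle_ineq2[of "exp x" "of_nat l"] by (simp add: norm_minus_commute)
  also have "\<dots> \<le> ?a + ?a / \<delta> * real l"
    using mult_right_mono[of 1 "?a / \<delta>" "real l"] assms by simp
  also have "\<dots> = ?a * (1 + real l / \<delta>)" by (simp add: algebra_simps)
  finally have "3 * cmod (exp x) \<le> 3 * (?a * (1 + real l / \<delta>))" by (intro mult_left_mono) auto
  then have "3 * cmod (exp x) \<le> Lip \<delta> * ?a" by (simp only: Lip_def mult_ac)
  then have "3 * cmod (exp x) * cmod (u - x) \<le> Lip \<delta> * ?a * cmod (u - x)" by (intro mult_right_mono) auto
  then show ?thesis using f_deriv_diff[OF assms(3)] by (simp add: algebra_simps)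
qed

lemma f_near_linear:
  assumes "\<delta> > 0" "\<delta> \<le> cmod (of_nat l - exp x)" "\<rho> \<le> 1" "u \<in> cball x \<rho>" "v \<in> cball x \<rho>"
  shows "cmod (f u - f v - (of_nat l - exp x) * (u - v)) \<le> Lip \<delta> * \<rho> * cmod (of_nat l - exp x) * cmod (u - v)"
proof (rule near_linear[where S="cball x \<rho>" and f'="\<lambda>z. of_nat l - exp z"])
  fix z assume z: "z \<in> cball x \<rho>"
  then have "cmod (z - x) \<le> \<rho>" by (simp add: dist_norm norm_minus_commute)
  then have "Lip \<delta> * cmod (z - x) * cmod (of_nat l - exp x) \<le> Lip \<delta> * \<rho> * cmod (of_nat l - exp x)"
    using Lip_ge[OF assms(1)] by (intro mult_right_mono mult_left_mono) auto
  then show "cmod (of_nat l - exp z - (of_nat l - exp x)) \<le> Lip \<delta> * \<rho> * cmod (of_nat l - exp x)"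
    using f_deriv_rel[OF assms(1,2), of z] \<open>cmod (z - x) \<le> \<rho>\<close> assms(3) by linarith
qed (use assms f_deriv in auto)

text \<open>Continuity of \<open>Ln\<close> at 1, applied to \<open>exp (x - a)\<close>; passing to
  the quotient keeps clear of the branch cut wherever \<open>w\<close> lies.\<close>

lemma exp_close_imp_close:
  assumes "d > 0" "exp a = w"
  obtains s where "s > 0" "\<And>x. cmod (exp x - w) < s \<Longrightarrow> \<exists>k. cmod (x - a - per k) < d"
proof -
  have w0: "w \<noteq> 0" using assms(2) by auto
  have "isCont Ln 1" by (rule continuous_at_Ln) (auto simp: complex_nonpos_Reals_iff)
  then obtain s where s: "s > 0" "\<And>z. cmod (z - 1) < s \<Longrightarrow> cmod (Ln z - Ln 1) < d"
    using assms(1) unfolding continuous_at_eps_delta dist_norm by metis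
  show thesis
  proof (rule that[of "s * cmod w"])
    show "s * cmod w > 0" using s w0 by simp
    fix x assume x: "cmod (exp x - w) < s * cmod w"
    define e where "e = Ln (exp (x - a))"
    have "exp (x - a) = exp x / w" using assms(2) by (simp add: exp_diff)
    then have "exp (x - a) - 1 = (exp x - w) / w" using w0 by (simp add: field_simps)
    then have "cmod (exp (x - a) - 1) < s" using x w0 by (simp add: norm_divide divide_less_eq)
    then have "cmod e < d" using s(2)[of "exp (x - a)"] by (simp add: e_def)
    moreover have "exp e = exp (x - a)" by (simp add: e_def)
    then obtain k where "x - a = e + per k" using exp_eq_per by metis
    then have "x - a - per k = e" by simp
    ultimately show "\<exists>k. cmod (x - a - per k) < d" by metis
  qed
qed

text \<open>If the derivative at \<open>x\<close> is small, \<open>x\<close> is close to a translate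
  of the single point \<open>Ln (of_nat l)\<close>, and by equivariance \<open>f x\<close> is close
  to \<open>CV\<close>; so one \<open>\<delta>\<close> serves the whole plane.\<close>

lemma far_from_CV:
  assumes "d > 0"
  obtains \<delta> where "\<delta> > 0" "\<And>x. (\<And>v. v \<in> CV \<Longrightarrow> d \<le> dist (f x) v) \<Longrightarrow> \<delta> \<le> cmod (of_nat l - exp x)"
proof -
  let ?a = "Ln (of_nat l)"
  have ea: "exp ?a = of_nat l" by (rule exp_Ln) (use l2 in simp)
  have "isCont f ?a" using f_deriv DERIV_isCont by blast
  then obtain e where e: "e > 0" "\<And>z. cmod (z - ?a) < e \<Longrightarrow> cmod (f z - f ?a) < d"
    using assms unfolding continuous_at_eps_delta dist_norm by metis
  obtain s where s: "s > 0" "\<And>x. cmod (exp x - of_nat l) < s \<Longrightarrow> \<exists>k. cmod (x - ?a - per k) < e"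
    using exp_close_imp_close[OF e(1) ea] by metis
  show thesis
  proof (rule that[OF s(1)])
    fix x assume far: "\<And>v. v \<in> CV \<Longrightarrow> d \<le> dist (f x) v"
    show "s \<le> cmod (of_nat l - exp x)"
    proof (rule ccontr)
      assume "\<not> s \<le> cmod (of_nat l - exp x)"
      then obtain k where k: "cmod (x - ?a - per k) < e" using s(2)[of x] by (auto simp: norm_minus_commute)
      define y where "y = x - per k"
      have "cmod (f y - v0) < d" using e(2)[of y] k by (simp add: y_def v0_def algebra_simps)
      moreover have "f x = f y + per (int l * k)" using f_per[of y k] by (simp add: y_def)
      ultimately have "dist (f x) (v0 + per (int l * k)) < d" by (simp add: dist_norm)
      moreover have "v0 + per (int l * k) \<in> CV" by (auto simp: CV_def)
      ultimately show False using far by fastforce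
    qed
  qed
qed

section \<open>The map as a covering of the complement of its critical values\<close>

lemma countable_CV: "countable CV"
  by (simp add: CV_def)

lemma closed_CV: "closed CV"
proof -
  have "v0 + per (int l * k) = v0 + per (int l * k')" if "dist (v0 + per (int l * k)) (v0 + per (int l * k')) < 1" for k k'
  proof -
    have "v0 + per (int l * k) - (v0 + per (int l * k')) = per (int l * (k - k'))"
      by (simp add: algebra_simps)
    then have "dist (v0 + per (int l * k)) (v0 + per (int l * k')) = cmod (per (int l * (k - k')))"
      by (simp only: dist_norm)
    also have "\<dots> = 2 * pi * real l * \<bar>real_of_int (k - k')\<bar>" unfolding cmod_per by (simp add: abs_mult)
    finally have "2 * pi * real l * \<bar>real_of_int (k - k')\<bar> < 1" using that by simp
    moreover have "2 * pi * real l \<ge> 1 * 1"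
      using l2 pi_ge_two by (intro mult_mono) auto
    ultimately have "\<bar>real_of_int (k - k')\<bar> < 1"
      by (smt (verit) mult_le_cancel_right1)
    then have "\<bar>k - k'\<bar> < 1" by linarith
    then show ?thesis by simp
  qed
  then have "\<And>x y. x \<in> CV \<Longrightarrow> y \<in> CV \<Longrightarrow> dist y x < 1 \<Longrightarrow> y = x" by (auto simp: CV_def)
  then show ?thesis by (intro discrete_imp_closed[of 1]) auto
qed

text \<open>At all points that \<open>f\<close> maps near \<open>w\<close> the derivative is at
  least some \<open>\<delta>\<close>, so \<open>f\<close> is nearly linear on discs of one common
  radius \<open>\<kappa>\<close> about them, and the images of these discs contain discs of one
  common radius. Infinitely many sheets are thus controlled at once.\<close>

lemma local_branches:
  assumes "w \<notin> CV"
  obtains \<rho> \<kappa> where "\<rho> > 0" "\<kappa> > 0" "ball w \<rho> \<inter> CV = {}"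
    "\<And>y. dist (f y) w < \<rho> \<Longrightarrow> of_nat l - exp y \<noteq> 0 \<and> \<rho> \<le> \<kappa> * cmod (of_nat l - exp y) / 2 \<and>
        (\<forall>u\<in>ball y \<kappa>. \<forall>v\<in>ball y \<kappa>. cmod (f u - f v - (of_nat l - exp y) * (u - v)) \<le> cmod (of_nat l - exp y) / 2 * cmod (u - v))"
proof -
  obtain d where d: "d > 0" "ball w d \<subseteq> - CV"
    using closed_CV assms by (metis ComplI open_Compl openE)
  obtain \<delta> where \<delta>: "\<delta> > 0" "\<And>x. (\<And>v. v \<in> CV \<Longrightarrow> d / 2 \<le> dist (f x) v) \<Longrightarrow> \<delta> \<le> cmod (of_nat l - exp x)"
    using far_from_CV[of "d / 2"] d by auto
  have L: "Lip \<delta> \<ge> 3" using Lip_ge \<delta> by blast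
  define \<kappa> where "\<kappa> = 1 / (2 * Lip \<delta>)"
  have \<kappa>: "\<kappa> > 0" "\<kappa> \<le> 1" "Lip \<delta> * \<kappa> = 1 / 2" using L by (auto simp: \<kappa>_def field_simps)
  \<comment> \<open>\<open>d / 2\<close> keeps \<open>f y\<close> away from \<open>CV\<close>;
    \<open>\<kappa> * \<delta> / 2\<close> is the radius that \<open>near_linear_surj\<close>
    provides.\<close>
  define \<rho> where "\<rho> = min (d / 2) (\<kappa> * \<delta> / 2)"
  show thesis
  proof (rule that[of \<rho> \<kappa>])
    show "\<rho> > 0" using d \<kappa> \<delta> by (simp add: \<rho>_def)
    show "\<kappa> > 0" by fact
    have "ball w \<rho> \<subseteq> ball w d" using d by (intro subset_ball) (auto simp: \<rho>_def min_def)
    then show "ball w \<rho> \<inter> CV = {}" using d(2) by blast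
    fix y assume y: "dist (f y) w < \<rho>"
    have far: "\<delta> \<le> cmod (of_nat l - exp y)"
    proof (rule \<delta>(2))
      fix v assume "v \<in> CV"
      then have "d \<le> dist w v" using d(2) by (auto simp: subset_iff not_less[symmetric])
      then show "d / 2 \<le> dist (f y) v"
        using y dist_triangle[of w v "f y"] by (simp add: \<rho>_def dist_commute)
    qed
    have "\<rho> \<le> \<kappa> * \<delta> / 2" by (simp add: \<rho>_def)
    also have "\<dots> \<le> \<kappa> * cmod (of_nat l - exp y) / 2" using far \<kappa> by (simp add: mult_left_mono)
    finally have "\<rho> \<le> \<kappa> * cmod (of_nat l - exp y) / 2" .
    moreover have "\<forall>u\<in>ball y \<kappa>. \<forall>v\<in>ball y \<kappa>. cmod (f u - f v - (of_nat l - exp y) * (u - v)) \<le> cmod (of_nat l - exp y) / 2 * cmod (u - v)"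
    proof (intro ballI)
      fix u v assume uv: "u \<in> ball y \<kappa>" "v \<in> ball y \<kappa>"
      have "cmod (f u - f v - (of_nat l - exp y) * (u - v)) \<le> Lip \<delta> * \<kappa> * cmod (of_nat l - exp y) * cmod (u - v)"
        by (rule f_near_linear[OF \<delta>(1) far \<kappa>(2)]) (use uv in auto)
      then show "cmod (f u - f v - (of_nat l - exp y) * (u - v)) \<le> cmod (of_nat l - exp y) / 2 * cmod (u - v)"
        by (simp add: \<kappa>(3))
    qed
    ultimately show "of_nat l - exp y \<noteq> 0 \<and> \<rho> \<le> \<kappa> * cmod (of_nat l - exp y) / 2 \<and>
        (\<forall>u\<in>ball y \<kappa>. \<forall>v\<in>ball y \<kappa>. cmod (f u - f v - (of_nat l - exp y) * (u - v)) \<le> cmod (of_nat l - exp y) / 2 * cmod (u - v))"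
      using far \<delta> by auto
  qed
qed

text \<open>A small disc off \<open>CV\<close> is either contained in the image or disjoint from it,
  so the image is open and closed in \<open>- CV\<close>, which is connected as the complement of a
  countable set.\<close>

lemma f_onto: "- CV \<subseteq> range f"
proof -
  define T where "T = range f \<inter> - CV"
  have con: "connected (- CV)"
    by (rule path_connected_imp_connected, rule path_connected_complement_countable) (auto simp: countable_CV)
  have op: "\<exists>\<rho>>0. ball w \<rho> \<inter> CV = {} \<and> (ball w \<rho> \<subseteq> range f \<or> ball w \<rho> \<inter> range f = {})" if w: "w \<in> - CV" for w
  proof -
    have "w \<notin> CV" using w by simp
    then obtain \<rho> \<kappa> where r: "\<rho> > 0" "\<kappa> > 0" "ball w \<rho> \<inter> CV = {}"
      "\<And>y. dist (f y) w < \<rho> \<Longrightarrow> of_nat l - exp y \<noteq> 0 \<and> \<rho> \<le> \<kappa> * cmod (of_nat l - exp y) / 2 \<and>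
        (\<forall>u\<in>ball y \<kappa>. \<forall>v\<in>ball y \<kappa>. cmod (f u - f v - (of_nat l - exp y) * (u - v)) \<le> cmod (of_nat l - exp y) / 2 * cmod (u - v))"
      using local_branches by metis
    have "ball w (\<rho>/2) \<subseteq> range f" if "z \<in> ball w (\<rho>/2)" "z = f y" for z y
    proof
      fix w' assume "w' \<in> ball w (\<rho>/2)"
      then have "cmod (w' - f y) < \<rho>" using that dist_triangle2[of w' "f y" w] by (simp add: dist_norm norm_minus_commute)
      moreover have y: "dist (f y) w < \<rho>" using that r(1) by (simp add: dist_commute)
      ultimately have "cmod (w' - f y) < \<kappa> * cmod (of_nat l - exp y) / 2" using r(4) by fastforce
      then obtain u where "f u = w'"
        using near_linear_surj[of y \<kappa> f "of_nat l - exp y" w'] r(4)[OF y] by blast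
      then show "w' \<in> range f" by auto
    qed
    then have "ball w (\<rho>/2) \<subseteq> range f \<or> ball w (\<rho>/2) \<inter> range f = {}" by blast
    moreover have "ball w (\<rho>/2) \<inter> CV = {}" using r(1,3) by (auto simp: disjoint_iff)
    ultimately show ?thesis using r(1) by (intro exI[of _ "\<rho>/2"]) auto
  qed
  have o1: "open T"
    unfolding open_contains_ball
  proof
    fix w assume w: "w \<in> T"
    then obtain \<rho> where "\<rho> > 0" "ball w \<rho> \<inter> CV = {}" "ball w \<rho> \<subseteq> range f \<or> ball w \<rho> \<inter> range f = {}"
      using op[of w] by (auto simp: T_def)
    moreover have "w \<in> ball w \<rho> \<inter> range f" using w \<open>\<rho> > 0\<close> by (simp add: T_def)
    ultimately show "\<exists>e>0. ball w e \<subseteq> T" unfolding T_def by (intro exI[of _ \<rho>]) blast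
  qed
  have o2: "open (- CV - range f)"
    unfolding open_contains_ball
  proof
    fix w assume w: "w \<in> - CV - range f"
    then obtain \<rho> where "\<rho> > 0" "ball w \<rho> \<inter> CV = {}" "ball w \<rho> \<subseteq> range f \<or> ball w \<rho> \<inter> range f = {}"
      using op[of w] by auto
    moreover have "w \<in> ball w \<rho>" using \<open>\<rho> > 0\<close> by simp
    ultimately show "\<exists>e>0. ball w e \<subseteq> - CV - range f" using w by (intro exI[of _ \<rho>]) blast
  qed
  have ne: "T \<noteq> {}"
  proof -
    \<comment> \<open>Far to the left the real part of the image drops below \<open>Re v0\<close>,
      the common real part of all points of \<open>CV\<close>.\<close>
    define t where "t = - (\<bar>Re v0\<bar> + \<bar>Re C\<bar> + 1)"
    have "Re (f (of_real t)) = Re C + real l * t - exp t" by (simp add: f_eq Re_exp)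
    also have "\<dots> < Re C + real l * t" by simp
    also have "real l * t \<le> 1 * t" using l2 by (intro mult_right_mono_neg) (auto simp: t_def)
    finally have "Re (f (of_real t)) < Re v0" by (simp add: t_def)
    then have "f (of_real t) \<notin> CV" by (auto simp: CV_def)
    then show ?thesis by (auto simp: T_def)
  qed
  have "- CV - range f = {}"
    using connectedD[OF con o1 o2] ne by (auto simp: T_def)
  then show ?thesis by blast
qed

text \<open>Each point of the fibre over \<open>w\<close> has its sheet in the disc of radius
  \<open>\<kappa>\<close> about it. Two sheets that share a point \<open>y\<close> have both centres
  in the disc about \<open>y\<close>, where \<open>f\<close> is injective.\<close>

lemma f_covering: "covering_space (f -` (- CV)) f (- CV)"
  unfolding covering_space_def
proof (intro conjI ballI)
  show "continuous_on (f -` (- CV)) f" by (rule f_cont)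
  show "f ` (f -` (- CV)) = - CV" using f_onto by auto
  fix w assume "w \<in> - CV"
  then have "w \<notin> CV" by simp
  then obtain \<rho> \<kappa> where r: "\<rho> > 0" "\<kappa> > 0" "ball w \<rho> \<inter> CV = {}"
    "\<And>y. dist (f y) w < \<rho> \<Longrightarrow> of_nat l - exp y \<noteq> 0 \<and> \<rho> \<le> \<kappa> * cmod (of_nat l - exp y) / 2 \<and>
        (\<forall>u\<in>ball y \<kappa>. \<forall>v\<in>ball y \<kappa>. cmod (f u - f v - (of_nat l - exp y) * (u - v)) \<le> cmod (of_nat l - exp y) / 2 * cmod (u - v))"
    using local_branches by metis
  have inj: "inj_on f (ball y \<kappa>)" if "dist (f y) w < \<rho>" for y
  proof (rule inj_onI)
    fix u v assume "u \<in> ball y \<kappa>" "v \<in> ball y \<kappa>" "f u = f v"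
    then show "u = v" using r(4)[OF that] near_linear_inj[of f u v "of_nat l - exp y"] by blast
  qed
  have surj: "\<exists>u\<in>ball y \<kappa>. f u = w'" if "dist (f y) w < \<rho>" "dist (f y) w' < \<rho>" for y w'
  proof -
    have "cmod (w' - f y) < \<kappa> * cmod (of_nat l - exp y) / 2"
      using r(4)[OF that(1)] that(2) by (auto simp: dist_norm norm_minus_commute)
    then show ?thesis
      using near_linear_surj[of y \<kappa> f "of_nat l - exp y" w'] r(4)[OF that(1)] by blast
  qed
  define U where "U x = ball x \<kappa> \<inter> f -` ball w \<rho>" for x
  have openU: "open (U x)" for x
    unfolding U_def by (intro open_Int open_vimage[OF open_ball f_cont]) auto
  show "\<exists>T. w \<in> T \<and> openin (top_of_set (- CV)) T \<and>
           (\<exists>v. \<Union> v = f -` (- CV) \<inter> f -` T \<and> (\<forall>u\<in>v. openin (top_of_set (f -` (- CV))) u) \<and>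
                pairwise disjnt v \<and> (\<forall>u\<in>v. \<exists>q. homeomorphism u T f q))"
  proof (intro exI[of _ "ball w \<rho>"] conjI exI[of _ "U ` (f -` {w})"])
    show "w \<in> ball w \<rho>" using r by simp
    show "openin (top_of_set (- CV)) (ball w \<rho>)" using r(3) by (intro open_subset) auto
    have sub: "f -` ball w \<rho> \<subseteq> f -` (- CV)" using r(3) by auto
    show "\<Union> (U ` (f -` {w})) = f -` (- CV) \<inter> f -` ball w \<rho>"
    proof
      show "\<Union> (U ` (f -` {w})) \<subseteq> f -` (- CV) \<inter> f -` ball w \<rho>" using sub by (auto simp: U_def)
      show "f -` (- CV) \<inter> f -` ball w \<rho> \<subseteq> \<Union> (U ` (f -` {w}))"
      proof
        fix y assume "y \<in> f -` (- CV) \<inter> f -` ball w \<rho>"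
        then have y: "dist (f y) w < \<rho>" by (simp add: dist_commute)
        then obtain x where "x \<in> ball y \<kappa>" "f x = w" using surj[OF y, of w] by auto
        then show "y \<in> \<Union> (U ` (f -` {w}))" using y by (intro UN_I[of x]) (auto simp: U_def dist_commute)
      qed
    qed
    show "\<forall>u\<in>U ` (f -` {w}). openin (top_of_set (f -` (- CV))) u"
    proof
      fix u assume "u \<in> U ` (f -` {w})"
      then obtain x where "u = U x" by auto
      then show "openin (top_of_set (f -` (- CV))) u"
        using openU[of x] sub by (intro open_subset) (auto simp: U_def)
    qed
    show "pairwise disjnt (U ` (f -` {w}))"
    proof (rule pairwiseI)
      fix u u' assume "u \<in> U ` (f -` {w})" "u' \<in> U ` (f -` {w})" "u \<noteq> u'"
      then obtain x x' where x: "u = U x" "u' = U x'" "f x = w" "f x' = w" "x \<noteq> x'" by auto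
      show "disjnt u u'"
      proof (rule ccontr)
        assume "\<not> disjnt u u'"
        then obtain y where y: "dist x y < \<kappa>" "dist x' y < \<kappa>" "dist (f y) w < \<rho>"
          by (auto simp: x U_def disjnt_def dist_commute)
        then have "x = x'" using inj[OF y(3)] x by (auto simp: inj_on_def dist_commute)
        then show False using x by simp
      qed
    qed
    show "\<forall>u\<in>U ` (f -` {w}). \<exists>q. homeomorphism u (ball w \<rho>) f q"
    proof
      fix u assume "u \<in> U ` (f -` {w})"
      then obtain x where x: "u = U x" "f x = w" by auto
      have d: "dist (f x) w < \<rho>" using x r by simp
      have "inj_on f (U x)" using inj[OF d] by (auto simp: U_def intro: inj_on_subset)
      then obtain g where "homeomorphism (U x) (f ` U x) f g"
        using invariance_of_domain_homeomorphism[OF openU[of x] f_cont] by auto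
      moreover have "f ` U x = ball w \<rho>"
      proof
        show "ball w \<rho> \<subseteq> f ` U x"
        proof
          fix w' assume "w' \<in> ball w \<rho>"
          then obtain u where "u \<in> ball x \<kappa>" "f u = w'" using surj[OF d, of w'] x by auto
          then show "w' \<in> f ` U x" using \<open>w' \<in> ball w \<rho>\<close> by (auto simp: U_def)
        qed
      qed (auto simp: U_def)
      ultimately show "\<exists>q. homeomorphism u (ball w \<rho>) f q" using x by auto
    qed
  qed
qed

lemma f_crit: "of_nat l - exp x = 0 \<Longrightarrow> f x \<in> CV"
proof -
  assume "of_nat l - exp x = 0"
  moreover have "exp (Ln (of_nat l)) = (of_nat l :: complex)" by (rule exp_Ln) (use l2 in simp)
  ultimately have "exp x = exp (Ln (of_nat l))" by simp
  then obtain k where "x = Ln (of_nat l) + per k" using exp_eq_per by blast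
  then show "f x \<in> CV" using f_per[of "Ln (of_nat l)" k] by (auto simp: CV_def v0_def)
qed

text \<open>A disc is simply connected, so the covering gives a continuous lift. It is holomorphic
  because \<open>f\<close> has nonzero derivative at every point whose image avoids
  \<open>CV\<close>.\<close>

lemma lift_ball:
  assumes hol: "\<phi> holomorphic_on ball a r" and r: "r > 0" and av: "\<phi> ` ball a r \<subseteq> - CV" and x: "f x = \<phi> a"
  obtains \<psi> where "\<psi> holomorphic_on ball a r" "\<psi> a = x" "\<And>\<zeta>. \<zeta> \<in> ball a r \<Longrightarrow> f (\<psi> \<zeta>) = \<phi> \<zeta>"
proof -
  have a: "a \<in> ball a r" using r by simp
  have "\<phi> a \<in> - CV" using av a by blast
  then have x': "x \<in> f -` (- CV)" using x by simp
  have sc: "simply_connected (ball a r)" by (simp add: convex_imp_simply_connected)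
  have lp: "locally path_connected (ball a r)" by (simp add: open_imp_locally_path_connected)
  have im: "\<phi> \<in> ball a r \<rightarrow> - CV" using av by auto
  obtain \<psi> where \<psi>: "continuous_on (ball a r) \<psi>" "\<psi> a = x" "\<And>y. y \<in> ball a r \<Longrightarrow> f (\<psi> y) = \<phi> y"
    using covering_space_lift_strong[OF f_covering x' a sc lp holomorphic_on_imp_continuous_on[OF hol] im x[symmetric]]
    by metis
  have "\<psi> holomorphic_on ball a r"
    unfolding holomorphic_on_open[OF open_ball]
  proof
    fix \<zeta> assume z: "\<zeta> \<in> ball a r"
    define y where "y = \<psi> \<zeta>"
    have "\<phi> \<zeta> \<in> - CV" using av z by blast
    then have ynz: "of_nat l - exp y \<noteq> 0" using f_crit[of y] \<psi>(3)[OF z] by (auto simp: y_def)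
    \<comment> \<open>Caratheodory's form of the derivative: the difference quotient of the lift is
      that of \<open>\<phi>\<close> divided by \<open>G\<close>, even where the lift takes the value
      \<open>y\<close> again.\<close>
    obtain G where G: "\<forall>u. f u - f y = G u * (u - y)" "isCont G y" "G y = of_nat l - exp y"
      using f_deriv[of y] unfolding CARAT_DERIV by blast
    obtain D where D: "(\<phi> has_field_derivative D) (at \<zeta>)"
      using hol z by (metis holomorphic_on_open open_ball)
    have c\<psi>: "isCont \<psi> \<zeta>" using \<psi>(1) z by (simp add: continuous_on_eq_continuous_at)
    have cG: "isCont (\<lambda>\<eta>. G (\<psi> \<eta>)) \<zeta>" using isCont_o2[OF c\<psi>] G(2) by (simp add: y_def)
    have lim: "((\<lambda>\<eta>. ((\<phi> \<eta> - \<phi> \<zeta>) / (\<eta> - \<zeta>)) / G (\<psi> \<eta>)) \<longlongrightarrow> D / (of_nat l - exp y)) (at \<zeta>)"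
      using D cG G(3) ynz unfolding has_field_derivative_iff isCont_def y_def
      by (intro tendsto_divide) auto
    have "eventually (\<lambda>\<eta>. G (\<psi> \<eta>) \<noteq> 0) (at \<zeta>)"
      using cG G(3) ynz unfolding isCont_def by (intro tendsto_imp_eventually_ne) (auto simp: y_def)
    moreover have "eventually (\<lambda>\<eta>. \<eta> \<in> ball a r) (at \<zeta>)" using z using eventually_at_in_open'[OF open_ball, of \<zeta> a r] by simp
    moreover have "eventually (\<lambda>\<eta>. \<eta> \<noteq> \<zeta>) (at \<zeta>)" by (simp add: eventually_at_filter)
    ultimately have "eventually (\<lambda>\<eta>. ((\<phi> \<eta> - \<phi> \<zeta>) / (\<eta> - \<zeta>)) / G (\<psi> \<eta>) = (\<psi> \<eta> - \<psi> \<zeta>) / (\<eta> - \<zeta>)) (at \<zeta>)"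
    proof eventually_elim
      case (elim \<eta>)
      have eq: "\<phi> \<eta> - \<phi> \<zeta> = G (\<psi> \<eta>) * (\<psi> \<eta> - \<psi> \<zeta>)"
        using G(1) \<psi>(3)[OF elim(2)] \<psi>(3)[OF z] unfolding y_def by metis
      show ?case unfolding eq using elim(1) by simp
    qed
    then have "((\<lambda>\<eta>. (\<psi> \<eta> - \<psi> \<zeta>) / (\<eta> - \<zeta>)) \<longlongrightarrow> D / (of_nat l - exp y)) (at \<zeta>)"
      by (rule Lim_transform_eventually[OF lim])
    then show "\<exists>f'. (\<psi> has_field_derivative f') (at \<zeta>)" unfolding has_field_derivative_iff by blast
  qed
  then show thesis using that \<psi> by blast
qed

end

section \<open>The attracting fixed point and the critical value\<close>

text \<open>Cauchy's estimate on the circle of half the radius, which lies inside the open disc;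
  hence the factor 2.\<close>

lemma cmod_deriv_le_ball:
  assumes "g holomorphic_on ball a r" "r > 0" "\<And>u. u \<in> ball a r \<Longrightarrow> cmod (g u) \<le> B"
  shows "cmod (deriv g a) \<le> 2 * B / r"
proof -
  have sub: "cball a (r/2) \<subseteq> ball a r" using assms(2) by auto
  have "cmod ((deriv ^^ 1) g a) \<le> fact 1 * B / (r/2) ^ 1"
  proof (rule Cauchy_inequality)
    show "g holomorphic_on ball a (r/2)" using assms(1) sub by (meson ball_subset_cball holomorphic_on_subset order_trans)
    show "continuous_on (cball a (r/2)) g" using assms(1) sub by (meson continuous_on_subset holomorphic_on_imp_continuous_on)
    fix x assume "cmod (a - x) = r/2"
    then show "cmod (g x) \<le> B" using assms(2) by (intro assms(3)) (simp add: dist_norm)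
  qed (use assms(2) in simp)
  then show ?thesis by (simp add: field_simps)
qed

section \<open>Lifting points and distances from the cylinder to the plane\<close>

lemma dist_to_cyl_le: "dist (to_cyl u) (to_cyl v) \<le> cmod (u - v)"
proof -
  have "setdist (to_cyl -` {to_cyl u}) (to_cyl -` {to_cyl v}) \<le> dist u v"
    by (rule setdist_le_dist) auto
  then show ?thesis by (simp add: dist_cylinder_def dist_norm)
qed

lemma to_cyl_lift_near:
  assumes "dist (to_cyl u) y < e"
  obtains v where "y = to_cyl v" "cmod (u - v) < e"
  using cyl_fibre_dist_less[OF assms refl] by (metis dist_norm)

lemma Re_cyl_to_cyl [simp]: "Re_cyl (to_cyl z) = Re z"
  by transfer simp

lemma Re_cyl_diff_le: "\<bar>Re_cyl x - Re_cyl y\<bar> \<le> dist x y"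
proof (rule field_le_epsilon)
  fix e :: real assume "e > 0"
  obtain u where u: "x = to_cyl u" using to_cyl_surj by metis
  have "dist (to_cyl u) y < dist x y + e" using u \<open>e > 0\<close> by simp
  then obtain v where "y = to_cyl v" "cmod (u - v) < dist x y + e" by (rule to_cyl_lift_near)
  then show "\<bar>Re_cyl x - Re_cyl y\<bar> \<le> dist x y + e"
    using abs_Re_le_cmod[of "u - v"] u by simp
qed

lemma isCont_Re_cyl: "isCont Re_cyl x"
  unfolding continuous_at_eps_delta dist_real_def
  using Re_cyl_diff_le by (meson le_less_trans)

lemma continuous_on_Re_cyl: "continuous_on S Re_cyl"
  using isCont_Re_cyl by (simp add: continuous_at_imp_continuous_on)

context fatou_map
begin

lemma F_pow_to_cyl: "(F ^^ n) (to_cyl z) = to_cyl ((f ^^ n) z)"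
  by (induction n) (simp_all add: F_map_to_cyl)

lemma f_pow_per: "(f ^^ n) (z + per k) = (f ^^ n) z + per (int l ^ n * k)"
  by (rule f_map_iter_shift)

lemma to_cyl_per [simp]: "to_cyl (z + per k) = to_cyl z"
  by (simp add: to_cyl_eq_iff_exp)

lemma to_cyl_eqE: "to_cyl z = to_cyl w \<Longrightarrow> \<exists>k. z = w + per k"
  using exp_eq_per by (simp add: to_cyl_eq_iff_exp)

lemma isCont_F: "isCont F x"
  unfolding continuous_at_eps_delta
proof (intro allI impI)
  fix e :: real assume "e > 0"
  obtain u where u: "x = to_cyl u" using to_cyl_surj by metis
  have "isCont f u" using f_deriv DERIV_isCont by blast
  then obtain d where d: "d > 0" "\<And>v. cmod (v - u) < d \<Longrightarrow> cmod (f v - f u) < e"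
    unfolding continuous_at_eps_delta dist_norm using \<open>e > 0\<close> by metis
  show "\<exists>d>0. \<forall>x'. dist x' x < d \<longrightarrow> dist (F x') (F x) < e"
  proof (intro exI[of _ d] conjI allI impI)
    fix x' assume "dist x' x < d"
    then have "dist (to_cyl u) x' < d" by (simp add: u dist_commute)
    then obtain v where v: "x' = to_cyl v" "cmod (u - v) < d" by (rule to_cyl_lift_near)
    have "dist (F x') (F x) \<le> cmod (f v - f u)" unfolding u v F_map_to_cyl by (rule dist_to_cyl_le)
    also have "\<dots> < e" using d(2)[of v] v(2) by (simp add: norm_minus_commute)
    finally show "dist (F x') (F x) < e" .
  qed (fact d(1))
qed

text \<open>Chosen such that for \<open>Re u \<le> - M\<close> the term \<open>of_nat l * u\<close>
  outweighs \<open>C\<close> and \<open>exp u\<close>, which has modulus at most 1, and each step of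
  \<open>f\<close> moves left by at least 1.\<close>

definition M where "M = cmod C + 3"

lemma left_half_plane: "Re u \<le> - M \<Longrightarrow> Re (f u) \<le> Re u - 1"
proof -
  assume u: "Re u \<le> - M"
  have M: "M \<ge> 3" by (simp add: M_def)
  have "Re (f u) = Re C + real l * Re u - Re (exp u)" by (simp add: f_eq)
  moreover have "\<bar>Re C\<bar> \<le> M - 3" using abs_Re_le_cmod[of C] by (simp add: M_def)
  moreover have "real l * Re u \<le> 2 * Re u" using l2 u M by (intro mult_right_mono_neg) auto
  moreover have "\<bar>Re (exp u)\<bar> \<le> 1"
    using abs_Re_le_cmod[of "exp u"] u M by (simp add: order_trans[of _ "exp (Re u)"] )
  ultimately show ?thesis using u by linarith
qed

lemma left_half_plane_iter: "Re u \<le> - M \<Longrightarrow> Re ((f ^^ n) u) \<le> Re u - real n"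
proof (induction n)
  case (Suc n)
  then have "Re ((f ^^ n) u) \<le> - M" by simp
  from left_half_plane[OF this] Suc show ?case by simp
qed simp

lemma Re_p: "Re p > 0"
proof -
  have "\<bar>Re c - real l\<bar> < 1"
    using c_ball abs_Re_le_cmod[of "of_nat l - c"] by (simp add: dist_norm)
  then have "Re c > 1" using l2 by linarith
  then have "cmod c > 1" using complex_Re_le_cmod[of c] by linarith
  then show ?thesis using c_nz by (simp add: p_def)
qed

lemma attracting_ex: "\<exists>s \<kappa>. 0 < s \<and> s \<le> 1 \<and> 0 < \<kappa> \<and> \<kappa> < 1 \<and> (\<forall>u\<in>cball p s. cmod (f u - p) \<le> \<kappa> * cmod (u - p))"
proof -
  \<comment> \<open>Halfway between the modulus of the multiplier and 1.\<close>
  define \<kappa> where "\<kappa> = (1 + cmod (of_nat l - c)) / 2"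
  have \<kappa>: "cmod (of_nat l - c) < \<kappa>" "0 < \<kappa>" "\<kappa> < 1" using mult_p by (auto simp: \<kappa>_def add_pos_nonneg)
  have "isCont (\<lambda>u. of_nat l - exp u) p" by (intro continuous_intros)
  then have "\<exists>d>0. \<forall>u. cmod (u - p) < d \<longrightarrow> cmod ((of_nat l - exp u) - (of_nat l - exp p)) < \<kappa> - cmod (of_nat l - c)"
    unfolding continuous_at_eps_delta dist_norm using \<kappa> by simp
  then obtain d where d: "d > 0" "\<And>u. cmod (u - p) < d \<Longrightarrow> cmod ((of_nat l - exp u) - (of_nat l - exp p)) < \<kappa> - cmod (of_nat l - c)"
    by blast
  define s where "s = min 1 (d / 2)"
  have "cmod (f u - f p) \<le> \<kappa> * cmod (u - p)" if "u \<in> cball p s" for u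
  proof (rule field_differentiable_bound[where S="cball p s" and f'="\<lambda>z. of_nat l - exp z"])
    fix z assume "z \<in> cball p s"
    then have "cmod (z - p) < d" using d(1) by (simp add: s_def dist_norm norm_minus_commute)
    from d(2)[OF this] have "cmod ((of_nat l - exp z) - (of_nat l - c)) < \<kappa> - cmod (of_nat l - c)" by (simp add: exp_p)
    then show "cmod (of_nat l - exp z) \<le> \<kappa>"
      using norm_triangle_ineq2[of "of_nat l - exp z" "of_nat l - c"] by linarith
    show "(f has_field_derivative of_nat l - exp z) (at z within cball p s)"
      using f_deriv has_field_derivative_at_within by blast
  qed (use that d(1) in \<open>auto simp: s_def\<close>)
  then show ?thesis using d(1) \<kappa> by (intro exI[of _ s] exI[of _ \<kappa>]) (auto simp: s_def f_p)
qed

definition s where "s = (SOME s. \<exists>\<kappa>. 0 < s \<and> s \<le> 1 \<and> 0 < \<kappa> \<and> \<kappa> < 1 \<and> (\<forall>u\<in>cball p s. cmod (f u - p) \<le> \<kappa> * cmod (u - p)))"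
definition \<kappa> where "\<kappa> = (SOME \<kappa>. 0 < s \<and> s \<le> 1 \<and> 0 < \<kappa> \<and> \<kappa> < 1 \<and> (\<forall>u\<in>cball p s. cmod (f u - p) \<le> \<kappa> * cmod (u - p)))"

lemma attracting: "0 < s" "s \<le> 1" "0 < \<kappa>" "\<kappa> < 1" "\<And>u. u \<in> cball p s \<Longrightarrow> cmod (f u - p) \<le> \<kappa> * cmod (u - p)"
proof -
  have "\<exists>\<kappa>. 0 < s \<and> s \<le> 1 \<and> 0 < \<kappa> \<and> \<kappa> < 1 \<and> (\<forall>u\<in>cball p s. cmod (f u - p) \<le> \<kappa> * cmod (u - p))"
    unfolding s_def by (rule someI_ex[OF attracting_ex])
  then have "0 < s \<and> s \<le> 1 \<and> 0 < \<kappa> \<and> \<kappa> < 1 \<and> (\<forall>u\<in>cball p s. cmod (f u - p) \<le> \<kappa> * cmod (u - p))"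
    unfolding \<kappa>_def by (rule someI_ex)
  then show "0 < s" "s \<le> 1" "0 < \<kappa>" "\<kappa> < 1" "\<And>u. u \<in> cball p s \<Longrightarrow> cmod (f u - p) \<le> \<kappa> * cmod (u - p)" by auto
qed

lemma attracting_iter:
  assumes "u \<in> ball p s"
  shows "cmod ((f ^^ n) u - p) \<le> \<kappa> ^ n * s \<and> (f ^^ n) u \<in> ball p s"
proof (induction n)
  case 0
  then show ?case using assms by (simp add: dist_norm norm_minus_commute less_imp_le)
next
  case (Suc n)
  let ?v = "(f ^^ n) u"
  have "cmod (f ?v - p) \<le> \<kappa> * cmod (?v - p)" using Suc by (intro attracting(5)) auto
  moreover have "\<kappa> * cmod (?v - p) \<le> \<kappa> * (\<kappa> ^ n * s)" using Suc attracting(3) by (intro mult_left_mono) auto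
  moreover have "\<kappa> * cmod (?v - p) \<le> 1 * cmod (?v - p)" using attracting(4) by (intro mult_right_mono) auto
  moreover have "cmod (?v - p) < s" using Suc by (simp add: dist_norm norm_minus_commute)
  ultimately show ?case by (simp add: dist_norm norm_minus_commute)
qed

lemma f_pow_holo: "(f ^^ n) holomorphic_on S"
  using f_map_iter_holomorphic holomorphic_on_subset by blast

lemma f_pow_deriv: "((f ^^ n) has_field_derivative deriv (f ^^ n) z) (at z)"
  using f_pow_holo[of n UNIV] by (simp add: holomorphic_derivI)

lemma deriv_f_pow_Suc: "deriv (f ^^ Suc n) z = (of_nat l - exp ((f ^^ n) z)) * deriv (f ^^ n) z"
proof -
  have "((\<lambda>z. f ((f ^^ n) z)) has_field_derivative (of_nat l - exp ((f ^^ n) z)) * deriv (f ^^ n) z) (at z)"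
    by (rule DERIV_chain2[OF f_deriv f_pow_deriv])
  then show ?thesis by (intro DERIV_imp_deriv) (simp add: comp_def)
qed

text \<open>
  Otherwise the inverse branches of all iterates fixing the attracting point live on a common disc.
  They avoid the left half-plane, so their derivatives are bounded, although the multiplier has
  modulus less than 1.
\<close>

lemma critical_value_attracted: "\<exists>n k. cmod ((f ^^ n) v0 - p - per k) < s / 2"
proof (rule ccontr)
  assume "\<not> ?thesis"
  then have far: "s / 2 \<le> cmod ((f ^^ n) v0 - p - per k)" for n k by (simp add: not_less)
  \<comment> \<open>The supposition says that the orbit of \<open>v0\<close> avoids all translates
    of the disc of this radius about \<open>p\<close>.\<close>
  define r where "r = s / 2"
  have r: "r > 0" "r \<le> 1" using attracting by (auto simp: r_def)
  have branch: "\<exists>h. h holomorphic_on ball p r \<and> h p = p \<and> (\<forall>u\<in>ball p r. (f ^^ n) (h u) = u)" for n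
  proof (induction n)
    case 0
    then show ?case by (intro exI[of _ "\<lambda>u. u"]) auto
  next
    case (Suc n)
    then obtain h where h: "h holomorphic_on ball p r" "h p = p" "\<And>u. u \<in> ball p r \<Longrightarrow> (f ^^ n) (h u) = u" by blast
    \<comment> \<open>A critical value among the values of the branch would put a translate of a
      point of the orbit of \<open>v0\<close> into the disc.\<close>
    have "h u \<notin> CV" if u: "u \<in> ball p r" for u
    proof
      assume "h u \<in> CV"
      then obtain k where "h u = v0 + per (int l * k)" by (auto simp: CV_def)
      then have "u = (f ^^ n) v0 + per (int l ^ n * (int l * k))" using h(3)[OF u] f_pow_per by metis
      then have "u - p = (f ^^ n) v0 - p - per (- (int l ^ n * (int l * k)))" by simp
      then have "s / 2 \<le> cmod (u - p)" using far by metis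
      then show False using u by (simp add: r_def dist_norm norm_minus_commute)
    qed
    then have "h ` ball p r \<subseteq> - CV" by auto
    moreover have "f p = h p" using h f_p by simp
    ultimately obtain \<psi> where \<psi>: "\<psi> holomorphic_on ball p r" "\<psi> p = p" "\<And>u. u \<in> ball p r \<Longrightarrow> f (\<psi> u) = h u"
      using lift_ball[OF h(1) r(1)] by metis
    have "(f ^^ Suc n) (\<psi> u) = u" if "u \<in> ball p r" for u
      unfolding funpow_Suc_right comp_def using \<psi>(3)[OF that] h(3)[OF that] by simp
    then show ?case using \<psi> by blast
  qed
  define K where "K = cmod c * (2 * exp M / r)"
  have K: "1 \<le> cmod (of_nat l - c) ^ n * K" for n
  proof -
    obtain h where h: "h holomorphic_on ball p r" "h p = p" "\<And>u. u \<in> ball p r \<Longrightarrow> (f ^^ n) (h u) = u" using branch by blast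
    have hd: "(h has_field_derivative deriv h p) (at p)" using h(1) r by (simp add: holomorphic_derivI)
    have "deriv (f ^^ n) p = (of_nat l - c) ^ n"
    proof (induction n)
      case (Suc n)
      have "(f ^^ n) p = p" by (induction n) (simp_all add: f_p)
      then show ?case using Suc by (simp add: deriv_f_pow_Suc exp_p del: funpow.simps)
    qed (simp add: id_def)
    then have "((\<lambda>u. (f ^^ n) (h u)) has_field_derivative (of_nat l - c) ^ n * deriv h p) (at p)"
      using DERIV_chain2[OF _ hd, of "f ^^ n"] f_pow_deriv[of n "h p"] h(2) by simp
    moreover have "((\<lambda>u. (f ^^ n) (h u)) has_field_derivative 1) (at p)"
    proof (rule has_field_derivative_transform_within_open[of "\<lambda>u. u" 1 p "ball p r"])
      fix u assume "u \<in> ball p r"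
      then show "u = (f ^^ n) (h u)" using h(3) by simp
    qed (use r in auto)
    ultimately have one: "(of_nat l - c) ^ n * deriv h p = 1" by (rule DERIV_unique)
    \<comment> \<open>Left of \<open>- M\<close> iteration only moves further left, so such a value
      could not return to the disc about \<open>p\<close>.\<close>
    have Re_h: "- M \<le> Re (h u)" if u: "u \<in> ball p r" for u
    proof (rule ccontr)
      assume "\<not> - M \<le> Re (h u)"
      then have "Re ((f ^^ n) (h u)) \<le> - M" using left_half_plane_iter[of "h u" n] by simp
      then have "Re u \<le> - M" using h(3)[OF u] by simp
      moreover have "M \<ge> 3" by (simp add: M_def)
      moreover have "\<bar>Re (u - p)\<bar> < 1" using u r abs_Re_le_cmod[of "u - p"] by (simp add: dist_norm norm_minus_commute)
      ultimately show False using Re_p by simp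
    qed
    \<comment> \<open>\<open>exp (- h u)\<close> is bounded by \<open>exp M\<close>, and its
      derivative at \<open>p\<close> has modulus \<open>cmod (deriv h p) / cmod c\<close>.\<close>
    have "cmod (deriv (\<lambda>u. exp (- h u)) p) \<le> 2 * exp M / r"
      by (rule cmod_deriv_le_ball) (use h(1) r Re_h in \<open>auto intro!: holomorphic_intros simp: minus_le_iff\<close>)
    moreover have "((\<lambda>u. exp (- h u)) has_field_derivative exp (- h p) * (- deriv h p)) (at p)"
      by (auto intro!: derivative_eq_intros hd)
    ultimately have "cmod (exp (- h p) * (- deriv h p)) \<le> 2 * exp M / r" by (simp add: DERIV_imp_deriv)
    then have "cmod (deriv h p) / cmod c \<le> 2 * exp M / r"
      by (simp add: h(2) norm_mult exp_minus exp_p norm_inverse divide_inverse mult.commute)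
    then have "cmod (deriv h p) \<le> K" using c_nz by (simp add: K_def field_simps)
    then have "cmod (of_nat l - c) ^ n * cmod (deriv h p) \<le> cmod (of_nat l - c) ^ n * K" by (intro mult_left_mono) auto
    moreover have "cmod (of_nat l - c) ^ n * cmod (deriv h p) = 1"
      using arg_cong[OF one, of cmod] by (simp add: norm_mult norm_power)
    ultimately show ?thesis by simp
  qed
  have "K > 0" using r c_nz by (simp add: K_def)
  then obtain n where "cmod (of_nat l - c) ^ n < 1 / K" using real_arch_pow_inv[of "1 / K"] mult_p by auto
  then show False using K[of n] \<open>K > 0\<close> by (simp add: field_simps)
qed

section \<open>Expansion on the Julia set\<close>

definition absorbing :: "cylinder set" where
  "absorbing = {x. Re_cyl x < - M} \<union> ball (to_cyl p) s"

text \<open>A whole neighbourhood of \<open>A\<close> of width \<open>\<epsilon>\<close> is mapped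
  into \<open>A\<close>: this margin produces the expansion. The bound on the right leaves room for
  fixed points outside \<open>A\<close>, and the last clause puts \<open>A\<close> into the Fatou
  set.\<close>

definition trap :: "cylinder set \<Rightarrow> bool" where
  "trap A \<longleftrightarrow> closed A \<and> (\<exists>\<epsilon>>0. \<forall>x\<in>A. \<forall>y. dist x y < \<epsilon> \<longrightarrow> F y \<in> A) \<and>
     (\<exists>B. \<forall>x\<in>A. Re_cyl x \<le> B) \<and> (\<forall>x\<in>A. \<exists>n. (F ^^ n) x \<in> absorbing)"

definition trap0 :: "cylinder set" where
  "trap0 = {x. Re_cyl x \<le> - M - 1} \<union> cball (to_cyl p) (s / 2)"

lemma trap0: "trap trap0"
  unfolding trap_def
proof (intro conjI)
  have "closed {x. Re_cyl x \<le> - M - 1}"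
    by (intro closed_Collect_le continuous_on_Re_cyl continuous_on_const)
  then show "closed trap0" unfolding trap0_def by (intro closed_Un closed_cball)
  \<comment> \<open>1/2 is less than the unit gained by a step to the left. In the disc one step
    takes radius \<open>s / 2 * (2 - \<kappa>)\<close> to \<open>\<kappa>\<close> times that, and
    \<open>\<kappa> * (2 - \<kappa>) \<le> 1\<close>.\<close>
  define \<epsilon> where "\<epsilon> = min (1/2) (s / 2 * (1 - \<kappa>))"
  have eps: "\<epsilon> > 0" "\<epsilon> \<le> 1/2" "\<epsilon> \<le> s / 2 * (1 - \<kappa>)" using attracting(1-4) by (auto simp: \<epsilon>_def)
  have "F y \<in> trap0" if "x \<in> trap0" "dist x y < \<epsilon>" for x y
  proof -
    obtain v where v: "y = to_cyl v" using to_cyl_surj by metis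
    from that(1) consider "Re_cyl x \<le> - M - 1" | "dist (to_cyl p) x \<le> s / 2" by (auto simp: trap0_def)
    then show ?thesis
    proof cases
      case 1
      then have "Re v \<le> - M" using Re_cyl_diff_le[of x y] that(2) eps v by simp
      moreover have "Re v \<le> - M - 1 + \<epsilon>" using 1 Re_cyl_diff_le[of x y] that(2) v by simp
      ultimately have "Re (f v) \<le> - M - 1" using left_half_plane[of v] eps by linarith
      then show ?thesis by (simp add: v F_map_to_cyl trap0_def)
    next
      case 2
      have "dist (to_cyl p) y < s / 2 + \<epsilon>" using 2 that(2) dist_triangle[of "to_cyl p" y x] by linarith
      then obtain w where w: "y = to_cyl w" "cmod (p - w) < s / 2 + \<epsilon>" by (rule to_cyl_lift_near)
      have "s / 2 * (1 - \<kappa>) \<le> s / 2 * 1" using attracting(1,3) by (intro mult_left_mono) auto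
      then have "w \<in> cball p s" using w eps by (simp add: dist_norm)
      then have "cmod (f w - p) \<le> \<kappa> * cmod (w - p)" by (rule attracting(5))
      also have "\<dots> \<le> \<kappa> * (s / 2 + s / 2 * (1 - \<kappa>))"
        using attracting(3) w eps by (intro mult_left_mono) (auto simp: norm_minus_commute)
      also have "\<dots> = s / 2 * (1 - (1 - \<kappa>)\<^sup>2)" by (simp add: power2_eq_square field_simps)
      also have "\<dots> \<le> s / 2 * 1" using attracting(1) by (intro mult_left_mono) auto
      finally have "dist (to_cyl p) (F y) \<le> s / 2"
        using dist_to_cyl_le[of p "f w"] by (simp add: w F_map_to_cyl norm_minus_commute)
      then show ?thesis by (simp add: trap0_def)
    qed
  qed
  then show "\<exists>\<epsilon>>0. \<forall>x\<in>trap0. \<forall>y. dist x y < \<epsilon> \<longrightarrow> F y \<in> trap0" using eps(1) by blast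
  have "Re_cyl x \<le> Re p + s" if "x \<in> trap0" for x
  proof -
    from that consider "Re_cyl x \<le> - M - 1" | "dist (to_cyl p) x \<le> s / 2" by (auto simp: trap0_def)
    then show ?thesis
    proof cases
      case 1
      moreover have "M \<ge> 3" by (simp add: M_def)
      ultimately show ?thesis using Re_p attracting(1) by linarith
    next
      case 2
      then show ?thesis using Re_cyl_diff_le[of "to_cyl p" x] attracting(1) by simp
    qed
  qed
  then show "\<exists>B. \<forall>x\<in>trap0. Re_cyl x \<le> B" by blast
  have "x \<in> absorbing" if "x \<in> trap0" for x
    using that attracting(1) by (auto simp: trap0_def absorbing_def)
  then show "\<forall>x\<in>trap0. \<exists>n. (F ^^ n) x \<in> absorbing" by (metis funpow_0)
qed

text \<open>Only a small closed ball about \<open>x\<close> is added; the full preimage of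
  \<open>A\<close> is unbounded to the right. Membership in the interior is carried along so that
  the extension can be repeated.\<close>

lemma trap_extend:
  assumes "trap A" "F x \<in> interior A"
  shows "\<exists>A'. trap A' \<and> A \<subseteq> A' \<and> x \<in> interior A'"
proof -
  obtain \<epsilon> B where A: "closed A" "\<epsilon> > 0" "\<And>x y. x \<in> A \<Longrightarrow> dist x y < \<epsilon> \<Longrightarrow> F y \<in> A"
      "\<And>x. x \<in> A \<Longrightarrow> Re_cyl x \<le> B" "\<And>x. x \<in> A \<Longrightarrow> \<exists>n. (F ^^ n) x \<in> absorbing"
    using assms(1) unfolding trap_def by metis
  obtain \<eta> where \<eta>: "\<eta> > 0" "ball (F x) \<eta> \<subseteq> A" using assms(2) by (meson mem_interior)
  obtain d where d: "d > 0" "\<And>y. dist y x < d \<Longrightarrow> dist (F y) (F x) < \<eta>"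
    using isCont_F[of x] \<eta>(1) unfolding continuous_at_eps_delta by metis
  have near: "F y \<in> A" if "dist x y < d" for y
    using d(2)[of y] that \<eta>(2) by (auto simp: dist_commute)
  define A' where "A' = A \<union> cball x (d / 2)"
  have "trap A'" unfolding trap_def
  proof (intro conjI)
    show "closed A'" using A(1) by (simp add: A'_def closed_Un)
    have "F v \<in> A'" if "u \<in> A'" "dist u v < min \<epsilon> (d / 2)" for u v
    proof -
      have "F v \<in> A" if "u \<in> cball x (d / 2)"
      proof (rule near)
        show "dist x v < d" using that \<open>dist u v < min \<epsilon> (d / 2)\<close> dist_triangle[of x v u] by simp
      qed
      then show ?thesis using that A(3)[of u v] by (auto simp: A'_def)
    qed
    then show "\<exists>\<epsilon>>0. \<forall>x\<in>A'. \<forall>y. dist x y < \<epsilon> \<longrightarrow> F y \<in> A'"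
      using A(2) d(1) by (intro exI[of _ "min \<epsilon> (d / 2)"]) auto
    have "Re_cyl y \<le> max B (Re_cyl x + d)" if "y \<in> A'" for y
      using that A(4)[of y] Re_cyl_diff_le[of x y] d(1) by (auto simp: A'_def)
    then show "\<exists>B. \<forall>x\<in>A'. Re_cyl x \<le> B" by blast
    show "\<forall>x\<in>A'. \<exists>n. (F ^^ n) x \<in> absorbing"
    proof
      fix y assume "y \<in> A'"
      then consider "y \<in> A" | "dist x y < d" using d(1) by (auto simp: A'_def)
      then show "\<exists>n. (F ^^ n) y \<in> absorbing"
      proof cases
        case 2
        then obtain n where "(F ^^ n) (F y) \<in> absorbing" using near A(5) by blast
        then show ?thesis by (intro exI[of _ "Suc n"]) (simp add: funpow_swap1)
      qed (rule A(5))
    qed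
  qed
  moreover have "x \<in> interior A'"
    unfolding mem_interior using d(1) by (intro exI[of _ "d/2"]) (auto simp: A'_def)
  ultimately show ?thesis by (intro exI[of _ A']) (auto simp: A'_def)
qed

text \<open>The orbit of \<open>v0\<close> enters the interior of \<open>trap0\<close> at some time;
  one extension for each earlier point of the orbit leads back to \<open>v0\<close>.\<close>

lemma trap_ex: "\<exists>A. trap A \<and> trap0 \<subseteq> A \<and> to_cyl v0 \<in> A"
proof -
  obtain n k where nk: "cmod ((f ^^ n) v0 - p - per k) < s / 2" using critical_value_attracted by blast
  have "to_cyl ((f ^^ n) v0) = to_cyl ((f ^^ n) v0 - per k)"
    using to_cyl_per[of "(f ^^ n) v0" "-k"] by simp
  then have "dist (to_cyl p) ((F ^^ n) (to_cyl v0)) \<le> cmod (p - ((f ^^ n) v0 - per k))"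
    unfolding F_pow_to_cyl using dist_to_cyl_le by metis
  also have "\<dots> < s / 2" using nk by (simp add: norm_minus_commute algebra_simps)
  finally have "(F ^^ n) (to_cyl v0) \<in> ball (to_cyl p) (s / 2)" by simp
  moreover have "ball (to_cyl p) (s / 2) \<subseteq> interior trap0"
    by (rule interior_maximal) (auto simp: trap0_def)
  ultimately have n: "(F ^^ n) (to_cyl v0) \<in> interior trap0" by blast
  have "\<exists>A. trap A \<and> trap0 \<subseteq> A \<and> x \<in> interior A" if "(F ^^ n) x \<in> interior trap0" for x
    using that
  proof (induction n arbitrary: x)
    case 0
    then show ?case using trap0 by auto
  next
    case (Suc n)
    then have "(F ^^ n) (F x) \<in> interior trap0" by (simp add: funpow_swap1)
    then obtain A where A: "trap A" "trap0 \<subseteq> A" "F x \<in> interior A" using Suc.IH by blast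
    from trap_extend[OF A(1,3)] A(2) show ?case by blast
  qed
  then show ?thesis using n interior_subset by blast
qed

definition A where "A = (SOME A. trap A \<and> trap0 \<subseteq> A \<and> to_cyl v0 \<in> A)"

lemma A: "trap A" "trap0 \<subseteq> A" "to_cyl v0 \<in> A"
proof -
  have "trap A \<and> trap0 \<subseteq> A \<and> to_cyl v0 \<in> A" unfolding A_def by (rule someI_ex[OF trap_ex])
  then show "trap A" "trap0 \<subseteq> A" "to_cyl v0 \<in> A" by auto
qed

definition \<epsilon> where "\<epsilon> = (SOME \<epsilon>. \<epsilon> > 0 \<and> (\<forall>x\<in>A. \<forall>y. dist x y < \<epsilon> \<longrightarrow> F y \<in> A))"

lemma \<epsilon>: "\<epsilon> > 0" "\<And>x y. x \<in> A \<Longrightarrow> dist x y < \<epsilon> \<Longrightarrow> F y \<in> A"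
proof -
  have "\<exists>\<epsilon>. \<epsilon> > 0 \<and> (\<forall>x\<in>A. \<forall>y. dist x y < \<epsilon> \<longrightarrow> F y \<in> A)" using A(1) unfolding trap_def by blast
  then have "\<epsilon> > 0 \<and> (\<forall>x\<in>A. \<forall>y. dist x y < \<epsilon> \<longrightarrow> F y \<in> A)" unfolding \<epsilon>_def by (rule someI_ex)
  then show "\<epsilon> > 0" "\<And>x y. x \<in> A \<Longrightarrow> dist x y < \<epsilon> \<Longrightarrow> F y \<in> A" by auto
qed

lemma A_bounded_right: "\<exists>B. \<forall>x\<in>A. Re_cyl x \<le> B" and A_absorbed: "\<And>x. x \<in> A \<Longrightarrow> \<exists>n. (F ^^ n) x \<in> absorbing"
  using A(1) unfolding trap_def by blast+

lemma F_A: "x \<in> A \<Longrightarrow> F x \<in> A"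
  using \<epsilon> by simp

definition U where "U = {z. to_cyl z \<notin> A}"

lemma CV_U: "CV \<inter> U = {}"
proof -
  have "to_cyl v \<in> A" if "v \<in> CV" for v
    using that A(3) by (auto simp: CV_def simp del: of_int_mult)
  then show ?thesis by (auto simp: U_def)
qed

text \<open>The margin of \<open>A\<close> read backwards: the preimage of \<open>U\<close> lies at
  depth \<open>\<epsilon>\<close> inside \<open>U\<close>.\<close>

lemma U_margin: "f x \<in> U \<Longrightarrow> cmod (x - y) < \<epsilon> \<Longrightarrow> y \<in> U"
proof (rule ccontr)
  assume a: "f x \<in> U" "cmod (x - y) < \<epsilon>" "y \<notin> U"
  then have "dist (to_cyl y) (to_cyl x) < \<epsilon>" using dist_to_cyl_le[of y x] by (simp add: norm_minus_commute)
  then have "F (to_cyl x) \<in> A" using \<epsilon>(2)[of "to_cyl y" "to_cyl x"] a by (simp add: U_def)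
  then show False using a by (simp add: U_def F_map_to_cyl)
qed

lemma U_Re: "u \<in> U \<Longrightarrow> Re u > - M - 1"
  using A(2) by (force simp: U_def trap0_def)

text \<open>\<open>A\<close> contains a disc about the class of \<open>p\<close>, so on
  \<open>U\<close> the function \<open>exp\<close> stays away from \<open>c = exp p\<close>. Thus
  \<open>1 / (exp u - c)\<close> is bounded on \<open>U\<close>, which yields a derivative bound for
  discs in \<open>U\<close>.\<close>

lemma U_omits: "\<exists>\<delta>>0. \<forall>u\<in>U. \<delta> \<le> cmod (exp u - c)"
proof -
  obtain \<delta> where d: "\<delta> > 0" "\<And>x. cmod (exp x - c) < \<delta> \<Longrightarrow> \<exists>k. cmod (x - p - per k) < s / 2"
    using exp_close_imp_close[of "s/2" p c] attracting(1) exp_p by (metis half_gt_zero)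
  have "\<delta> \<le> cmod (exp u - c)" if u: "u \<in> U" for u
  proof (rule ccontr)
    assume "\<not> ?thesis"
    then obtain k where k: "cmod (u - p - per k) < s / 2" using d(2) by force
    have "dist (to_cyl p) (to_cyl (u - per k)) \<le> cmod (p - (u - per k))" by (rule dist_to_cyl_le)
    also have "\<dots> \<le> s / 2" using k by (simp add: norm_minus_commute algebra_simps)
    finally have "to_cyl (u - per k) \<in> A" using A(2) by (auto simp: trap0_def)
    moreover have "to_cyl (u - per k) = to_cyl u" using to_cyl_per[of u "-k"] by simp
    ultimately show False using u by (simp add: U_def)
  qed
  then show ?thesis using d(1) by blast
qed

section \<open>The set of points that are never trapped\<close>

definition Kset where "Kset = {x. \<forall>n. (F ^^ n) x \<notin> A}"

lemma F_Kset_iff: "F x \<in> Kset \<longleftrightarrow> x \<in> Kset"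
proof
  assume a: "F x \<in> Kset"
  have "(F ^^ n) x \<notin> A" for n
  proof (cases n)
    case 0
    have "(F ^^ 0) (F x) \<notin> A" using a unfolding Kset_def by blast
    then show ?thesis using 0 F_A by auto
  next
    case (Suc m)
    have "(F ^^ m) (F x) \<notin> A" using a unfolding Kset_def by blast
    then show ?thesis using Suc by (simp add: funpow_swap1)
  qed
  then show "x \<in> Kset" by (simp add: Kset_def)
next
  assume a: "x \<in> Kset"
  have "(F ^^ n) (F x) \<notin> A" for n
    using a unfolding Kset_def by (metis (mono_tags) funpow_Suc_right comp_apply mem_Collect_eq)
  then show "F x \<in> Kset" by (simp add: Kset_def)
qed

lemma F_pow_Kset_iff: "(F ^^ n) x \<in> Kset \<longleftrightarrow> x \<in> Kset"
  by (induction n) (simp_all add: F_Kset_iff)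

abbreviation K where "K \<equiv> to_cyl -` Kset"

lemma f_K_iff: "f x \<in> K \<longleftrightarrow> x \<in> K"
  using F_Kset_iff[of "to_cyl x"] by (simp add: F_map_to_cyl)

lemma f_pow_K_iff: "(f ^^ n) x \<in> K \<longleftrightarrow> x \<in> K"
  using F_pow_Kset_iff[of n "to_cyl x"] by (simp add: F_pow_to_cyl)

lemma K_U: "x \<in> K \<Longrightarrow> x \<in> U"
  unfolding Kset_def U_def by (metis (mono_tags) funpow_0 mem_Collect_eq vimage_eq)

lemma K_Re: "x \<in> K \<Longrightarrow> Re x > - M - 1"
  using K_U U_Re by blast

lemma K_margin: "x \<in> K \<Longrightarrow> cmod (x - y) < \<epsilon> \<Longrightarrow> y \<in> U"
  using U_margin K_U f_K_iff by blast

text \<open>\<open>f x\<close> is again in \<open>K\<close>, hence at distance at least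
  \<open>\<epsilon>\<close> from \<open>CV\<close>, which lies outside \<open>U\<close>.\<close>

lemma K_far_from_crit: "\<exists>\<delta>>0. \<forall>x\<in>K. \<delta> \<le> cmod (of_nat l - exp x)"
proof -
  obtain \<delta> where d: "\<delta> > 0" "\<And>x. (\<And>v. v \<in> CV \<Longrightarrow> \<epsilon> \<le> dist (f x) v) \<Longrightarrow> \<delta> \<le> cmod (of_nat l - exp x)"
    using far_from_CV[OF \<epsilon>(1)] by metis
  have "\<delta> \<le> cmod (of_nat l - exp x)" if x: "x \<in> K" for x
  proof (rule d(2))
    fix v assume "v \<in> CV"
    then have "v \<notin> U" using CV_U by blast
    then show "\<epsilon> \<le> dist (f x) v" using K_margin[of "f x" v] x f_K_iff by (force simp: dist_norm)
  qed
  then show ?thesis using d(1) by blast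
qed

text \<open>
  \<open>E\<close> is the reciprocal of the infinitesimal Kobayashi metric of \<open>U\<close>. Discs in \<open>U\<close> lift through
  \<open>f\<close>, and the lifted discs may be moved by \<open>\<epsilon>\<close> inside \<open>U\<close>; this is the source of expansion.
\<close>

definition discs :: "complex \<Rightarrow> (complex \<Rightarrow> complex) set" where
  "discs x = {\<phi>. \<phi> holomorphic_on ball 0 1 \<and> \<phi> ` ball 0 1 \<subseteq> U \<and> \<phi> 0 = x}"

definition E :: "complex \<Rightarrow> real" where
  "E x = (SUP \<phi>\<in>discs x. cmod (deriv \<phi> 0))"

text \<open>Cauchy's estimate for \<open>1 / (exp (\<phi> u) - c)\<close>, which is bounded by
  \<open>U_omits\<close>. The resulting bound grows like \<open>exp (Re x)\<close> to the
  right.\<close>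

lemma disc_deriv_bound:
  "\<exists>\<delta>>0. \<forall>x. \<forall>\<phi>\<in>discs x. cmod (deriv \<phi> 0) \<le> 2 / \<delta> * (exp (Re x) + cmod c)\<^sup>2 / exp (Re x)"
proof -
  obtain \<delta> where d: "\<delta> > 0" "\<And>u. u \<in> U \<Longrightarrow> \<delta> \<le> cmod (exp u - c)" using U_omits by blast
  have "cmod (deriv \<phi> 0) \<le> 2 / \<delta> * (exp (Re x) + cmod c)\<^sup>2 / exp (Re x)" if "\<phi> \<in> discs x" for x \<phi>
  proof -
    have \<phi>: "\<phi> holomorphic_on ball 0 1" "\<And>u. u \<in> ball 0 1 \<Longrightarrow> \<phi> u \<in> U" "\<phi> 0 = x" using that by (auto simp: discs_def)
    have nz: "exp (\<phi> u) - c \<noteq> 0" if "u \<in> ball 0 1" for u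
    proof -
      have "cmod (exp (\<phi> u) - c) > 0" using d(1) d(2)[OF \<phi>(2)[OF that]] by linarith
      then show ?thesis by simp
    qed
    let ?g = "\<lambda>u. 1 / (exp (\<phi> u) - c)"
    have "cmod (deriv ?g 0) \<le> 2 * (1 / \<delta>) / 1"
    proof (rule cmod_deriv_le_ball)
      show "?g holomorphic_on ball 0 1" using \<phi>(1) nz by (intro holomorphic_intros) auto
      fix u :: complex assume "u \<in> ball 0 1"
      then have "\<delta> \<le> cmod (exp (\<phi> u) - c)" by (intro d(2) \<phi>(2))
      then show "cmod (?g u) \<le> 1 / \<delta>" using d(1) by (simp add: norm_divide frac_le)
    qed simp
    moreover have pd: "(\<phi> has_field_derivative deriv \<phi> 0) (at 0)" using \<phi>(1) by (simp add: holomorphic_derivI)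
    have "(?g has_field_derivative - (exp x * deriv \<phi> 0) / (exp x - c)\<^sup>2) (at 0)"
      using nz[of 0] by (auto intro!: derivative_eq_intros pd simp: \<phi>(3) power2_eq_square)
    then have "deriv ?g 0 = - (exp x * deriv \<phi> 0) / (exp x - c)\<^sup>2" by (rule DERIV_imp_deriv)
    ultimately have "exp (Re x) * cmod (deriv \<phi> 0) / (cmod (exp x - c))\<^sup>2 \<le> 2 / \<delta>"
      by (simp add: norm_divide norm_mult norm_power)
    moreover have "cmod (exp x - c) > 0" using nz[of 0] \<phi>(3) by simp
    ultimately have "exp (Re x) * cmod (deriv \<phi> 0) \<le> 2 / \<delta> * (cmod (exp x - c))\<^sup>2"
      by (simp add: divide_le_eq)
    also have "\<dots> \<le> 2 / \<delta> * (exp (Re x) + cmod c)\<^sup>2"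
      using d(1) norm_triangle_ineq4[of "exp x" c] by (intro mult_left_mono power_mono) auto
    finally show ?thesis by (simp only: pos_le_divide_eq[OF exp_gt_zero] mult.commute)
  qed
  then show ?thesis using d(1) by blast
qed

lemma bdd_discs: "bdd_above ((\<lambda>\<phi>. cmod (deriv \<phi> 0)) ` discs x)"
  using disc_deriv_bound by (meson bdd_aboveI2)

lemma E_upper: "\<phi> \<in> discs x \<Longrightarrow> cmod (deriv \<phi> 0) \<le> E x"
  unfolding E_def using bdd_discs by (intro cSUP_upper)

lemma discs_const: "x \<in> U \<Longrightarrow> (\<lambda>_. x) \<in> discs x"
  by (auto simp: discs_def)

lemma E_lower: "x \<in> K \<Longrightarrow> \<epsilon> \<le> E x"
proof -
  assume x: "x \<in> K"
  have "(\<lambda>u. x + of_real \<epsilon> * u) \<in> discs x"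
  proof -
    have "x + of_real \<epsilon> * u \<in> U" if "cmod u < 1" for u
      using \<epsilon>(1) that by (intro K_margin[OF x]) (simp add: norm_mult)
    then show ?thesis by (auto simp: discs_def intro!: holomorphic_intros)
  qed
  moreover have "deriv (\<lambda>u. x + of_real \<epsilon> * u) 0 = of_real \<epsilon>"
    by (rule DERIV_imp_deriv) (auto intro!: derivative_eq_intros)
  ultimately show ?thesis using E_upper[of "\<lambda>u. x + of_real \<epsilon> * u" x] \<epsilon>(1) by simp
qed

lemma E_f_le:
  assumes "f x \<in> U"
  shows "E (f x) \<le> cmod (of_nat l - exp x) * (E x - \<epsilon>)"
  unfolding E_def[of "f x"]
proof (rule cSUP_least)
  show "discs (f x) \<noteq> {}" using discs_const[OF assms] by blast
  fix \<phi> assume "\<phi> \<in> discs (f x)"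
  then have \<phi>: "\<phi> holomorphic_on ball 0 1" "\<phi> ` ball 0 1 \<subseteq> U" "\<phi> 0 = f x" by (auto simp: discs_def)
  have "\<phi> ` ball 0 1 \<subseteq> - CV" using \<phi>(2) CV_U by blast
  then obtain \<psi> where \<psi>: "\<psi> holomorphic_on ball 0 1" "\<psi> 0 = x" "\<And>u. u \<in> ball 0 1 \<Longrightarrow> f (\<psi> u) = \<phi> u"
    using lift_ball[OF \<phi>(1)] \<phi>(3) by (metis zero_less_one)
  have \<psi>d: "(\<psi> has_field_derivative deriv \<psi> 0) (at 0)" using \<psi>(1) by (simp add: holomorphic_derivI)
  \<comment> \<open>A unit vector in the direction of the derivative of the lift, so that the term
    added below lengthens that derivative by exactly \<open>\<epsilon>\<close>.\<close>
  define \<eta> where "\<eta> = (if deriv \<psi> 0 = 0 then 1 else deriv \<psi> 0 / of_real (cmod (deriv \<psi> 0)))"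
  have \<eta>: "cmod \<eta> = 1" "cmod (deriv \<psi> 0 + of_real \<epsilon> * \<eta>) = cmod (deriv \<psi> 0) + \<epsilon>"
  proof -
    show "cmod \<eta> = 1" by (simp add: \<eta>_def norm_divide)
    have "deriv \<psi> 0 = of_real (cmod (deriv \<psi> 0)) * \<eta>" by (simp add: \<eta>_def)
    then have "deriv \<psi> 0 + of_real \<epsilon> * \<eta> = of_real (cmod (deriv \<psi> 0) + \<epsilon>) * \<eta>"
      by (metis distrib_right of_real_add)
    then show "cmod (deriv \<psi> 0 + of_real \<epsilon> * \<eta>) = cmod (deriv \<psi> 0) + \<epsilon>"
      using \<open>cmod \<eta> = 1\<close> \<epsilon>(1) by (simp only: norm_mult norm_of_real) simp
  qed
  let ?\<psi> = "\<lambda>u. \<psi> u + of_real \<epsilon> * \<eta> * u"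
  \<comment> \<open>The lift has its values in the preimage of \<open>U\<close>, so they may be
    moved by less than \<open>\<epsilon>\<close>.\<close>
  have "?\<psi> u \<in> U" if "u \<in> ball 0 1" for u
  proof (rule U_margin)
    show "f (\<psi> u) \<in> U" using \<psi>(3)[OF that] \<phi>(2) that by auto
    show "cmod (\<psi> u - ?\<psi> u) < \<epsilon>" using \<eta>(1) \<epsilon>(1) that by (simp add: norm_mult)
  qed
  then have "?\<psi> \<in> discs x" using \<psi> by (auto simp: discs_def intro!: holomorphic_intros)
  moreover have "deriv ?\<psi> 0 = deriv \<psi> 0 + of_real \<epsilon> * \<eta>"
    by (rule DERIV_imp_deriv) (auto intro!: derivative_eq_intros \<psi>d)
  ultimately have le: "cmod (deriv \<psi> 0) + \<epsilon> \<le> E x" using E_upper[of ?\<psi> x] \<eta>(2) by simp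
  have "((\<lambda>u. f (\<psi> u)) has_field_derivative (of_nat l - exp x) * deriv \<psi> 0) (at 0)"
    using DERIV_chain2[OF f_deriv \<psi>d] \<psi>(2) by simp
  then have "(\<phi> has_field_derivative (of_nat l - exp x) * deriv \<psi> 0) (at 0)"
    by (rule has_field_derivative_transform_within_open[of _ _ _ "ball 0 1"]) (use \<psi>(3) in auto)
  then have "deriv \<phi> 0 = (of_nat l - exp x) * deriv \<psi> 0" by (rule DERIV_imp_deriv)
  then have "cmod (deriv \<phi> 0) = cmod (of_nat l - exp x) * cmod (deriv \<psi> 0)" by (simp add: norm_mult)
  also have "\<dots> \<le> cmod (of_nat l - exp x) * (E x - \<epsilon>)" using le by (intro mult_left_mono) auto
  finally show "cmod (deriv \<phi> 0) \<le> cmod (of_nat l - exp x) * (E x - \<epsilon>)" .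
qed

text \<open>
  Far to the right \<open>E\<close> is unbounded, but there \<open>f\<close> expands the flat metric; truncating \<open>E\<close> gives
  a metric which is comparable to the flat one and uniformly expanded.
\<close>

lemma expanding_metric_ex:
  "\<exists>\<mu> T \<sigma>. 1 < \<mu> \<and> (\<forall>x\<in>K. \<epsilon> \<le> \<sigma> x \<and> \<sigma> x \<le> T \<and> \<mu> * \<sigma> (f x) \<le> cmod (of_nat l - exp x) * \<sigma> x)"
proof -
  obtain \<delta> where d: "\<delta> > 0" "\<And>x \<phi>. \<phi> \<in> discs x \<Longrightarrow> cmod (deriv \<phi> 0) \<le> 2 / \<delta> * (exp (Re x) + cmod c)\<^sup>2 / exp (Re x)"
    using disc_deriv_bound by blast
  \<comment> \<open>At points of \<open>K\<close> with \<open>Re x \<ge> X\<close> the derivative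
    has modulus at least 2; \<open>T\<close> is at least \<open>E\<close> at all others.\<close>
  define X where "X = ln (real l + 2)"
  define T where "T = max (2 * \<epsilon>) (2 / \<delta> * (exp X + cmod c)\<^sup>2 / exp (- M - 1))"
  have T: "T \<ge> 2 * \<epsilon>" "T > 0" using \<epsilon>(1) by (auto simp: T_def)
  have big: "cmod (of_nat l - exp x) \<ge> 2" if x: "x \<in> K" "E x > T" for x
  proof (rule ccontr)
    assume "\<not> ?thesis"
    moreover have "exp (Re x) - real l \<le> cmod (of_nat l - exp x)"
      using norm_triangle_ineq2[of "exp x" "of_nat l"] by (simp add: norm_minus_commute)
    ultimately have "exp (Re x) < real l + 2" by simp
    then have "exp (Re x) < exp X" by (simp add: X_def)
    moreover have "exp (- M - 1) \<le> exp (Re x)" using K_Re[OF x(1)] by simp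
    ultimately have le: "2 / \<delta> * (exp (Re x) + cmod c)\<^sup>2 / exp (Re x) \<le> 2 / \<delta> * (exp X + cmod c)\<^sup>2 / exp (- M - 1)"
      using d(1) by (intro frac_le mult_left_mono power_mono) (auto simp: add_nonneg_nonneg)
    have "E x \<le> 2 / \<delta> * (exp (Re x) + cmod c)\<^sup>2 / exp (Re x)"
      unfolding E_def using discs_const[OF K_U[OF x(1)]] d(2) by (intro cSUP_least) auto
    then show False using le x(2) by (simp add: T_def)
  qed
  define \<sigma> where "\<sigma> x = min (E x) T" for x
  \<comment> \<open>Below the truncation
    \<open>E x - \<epsilon> \<le> (1 - \<epsilon> / T) * E x\<close>, which gives the second value;
    above it the derivative alone gives 2.\<close>
  define \<mu> where "\<mu> = min 2 (1 / (1 - \<epsilon> / T))"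
  have q: "0 < 1 - \<epsilon> / T" "1 - \<epsilon> / T < 1" using T \<epsilon>(1) by (auto simp: field_simps)
  have \<mu>: "1 < \<mu>" "\<mu> \<le> 2" "\<mu> * (1 - \<epsilon> / T) \<le> 1"
  proof -
    show "1 < \<mu>" "\<mu> \<le> 2" using q by (auto simp: \<mu>_def)
    have "\<mu> * (1 - \<epsilon> / T) \<le> (1 / (1 - \<epsilon> / T)) * (1 - \<epsilon> / T)" using q by (intro mult_right_mono) (auto simp: \<mu>_def)
    moreover have "1 / a * a = 1" if "a > 0" for a :: real using that by simp
    from this[OF q(1)] have "(1 / (1 - \<epsilon> / T)) * (1 - \<epsilon> / T) = 1" .
    ultimately show "\<mu> * (1 - \<epsilon> / T) \<le> 1" by linarith
  qed
  have "\<mu> * \<sigma> (f x) \<le> cmod (of_nat l - exp x) * \<sigma> x" if x: "x \<in> K" for x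
  proof (cases "E x \<le> T")
    case True
    have fx: "f x \<in> U" using x f_K_iff K_U by blast
    have "E x - \<epsilon> \<le> (1 - \<epsilon> / T) * E x"
      using True T \<epsilon>(1) mult_left_mono[of "E x" T "\<epsilon> / T"] by (simp add: algebra_simps)
    then have "cmod (of_nat l - exp x) * (E x - \<epsilon>) \<le> cmod (of_nat l - exp x) * ((1 - \<epsilon> / T) * E x)"
      by (intro mult_left_mono) auto
    moreover have "\<sigma> (f x) \<le> E (f x)" by (simp add: \<sigma>_def)
    ultimately have "\<sigma> (f x) \<le> cmod (of_nat l - exp x) * ((1 - \<epsilon> / T) * E x)"
      using E_f_le[OF fx] by (meson order_trans)
    then have "\<mu> * \<sigma> (f x) \<le> \<mu> * (cmod (of_nat l - exp x) * ((1 - \<epsilon> / T) * E x))" using \<mu> by (intro mult_left_mono) auto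
    also have "\<dots> = (\<mu> * (1 - \<epsilon> / T)) * (cmod (of_nat l - exp x) * E x)" by simp
    also have "\<dots> \<le> 1 * (cmod (of_nat l - exp x) * E x)"
      using \<mu> E_lower[OF x] \<epsilon>(1) by (intro mult_right_mono mult_nonneg_nonneg) auto
    finally show ?thesis using True by (simp add: \<sigma>_def min_absorb1)
  next
    case False
    then have "\<sigma> x = T" "2 \<le> cmod (of_nat l - exp x)" using big[OF x] by (auto simp: \<sigma>_def)
    moreover have "\<mu> * \<sigma> (f x) \<le> 2 * T"
      using \<mu> E_lower[of "f x"] x f_K_iff \<epsilon>(1) T by (intro mult_mono) (auto simp: \<sigma>_def)
    moreover have "2 * T \<le> cmod (of_nat l - exp x) * T"
      using T \<open>2 \<le> cmod (of_nat l - exp x)\<close> by (intro mult_right_mono) auto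
    ultimately show ?thesis by simp
  qed
  moreover have "\<epsilon> \<le> \<sigma> x \<and> \<sigma> x \<le> T" if "x \<in> K" for x using E_lower[OF that] T \<epsilon>(1) by (auto simp: \<sigma>_def)
  ultimately show ?thesis using \<mu>(1) by blast
qed

end

section \<open>Shadowing and bounded distortion\<close>

text \<open>The lower bound rests on \<open>1 / (1 - q) \<le> 1 + 2 * q\<close> for
  \<open>q \<le> 1 / 2\<close>; hence the factor 2 in the exponents.\<close>

lemma exp_prod_bounds:
  fixes q :: "nat \<Rightarrow> real"
  assumes "\<And>j. j < n \<Longrightarrow> 0 \<le> q j" "\<And>j. j < n \<Longrightarrow> q j \<le> 1 / 2" "(\<Sum>j<n. q j) \<le> B"
  shows "(\<Prod>j<n. 1 + q j) \<le> exp (2 * B)" "exp (- 2 * B) \<le> (\<Prod>j<n. 1 - q j)"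
proof -
  have B: "0 \<le> (\<Sum>j<n. q j)" by (rule sum_nonneg) (use assms(1) in auto)
  have "(\<Prod>j<n. 1 + q j) \<le> (\<Prod>j<n. exp (q j))"
    by (rule prod_mono) (use assms(1) in \<open>auto simp: add_nonneg_nonneg intro: exp_ge_add_one_self\<close>)
  also have "\<dots> = exp (\<Sum>j<n. q j)" by (simp add: exp_sum)
  also have "\<dots> \<le> exp (2 * B)" using assms(3) B by simp
  finally show "(\<Prod>j<n. 1 + q j) \<le> exp (2 * B)" .
  have low: "exp (- 2 * q j) \<le> 1 - q j" if "j < n" for j
  proof -
    have q: "0 \<le> q j" "q j \<le> 1/2" using assms(1,2) that by auto
    have "1 = (1 - q j) * (1 + q j / (1 - q j))" using q by (simp add: field_simps)
    also have "\<dots> \<le> (1 - q j) * (1 + 2 * q j)"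
    proof (intro mult_left_mono add_left_mono)
      have "q j / (1 - q j) \<le> q j / (1 / 2)" using q by (intro divide_left_mono) auto
      then show "q j / (1 - q j) \<le> 2 * q j" by simp
    qed (use q in auto)
    also have "\<dots> \<le> (1 - q j) * exp (2 * q j)" using q exp_ge_add_one_self[of "2 * q j"] by (intro mult_left_mono) auto
    finally have "exp (- 2 * q j) * 1 \<le> exp (- 2 * q j) * ((1 - q j) * exp (2 * q j))" by (intro mult_left_mono) auto
    also have "\<dots> = (1 - q j) * (exp (- 2 * q j) * exp (2 * q j))" by (simp only: mult_ac)
    also have "exp (- 2 * q j) * exp (2 * q j) = 1" by (simp add: exp_minus_inverse exp_add[symmetric])
    finally show ?thesis by simp
  qed
  have "exp (- 2 * B) \<le> exp (\<Sum>j<n. - 2 * q j)" using assms(3) by (simp add: sum_distrib_left[symmetric] sum_negf)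
  also have "\<dots> = (\<Prod>j<n. exp (- 2 * q j))" by (simp add: exp_sum)
  also have "\<dots> \<le> (\<Prod>j<n. 1 - q j)" by (rule prod_mono) (use low in auto)
  finally show "exp (- 2 * B) \<le> (\<Prod>j<n. 1 - q j)" .
qed

text \<open>Fixes the constants whose existence \<open>K_far_from_crit\<close> and
  \<open>expanding_metric_ex\<close> assert. Lengths at \<open>x\<close> are measured by
  \<open>cmod (u - x) / \<sigma> x\<close>.\<close>

locale fatou_expanding = fatou_map +
  fixes \<delta> \<mu> T :: real and \<sigma> :: "complex \<Rightarrow> real"
  assumes \<delta>_pos: "\<delta> > 0" and K_\<delta>: "\<And>x. x \<in> K \<Longrightarrow> \<delta> \<le> cmod (of_nat l - exp x)"
    and \<mu>: "\<mu> > 1"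
    and \<sigma>_bounds: "\<And>x. x \<in> K \<Longrightarrow> \<epsilon> \<le> \<sigma> x \<and> \<sigma> x \<le> T"
    and expand: "\<And>x. x \<in> K \<Longrightarrow> \<mu> * \<sigma> (f x) \<le> cmod (of_nat l - exp x) * \<sigma> x"
    and T_ge: "T \<ge> \<epsilon>"
begin

text \<open>The expansion \<open>\<mu>\<close> is split: one factor \<open>1 / \<theta>\<close>
  absorbs the nonlinearity, bounded on discs of radius \<open>\<eta>\<close> by
  \<open>Lip \<delta> * \<eta> \<le> 1 - \<theta>\<close>, and the other remains as the contraction
  of inverse branches.\<close>

definition \<theta> where "\<theta> = sqrt (1 / \<mu>)"
definition \<eta> where "\<eta> = min (1 / 2) ((1 - \<theta>)) / Lip \<delta>"
text \<open>A disc of flat radius \<open>r0\<close> has radius at most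
  \<open>\<eta> / (4 * T)\<close> when measured with \<open>\<sigma>\<close>, which in turn means at
  most \<open>\<eta> / 4\<close> in the flat metric.\<close>

definition r0 where "r0 = \<epsilon> * \<eta> / (4 * T)"
definition Dc where "Dc = exp (1 / (1 - \<theta>))"

lemma \<theta>: "0 < \<theta>" "\<theta> < 1" "\<theta> * \<mu> * \<theta> = 1"
proof -
  show "0 < \<theta>" "\<theta> < 1" using \<mu> by (auto simp: \<theta>_def)
  have "\<theta> * \<theta> = 1 / \<mu>" using \<mu> by (simp add: \<theta>_def)
  then have "\<theta> * \<theta> * \<mu> = 1" using \<mu> by simp
  then show "\<theta> * \<mu> * \<theta> = 1" by (simp only: mult_ac)
qed

lemma T_pos: "T > 0"
  using T_ge \<epsilon>(1) by simp

lemma \<eta>: "0 < \<eta>" "\<eta> \<le> 1" "Lip \<delta> * \<eta> \<le> 1 / 2" "Lip \<delta> * \<eta> \<le> 1 - \<theta>"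
proof -
  have L: "Lip \<delta> \<ge> 3" by (rule Lip_ge[OF \<delta>_pos])
  show "0 < \<eta>" using L \<theta> by (simp add: \<eta>_def)
  show "Lip \<delta> * \<eta> \<le> 1 / 2" "Lip \<delta> * \<eta> \<le> 1 - \<theta>" using L by (auto simp: \<eta>_def min_def)
  have "\<eta> \<le> (1/2) / 3" unfolding \<eta>_def using L by (intro frac_le) (auto simp: min_def)
  then show "\<eta> \<le> 1" by simp
qed

lemma r0_pos: "r0 > 0" and r0_le: "r0 \<le> \<eta> / 4"
proof -
  show "r0 > 0" using \<epsilon>(1) \<eta>(1) T_pos by (simp add: r0_def)
  have "\<epsilon> * \<eta> / (4 * T) \<le> T * \<eta> / (4 * T)" using T_ge T_pos \<eta>(1) by (intro divide_right_mono mult_right_mono) auto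
  then show "r0 \<le> \<eta> / 4" using T_pos by (simp add: r0_def)
qed

lemma near_linear_K:
  assumes "x \<in> K" "\<rho> \<le> \<eta>" "u \<in> cball x \<rho>" "v \<in> cball x \<rho>"
  shows "cmod (f u - f v - (of_nat l - exp x) * (u - v)) \<le> Lip \<delta> * \<rho> * cmod (of_nat l - exp x) * cmod (u - v)"
  by (rule f_near_linear[OF \<delta>_pos K_\<delta>[OF assms(1)]]) (use assms \<eta>(2) in auto)

lemma near_linear_K_bounds:
  assumes "x \<in> K" "\<rho> \<le> \<eta>" "u \<in> cball x \<rho>" "v \<in> cball x \<rho>"
  shows "cmod (f u - f v) \<le> (1 + Lip \<delta> * \<rho>) * cmod (of_nat l - exp x) * cmod (u - v)"
    "(1 - Lip \<delta> * \<rho>) * cmod (of_nat l - exp x) * cmod (u - v) \<le> cmod (f u - f v)"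
proof -
  let ?A = "(of_nat l - exp x) * (u - v)"
  have "\<bar>cmod (f u - f v) - cmod ?A\<bar> \<le> cmod (f u - f v - ?A)" by (rule norm_triangle_ineq3)
  also have "\<dots> \<le> Lip \<delta> * \<rho> * cmod (of_nat l - exp x) * cmod (u - v)" by (rule near_linear_K[OF assms])
  finally have "\<bar>cmod (f u - f v) - cmod (of_nat l - exp x) * cmod (u - v)\<bar>
      \<le> Lip \<delta> * \<rho> * cmod (of_nat l - exp x) * cmod (u - v)" by (simp only: norm_mult)
  then show "cmod (f u - f v) \<le> (1 + Lip \<delta> * \<rho>) * cmod (of_nat l - exp x) * cmod (u - v)"
    "(1 - Lip \<delta> * \<rho>) * cmod (of_nat l - exp x) * cmod (u - v) \<le> cmod (f u - f v)"
    by (auto simp: algebra_simps abs_le_iff)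
qed

lemma f_inj_near_K:
  assumes "x \<in> K" "u \<in> cball x \<eta>" "v \<in> cball x \<eta>" "f u = f v"
  shows "u = v"
proof -
  have a: "0 < cmod (of_nat l - exp x)" using K_\<delta>[OF assms(1)] \<delta>_pos by linarith
  have "Lip \<delta> * \<eta> * cmod (of_nat l - exp x) * cmod (u - v) \<le> 1 / 2 * cmod (of_nat l - exp x) * cmod (u - v)"
    using \<eta>(3) by (intro mult_right_mono) auto
  then have "cmod (f u - f v - (of_nat l - exp x) * (u - v)) \<le> cmod (of_nat l - exp x) / 2 * cmod (u - v)"
    using near_linear_K[OF assms(1) order_refl assms(2,3)] by simp
  then show ?thesis by (rule near_linear_inj) (use a assms(4) in auto)
qed

text \<open>Near \<open>x\<close> lengths measured with \<open>\<sigma>\<close> expand by at least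
  \<open>\<theta> * \<mu> = 1 / \<theta>\<close>. The image of the disc of radius
  \<open>\<eta>\<close> contains a disc whose radius is \<open>\<eta> / 2\<close> times the
  derivative, and \<open>v\<close> lies in it.\<close>

lemma shadow_step:
  assumes x: "x \<in> K" and v: "cmod (v - f x) / \<sigma> (f x) \<le> \<eta> / (4 * T)"
  obtains u where "f u = v" "cmod (u - x) \<le> \<eta>" "cmod (u - x) / \<sigma> x \<le> \<theta> * (cmod (v - f x) / \<sigma> (f x))"
proof -
  let ?a = "of_nat l - exp x"
  have a: "cmod ?a > 0" using K_\<delta>[OF x] \<delta>_pos by linarith
  have sx: "0 < \<sigma> x" "\<sigma> x \<le> T" and sf: "0 < \<sigma> (f x)" "\<sigma> (f x) \<le> T"
    using \<sigma>_bounds[OF x] \<sigma>_bounds[of "f x"] x f_K_iff \<epsilon>(1) by auto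
  have "\<sigma> (f x) \<le> \<mu> * \<sigma> (f x)" using \<mu> sf by simp
  also have "\<dots> \<le> cmod ?a * \<sigma> x" by (rule expand[OF x])
  also have "\<dots> \<le> cmod ?a * T" using sx by (intro mult_left_mono) auto
  finally have le: "\<sigma> (f x) \<le> cmod ?a * T" .
  have "cmod (v - f x) \<le> \<eta> / (4 * T) * \<sigma> (f x)" using v sf by (simp add: divide_le_eq)
  also have "\<dots> \<le> \<eta> / (4 * T) * (cmod ?a * T)" using le \<eta>(1) T_pos by (intro mult_left_mono) auto
  also have "\<dots> = \<eta> * cmod ?a / 4" using T_pos by simp
  also have "\<dots> < \<eta> * cmod ?a / 2" using a \<eta>(1) by simp
  finally have small: "cmod (v - f x) < \<eta> * cmod ?a / 2" .
  have lin: "cmod (f u - f w - ?a * (u - w)) \<le> cmod ?a / 2 * cmod (u - w)" if "u \<in> ball x \<eta>" "w \<in> ball x \<eta>" for u w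
  proof -
    have "Lip \<delta> * \<eta> * cmod ?a * cmod (u - w) \<le> 1 / 2 * cmod ?a * cmod (u - w)"
      using \<eta>(3) by (intro mult_right_mono) auto
    then show ?thesis using near_linear_K[OF x order_refl, of u w] that by simp
  qed
  obtain u where u: "u \<in> ball x \<eta>" "f u = v"
    using near_linear_surj[of x \<eta> f ?a v] lin a small by auto
  have "\<theta> * cmod ?a * cmod (u - x) \<le> (1 - Lip \<delta> * \<eta>) * cmod ?a * cmod (u - x)"
    using \<eta>(4) by (intro mult_right_mono) auto
  also have "\<dots> \<le> cmod (f u - f x)" by (rule near_linear_K_bounds(2)[OF x order_refl]) (use u \<eta>(1) in auto)
  finally have b: "\<theta> * cmod ?a * cmod (u - x) \<le> cmod (v - f x)" using u by simp
  have "cmod (u - x) * \<sigma> (f x) \<le> \<theta> * cmod (v - f x) * \<sigma> x"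
  proof -
    have "cmod (u - x) * \<sigma> (f x) = \<theta> * \<theta> * (cmod (u - x) * (\<mu> * \<sigma> (f x)))" using \<theta>(3) by (simp add: mult_ac)
    also have "\<dots> \<le> \<theta> * \<theta> * (cmod (u - x) * (cmod ?a * \<sigma> x))"
      using expand[OF x] \<theta>(1) by (intro mult_left_mono) auto
    also have "\<dots> = \<theta> * (\<theta> * cmod ?a * cmod (u - x)) * \<sigma> x" by (simp add: mult_ac)
    also have "\<dots> \<le> \<theta> * cmod (v - f x) * \<sigma> x" using b \<theta>(1) sx by (intro mult_right_mono mult_left_mono) auto
    finally show ?thesis .
  qed
  then have "cmod (u - x) / \<sigma> x \<le> \<theta> * (cmod (v - f x) / \<sigma> (f x))"
    using sx sf by (simp add: field_simps)
  then show thesis using that u by (auto simp: dist_norm norm_minus_commute)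
qed

text \<open>\<open>shadows n x y\<close>: the first \<open>n\<close> steps of \<open>y\<close> follow those of \<open>x\<close> along an inverse branch of \<open>f\<^sup>n\<close>.\<close>

definition shadows :: "nat \<Rightarrow> complex \<Rightarrow> complex \<Rightarrow> bool" where
  "shadows n x y \<longleftrightarrow> (\<forall>j\<le>n. cmod ((f ^^ j) y - (f ^^ j) x) \<le> \<eta> / 4 * \<theta> ^ (n - j))"

lemma shadows_dist: "shadows n x y \<Longrightarrow> j \<le> n \<Longrightarrow> cmod ((f ^^ j) y - (f ^^ j) x) \<le> \<eta> / 4"
proof -
  assume a: "shadows n x y" "j \<le> n"
  then have "cmod ((f ^^ j) y - (f ^^ j) x) \<le> \<eta> / 4 * \<theta> ^ (n - j)" by (simp add: shadows_def)
  also have "\<dots> \<le> \<eta> / 4 * 1" using \<theta> \<eta>(1) by (intro mult_left_mono power_le_one) auto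
  finally show ?thesis by simp
qed

lemma shadows_refl: "shadows n x x"
  using \<eta>(1) \<theta>(1) by (simp add: shadows_def)

lemma shadows_per: "shadows n x y \<Longrightarrow> shadows n (x + per k) (y + per k)"
  by (simp add: shadows_def f_pow_per)

lemma shadow_ex:
  assumes "x \<in> K" "cmod (v - (f ^^ n) x) \<le> r0"
  obtains y where "(f ^^ n) y = v" "shadows n x y"
proof -
  \<comment> \<open>The induction measures distances with \<open>\<sigma>\<close>, where each
    pullback contracts; the flat bound follows at the end from
    \<open>\<epsilon> \<le> \<sigma> x\<close> and \<open>\<sigma> x \<le> T\<close>.\<close>
  have main: "\<exists>y. (f ^^ n) y = v \<and> (\<forall>j\<le>n. cmod ((f ^^ j) y - (f ^^ j) x) / \<sigma> ((f ^^ j) x) \<le> \<theta> ^ (n - j) * (\<eta> / (4 * T)))"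
    if "x \<in> K" "cmod (v - (f ^^ n) x) / \<sigma> ((f ^^ n) x) \<le> \<eta> / (4 * T)" for x n v
    using that
  proof (induction n arbitrary: x)
    case 0
    then show ?case by (intro exI[of _ v]) auto
  next
    case (Suc n)
    have "cmod (v - (f ^^ n) (f x)) / \<sigma> ((f ^^ n) (f x)) \<le> \<eta> / (4 * T)" using Suc.prems(2) by (simp add: funpow_swap1)
    then obtain w where w: "(f ^^ n) w = v" "\<And>j. j \<le> n \<Longrightarrow> cmod ((f ^^ j) w - (f ^^ j) (f x)) / \<sigma> ((f ^^ j) (f x)) \<le> \<theta> ^ (n - j) * (\<eta> / (4 * T))"
      using Suc.IH[of "f x"] Suc.prems(1) f_K_iff by blast
    have w0: "cmod (w - f x) / \<sigma> (f x) \<le> \<theta> ^ n * (\<eta> / (4 * T))" using w(2)[of 0] by simp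
    also have "\<dots> \<le> 1 * (\<eta> / (4 * T))" using \<theta> \<eta>(1) T_pos by (intro mult_right_mono power_le_one) auto
    finally have "cmod (w - f x) / \<sigma> (f x) \<le> \<eta> / (4 * T)" by simp
    then obtain u where u: "f u = w" "cmod (u - x) / \<sigma> x \<le> \<theta> * (cmod (w - f x) / \<sigma> (f x))"
      using shadow_step[OF Suc.prems(1)] by metis
    have "cmod (u - x) / \<sigma> x \<le> \<theta> * (\<theta> ^ n * (\<eta> / (4 * T)))"
      using u(2) mult_left_mono[OF w0, of \<theta>] \<theta>(1) by linarith
    then have "cmod ((f ^^ j) u - (f ^^ j) x) / \<sigma> ((f ^^ j) x) \<le> \<theta> ^ (Suc n - j) * (\<eta> / (4 * T))" if "j \<le> Suc n" for j
      using w(2)[of "j - 1"] that u(1) by (cases j) (auto simp: funpow_swap1 mult.assoc)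
    moreover have "(f ^^ Suc n) u = v" using w(1) u(1) by (simp add: funpow_swap1)
    ultimately show ?case by blast
  qed
  have s: "\<epsilon> \<le> \<sigma> ((f ^^ j) x)" "\<sigma> ((f ^^ j) x) \<le> T" for j using \<sigma>_bounds[of "(f ^^ j) x"] assms(1) f_pow_K_iff by auto
  have "cmod (v - (f ^^ n) x) / \<sigma> ((f ^^ n) x) \<le> r0 / \<epsilon>" using assms(2) s(1)[of n] \<epsilon>(1) r0_pos by (intro frac_le) auto
  also have "\<dots> = \<eta> / (4 * T)" using \<epsilon>(1) by (simp add: r0_def)
  finally obtain y where y: "(f ^^ n) y = v" "\<And>j. j \<le> n \<Longrightarrow> cmod ((f ^^ j) y - (f ^^ j) x) / \<sigma> ((f ^^ j) x) \<le> \<theta> ^ (n - j) * (\<eta> / (4 * T))"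
    using main[OF assms(1)] by blast
  have "cmod ((f ^^ j) y - (f ^^ j) x) \<le> \<eta> / 4 * \<theta> ^ (n - j)" if "j \<le> n" for j
  proof -
    have sp: "0 < \<sigma> ((f ^^ j) x)" using s(1)[of j] \<epsilon>(1) by simp
    have "cmod ((f ^^ j) y - (f ^^ j) x) \<le> \<theta> ^ (n - j) * (\<eta> / (4 * T)) * \<sigma> ((f ^^ j) x)"
      using y(2)[OF that] sp by (simp add: pos_divide_le_eq)
    also have "\<dots> \<le> \<theta> ^ (n - j) * (\<eta> / (4 * T)) * T" using s(2)[of j] \<theta>(1) \<eta>(1) T_pos by (intro mult_left_mono) auto
    also have "\<dots> = \<eta> / 4 * \<theta> ^ (n - j)" using T_pos by simp
    finally show ?thesis .
  qed
  then show thesis using that y(1) by (simp add: shadows_def)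
qed

text \<open>Agreement at time \<open>n\<close> propagates backwards, since \<open>f\<close> is
  injective on discs of radius \<open>\<eta>\<close> about points of \<open>K\<close>.\<close>

lemma closing:
  assumes "x \<in> K" "\<And>j. j < n \<Longrightarrow> cmod ((f ^^ j) y - (f ^^ j) x) \<le> \<eta>" "(f ^^ n) y = (f ^^ n) x"
  shows "y = x"
  using assms(2,3)
proof (induction n)
  case (Suc n)
  have "(f ^^ n) y = (f ^^ n) x"
  proof (rule f_inj_near_K[of "(f ^^ n) x"])
    show "(f ^^ n) x \<in> K" using assms(1) f_pow_K_iff by blast
    show "(f ^^ n) y \<in> cball ((f ^^ n) x) \<eta>" using Suc.prems(1)[of n] by (simp add: dist_norm norm_minus_commute)
    show "f ((f ^^ n) y) = f ((f ^^ n) x)" using Suc.prems(2) by simp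
  qed (use \<eta>(1) in simp)
  then show ?case using Suc by simp
qed simp

text \<open>Two points shadowed by the same orbit stay within \<open>\<eta> / 4 + \<eta> / 4\<close>
  of each other. This later shows that transporting preimages along inverse branches is
  injective.\<close>

lemma shadows_unique:
  assumes "x1 \<in> K" "shadows n x1 y" "shadows n x2 y" "(f ^^ n) x1 = (f ^^ n) x2"
  shows "x1 = x2"
proof -
  have "cmod ((f ^^ j) x2 - (f ^^ j) x1) \<le> \<eta>" if "j < n" for j
    using shadows_dist[OF assms(2), of j] shadows_dist[OF assms(3), of j] that \<eta>(1)
      norm_triangle_ineq4[of "(f ^^ j) y - (f ^^ j) x1" "(f ^^ j) y - (f ^^ j) x2"] by simp
  then have "x2 = x1" by (intro closing[OF assms(1), of n]) (use assms(4) in auto)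
  then show ?thesis by simp
qed

lemma cmod_deriv_f_pow: "cmod (deriv (f ^^ n) x) = (\<Prod>j<n. cmod (of_nat l - exp ((f ^^ j) x)))"
  by (induction n) (simp_all add: deriv_f_pow_Suc norm_mult id_def mult.commute del: funpow.simps(2))

text \<open>The one-step inequality for \<open>\<sigma>\<close> telescopes along the orbit;
  \<open>\<epsilon> / T\<close> is the price of returning to the flat metric.\<close>

lemma expansion:
  assumes "x \<in> K"
  shows "\<epsilon> / T * \<mu> ^ n \<le> cmod (deriv (f ^^ n) x)"
proof -
  have K: "(f ^^ j) x \<in> K" for j using assms f_pow_K_iff by blast
  have "\<mu> ^ n * \<sigma> ((f ^^ n) x) \<le> cmod (deriv (f ^^ n) x) * \<sigma> x"
  proof (induction n)
    case (Suc n)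
    have "\<mu> ^ Suc n * \<sigma> ((f ^^ Suc n) x) = \<mu> ^ n * (\<mu> * \<sigma> (f ((f ^^ n) x)))" by simp
    also have "\<dots> \<le> \<mu> ^ n * (cmod (of_nat l - exp ((f ^^ n) x)) * \<sigma> ((f ^^ n) x))"
      using expand[OF K[of n]] \<mu> by (intro mult_left_mono) auto
    also have "\<dots> = cmod (of_nat l - exp ((f ^^ n) x)) * (\<mu> ^ n * \<sigma> ((f ^^ n) x))" by simp
    also have "\<dots> \<le> cmod (of_nat l - exp ((f ^^ n) x)) * (cmod (deriv (f ^^ n) x) * \<sigma> x)"
      using Suc by (intro mult_left_mono) auto
    also have "\<dots> = cmod (deriv (f ^^ Suc n) x) * \<sigma> x" by (simp add: deriv_f_pow_Suc norm_mult del: funpow.simps)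
    finally show ?case .
  qed (simp add: id_def)
  moreover have "\<mu> ^ n * \<epsilon> \<le> \<mu> ^ n * \<sigma> ((f ^^ n) x)" using \<sigma>_bounds[OF K[of n]] \<mu> by (intro mult_left_mono) auto
  moreover have "cmod (deriv (f ^^ n) x) * \<sigma> x \<le> cmod (deriv (f ^^ n) x) * T"
    using \<sigma>_bounds[OF assms] by (intro mult_left_mono) auto
  ultimately have "\<mu> ^ n * \<epsilon> \<le> cmod (deriv (f ^^ n) x) * T" by linarith
  then show ?thesis using T_pos by (simp add: field_simps)
qed

text \<open>Shadowing distances decay geometrically backwards from time \<open>n\<close>, so the
  relative errors have a sum bounded independently of \<open>n\<close>. This is the source of
  bounded distortion.\<close>

lemma shadow_errors:
  defines "q \<equiv> \<lambda>n j. Lip \<delta> * (\<eta> / 4 * \<theta> ^ (n - j))"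
  shows "0 \<le> q n j" "q n j \<le> 1 / 2" "(\<Prod>j<n. 1 + q n j) \<le> Dc" "1 / Dc \<le> (\<Prod>j<n. 1 - q n j)"
proof -
  have L: "Lip \<delta> \<ge> 3" by (rule Lip_ge[OF \<delta>_pos])
  have q: "q n j = (Lip \<delta> * \<eta>) / 4 * \<theta> ^ (n - j)" for n j by (simp add: q_def)
  have q0: "0 \<le> q n j" for j using L \<eta>(1) \<theta>(1) by (simp add: q)
  have q8: "q n j \<le> 1 / 8 * \<theta> ^ (n - j)" for j unfolding q using \<eta>(3) \<theta>(1) by (intro mult_right_mono) auto
  have q1: "q n j \<le> 1 / 2" for j
  proof -
    have "1 / 8 * \<theta> ^ (n - j) \<le> 1 / 8 * 1" using \<theta> by (intro mult_left_mono power_le_one) auto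
    then show ?thesis using q8[of j] by simp
  qed
  show "0 \<le> q n j" "q n j \<le> 1 / 2" using q0 q1 by auto
  have "(\<Sum>j<n. q n j) \<le> (\<Sum>j<n. 1 / 8 * \<theta> ^ (n - j))" by (intro sum_mono q8)
  also have "\<dots> = 1 / 8 * (\<Sum>j<n. \<theta> ^ (n - j))" by (simp add: sum_distrib_left)
  also have "(\<Sum>j<n. \<theta> ^ (n - j)) = (\<Sum>i<n. \<theta> ^ Suc i)"
    by (subst sum.nat_diff_reindex[symmetric]) (auto intro!: sum.cong simp: Suc_diff_Suc)
  also have "\<dots> \<le> (\<Sum>i<n. \<theta> ^ i)" using \<theta> by (intro sum_mono) (auto simp: mult_left_le_one_le)
  also have "\<dots> \<le> (\<Sum>i. \<theta> ^ i)" using \<theta> by (intro sum_le_suminf summable_geometric) auto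
  also have "\<dots> = 1 / (1 - \<theta>)" using \<theta> by (intro suminf_geometric) auto
  finally have s8: "(\<Sum>j<n. q n j) \<le> 1 / 8 * (1 / (1 - \<theta>))" by simp
  have "1 / 8 * S \<le> S / 2" if "0 \<le> S" for S :: real using that by simp
  from this[of "1 / (1 - \<theta>)"] have "1 / 8 * (1 / (1 - \<theta>)) \<le> 1 / (1 - \<theta>) / 2" using \<theta> by simp
  with s8 have "(\<Sum>j<n. q n j) \<le> 1 / (1 - \<theta>) / 2" by (rule order_trans)
  note b = exp_prod_bounds[of n "q n", OF q0 q1 this]
  have e: "2 * (S / 2) = S" "- 2 * (S / 2) = - S" for S :: real by simp_all
  show "(\<Prod>j<n. 1 + q n j) \<le> Dc" "1 / Dc \<le> (\<Prod>j<n. 1 - q n j)"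
    using b unfolding e by (simp_all only: Dc_def exp_minus inverse_eq_divide)
qed

lemma Dc_pos: "Dc > 0" and Dc_ge: "Dc \<ge> 1"
  using \<theta> by (simp_all add: Dc_def)

text \<open>One-step bounds multiplied along the orbit, with all derivatives taken at the reference
  point \<open>x\<close>. It stands in for Koebe's distortion theorem.\<close>

lemma shadow_dist_bounds:
  assumes x: "x \<in> K" and y: "shadows n x y" "shadows n x y'"
  shows "cmod ((f ^^ n) y - (f ^^ n) y') \<le> Dc * cmod (deriv (f ^^ n) x) * cmod (y - y')"
    "cmod (deriv (f ^^ n) x) * cmod (y - y') \<le> Dc * cmod ((f ^^ n) y - (f ^^ n) y')"
proof -
  let ?q = "\<lambda>j. Lip \<delta> * (\<eta> / 4 * \<theta> ^ (n - j))"
  let ?a = "\<lambda>j. cmod (of_nat l - exp ((f ^^ j) x))"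
  note q = shadow_errors(1,2)[of n]
  have step: "cmod ((f ^^ Suc j) y - (f ^^ Suc j) y') \<le> (1 + ?q j) * ?a j * cmod ((f ^^ j) y - (f ^^ j) y')"
    "(1 - ?q j) * ?a j * cmod ((f ^^ j) y - (f ^^ j) y') \<le> cmod ((f ^^ Suc j) y - (f ^^ Suc j) y')" if "j < n" for j
  proof -
    have K: "(f ^^ j) x \<in> K" using x f_pow_K_iff by blast
    have "\<eta> / 4 * \<theta> ^ (n - j) \<le> \<eta> / 4 * 1" using \<theta> \<eta>(1) by (intro mult_left_mono power_le_one) auto
    then have le: "\<eta> / 4 * \<theta> ^ (n - j) \<le> \<eta>" using \<eta>(1) by linarith
    have "(f ^^ j) y \<in> cball ((f ^^ j) x) (\<eta> / 4 * \<theta> ^ (n - j))" "(f ^^ j) y' \<in> cball ((f ^^ j) x) (\<eta> / 4 * \<theta> ^ (n - j))"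
      using y that by (auto simp: shadows_def dist_norm norm_minus_commute)
    from near_linear_K_bounds[OF K le this]
    show "cmod ((f ^^ Suc j) y - (f ^^ Suc j) y') \<le> (1 + ?q j) * ?a j * cmod ((f ^^ j) y - (f ^^ j) y')"
      "(1 - ?q j) * ?a j * cmod ((f ^^ j) y - (f ^^ j) y') \<le> cmod ((f ^^ Suc j) y - (f ^^ Suc j) y')" by auto
  qed
  have "cmod ((f ^^ k) y - (f ^^ k) y') \<le> (\<Prod>j<k. 1 + ?q j) * (\<Prod>j<k. ?a j) * cmod (y - y') \<and>
        (\<Prod>j<k. 1 - ?q j) * (\<Prod>j<k. ?a j) * cmod (y - y') \<le> cmod ((f ^^ k) y - (f ^^ k) y')" if "k \<le> n" for k
    using that
  proof (induction k)
    case (Suc k)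
    have k: "k < n" using Suc.prems by simp
    have "cmod ((f ^^ Suc k) y - (f ^^ Suc k) y') \<le> (1 + ?q k) * ?a k * cmod ((f ^^ k) y - (f ^^ k) y')" by (rule step(1)[OF k])
    also have "\<dots> \<le> (1 + ?q k) * ?a k * ((\<Prod>j<k. 1 + ?q j) * (\<Prod>j<k. ?a j) * cmod (y - y'))"
      using Suc q(1)[of k] by (intro mult_left_mono mult_nonneg_nonneg) auto
    finally have 1: "cmod ((f ^^ Suc k) y - (f ^^ Suc k) y') \<le> (\<Prod>j<Suc k. 1 + ?q j) * (\<Prod>j<Suc k. ?a j) * cmod (y - y')"
      by (simp only: prod.lessThan_Suc mult_ac)
    have "(1 - ?q k) * ?a k * ((\<Prod>j<k. 1 - ?q j) * (\<Prod>j<k. ?a j) * cmod (y - y')) \<le> (1 - ?q k) * ?a k * cmod ((f ^^ k) y - (f ^^ k) y')"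
      using Suc q(2)[of k] by (intro mult_left_mono mult_nonneg_nonneg) auto
    also have "\<dots> \<le> cmod ((f ^^ Suc k) y - (f ^^ Suc k) y')" by (rule step(2)[OF k])
    finally have 2: "(\<Prod>j<Suc k. 1 - ?q j) * (\<Prod>j<Suc k. ?a j) * cmod (y - y') \<le> cmod ((f ^^ Suc k) y - (f ^^ Suc k) y')"
      by (simp only: prod.lessThan_Suc mult_ac)
    show ?case using 1 2 by blast
  qed simp
  from this[of n]
  have up: "cmod ((f ^^ n) y - (f ^^ n) y') \<le> (\<Prod>j<n. 1 + ?q j) * cmod (deriv (f ^^ n) x) * cmod (y - y')"
    and low: "(\<Prod>j<n. 1 - ?q j) * cmod (deriv (f ^^ n) x) * cmod (y - y') \<le> cmod ((f ^^ n) y - (f ^^ n) y')"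
    by (auto simp: cmod_deriv_f_pow)
  have "(\<Prod>j<n. 1 + ?q j) * cmod (deriv (f ^^ n) x) * cmod (y - y') \<le> Dc * cmod (deriv (f ^^ n) x) * cmod (y - y')"
    by (intro mult_right_mono shadow_errors(3)) auto
  then show "cmod ((f ^^ n) y - (f ^^ n) y') \<le> Dc * cmod (deriv (f ^^ n) x) * cmod (y - y')" using up by linarith
  have "1 / Dc * cmod (deriv (f ^^ n) x) * cmod (y - y') \<le> (\<Prod>j<n. 1 - ?q j) * cmod (deriv (f ^^ n) x) * cmod (y - y')"
    by (intro mult_right_mono shadow_errors(4)) auto
  then have "1 / Dc * cmod (deriv (f ^^ n) x) * cmod (y - y') \<le> cmod ((f ^^ n) y - (f ^^ n) y')" using low by linarith
  then show "cmod (deriv (f ^^ n) x) * cmod (y - y') \<le> Dc * cmod ((f ^^ n) y - (f ^^ n) y')"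
    using Dc_pos by (simp add: field_simps)
qed

lemma shadow_deriv_bounds:
  assumes x: "x \<in> K" and y: "shadows n x y"
  shows "cmod (deriv (f ^^ n) y) \<le> Dc * cmod (deriv (f ^^ n) x)"
    "cmod (deriv (f ^^ n) x) \<le> Dc * cmod (deriv (f ^^ n) y)"
proof -
  let ?q = "\<lambda>j. Lip \<delta> * (\<eta> / 4 * \<theta> ^ (n - j))"
  let ?a = "\<lambda>x j. cmod (of_nat l - exp ((f ^^ j) x))"
  note q = shadow_errors(1,2)[of n]
  have step: "?a y j \<le> (1 + ?q j) * ?a x j" "(1 - ?q j) * ?a x j \<le> ?a y j" if "j < n" for j
  proof -
    have K: "(f ^^ j) x \<in> K" using x f_pow_K_iff by blast
    have d: "cmod ((f ^^ j) y - (f ^^ j) x) \<le> \<eta> / 4 * \<theta> ^ (n - j)" using y that by (simp add: shadows_def)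
    have d1: "cmod ((f ^^ j) y - (f ^^ j) x) \<le> 1" using shadows_dist[OF y, of j] that \<eta>(2) by simp
    have L: "Lip \<delta> \<ge> 3" by (rule Lip_ge[OF \<delta>_pos])
    have "cmod ((of_nat l - exp ((f ^^ j) y)) - (of_nat l - exp ((f ^^ j) x))) \<le> Lip \<delta> * cmod ((f ^^ j) y - (f ^^ j) x) * ?a x j"
      by (rule f_deriv_rel[OF \<delta>_pos K_\<delta>[OF K] d1])
    also have "\<dots> \<le> ?q j * ?a x j" using d L by (intro mult_right_mono mult_left_mono) auto
    finally have "\<bar>?a y j - ?a x j\<bar> \<le> ?q j * ?a x j" using norm_triangle_ineq3 order_trans by blast
    then show "?a y j \<le> (1 + ?q j) * ?a x j" "(1 - ?q j) * ?a x j \<le> ?a y j"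
      unfolding distrib_right left_diff_distrib mult_1_left by linarith+
  qed
  have "(\<Prod>j<n. ?a y j) \<le> (\<Prod>j<n. (1 + ?q j) * ?a x j)" by (rule prod_mono) (use step(1) in auto)
  also have "\<dots> = (\<Prod>j<n. 1 + ?q j) * (\<Prod>j<n. ?a x j)" by (rule prod.distrib)
  also have "\<dots> \<le> Dc * (\<Prod>j<n. ?a x j)" by (intro mult_right_mono shadow_errors(3) prod_nonneg) auto
  finally show "cmod (deriv (f ^^ n) y) \<le> Dc * cmod (deriv (f ^^ n) x)" by (simp add: cmod_deriv_f_pow)
  have "1 / Dc * (\<Prod>j<n. ?a x j) \<le> (\<Prod>j<n. 1 - ?q j) * (\<Prod>j<n. ?a x j)"
    by (intro mult_right_mono shadow_errors(4) prod_nonneg) auto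
  also have "\<dots> = (\<Prod>j<n. (1 - ?q j) * ?a x j)" by (rule prod.distrib[symmetric])
  also have "\<dots> \<le> (\<Prod>j<n. ?a y j)"
  proof (rule prod_mono)
    fix j assume "j \<in> {..<n}"
    moreover have "?q j \<le> 1" using q(2)[of j] by linarith
    ultimately show "0 \<le> (1 - ?q j) * ?a x j \<and> (1 - ?q j) * ?a x j \<le> ?a y j" using step(2)[of j] by simp
  qed
  finally show "cmod (deriv (f ^^ n) x) \<le> Dc * cmod (deriv (f ^^ n) y)"
    using Dc_pos by (simp add: cmod_deriv_f_pow field_simps)
qed

end

section \<open>Preimages of a repelling fixed point\<close>

lemma int_shift_near: "\<exists>k::int. \<bar>a + 2 * pi * real_of_int k - b\<bar> \<le> pi"
proof -
  define k where "k = round ((b - a) / (2 * pi))"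
  have "\<bar>real_of_int k - (b - a) / (2 * pi)\<bar> \<le> 1 / 2" unfolding k_def by (rule of_int_round_abs_le)
  then have "\<bar>real_of_int k - (b - a) / (2 * pi)\<bar> * (2 * pi) \<le> 1 / 2 * (2 * pi)" by (intro mult_right_mono) auto
  moreover have "\<bar>real_of_int k - (b - a) / (2 * pi)\<bar> * (2 * pi) = \<bar>(real_of_int k - (b - a) / (2 * pi)) * (2 * pi)\<bar>"
    by (simp add: abs_mult)
  moreover have "(real_of_int k - (b - a) / (2 * pi)) * (2 * pi) = a + 2 * pi * real_of_int k - b"
    by (simp add: field_simps)
  ultimately show ?thesis by (intro exI[of _ k]) simp
qed

lemma eventually_log_lt_linear: "\<exists>R0>0. \<forall>R\<ge>R0. a + b * ln R < d * (R :: real)" if "d > 0"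
proof -
  have "eventually (\<lambda>R::real. a + b * ln R < d * R) at_top" using that by real_asymp
  then obtain R0 where "\<And>R. R \<ge> R0 \<Longrightarrow> a + b * ln R < d * R" unfolding eventually_at_top_linorder by blast
  then show ?thesis by (intro exI[of _ "max R0 1"]) auto
qed

context fatou_map
begin

text \<open>The parameter \<open>e\<close> is 0 for preimages and 1 for fixed points.\<close>

lemma far_cover:
  fixes e :: complex
  assumes W: "4 * (real l + 1) \<le> exp (Re y)" and e: "cmod e \<le> 1" and \<rho>: "0 < \<rho>" "\<rho> \<le> 1 / 12"
    and w: "cmod (w - (f y - e * y)) < \<rho> * exp (Re y) / 2"
  obtains u where "cmod (u - y) < \<rho>" "f u - e * u = w"
proof -
  \<comment> \<open>The derivative is \<open>of_nat l - e - exp u\<close>. Compared with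
    \<open>- exp y\<close> it errs by at most \<open>l + 1 \<le> exp (Re y) / 4\<close> through the
    constants and by \<open>3 / 12\<close> of \<open>exp (Re y)\<close> through the variation of
    \<open>exp\<close>, in total by half.\<close>
  let ?a = "- exp y"
  have lin: "cmod ((f u - e * u) - (f v - e * v) - ?a * (u - v)) \<le> cmod ?a / 2 * cmod (u - v)"
    if uv: "u \<in> ball y \<rho>" "v \<in> ball y \<rho>" for u v
  proof (rule near_linear[where S="ball y \<rho>" and f'="\<lambda>u. (of_nat l - exp u) - e"])
    fix u assume u: "u \<in> ball y \<rho>"
    show "((\<lambda>u. f u - e * u) has_field_derivative of_nat l - exp u - e) (at u)"
      by (auto intro!: derivative_eq_intros f_deriv)
    have d: "cmod (u - y) \<le> 1 / 12" using u \<rho> by (simp add: dist_norm norm_minus_commute)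
    have "cmod (exp u - exp y) \<le> 3 * cmod (exp y) * cmod (u - y)"
      using f_deriv_diff[of u y] d by (simp add: norm_minus_commute)
    also have "\<dots> \<le> 3 * cmod (exp y) * (1 / 12)" using d by (intro mult_left_mono) auto
    finally have "cmod (exp u - exp y) \<le> exp (Re y) / 4" by simp
    moreover have eq: "of_nat l - exp u - e - ?a = (of_nat l - e) - (exp u - exp y)" by simp
    moreover have "cmod ((of_nat l - e) - (exp u - exp y)) \<le> cmod (of_nat l - e) + cmod (exp u - exp y)" by (rule norm_triangle_ineq4)
    moreover have "cmod (of_nat l - e) \<le> real l + 1" using norm_triangle_ineq4[of "of_nat l" e] e by simp
    moreover have "cmod ?a = exp (Re y)" by simp
    ultimately show "cmod (of_nat l - exp u - e - ?a) \<le> cmod ?a / 2" unfolding eq using W by argo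
  qed (use uv in auto)
  obtain u where "u \<in> ball y \<rho>" "f u - e * u = w"
    using near_linear_surj[of y \<rho> "\<lambda>u. f u - e * u" ?a w] lin w by auto
  then show thesis using that by (auto simp: dist_norm norm_minus_commute)
qed

lemma cmod_diff_per_le:
  "\<exists>k. cmod (w + per k - z) \<le> \<bar>Re w - Re z\<bar> + pi"
proof -
  obtain k where k: "\<bar>Im w + 2 * pi * real_of_int k - Im z\<bar> \<le> pi" using int_shift_near by blast
  have "cmod (w + per k - z) \<le> \<bar>Re (w + per k - z)\<bar> + \<bar>Im (w + per k - z)\<bar>" by (rule cmod_le)
  also have "\<dots> \<le> \<bar>Re w - Re z\<bar> + pi" using k by simp
  finally show ?thesis by blast
qed

text \<open>With \<open>exp y\<close> purely imaginary the real part of \<open>f y\<close> is only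
  of logarithmic size in \<open>R\<close>, whereas the derivative has size about
  \<open>R\<close>.\<close>

lemma exists_exp_eq_i:
  assumes "R > 0"
  obtains y where "exp y = \<i> * of_real R" "Re y = ln R" "\<bar>Im y - b\<bar> \<le> pi"
proof -
  obtain k where k: "\<bar>pi / 2 + 2 * pi * real_of_int k - b\<bar> \<le> pi" using int_shift_near by blast
  define y0 where "y0 = Complex (ln R) (pi / 2)"
  have "exp y0 = \<i> * of_real R" using assms by (simp add: y0_def exp_eq_polar cis.ctr complex_eq_iff Re_exp Im_exp)
  then show thesis using that[of "y0 + per k"] k by (simp add: y0_def)
qed

text \<open>The image of the disc of radius 1/12 about \<open>y\<close> contains a disc of radius
  \<open>R / 24\<close>. Real parts differ by at most a constant plus \<open>l * ln R\<close>,
  imaginary parts by at most \<open>pi\<close> modulo periods, so for large \<open>R\<close> a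
  translate of every \<open>w\<close> in the strip is hit.\<close>

lemma cover_via_right:
  fixes e :: complex
  assumes "R > 0" "4 * (real l + 1) \<le> R" "e = 0 \<or> e = 1"
    and big: "(cmod C + B + pi) + real l * ln R < R / 24" and R1: "R \<ge> 1"
    and w: "\<bar>Re w\<bar> \<le> B" and y: "exp y = \<i> * of_real R" "Re y = ln R"
  obtains u k where "cmod (u - y) < 1 / 12" "f u - e * u = w + per k"
proof -
  obtain k where k: "cmod (w + per k - (f y - e * y)) \<le> \<bar>Re w - Re (f y - e * y)\<bar> + pi"
    using cmod_diff_per_le by blast
  have e: "Re (e * y) = Re e * ln R" "0 \<le> Re e" "Re e \<le> 1" using assms(3) y(2) by auto
  have l1: "Re e \<le> real l" using e l2 by linarith
  have "Re (f y - e * y) = Re C + (real l - Re e) * ln R" using y e by (simp add: f_eq algebra_simps)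
  moreover have "0 \<le> (real l - Re e) * ln R" "(real l - Re e) * ln R \<le> real l * ln R"
    using R1 l1 e by (auto intro!: mult_right_mono)
  ultimately have "\<bar>Re (f y - e * y)\<bar> \<le> cmod C + real l * ln R" using abs_Re_le_cmod[of C] by linarith
  then have "cmod (w + per k - (f y - e * y)) < R / 24" using k w big by linarith
  then have "cmod (w + per k - (f y - e * y)) < 1 / 12 * exp (Re y) / 2" using y assms(1) by simp
  moreover have "4 * (real l + 1) \<le> exp (Re y)" using y assms(1,2) by simp
  moreover have "cmod e \<le> 1" using assms(3) by auto
  ultimately obtain u where "cmod (u - y) < 1 / 12" "f u - e * u = w + per k"
    using far_cover[of y e "1/12" "w + per k"] by auto
  then show thesis using that by blast
qed

lemma large_R: "\<exists>R0\<ge>1. \<forall>R\<ge>R0. 4 * (real l + 1) \<le> R \<and> (cmod C + B + pi) + real l * ln R < R / 24"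
proof -
  obtain R0 where R0: "\<And>R. R \<ge> R0 \<Longrightarrow> (cmod C + B + pi) + real l * ln R < 1 / 24 * R"
    using eventually_log_lt_linear[of "1/24" "cmod C + B + pi" "real l"] by auto
  show ?thesis
    using R0 by (intro exI[of _ "max (max R0 (4 * (real l + 1))) 1"]) auto
qed

text \<open>One step is not enough, as \<open>f y\<close> may itself lie at a distance of order
  \<open>exp (Re y)\<close> from the strip. It serves to move to a point near \<open>f y\<close> at
  which \<open>exp\<close> is almost purely imaginary; from there the second step covers the
  strip.\<close>

lemma two_step_cover:
  assumes "0 < \<rho>" "\<rho> \<le> 1 / 12"
  shows "\<exists>T2. \<forall>y\<in>K. \<forall>w. Re y \<ge> T2 \<longrightarrow> \<bar>Re w\<bar> \<le> B \<longrightarrow> (\<exists>x k. cmod (x - y) < \<rho> \<and> f (f x) = w + per k)"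
proof -
  obtain R0 where R0: "R0 \<ge> 1" "\<And>R. R \<ge> R0 \<Longrightarrow> 4 * (real l + 1) \<le> R \<and> (cmod C + B + pi) + real l * ln R < R / 24"
    using large_R by blast
  define D where "D = ln R0 + M + 1 + pi + 1"
  have "ln R0 \<ge> 0" "M \<ge> 3" using R0(1) by (auto simp: M_def)
  then have Dp: "D > 0" using pi_gt_zero unfolding D_def by linarith
  define T2 where "T2 = ln (max (4 * (real l + 1)) (2 * (D + 1) / \<rho>))"
  have "\<exists>x k. cmod (x - y) < \<rho> \<and> f (f x) = w + per k" if y: "y \<in> K" "Re y \<ge> T2" and w: "\<bar>Re w\<bar> \<le> B" for y w
  proof -
    have "exp T2 = max (4 * (real l + 1)) (2 * (D + 1) / \<rho>)" unfolding T2_def by (rule exp_ln) (simp add: less_max_iff_disj)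
    moreover have "exp T2 \<le> exp (Re y)" using y by simp
    ultimately have W: "4 * (real l + 1) \<le> exp (Re y)" "2 * (D + 1) / \<rho> \<le> exp (Re y)" by auto
    have fy: "Re (f y) > - M - 1" using K_Re f_K_iff y(1) by blast
    \<comment> \<open>\<open>ln R\<close> is within a bounded distance of \<open>Re (f y)\<close>,
      because \<open>Re (f y) > - M - 1\<close> on \<open>K\<close>; \<open>D\<close> bounds the way
      from \<open>f y\<close> to the intermediate point.\<close>
    define R where "R = max R0 (exp (Re (f y)))"
    have R: "R \<ge> R0" "R > 0" "R \<ge> 1" using R0(1) by (auto simp: R_def)
    obtain y1 where y1: "exp y1 = \<i> * of_real R" "Re y1 = ln R" "\<bar>Im y1 - Im (f y)\<bar> \<le> pi"
      using exists_exp_eq_i[OF R(2)] by metis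
    obtain u k where u: "cmod (u - y1) < 1 / 12" "f u - 0 * u = w + per k"
      using cover_via_right[of R 0 B w y1] R R0(2)[OF R(1)] w y1 by auto
    have "ln R = max (ln R0) (Re (f y))" unfolding R_def using R0(1)
      by (auto simp: max_def ln_ge_iff) (metis exp_gt_zero ln_exp ln_le_cancel_iff not_le order_less_le_trans zero_less_one)+
    then have "\<bar>ln R - Re (f y)\<bar> \<le> ln R0 + M + 1" using fy R0(1) by (auto simp: max_def M_def)
    then have "cmod (y1 - f y) \<le> ln R0 + M + 1 + pi"
      using cmod_le[of "y1 - f y"] y1 by simp
    then have "cmod (u - f y) < D" using norm_triangle_ineq[of "u - y1" "y1 - f y"] u(1) by (simp add: D_def)
    also have "D < \<rho> * exp (Re y) / 2" using W(2) assms(1) by (simp add: field_simps)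
    finally have "cmod (u - (f y - 0 * y)) < \<rho> * exp (Re y) / 2" by simp
    then obtain x where x: "cmod (x - y) < \<rho>" "f x - 0 * x = u"
      using far_cover[OF W(1) _ assms] by (metis norm_zero zero_le_one)
    then show ?thesis using u(2) by (intro exI[of _ x] exI[of _ k]) simp
  qed
  then show ?thesis by blast
qed

text \<open>\<open>cover_via_right\<close> for \<open>f u - u\<close> and target 0 gives a point
  fixed up to a period. To the right of \<open>A\<close> such a point is never trapped. The
  multiplier is made large enough to beat the square of the growth \<open>l ^ n\<close> of the
  lifted orbit.\<close>

lemma good_fixed_point_ex:
  "\<exists>q k. f q = q + per k \<and> q \<in> K \<and> 2 * (real l)\<^sup>2 \<le> cmod (of_nat l - exp q)"
proof -
  obtain B where B: "\<And>x. x \<in> A \<Longrightarrow> Re_cyl x \<le> B" using A_bounded_right by blast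
  obtain R0 where R0: "R0 \<ge> 1" "\<And>R. R \<ge> R0 \<Longrightarrow> 4 * (real l + 1) \<le> R \<and> (cmod C + 0 + pi) + real l * ln R < R / 24"
    using large_R[of 0] by blast
  \<comment> \<open>The terms serve the covering, the position to the right of \<open>A\<close>, and
    the multiplier; the 3 makes up for the deviation of \<open>Re q\<close> from
    \<open>ln R\<close>.\<close>
  define R where "R = max (max R0 (exp (B + 1))) (3 * (2 * (real l)\<^sup>2 + real l))"
  have R: "R \<ge> R0" "R \<ge> exp (B + 1)" "R \<ge> 3 * (2 * (real l)\<^sup>2 + real l)" by (auto simp: R_def)
  have Rp: "R > 0" "R \<ge> 1" using R R0(1) by auto
  obtain y where y: "exp y = \<i> * of_real R" "Re y = ln R" using exists_exp_eq_i[OF Rp(1)] by metis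
  obtain q k where q: "cmod (q - y) < 1 / 12" "f q - 1 * q = 0 + per k"
    using cover_via_right[of R 1 0 0 y] Rp R0(2)[OF R(1)] y by auto
  have fq: "f q = q + per k" using q(2) by (simp add: algebra_simps)
  have Rq: "Re q \<ge> ln R - 1 / 12" using abs_Re_le_cmod[of "q - y"] q(1) y(2) by simp
  have "ln R \<ge> B + 1" using R(2) Rp by (simp add: ln_ge_iff)
  then have nA: "to_cyl q \<notin> A" using B[of "to_cyl q"] Rq by auto
  have "(F ^^ n) (to_cyl q) = to_cyl q" for n
    by (induction n) (simp_all add: F_map_to_cyl fq)
  then have K: "q \<in> K" using nA by (simp add: Kset_def)
  have "R * (1 / 3) \<le> R * exp (- 1 / 12)"
  proof (intro mult_left_mono)
    have "1 + (- 1 / 12) \<le> exp (- 1 / 12 :: real)" by (rule exp_ge_add_one_self)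
    then show "1 / 3 \<le> exp (- 1 / 12 :: real)" by simp
  qed (use Rp in simp)
  also have "R * exp (- 1 / 12) = exp (ln R + - 1 / 12)" using Rp by (simp only: exp_add exp_ln)
  also have "\<dots> \<le> exp (Re q)" using Rq by (subst exp_le_cancel_iff) linarith
  finally have "R / 3 \<le> exp (Re q)" by simp
  moreover have "exp (Re q) - real l \<le> cmod (of_nat l - exp q)"
    using norm_triangle_ineq2[of "exp q" "of_nat l"] by (simp add: norm_minus_commute)
  ultimately have "2 * (real l)\<^sup>2 \<le> cmod (of_nat l - exp q)" using R(3) by argo
  then show ?thesis using fq K by blast
qed

definition p0 where "p0 = (SOME q. \<exists>k. f q = q + per k \<and> q \<in> K \<and> 2 * (real l)\<^sup>2 \<le> cmod (of_nat l - exp q))"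

lemma p0: "\<exists>k. f p0 = p0 + per k" "p0 \<in> K" "2 * (real l)\<^sup>2 \<le> cmod (of_nat l - exp p0)"
proof -
  have "\<exists>k. f p0 = p0 + per k \<and> p0 \<in> K \<and> 2 * (real l)\<^sup>2 \<le> cmod (of_nat l - exp p0)"
    unfolding p0_def by (rule someI_ex[OF good_fixed_point_ex])
  then show "\<exists>k. f p0 = p0 + per k" "p0 \<in> K" "2 * (real l)\<^sup>2 \<le> cmod (of_nat l - exp p0)" by blast+
qed

lemma F_p0: "(F ^^ n) (to_cyl p0) = to_cyl p0"
proof -
  obtain k where "f p0 = p0 + per k" using p0(1) by blast
  then show ?thesis by (induction n) (simp_all add: F_map_to_cyl)
qed

lemma f_pow_p0: "\<exists>m. (f ^^ n) p0 = p0 + per m"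
  using F_p0[of n] to_cyl_eqE unfolding F_pow_to_cyl by blast

lemma f_pow_p0_growth: "\<exists>B\<ge>0. \<forall>n. cmod ((f ^^ n) (p0 + per j)) \<le> B * real l ^ n"
proof -
  obtain k where k: "f p0 = p0 + per k" using p0(1) by blast
  \<comment> \<open>With \<open>- 1\<close> the bound becomes inductive:
    \<open>1 + l * (l ^ n - 1) \<le> l ^ Suc n - 1\<close> as \<open>l \<ge> 2\<close>.\<close>
  have strong: "\<exists>m. (f ^^ n) p0 = p0 + per m \<and> \<bar>m\<bar> \<le> \<bar>k\<bar> * (int l ^ n - 1)" for n
  proof (induction n)
    case 0
    then show ?case by (intro exI[of _ 0]) simp
  next
    case (Suc n)
    then obtain m where m: "(f ^^ n) p0 = p0 + per m" "\<bar>m\<bar> \<le> \<bar>k\<bar> * (int l ^ n - 1)" by blast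
    have "(f ^^ Suc n) p0 = f (p0 + per m)" by (simp only: funpow.simps comp_apply m(1))
    also have "\<dots> = f p0 + per (int l * m)" by (rule f_per)
    also have "\<dots> = p0 + per (k + int l * m)" by (simp add: k algebra_simps)
    finally have "(f ^^ Suc n) p0 = p0 + per (k + int l * m)" .
    moreover have "\<bar>k + int l * m\<bar> \<le> \<bar>k\<bar> * (int l ^ Suc n - 1)"
    proof -
      have "\<bar>k + int l * m\<bar> \<le> \<bar>k\<bar> + int l * \<bar>m\<bar>" using abs_triangle_ineq[of k "int l * m"] by (simp add: abs_mult)
      also have "\<dots> \<le> \<bar>k\<bar> + int l * (\<bar>k\<bar> * (int l ^ n - 1))" using m(2) by (intro add_left_mono mult_left_mono) auto
      also have "\<dots> = \<bar>k\<bar> * (int l ^ Suc n - (int l - 1))" by (simp add: algebra_simps)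
      also have "\<dots> \<le> \<bar>k\<bar> * (int l ^ Suc n - 1)" using l2 by (intro mult_left_mono) auto
      finally show ?thesis .
    qed
    ultimately show ?case by blast
  qed
  have "\<exists>m. (f ^^ n) p0 = p0 + per m \<and> \<bar>m\<bar> \<le> \<bar>k\<bar> * int l ^ n" for n
  proof -
    obtain m where m: "(f ^^ n) p0 = p0 + per m" "\<bar>m\<bar> \<le> \<bar>k\<bar> * (int l ^ n - 1)"
      using strong[of n] by blast
    have "\<bar>k\<bar> * (int l ^ n - 1) \<le> \<bar>k\<bar> * int l ^ n" by (intro mult_left_mono) auto
    then show ?thesis using m by (meson order_trans)
  qed
  then obtain m where m: "\<And>n. (f ^^ n) p0 = p0 + per (m n)" "\<And>n. \<bar>m n\<bar> \<le> \<bar>k\<bar> * int l ^ n" by metis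
  define B where "B = cmod p0 + 2 * pi * (real_of_int \<bar>k\<bar> + real_of_int \<bar>j\<bar>)"
  have "cmod ((f ^^ n) (p0 + per j)) \<le> B * real l ^ n" for n
  proof -
    have "(f ^^ n) (p0 + per j) = p0 + per (m n + int l ^ n * j)" unfolding f_pow_per m(1) by (simp add: algebra_simps)
    then have "cmod ((f ^^ n) (p0 + per j)) \<le> cmod p0 + cmod (per (m n + int l ^ n * j))"
      using norm_triangle_ineq by metis
    also have "\<dots> = cmod p0 + 2 * pi * real_of_int \<bar>m n + int l ^ n * j\<bar>" by (simp only: cmod_per of_int_abs)
    also have "\<bar>m n + int l ^ n * j\<bar> \<le> \<bar>k\<bar> * int l ^ n + int l ^ n * \<bar>j\<bar>"
      using m(2)[of n] abs_triangle_ineq[of "m n" "int l ^ n * j"] by (simp add: abs_mult)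
    also have "\<dots> = (\<bar>k\<bar> + \<bar>j\<bar>) * int l ^ n" by (simp add: algebra_simps)
    finally have "cmod ((f ^^ n) (p0 + per j)) \<le> cmod p0 * 1 + 2 * pi * ((real_of_int \<bar>k\<bar> + real_of_int \<bar>j\<bar>) * real l ^ n)"
      by simp
    also have "\<dots> \<le> cmod p0 * real l ^ n + 2 * pi * ((real_of_int \<bar>k\<bar> + real_of_int \<bar>j\<bar>) * real l ^ n)"
      using l2 by (intro add_right_mono mult_left_mono) auto
    finally show ?thesis by (simp add: B_def algebra_simps)
  qed
  moreover have "B \<ge> 0" by (simp add: B_def)
  ultimately show ?thesis by blast
qed

end

context fatou_expanding
begin

section \<open>Uniform mixing on the invariant set\<close>

text \<open>If a disc about \<open>z\<close> missed all such \<open>x\<close>, then the exponential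
  of \<open>(f ^^ n) x - w\<close> would omit 0 and 1 there, and Schottky's theorem with Cauchy's
  estimate would bound its derivative at \<open>z\<close>. But its value at \<open>z\<close> is
  bounded below, as \<open>K\<close> is bounded on the left, and the derivative of
  \<open>f ^^ n\<close> grows exponentially.\<close>

lemma mixing_bounded:
  assumes "\<rho> > 0"
  shows "\<exists>N. \<forall>n\<ge>N. \<forall>z\<in>K. \<forall>w. Re ((f ^^ n) z) \<le> B \<longrightarrow> \<bar>Re w\<bar> \<le> B \<longrightarrow> (\<exists>x k. cmod (x - z) < \<rho> \<and> (f ^^ n) x = w + per k)"
proof -
  \<comment> \<open>Schottky's bound on the disc of radius 1/2 for functions of modulus at most
    \<open>exp (2 * B)\<close> at the centre.\<close>
  define S where "S = exp (pi * exp (pi * (2 + 2 * exp (2 * B) + 12 * (1/2) / (1 - 1/2))))"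
  define r where "r = \<rho> / 2"
  have r: "r > 0" "r < \<rho>" using assms by (auto simp: r_def)
  define Q where "Q = 4 * S * T * exp (M + 1 + B) / (r * \<epsilon>)"
  obtain N where N: "Q < \<mu> ^ N" using real_arch_pow[OF \<mu>] by blast
  have "\<exists>x k. cmod (x - z) < \<rho> \<and> (f ^^ n) x = w + per k"
    if n: "n \<ge> N" and z: "z \<in> K" and B: "Re ((f ^^ n) z) \<le> B" "\<bar>Re w\<bar> \<le> B" for n z w
  proof (rule ccontr)
    assume no: "\<not> ?thesis"
    define g where "g \<zeta> = exp ((f ^^ n) (z + of_real r * \<zeta>) - w)" for \<zeta>
    have hol: "g holomorphic_on X" for X
    proof -
      have "(\<lambda>\<zeta>. (f ^^ n) (z + of_real r * \<zeta>)) holomorphic_on X"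
        by (rule holomorphic_on_compose_gen[OF _ f_pow_holo[of n UNIV], unfolded o_def]) (auto intro!: holomorphic_intros)
      then show ?thesis unfolding g_def by (intro holomorphic_intros)
    qed
    have not01: "\<not> (g \<zeta> = 0 \<or> g \<zeta> = 1)" if "\<zeta> \<in> cball 0 1" for \<zeta>
    proof
      assume "g \<zeta> = 0 \<or> g \<zeta> = 1"
      then have "exp ((f ^^ n) (z + of_real r * \<zeta>)) = exp w" by (simp add: g_def exp_diff)
      then obtain k where "(f ^^ n) (z + of_real r * \<zeta>) = w + per k" using exp_eq_per by blast
      moreover have "cmod (z + of_real r * \<zeta> - z) < \<rho>"
      proof -
        have "r * cmod \<zeta> \<le> r * 1" using that r by (intro mult_left_mono) auto
        then have "r * cmod \<zeta> < \<rho>" using r by linarith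
        then show ?thesis using r by (simp add: norm_mult)
      qed
      ultimately show False using no by blast
    qed
    have g0: "cmod (g 0) = exp (Re ((f ^^ n) z) - Re w)" by (simp add: g_def)
    have "cmod (g 0) \<le> exp (2 * B)" unfolding g0 using B by simp
    then have gS: "cmod (g \<zeta>) \<le> S" if "\<zeta> \<in> ball 0 (1/2)" for \<zeta>
      using Schottky[OF hol _ not01, of "exp (2 * B)" "1/2" \<zeta>] that unfolding S_def by simp
    have "cmod (deriv g 0) \<le> 2 * S / (1/2)" by (rule cmod_deriv_le_ball[OF hol _ gS]) auto
    moreover have "(g has_field_derivative g 0 * (deriv (f ^^ n) z * of_real r)) (at 0)"
    proof -
      have "((\<lambda>\<zeta>. (f ^^ n) (z + of_real r * \<zeta>)) has_field_derivative deriv (f ^^ n) (z + of_real r * 0) * of_real r) (at 0)"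
        by (rule DERIV_chain2[OF f_pow_deriv]) (auto intro!: derivative_eq_intros)
      then show ?thesis unfolding g_def by (auto intro!: derivative_eq_intros)
    qed
    ultimately have "cmod (g 0) * (cmod (deriv (f ^^ n) z) * r) \<le> 4 * S"
      using r by (simp add: DERIV_imp_deriv norm_mult)
    moreover have "exp (- (M + 1 + B)) * (\<epsilon> / T * \<mu> ^ n * r) \<le> cmod (g 0) * (cmod (deriv (f ^^ n) z) * r)"
    proof (intro mult_mono)
      have "Re ((f ^^ n) z) > - M - 1" using K_Re f_pow_K_iff z by blast
      then show "exp (- (M + 1 + B)) \<le> cmod (g 0)" unfolding g0 using B by simp
      show "\<epsilon> / T * \<mu> ^ n \<le> cmod (deriv (f ^^ n) z)" by (rule expansion[OF z])
    qed (use r \<epsilon>(1) T_pos \<mu> in auto)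
    ultimately have "exp (- (M + 1 + B)) * (\<epsilon> / T * \<mu> ^ n * r) \<le> 4 * S" by linarith
    then have "exp (M + 1 + B) * (exp (- (M + 1 + B)) * (\<epsilon> / T * \<mu> ^ n * r)) \<le> exp (M + 1 + B) * (4 * S)"
      by (intro mult_left_mono) auto
    then have "\<epsilon> / T * \<mu> ^ n * r \<le> exp (M + 1 + B) * (4 * S)"
      by (simp only: mult.assoc[symmetric] exp_minus_inverse exp_add[symmetric]) (simp add: mult_ac)
    then have "\<mu> ^ n \<le> Q" using r \<epsilon>(1) T_pos by (simp add: Q_def field_simps)
    moreover have "\<mu> ^ N \<le> \<mu> ^ n" using n \<mu> by (intro power_increasing) auto
    ultimately show False using N by simp
  qed
  then show ?thesis by blast
qed

text \<open>After \<open>n\<close> steps the orbit of \<open>z\<close> is either far to the right,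
  where two further steps cover and the point found is pulled back by shadowing, or in the bounded
  part, where mixing applies. As \<open>p0\<close> is fixed on the cylinder, both cases can end at
  the same time \<open>n + 2\<close>.\<close>

lemma preimages_of_p0_dense:
  assumes "\<rho> > 0"
  shows "\<exists>N. \<forall>z\<in>K. \<exists>x. cmod (x - z) < \<rho> \<and> (F ^^ N) (to_cyl x) = to_cyl p0"
proof -
  define r1 where "r1 = min r0 (1 / 12)"
  have r1: "0 < r1" "r1 \<le> 1 / 12" "r1 \<le> r0" using r0_pos by (auto simp: r1_def)
  obtain T2 where T2: "\<And>y w. y \<in> K \<Longrightarrow> Re y \<ge> T2 \<Longrightarrow> \<bar>Re w\<bar> \<le> \<bar>Re p0\<bar> \<Longrightarrow> \<exists>x k. cmod (x - y) < r1 \<and> f (f x) = w + per k"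
    using two_step_cover[OF r1(1,2)] by metis
  obtain N1 where N1: "\<And>n z w. n \<ge> N1 \<Longrightarrow> z \<in> K \<Longrightarrow> Re ((f ^^ n) z) \<le> max T2 \<bar>Re p0\<bar> \<Longrightarrow> \<bar>Re w\<bar> \<le> max T2 \<bar>Re p0\<bar> \<Longrightarrow>
      \<exists>x k. cmod (x - z) < \<rho> \<and> (f ^^ n) x = w + per k"
    using mixing_bounded[OF assms, of "max T2 \<bar>Re p0\<bar>"] by blast
  obtain N2 where N2: "\<theta> ^ N2 < \<rho> / \<eta>" using real_arch_pow_inv[of "\<rho> / \<eta>" \<theta>] assms \<eta>(1) \<theta> by auto
  define n where "n = max N1 N2"
  have "\<theta> ^ n \<le> \<theta> ^ N2" using \<theta> by (intro power_decreasing) (auto simp: n_def)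
  then have "\<theta> ^ n < \<rho> / \<eta>" using N2 by simp
  then have "\<eta> * \<theta> ^ n < \<rho>" using \<eta>(1) by (simp add: field_simps)
  moreover have "0 \<le> \<eta> * \<theta> ^ n" using \<eta>(1) \<theta>(1) by simp
  ultimately have \<theta>n: "\<eta> / 4 * \<theta> ^ n < \<rho>" by simp
  have "\<exists>x. cmod (x - z) < \<rho> \<and> (F ^^ (n + 2)) (to_cyl x) = to_cyl p0" if z: "z \<in> K" for z
  proof (cases "Re ((f ^^ n) z) \<ge> T2")
    case True
    have "(f ^^ n) z \<in> K" using z f_pow_K_iff by blast
    then obtain u k where u: "cmod (u - (f ^^ n) z) < r1" "f (f u) = p0 + per k" using T2 True by blast
    have "cmod (u - (f ^^ n) z) \<le> r0" using u(1) r1(3) by simp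
    then obtain x where x: "(f ^^ n) x = u" "shadows n z x" using shadow_ex[OF z] by blast
    have "cmod ((f ^^ 0) x - (f ^^ 0) z) \<le> \<eta> / 4 * \<theta> ^ (n - 0)" using x(2) unfolding shadows_def by blast
    then have "cmod (x - z) < \<rho>" using \<theta>n by simp
    moreover have "(f ^^ (n + 2)) x = p0 + per k" using x(1) u(2) by (simp add: funpow_add numeral_2_eq_2 add.commute[of n])
    ultimately show ?thesis unfolding F_pow_to_cyl by (metis to_cyl_per)
  next
    case False
    have "N1 \<le> n" by (simp add: n_def)
    moreover have "Re ((f ^^ n) z) \<le> max T2 \<bar>Re p0\<bar>" "\<bar>Re p0\<bar> \<le> max T2 \<bar>Re p0\<bar>"
      using False by (simp_all add: le_max_iff_disj)
    ultimately obtain x k where x: "cmod (x - z) < \<rho>" "(f ^^ n) x = p0 + per k"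
      using N1[OF _ z, of n p0] by blast
    have "(F ^^ (n + 2)) (to_cyl x) = (F ^^ 2) ((F ^^ n) (to_cyl x))" by (metis add.commute comp_apply funpow_add)
    also have "(F ^^ n) (to_cyl x) = to_cyl p0" using x(2) by (simp add: F_pow_to_cyl)
    finally show ?thesis using x(1) F_p0[of 2] by auto
  qed
  then show ?thesis by blast
qed

text \<open>Mixing at \<open>p0\<close>, whose orbit keeps its real part. The time is uniform only
  over points of bounded real part, which later restricts the preimages that can be used.\<close>

lemma reach_from_p0:
  assumes "\<rho> > 0"
  shows "\<exists>N. \<forall>y\<in>K. Re y \<le> B \<longrightarrow> (\<exists>x. cmod (x - p0) < \<rho> \<and> (F ^^ N) (to_cyl x) = to_cyl y)"
proof -
  define B' where "B' = max (max B (M + 1)) \<bar>Re p0\<bar>"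
  obtain N where N: "\<And>n z w. n \<ge> N \<Longrightarrow> z \<in> K \<Longrightarrow> Re ((f ^^ n) z) \<le> B' \<Longrightarrow> \<bar>Re w\<bar> \<le> B' \<Longrightarrow>
      \<exists>x k. cmod (x - z) < \<rho> \<and> (f ^^ n) x = w + per k"
    using mixing_bounded[OF assms, of B'] by blast
  have "\<exists>x. cmod (x - p0) < \<rho> \<and> (F ^^ N) (to_cyl x) = to_cyl y" if y: "y \<in> K" "Re y \<le> B" for y
  proof -
    obtain m where "(f ^^ N) p0 = p0 + per m" using f_pow_p0 by blast
    then have "Re ((f ^^ N) p0) \<le> B'" by (auto simp: B'_def)
    moreover have "\<bar>Re y\<bar> \<le> B'" using K_Re[OF y(1)] y(2) by (auto simp: B'_def M_def)
    ultimately obtain x k where "cmod (x - p0) < \<rho>" "(f ^^ N) x = y + per k" using N[of N p0 y] p0(2) by auto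
    then show ?thesis unfolding F_pow_to_cyl by (metis to_cyl_per)
  qed
  then show ?thesis by blast
qed

end

section \<open>The Julia set\<close>

lemma sequence_bounded_or_tends_to_top:
  fixes a :: "nat \<Rightarrow> nat"
  shows "(\<exists>m. infinite {i. a i = m}) \<or> filterlim a at_top sequentially"
proof (rule disjCI)
  assume "\<not> filterlim a at_top sequentially"
  then obtain B where "\<not> eventually (\<lambda>i. B \<le> a i) sequentially" unfolding filterlim_at_top by blast
  then have "infinite {i. a i < B}"
    by (metis (mono_tags, lifting) cofinite_eq_sequentially eventually_cofinite not_le Collect_cong)
  moreover have "{i. a i < B} = (\<Union>m\<in>{..<B}. {i. a i = m})" by auto
  ultimately show "\<exists>m. infinite {i. a i = m}" by auto
qed

context fatou_map
begin

text \<open>A sequence of iterates either repeats one iterate infinitely often, which gives a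
  constant subsequence, or its indices tend to infinity.\<close>

lemma normal_family_iterates:
  assumes "\<And>a :: nat \<Rightarrow> nat. filterlim a at_top sequentially \<Longrightarrow>
      (\<exists>h. \<forall>K. compact K \<and> K \<subseteq> D \<longrightarrow> uniform_limit K (\<lambda>n. f ^^ a n) h sequentially) \<or>
      (\<forall>K. compact K \<and> K \<subseteq> D \<longrightarrow> (\<forall>M. eventually (\<lambda>n. \<forall>z\<in>K. M < cmod ((f ^^ a n) z)) sequentially))"
  shows "normal_family_on D (range (\<lambda>n. f ^^ n))"
  unfolding normal_family_on_def
proof (intro allI impI)
  fix g :: "nat \<Rightarrow> complex \<Rightarrow> complex" assume "range g \<subseteq> range (\<lambda>n. f ^^ n)"
  then have "\<forall>i. \<exists>n. g i = f ^^ n" by blast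
  then obtain a where a: "\<And>i. g i = f ^^ a i" by metis
  from sequence_bounded_or_tends_to_top[of a] show "\<exists>r. strict_mono (r :: nat \<Rightarrow> nat) \<and>
           ((\<exists>h. \<forall>K. compact K \<and> K \<subseteq> D \<longrightarrow> uniform_limit K (\<lambda>n. g (r n)) h sequentially) \<or>
            (\<forall>K. compact K \<and> K \<subseteq> D \<longrightarrow> (\<forall>M. eventually (\<lambda>n. \<forall>z\<in>K. M < cmod (g (r n) z)) sequentially)))"
  proof
    assume "\<exists>m. infinite {i. a i = m}"
    then obtain m where m: "infinite {i. a i = m}" by blast
    define r where "r = enumerate {i. a i = m}"
    have "a (r n) = m" for n using enumerate_in_set[OF m, of n] by (simp add: r_def)
    then have "uniform_limit K (\<lambda>n. g (r n)) (f ^^ m) sequentially" for K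
      by (simp add: a uniform_limit_const)
    then show ?thesis using strict_mono_enumerate[OF m] unfolding r_def[symmetric] by blast
  next
    assume "filterlim a at_top sequentially"
    from assms[OF this] show ?thesis by (intro exI[of _ id]) (simp add: a strict_mono_def)
  qed
qed

text \<open>From time \<open>m\<close> on real parts decrease at unit speed, uniformly on the set;
  this is the alternative of convergence to infinity.\<close>

lemma fatou_left:
  assumes "\<And>u. u \<in> D \<Longrightarrow> Re ((f ^^ m) u) < - M"
  shows "normal_family_on D (range (\<lambda>n. f ^^ n))"
proof (rule normal_family_iterates, rule disjI2, intro allI impI)
  fix a :: "nat \<Rightarrow> nat" and X and B :: real assume a: "filterlim a at_top sequentially" and X: "compact X \<and> X \<subseteq> D"
  have "eventually (\<lambda>n. m + nat \<lceil>\<bar>B\<bar>\<rceil> \<le> a n) sequentially" using a unfolding filterlim_at_top by blast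
  then show "eventually (\<lambda>n. \<forall>z\<in>X. B < cmod ((f ^^ a n) z)) sequentially"
  proof eventually_elim
    case (elim n)
    show ?case
    proof
      fix z assume "z \<in> X"
      then have "Re ((f ^^ m) z) < - M" using X assms by blast
      then have "Re ((f ^^ (a n - m)) ((f ^^ m) z)) \<le> Re ((f ^^ m) z) - real (a n - m)"
        by (intro left_half_plane_iter) simp
      moreover have eq: "(f ^^ (a n - m)) ((f ^^ m) z) = (f ^^ a n) z"
        using elim by (metis add_leD1 funpow_add comp_apply le_add_diff_inverse2)
      ultimately have "Re ((f ^^ a n) z) \<le> Re ((f ^^ m) z) - real (a n - m)" by simp
      moreover have "\<bar>B\<bar> \<le> real (a n - m)" using elim by linarith
      moreover have "M \<ge> 3" by (simp add: M_def)
      ultimately show "B < cmod ((f ^^ a n) z)"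
        using abs_Re_le_cmod[of "(f ^^ a n) z"] \<open>Re ((f ^^ m) z) < - M\<close> by linarith
    qed
  qed
qed

text \<open>On the cylinder these orbits converge, but in the plane they are displaced by
  \<open>per (int l ^ (n - m) * k)\<close>. So the iterates converge to \<open>p\<close> if
  \<open>k = 0\<close> and tend to infinity otherwise; both alternatives of normality occur.\<close>

lemma fatou_attracted:
  assumes D: "\<And>u. u \<in> D \<Longrightarrow> (f ^^ m) u - per k \<in> ball p s"
  shows "normal_family_on D (range (\<lambda>n. f ^^ n))"
proof (rule normal_family_iterates)
  fix a :: "nat \<Rightarrow> nat" assume a: "filterlim a at_top sequentially"
  have it: "(f ^^ n) u = (f ^^ (n - m)) ((f ^^ m) u - per k) + per (int l ^ (n - m) * k)" if "n \<ge> m" for n u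
  proof -
    have "(f ^^ n) u = (f ^^ (n - m)) ((f ^^ m) u)" using that by (metis funpow_add comp_apply le_add_diff_inverse2)
    also have "(f ^^ m) u = ((f ^^ m) u - per k) + per k" by simp
    finally show ?thesis by (simp only: f_pow_per)
  qed
  show "(\<exists>h. \<forall>K. compact K \<and> K \<subseteq> D \<longrightarrow> uniform_limit K (\<lambda>n. f ^^ a n) h sequentially) \<or>
      (\<forall>K. compact K \<and> K \<subseteq> D \<longrightarrow> (\<forall>M. eventually (\<lambda>n. \<forall>z\<in>K. M < cmod ((f ^^ a n) z)) sequentially))"
  proof (cases "k = 0")
    case True
    have "uniform_limit X (\<lambda>n. f ^^ a n) (\<lambda>_. p) sequentially" if X: "X \<subseteq> D" for X
      unfolding uniform_limit_iff
    proof (intro allI impI)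
      fix e :: real assume "e > 0"
      then obtain j where j: "\<kappa> ^ j < e / s" using real_arch_pow_inv[of "e / s" \<kappa>] attracting by auto
      have "eventually (\<lambda>n. m + j \<le> a n) sequentially" using a unfolding filterlim_at_top by blast
      then show "eventually (\<lambda>n. \<forall>u\<in>X. dist ((f ^^ a n) u) p < e) sequentially"
      proof eventually_elim
        case (elim n)
        show ?case
        proof
          fix u assume "u \<in> X"
          then have "(f ^^ m) u - per k \<in> ball p s" using X D by blast
          then have "cmod ((f ^^ (a n - m)) ((f ^^ m) u - per k) - p) \<le> \<kappa> ^ (a n - m) * s" using attracting_iter by blast
          moreover have "\<kappa> ^ (a n - m) * s \<le> \<kappa> ^ j * s"
            using elim attracting by (intro mult_right_mono power_decreasing) auto
          moreover have "\<kappa> ^ j * s < e" using j attracting(1) by (simp add: field_simps)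
          ultimately show "dist ((f ^^ a n) u) p < e" using it[of "a n" u] elim True by (simp add: dist_norm)
        qed
      qed
    qed
    then show ?thesis by blast
  next
    case False
    have "eventually (\<lambda>n. \<forall>u\<in>X. B < cmod ((f ^^ a n) u)) sequentially" if X: "X \<subseteq> D" for X B
    proof -
      have "eventually (\<lambda>n. m + nat \<lceil>\<bar>B\<bar> + cmod p + s\<rceil> \<le> a n) sequentially" using a unfolding filterlim_at_top by blast
      then show ?thesis
      proof eventually_elim
        case (elim n)
        show ?case
        proof
          fix u assume "u \<in> X"
          let ?v = "(f ^^ (a n - m)) ((f ^^ m) u - per k)"
          have "(f ^^ m) u - per k \<in> ball p s" using \<open>u \<in> X\<close> X D by blast
          then have "?v \<in> ball p s" using attracting_iter by blast
          then have v: "cmod ?v \<le> cmod p + s" using norm_triangle_ineq2[of ?v p] by (simp add: dist_norm norm_minus_commute)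
          have "real (a n - m) < real (2 ^ (a n - m))" using of_nat_less_two_power[of "a n - m"] by simp
          also have "\<dots> \<le> real l ^ (a n - m)" using l2 by (simp add: power_mono)
          also have "\<dots> = 1 * (real l ^ (a n - m) * 1)" by simp
          also have "\<dots> \<le> 2 * pi * (real l ^ (a n - m) * \<bar>real_of_int k\<bar>)"
            using False pi_ge_two by (intro mult_mono mult_nonneg_nonneg) auto
          also have "\<dots> = cmod (per (int l ^ (a n - m) * k))" unfolding cmod_per by (simp add: abs_mult)
          finally have "real (a n - m) < cmod (per (int l ^ (a n - m) * k))" .
          moreover have "\<bar>B\<bar> + cmod p + s \<le> real (a n - m)" using elim by linarith
          moreover have "cmod (per (int l ^ (a n - m) * k)) - cmod ?v \<le> cmod ((f ^^ a n) u)"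
            using it[of "a n" u] elim norm_triangle_ineq2[of "per (int l ^ (a n - m) * k)" "- ?v"]
            by (simp add: add.commute)
          ultimately show "B < cmod ((f ^^ a n) u)" using v by linarith
        qed
      qed
    qed
    then show ?thesis by blast
  qed
qed

lemma isCont_f_pow: "isCont (f ^^ n) z"
  using f_pow_deriv DERIV_isCont by blast

lemma julia_subset_K: "julia_set f \<subseteq> K"
proof
  fix z assume z: "z \<in> julia_set f"
  show "z \<in> K"
  proof (rule ccontr)
    assume "z \<notin> K"
    then obtain n where "(F ^^ n) (to_cyl z) \<in> A" by (auto simp: Kset_def)
    then obtain j where "(F ^^ j) ((F ^^ n) (to_cyl z)) \<in> absorbing" using A_absorbed by blast
    then have "(F ^^ (j + n)) (to_cyl z) \<in> absorbing" by (simp add: funpow_add)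
    then obtain m where "to_cyl ((f ^^ m) z) \<in> absorbing" unfolding F_pow_to_cyl by blast
    then consider "Re ((f ^^ m) z) < - M" | "dist (to_cyl p) (to_cyl ((f ^^ m) z)) < s"
      by (auto simp: absorbing_def)
    then have "\<exists>e>0. normal_family_on (ball z e) (range (\<lambda>n. f ^^ n))"
    proof cases
      case 1
      then obtain e where "e > 0" "\<And>u. cmod (u - z) < e \<Longrightarrow> cmod ((f ^^ m) u - (f ^^ m) z) < - M - Re ((f ^^ m) z)"
        using isCont_f_pow[of z m] unfolding continuous_at_eps_delta dist_norm by (metis diff_gt_0_iff_gt)
      moreover from this have "Re ((f ^^ m) u) < - M" if "u \<in> ball z e" for u
        using that abs_Re_le_cmod[of "(f ^^ m) u - (f ^^ m) z"] by (force simp: dist_norm norm_minus_commute)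
      ultimately show ?thesis using fatou_left by blast
    next
      case 2
      then obtain v where v: "to_cyl ((f ^^ m) z) = to_cyl v" "cmod (p - v) < s" by (rule to_cyl_lift_near)
      then obtain k where k: "(f ^^ m) z = v + per k" using to_cyl_eqE by blast
      obtain e where e: "e > 0" "\<And>u. cmod (u - z) < e \<Longrightarrow> cmod ((f ^^ m) u - (f ^^ m) z) < s - cmod (p - v)"
        using isCont_f_pow[of z m] v(2) unfolding continuous_at_eps_delta dist_norm by (metis diff_gt_0_iff_gt)
      have "(f ^^ m) u - per k \<in> ball p s" if "u \<in> ball z e" for u
      proof -
        have "cmod ((f ^^ m) u - (f ^^ m) z) < s - cmod (p - v)" using that by (intro e(2)) (simp add: dist_norm norm_minus_commute)
        moreover have eq: "p - ((f ^^ m) u - per k) = (p - v) - ((f ^^ m) u - (f ^^ m) z)" by (simp add: k)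
        moreover have "cmod ((p - v) - ((f ^^ m) u - (f ^^ m) z)) \<le> cmod (p - v) + cmod ((f ^^ m) u - (f ^^ m) z)"
          by (rule norm_triangle_ineq4)
        ultimately show ?thesis unfolding mem_ball dist_norm eq by linarith
      qed
      then show ?thesis using fatou_attracted e(1) by blast
    qed
    then show False using z by (auto simp: julia_set_def fatou_set_def)
  qed
qed

end

context fatou_expanding
begin

lemma deriv_f_pow_add: "deriv (f ^^ (m + n)) x = deriv (f ^^ m) ((f ^^ n) x) * deriv (f ^^ n) x"
proof -
  have "((\<lambda>x. (f ^^ m) ((f ^^ n) x)) has_field_derivative deriv (f ^^ m) ((f ^^ n) x) * deriv (f ^^ n) x) (at x)"
    by (rule DERIV_chain2[OF f_pow_deriv f_pow_deriv])
  then show ?thesis by (intro DERIV_imp_deriv) (simp add: funpow_add comp_def)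
qed

lemma deriv_f_pow_p0: "cmod (deriv (f ^^ n) (p0 + per j)) = cmod (of_nat l - exp p0) ^ n"
proof -
  have "exp ((f ^^ i) (p0 + per j)) = exp p0" for i
  proof -
    obtain m where m: "(f ^^ i) p0 = p0 + per m" using f_pow_p0 by blast
    show ?thesis unfolding f_pow_per m by (simp only: exp_per)
  qed
  then show ?thesis unfolding cmod_deriv_f_pow by simp
qed

lemma deriv_unbounded: "x \<in> K \<Longrightarrow> \<exists>N. \<forall>n\<ge>N. B < cmod (deriv (f ^^ n) x)"
proof -
  assume x: "x \<in> K"
  obtain N where N: "B * T / \<epsilon> < \<mu> ^ N" using real_arch_pow[OF \<mu>] by blast
  have "B < cmod (deriv (f ^^ n) x)" if "n \<ge> N" for n
  proof -
    have "\<mu> ^ N \<le> \<mu> ^ n" using that \<mu> by (intro power_increasing) auto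
    then have "B * T / \<epsilon> < \<mu> ^ n" using N by simp
    then have "B < \<epsilon> / T * \<mu> ^ n" using \<epsilon>(1) T_pos by (simp add: field_simps)
    then show ?thesis using expansion[OF x, of n] by simp
  qed
  then show ?thesis by blast
qed

text \<open>
  Preimages of the fixed point \<open>p0\<close> of the map on the cylinder are dense in \<open>K\<close>. Along the orbit of such a preimage
  the iterates grow like \<open>l\<^sup>n\<close>, but their derivatives grow faster than \<open>l\<^sup>2\<^sup>n\<close>; so the
  reciprocals of the iterates do not stay bounded either.
\<close>

lemma K_subset_julia: "K \<subseteq> julia_set f"
proof
  fix z assume z: "z \<in> K"
  show "z \<in> julia_set f"
  proof (rule ccontr)
    assume "z \<notin> julia_set f"
    then obtain e where e: "e > 0" "normal_family_on (ball z e) (range (\<lambda>n. f ^^ n))"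
      by (auto simp: julia_set_def fatou_set_def)
    obtain r :: "nat \<Rightarrow> nat" where r: "strict_mono r"
      "(\<exists>h. \<forall>K. compact K \<and> K \<subseteq> ball z e \<longrightarrow> uniform_limit K (\<lambda>n. f ^^ (r n)) h sequentially) \<or>
        (\<forall>K. compact K \<and> K \<subseteq> ball z e \<longrightarrow> (\<forall>M. eventually (\<lambda>n. \<forall>z\<in>K. M < cmod ((f ^^ (r n)) z)) sequentially))"
      using e(2)[unfolded normal_family_on_def, rule_format, of "\<lambda>n. f ^^ n"] by auto
    have rn: "n \<le> r n" for n by (rule seq_suble[OF r(1)])
    obtain N where N: "\<And>z. z \<in> K \<Longrightarrow> \<exists>x. cmod (x - z) < e / 2 \<and> (F ^^ N) (to_cyl x) = to_cyl p0"
      using preimages_of_p0_dense[of "e/2"] e(1) by auto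
    obtain x where x: "cmod (x - z) < e / 2" "(F ^^ N) (to_cyl x) = to_cyl p0" using N z by blast
    have xK: "x \<in> K" using F_pow_Kset_iff[of N "to_cyl x"] x(2) p0(2) by simp
    obtain j where j: "(f ^^ N) x = p0 + per j" using x(2) to_cyl_eqE unfolding F_pow_to_cyl by blast
    define R where "R = e / 4"
    have Rp: "R > 0" using e by (simp add: R_def)
    have sub: "cball x R \<subseteq> ball z e"
    proof
      fix u assume "u \<in> cball x R"
      then show "u \<in> ball z e" using x(1) e(1) dist_triangle[of z u x] by (simp add: R_def dist_norm norm_minus_commute)
    qed
    from r(2) show False
    proof
      assume "\<exists>h. \<forall>K. compact K \<and> K \<subseteq> ball z e \<longrightarrow> uniform_limit K (\<lambda>n. f ^^ (r n)) h sequentially"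
      then obtain h where h: "uniform_limit (cball x R) (\<lambda>n. f ^^ (r n)) h sequentially" using sub by (meson compact_cball)
      have "continuous_on (cball x R) h"
        by (rule uniform_limit_theorem[OF _ h])
           (auto intro!: always_eventually continuous_at_imp_continuous_on isCont_f_pow)
      then have "bounded (h ` cball x R)" using compact_continuous_image compact_imp_bounded compact_cball by blast
      then obtain B where B: "\<And>u. u \<in> cball x R \<Longrightarrow> cmod (h u) \<le> B" unfolding bounded_iff by blast
      have "eventually (\<lambda>n. \<forall>u\<in>cball x R. dist ((f ^^ (r n)) u) (h u) < 1) sequentially"
        using h unfolding uniform_limit_iff by (meson zero_less_one)
      then obtain N1 where N1: "\<And>n u. n \<ge> N1 \<Longrightarrow> u \<in> cball x R \<Longrightarrow> dist ((f ^^ (r n)) u) (h u) < 1"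
        unfolding eventually_sequentially by blast
      obtain N2 where N2: "\<And>n. n \<ge> N2 \<Longrightarrow> 2 * (B + 1) / R < cmod (deriv (f ^^ n) x)" using deriv_unbounded[OF xK] by blast
      define n where "n = max N1 N2"
      have "cmod ((f ^^ r n) u) \<le> B + 1" if "u \<in> ball x R" for u
        using N1[of n u] B[of u] that norm_triangle_ineq2[of "(f ^^ r n) u" "h u"] by (force simp: n_def dist_norm)
      then have "cmod (deriv (f ^^ r n) x) \<le> 2 * (B + 1) / R" by (intro cmod_deriv_le_ball f_pow_holo Rp)
      moreover have "r n \<ge> N2" using rn[of n] by (simp add: n_def)
      ultimately show False using N2[of "r n"] by simp
    next
      assume "\<forall>K. compact K \<and> K \<subseteq> ball z e \<longrightarrow> (\<forall>M. eventually (\<lambda>n. \<forall>z\<in>K. M < cmod ((f ^^ (r n)) z)) sequentially)"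
      then have "eventually (\<lambda>n. \<forall>u\<in>cball x R. 1 < cmod ((f ^^ (r n)) u)) sequentially" using sub by (meson compact_cball)
      then obtain N1 where N1: "\<And>n u. n \<ge> N1 \<Longrightarrow> u \<in> cball x R \<Longrightarrow> 1 < cmod ((f ^^ (r n)) u)"
        unfolding eventually_sequentially by blast
      obtain B where B: "B \<ge> 0" "\<And>n. cmod ((f ^^ n) (p0 + per j)) \<le> B * real l ^ n" using f_pow_p0_growth[of j] by blast
      define b where "b = cmod (deriv (f ^^ N) x)"
      have b: "b > 0"
      proof -
        have "0 < \<epsilon> / T * \<mu> ^ N" using \<epsilon>(1) T_pos \<mu> by simp
        then show ?thesis using expansion[OF xK, of N] unfolding b_def by linarith
      qed
      have bound: "2 ^ i * b \<le> 2 / R * B\<^sup>2" if i: "N1 \<le> n" "r n = i + N" for n i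
      proof -
        \<comment> \<open>On the disc \<open>1 / ?g u\<close> is bounded by 1, so Cauchy's estimate
          bounds the derivative of \<open>?g\<close> at \<open>x\<close> by a multiple of the square
          of its value.\<close>
        let ?g = "f ^^ r n"
        have nz: "?g u \<noteq> 0" "1 < cmod (?g u)" if "u \<in> ball x R" for u
          using N1[OF i(1), of u] that by auto
        have "cmod (deriv (\<lambda>u. 1 / ?g u) x) \<le> 2 * 1 / R"
        proof (rule cmod_deriv_le_ball[OF _ Rp])
          show "(\<lambda>u. 1 / ?g u) holomorphic_on ball x R" using nz by (intro holomorphic_intros f_pow_holo) auto
          fix u assume "u \<in> ball x R"
          then show "cmod (1 / ?g u) \<le> 1" using nz(2) by (simp add: norm_divide divide_le_eq_1 less_imp_le)
        qed
        moreover have "((\<lambda>u. 1 / ?g u) has_field_derivative - deriv ?g x / (?g x)\<^sup>2) (at x)"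
          using nz(1)[of x] Rp by (auto intro!: derivative_eq_intros f_pow_deriv simp: power2_eq_square)
        ultimately have "cmod (deriv ?g x) / (cmod (?g x))\<^sup>2 \<le> 2 / R"
          by (simp add: DERIV_imp_deriv norm_divide norm_power)
        then have le: "cmod (deriv ?g x) \<le> 2 / R * (cmod (?g x))\<^sup>2"
          using nz(1)[of x] Rp by (simp add: pos_divide_le_eq)
        have "cmod (?g x) \<le> B * real l ^ i" using B(2)[of i] by (simp add: i(2) funpow_add j)
        then have "(cmod (?g x))\<^sup>2 \<le> (B * real l ^ i)\<^sup>2" by (intro power_mono) auto
        then have "cmod (deriv ?g x) \<le> 2 / R * (B * real l ^ i)\<^sup>2" using le Rp
          by (meson mult_left_mono order_trans divide_nonneg_pos zero_le_numeral)
        moreover have "cmod (deriv ?g x) = cmod (of_nat l - exp p0) ^ i * b"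
          by (simp add: i(2) deriv_f_pow_add norm_mult j deriv_f_pow_p0 b_def)
        moreover have "(2 * (real l)\<^sup>2) ^ i * b \<le> cmod (of_nat l - exp p0) ^ i * b"
          using p0(3) b by (intro mult_right_mono power_mono) auto
        ultimately have "(2 * (real l)\<^sup>2) ^ i * b \<le> 2 / R * (B * real l ^ i)\<^sup>2" by linarith
        then have "(real l ^ i)\<^sup>2 * (2 ^ i * b) \<le> (real l ^ i)\<^sup>2 * (2 / R * B\<^sup>2)"
          by (simp add: power_mult_distrib power_mult[symmetric] mult_ac)
        moreover have "(real l ^ i)\<^sup>2 > 0" using l2 by simp
        ultimately show ?thesis by (rule mult_left_le_imp_le)
      qed
      obtain i where i: "2 / R * B\<^sup>2 / b < 2 ^ i" using real_arch_pow[of 2] by auto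
      define n where "n = max N1 (i + N)"
      have "r n \<ge> i + N" using rn[of n] by (simp add: n_def)
      then obtain i' where i': "r n = i' + N" "i' \<ge> i" by (metis add_diff_inverse_nat add.commute add_le_cancel_right not_less le_Suc_ex add.assoc add.left_commute)
      have "2 ^ i' * b \<le> 2 / R * B\<^sup>2" using bound[of n i'] i'(1) by (simp add: n_def)
      moreover have "(2::real) ^ i \<le> 2 ^ i'" using i'(2) by (intro power_increasing) auto
      then have "2 / R * B\<^sup>2 / b < 2 ^ i'" using i by linarith
      then have "2 / R * B\<^sup>2 < 2 ^ i' * b" using b by (simp only: pos_divide_less_eq)
      ultimately show False by linarith
    qed
  qed
qed

lemma julia_eq_K: "julia_set f = K"
  using julia_subset_K K_subset_julia by blast

lemma julia_F_eq: "julia_F l c = Kset"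
proof -
  have "to_cyl ` K = Kset" using to_cyl_surj by (auto simp: image_iff) metis
  then show ?thesis by (simp add: julia_F_def julia_eq_K)
qed

end

section \<open>Partition sums\<close>

lemma floor_cell:
  fixes a b h :: real
  assumes "h > 0" "\<lfloor>a / h\<rfloor> = \<lfloor>b / h\<rfloor>"
  shows "\<bar>a - b\<bar> \<le> h"
proof -
  have "\<bar>a / h - b / h\<bar> \<le> 1" using assms(2) by linarith
  then have "\<bar>(a - b) / h\<bar> \<le> 1" by (simp add: diff_divide_distrib)
  then show ?thesis using assms(1) by (simp add: abs_divide divide_le_eq)
qed

context fatou_expanding
begin

abbreviation dn :: "nat \<Rightarrow> cylinder \<Rightarrow> real" where "dn n x \<equiv> F_deriv_norm l c n x"
abbreviation wt :: "real \<Rightarrow> nat \<Rightarrow> cylinder \<Rightarrow> ennreal" where "wt t n x \<equiv> ennreal (dn n x powr (- t))"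
abbreviation Z :: "real \<Rightarrow> nat \<Rightarrow> cylinder \<Rightarrow> ennreal" where "Z t n q \<equiv> partition_sum l c t n q"

lemma dn_to_cyl: "dn n (to_cyl z) = cmod (deriv (f ^^ n) z)"
  by (simp add: F_deriv_norm.abs_eq to_cyl.abs_eq)

lemma dn_nonneg: "dn n x \<ge> 0"
  using to_cyl_surj[of x] by (auto simp: dn_to_cyl)

lemma dn_add: "dn (m + n) x = dn m ((F ^^ n) x) * dn n x"
proof -
  obtain z where "to_cyl z = x" using to_cyl_surj by blast
  then show ?thesis by (auto simp: F_pow_to_cyl dn_to_cyl deriv_f_pow_add norm_mult)
qed

lemma dn_0 [simp]: "dn 0 x = 1"
  using to_cyl_surj[of x] by (auto simp: dn_to_cyl)

lemma dn_expand: "x \<in> Kset \<Longrightarrow> \<epsilon> / T * \<mu> ^ n \<le> dn n x"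
  using to_cyl_surj[of x] expansion by (auto simp: dn_to_cyl)

lemma dn_pos: "x \<in> Kset \<Longrightarrow> dn n x > 0"
proof -
  assume "x \<in> Kset"
  moreover have "0 < \<epsilon> / T * \<mu> ^ n" using \<epsilon>(1) T_pos \<mu> by simp
  ultimately show ?thesis using dn_expand[of x n] by linarith
qed

lemma Kset_preimage: "q \<in> Kset \<Longrightarrow> x \<in> (F ^^ n) -` {q} \<Longrightarrow> x \<in> Kset"
  using F_pow_Kset_iff[of n x] by simp

lemma Z_eq:
  assumes "q \<in> Kset"
  shows "Z t n q = (\<Sum>\<^sub>\<infinity>x\<in>(F ^^ n) -` {q}. wt t n x)"
  unfolding partition_sum_def
proof (rule infsum_cong)
  fix x assume "x \<in> (F ^^ n) -` {q}"
  then have "dn n x > 0" using Kset_preimage assms dn_pos by blast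
  then show "inverse (ennreal (dn n x powr t)) = wt t n x"
    by (simp add: powr_minus inverse_ennreal)
qed

lemma Z_0: "q \<in> Kset \<Longrightarrow> Z t 0 q = 1"
proof -
  assume "q \<in> Kset"
  moreover have "(F ^^ 0) -` {q} = {q}" by auto
  ultimately show ?thesis by (simp add: Z_eq)
qed

text \<open>The chain rule over the tree of preimages: a preimage of order \<open>m + n\<close> is
  grouped with its image under \<open>F ^^ m\<close>.\<close>

lemma Z_add:
  assumes q: "q \<in> Kset"
  shows "Z t (m + n) q = (\<Sum>\<^sub>\<infinity>x\<in>(F ^^ n) -` {q}. wt t n x * Z t m x)"
proof -
  define S where "S = (SIGMA x:(F ^^ n) -` {q}. (F ^^ m) -` {x})"
  have "(\<Sum>\<^sub>\<infinity>x\<in>(F ^^ n) -` {q}. wt t n x * Z t m x) = (\<Sum>\<^sub>\<infinity>x\<in>(F ^^ n) -` {q}. \<Sum>\<^sub>\<infinity>y\<in>(F ^^ m) -` {x}. wt t n x * wt t m y)"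
    by (rule infsum_cong) (simp add: infsum_ennreal_cmult Z_eq[OF Kset_preimage[OF q]])
  also have "\<dots> = infsum (\<lambda>(x, y). wt t n x * wt t m y) S"
    unfolding S_def infsum_ennreal_Sigma by simp
  also have "S = (\<lambda>y. ((F ^^ m) y, y)) ` ((F ^^ (m + n)) -` {q})"
    by (auto simp: S_def funpow_add add.commute[of m n])
  also have "infsum (\<lambda>(x, y). wt t n x * wt t m y) \<dots> = (\<Sum>\<^sub>\<infinity>y\<in>(F ^^ (m + n)) -` {q}. wt t n ((F ^^ m) y) * wt t m y)"
    by (subst infsum_reindex) (auto simp: inj_on_def comp_def)
  also have "\<dots> = (\<Sum>\<^sub>\<infinity>y\<in>(F ^^ (m + n)) -` {q}. wt t (m + n) y)"
    by (rule infsum_cong)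
       (auto simp: add.commute[of m n] dn_add powr_mult ennreal_mult[symmetric] dn_nonneg)
  finally show ?thesis by (simp add: Z_eq[OF q])
qed

lemma lift_strip: "\<exists>z. to_cyl z = q \<and> \<bar>Im z\<bar> \<le> pi"
proof -
  obtain w where w: "to_cyl w = q" using to_cyl_surj by blast
  obtain k :: int where "\<bar>Im w + 2 * pi * real_of_int k - 0\<bar> \<le> pi" using int_shift_near by blast
  then show ?thesis using w by (intro exI[of _ "w + per k"]) simp
qed

text \<open>\<open>Kset\<close> is bounded on the left, so its part with
  \<open>Re_cyl x \<le> X\<close> lifts into a compact rectangle.\<close>

lemma dn_bounded: "\<exists>D>0. \<forall>x\<in>Kset. Re_cyl x \<le> X \<longrightarrow> dn N x \<le> D"
proof -
  define R where "R = cbox (Complex (- M - 1) (- pi)) (Complex X pi)"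
  have "continuous_on UNIV (deriv (f ^^ N))"
    by (intro holomorphic_on_imp_continuous_on holomorphic_deriv f_pow_holo) auto
  then have "bounded (deriv (f ^^ N) ` R)"
    unfolding R_def by (intro compact_imp_bounded compact_continuous_image compact_cbox) (auto intro: continuous_on_subset)
  then obtain D where D: "\<And>z. z \<in> R \<Longrightarrow> cmod (deriv (f ^^ N) z) \<le> D" unfolding bounded_iff by blast
  have "dn N x \<le> max D 1" if x: "x \<in> Kset" "Re_cyl x \<le> X" for x
  proof -
    obtain z where z: "to_cyl z = x" "\<bar>Im z\<bar> \<le> pi" using lift_strip by blast
    have "z \<in> R" using z x K_Re[of z] by (auto simp: R_def in_cbox_complex_iff)
    then show ?thesis using D[of z] z by (auto simp: dn_to_cyl)
  qed
  then show ?thesis by (intro exI[of _ "max D 1"]) auto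
qed

text \<open>The last hypothesis removes the ambiguity of lifts: the translation that takes
  \<open>y2\<close> to \<open>y1\<close> then also matches the endpoints, so
  \<open>shadows_unique\<close> applies in the plane.\<close>

lemma shadow_lift_inj:
  assumes x: "x1 \<in> K" "x2 \<in> K" and f: "to_cyl ((f ^^ n) x1) = to_cyl ((f ^^ n) x2)"
    and sh: "shadows n x1 y1" "shadows n x2 y2" and y: "to_cyl y1 = to_cyl y2"
    and v: "(f ^^ n) y1 - (f ^^ n) x1 = (f ^^ n) y2 - (f ^^ n) x2"
  shows "to_cyl x1 = to_cyl x2"
proof -
  obtain k where k: "y1 = y2 + per k" using y to_cyl_eqE by blast
  have sh2: "shadows n (x2 + per k) y1" using shadows_per[OF sh(2)] k by simp
  have "(f ^^ n) x1 = (f ^^ n) (x2 + per k)" using v unfolding k f_pow_per by (simp add: algebra_simps)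
  then have "x1 = x2 + per k" by (rule shadows_unique[OF x(1) sh(1) sh2])
  then show ?thesis by simp
qed

text \<open>Inverse branches match preimages of \<open>q1\<close> injectively with preimages of
  \<open>q\<close>, and derivatives change by at most the factor \<open>Dc\<close>. The displacement
  between lifts of \<open>q1\<close> and \<open>q\<close> is chosen once for all preimages, as
  \<open>shadow_lift_inj\<close> requires.\<close>

lemma Z_distortion:
  assumes p: "q1 \<in> Kset" and q: "q \<in> Kset" and d: "dist q1 q < r0" and t: "t \<ge> 0"
  shows "Z t n q1 \<le> ennreal (Dc powr t) * Z t n q"
proof -
  obtain pp where pp: "to_cyl pp = q1" using to_cyl_surj by blast
  have "dist (to_cyl pp) q < r0" using d pp by simp
  then obtain qq where qq: "q = to_cyl qq" "cmod (pp - qq) < r0" by (rule to_cyl_lift_near)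
  have "\<exists>z y. to_cyl z = x \<and> z \<in> K \<and> shadows n z y \<and> to_cyl ((f ^^ n) y) = q \<and> (f ^^ n) y - (f ^^ n) z = qq - pp"
    if x: "x \<in> (F ^^ n) -` {q1}" for x
  proof -
    obtain z where z: "to_cyl z = x" using to_cyl_surj by blast
    have zK: "z \<in> K" using Kset_preimage[OF p x] z by simp
    have "to_cyl ((f ^^ n) z) = to_cyl pp" using x z pp by (auto simp: F_pow_to_cyl)
    then obtain k where k: "(f ^^ n) z = pp + per k" using to_cyl_eqE by blast
    have "cmod ((qq + per k) - (f ^^ n) z) \<le> r0" using qq(2) by (simp add: k norm_minus_commute)
    then obtain y where "(f ^^ n) y = qq + per k" "shadows n z y" by (rule shadow_ex[OF zK])
    then show ?thesis using z zK qq(1) k by (intro exI[of _ z] exI[of _ y]) simp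
  qed
  then obtain zz yy where zy: "\<And>x. x \<in> (F ^^ n) -` {q1} \<Longrightarrow> to_cyl (zz x) = x \<and> zz x \<in> K \<and> shadows n (zz x) (yy x) \<and>
      to_cyl ((f ^^ n) (yy x)) = q \<and> (f ^^ n) (yy x) - (f ^^ n) (zz x) = qq - pp"
    by metis
  have "Z t n q1 = (\<Sum>\<^sub>\<infinity>x\<in>(F ^^ n) -` {q1}. wt t n x)" by (rule Z_eq[OF p])
  also have "\<dots> \<le> (\<Sum>\<^sub>\<infinity>x\<in>(F ^^ n) -` {q}. ennreal (Dc powr t) * wt t n x)"
  proof (rule infsum_ennreal_inj_le[where \<phi>="\<lambda>x. to_cyl (yy x)"])
    show "inj_on (\<lambda>x. to_cyl (yy x)) ((F ^^ n) -` {q1})"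
    proof (rule inj_onI)
      fix x1 x2 assume x: "x1 \<in> (F ^^ n) -` {q1}" "x2 \<in> (F ^^ n) -` {q1}" "to_cyl (yy x1) = to_cyl (yy x2)"
      have "to_cyl ((f ^^ n) (zz x1)) = q1" "to_cyl ((f ^^ n) (zz x2)) = q1"
        using zy[OF x(1)] zy[OF x(2)] x(1,2) F_pow_to_cyl[of n "zz x1"] F_pow_to_cyl[of n "zz x2"] by auto
      then have "to_cyl (zz x1) = to_cyl (zz x2)"
        using zy[OF x(1)] zy[OF x(2)] x(3) by (intro shadow_lift_inj[of "zz x1" "zz x2" n "yy x1" "yy x2"]) auto
      then show "x1 = x2" using zy[OF x(1)] zy[OF x(2)] by simp
    qed
    show "(\<lambda>x. to_cyl (yy x)) ` ((F ^^ n) -` {q1}) \<subseteq> (F ^^ n) -` {q}"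
      using zy by (auto simp: F_pow_to_cyl)
    fix x assume x: "x \<in> (F ^^ n) -` {q1}"
    have zx: "zz x \<in> K" "shadows n (zz x) (yy x)" "to_cyl (zz x) = x" using zy[OF x] by auto
    have "dn n (to_cyl (yy x)) \<le> Dc * dn n x"
      using shadow_deriv_bounds(1)[OF zx(1,2)] dn_to_cyl[of n "yy x"] dn_to_cyl[of n "zz x"] unfolding zx(3) by simp
    moreover have "dn n (to_cyl (yy x)) > 0"
      using zy[OF x] q F_pow_Kset_iff[of n "to_cyl (yy x)"] dn_pos by (simp add: F_pow_to_cyl)
    moreover have "dn n x > 0" using dn_pos Kset_preimage[OF p x] by blast
    ultimately have "(Dc * dn n x) powr (- t) \<le> dn n (to_cyl (yy x)) powr (- t)"
      using t by (intro powr_mono2') auto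
    then have "Dc powr t * (Dc * dn n x) powr (- t) \<le> Dc powr t * dn n (to_cyl (yy x)) powr (- t)"
      by (intro mult_left_mono) auto
    moreover have "Dc powr t * (Dc * dn n x) powr (- t) = dn n x powr (- t)"
      using Dc_pos by (simp add: powr_mult powr_minus field_simps)
    ultimately show "wt t n x \<le> ennreal (Dc powr t) * wt t n (to_cyl (yy x))"
      by (simp add: ennreal_mult[symmetric] ennreal_leI)
  qed
  also have "\<dots> = ennreal (Dc powr t) * Z t n q" by (simp add: infsum_ennreal_cmult Z_eq[OF q])
  finally show ?thesis .
qed

text \<open>
  Preimages of one point are separated by the branch index \<open>k\<close> and a square grid whose cells are
  smaller than the injectivity radius.
\<close>

lemma preimage_coding:
  assumes q: "q \<in> Kset"
  shows "\<exists>(z :: cylinder \<Rightarrow> complex) (k :: cylinder \<Rightarrow> int).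
    (\<forall>x\<in>F -` {q}. to_cyl (z x) = x \<and> z x \<in> K \<and> \<bar>Im (z x)\<bar> \<le> pi \<and> \<bar>2 * pi * real_of_int (k x) - Im (f (z x))\<bar> \<le> pi) \<and>
    inj_on (\<lambda>x. (k x, \<lfloor>Re (z x) / (\<eta> / 2)\<rfloor>, \<lfloor>Im (z x) / (\<eta> / 2)\<rfloor>)) (F -` {q})"
proof -
  obtain qq where qq: "to_cyl qq = q" "\<bar>Im qq\<bar> \<le> pi" using lift_strip by blast
  have "\<exists>z k. to_cyl z = x \<and> \<bar>Im z\<bar> \<le> pi \<and> f z = qq + per k" if "x \<in> F -` {q}" for x
  proof -
    obtain z where z: "to_cyl z = x" "\<bar>Im z\<bar> \<le> pi" using lift_strip by blast
    have "to_cyl (f z) = to_cyl qq" using that z qq F_map_to_cyl[of l c z] by simp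
    then show ?thesis using z to_cyl_eqE by blast
  qed
  then obtain z k where zk: "\<And>x. x \<in> F -` {q} \<Longrightarrow> to_cyl (z x) = x \<and> \<bar>Im (z x)\<bar> \<le> pi \<and> f (z x) = qq + per (k x)" by metis
  have K: "z x \<in> K" if "x \<in> F -` {q}" for x using zk[OF that] that q F_Kset_iff[of x] by simp
  show ?thesis
  proof (rule exI[of _ z], rule exI[of _ k], rule conjI, rule ballI)
    fix x assume x: "x \<in> F -` {q}"
    have "Im (f (z x)) = Im qq + 2 * pi * real_of_int (k x)" using zk[OF x] by simp
    then show "to_cyl (z x) = x \<and> z x \<in> K \<and> \<bar>Im (z x)\<bar> \<le> pi \<and> \<bar>2 * pi * real_of_int (k x) - Im (f (z x))\<bar> \<le> pi"
      using zk[OF x] K[OF x] qq(2) by simp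
  next
    show "inj_on (\<lambda>x. (k x, \<lfloor>Re (z x) / (\<eta> / 2)\<rfloor>, \<lfloor>Im (z x) / (\<eta> / 2)\<rfloor>)) (F -` {q})"
    proof (rule inj_onI)
      fix x y assume x: "x \<in> F -` {q}" and y: "y \<in> F -` {q}"
        and eq: "(k x, \<lfloor>Re (z x) / (\<eta> / 2)\<rfloor>, \<lfloor>Im (z x) / (\<eta> / 2)\<rfloor>) = (k y, \<lfloor>Re (z y) / (\<eta> / 2)\<rfloor>, \<lfloor>Im (z y) / (\<eta> / 2)\<rfloor>)"
      have "cmod (z x - z y) \<le> \<bar>Re (z x - z y)\<bar> + \<bar>Im (z x - z y)\<bar>" by (rule cmod_le)
      also have "\<dots> \<le> \<eta>" using floor_cell[of "\<eta> / 2" "Re (z x)" "Re (z y)"] floor_cell[of "\<eta> / 2" "Im (z x)" "Im (z y)"] eq \<eta>(1) by simp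
      finally have "z y \<in> cball (z x) \<eta>" by (simp add: dist_norm)
      moreover have "f (z x) = f (z y)" using zk[OF x] zk[OF y] eq by simp
      ultimately have "z x = z y" using f_inj_near_K[OF K[OF x], of "z x" "z y"] \<eta>(1) by simp
      then show "x = y" using zk[OF x] zk[OF y] by metis
    qed
  qed
qed

section \<open>Counting preimages and tails of partition sums\<close>

lemma countable_preimages: "q \<in> Kset \<Longrightarrow> countable ((F ^^ n) -` {q})"
proof (induction n arbitrary: q)
  case 0
  have "(F ^^ 0) -` {q} = {q}" by auto
  then show ?case by simp
next
  case (Suc n)
  obtain z :: "cylinder \<Rightarrow> complex" and k :: "cylinder \<Rightarrow> int"
    where inj: "inj_on (\<lambda>x. (k x, \<lfloor>Re (z x) / (\<eta> / 2)\<rfloor>, \<lfloor>Im (z x) / (\<eta> / 2)\<rfloor>)) (F -` {q})"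
    using preimage_coding[OF Suc.prems] by blast
  have "countable (F -` {q})" by (rule countable_image_inj_on[OF countableI_type inj])
  moreover have "(F ^^ Suc n) -` {q} = (\<Union>x\<in>F -` {q}. (F ^^ n) -` {x})" by auto
  moreover have "x \<in> Kset" if "x \<in> F -` {q}" for x using that Suc.prems F_Kset_iff[of x] by simp
  ultimately show ?case using Suc.IH by (simp only: countable_UN)
qed

text \<open>In a slab of width 1 boundedly many grid cells occur, and the branch index
  \<open>k\<close> has \<open>2 * pi * k\<close> close to the imaginary part of the lifted image,
  which leaves a number of values of order \<open>exp X\<close>.\<close>

lemma preimage_cell_count:
  "\<exists>C'>0. \<forall>q\<in>Kset. \<forall>X\<ge>- M - 2. finite {x \<in> F -` {q}. X \<le> Re_cyl x \<and> Re_cyl x < X + 1} \<and>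
     real (card {x \<in> F -` {q}. X \<le> Re_cyl x \<and> Re_cyl x < X + 1}) \<le> C' * exp X"
proof -
  define h where "h = \<eta> / 2"
  have h: "h > 0" using \<eta>(1) by (simp add: h_def)
  \<comment> \<open>Bounds the contribution to \<open>2 * pi * k\<close> of everything but the
    exponential.\<close>
  define C0 where "C0 = cmod C + real l * pi + pi"
  have C0: "C0 \<ge> 0" by (simp add: C0_def)
  define C' where "C' = ((2 * C0 + 1) * exp (M + 2) + 2 * exp 1) * (1 / h + 2) * (2 * pi / h + 2)"
  have "finite {x \<in> F -` {q}. X \<le> Re_cyl x \<and> Re_cyl x < X + 1} \<and>
     real (card {x \<in> F -` {q}. X \<le> Re_cyl x \<and> Re_cyl x < X + 1}) \<le> C' * exp X" if q: "q \<in> Kset" and X: "X \<ge> - M - 2" for q X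
  proof -
    let ?S = "{x \<in> F -` {q}. X \<le> Re_cyl x \<and> Re_cyl x < X + 1}"
    obtain z k where zk: "\<And>x. x \<in> F -` {q} \<Longrightarrow> to_cyl (z x) = x \<and> z x \<in> K \<and> \<bar>Im (z x)\<bar> \<le> pi \<and> \<bar>2 * pi * real_of_int (k x) - Im (f (z x))\<bar> \<le> pi"
      and inj: "inj_on (\<lambda>x. (k x, \<lfloor>Re (z x) / (\<eta> / 2)\<rfloor>, \<lfloor>Im (z x) / (\<eta> / 2)\<rfloor>)) (F -` {q})"
      using preimage_coding[OF q] by blast
    define kb where "kb = \<lfloor>C0 + exp (X + 1)\<rfloor>"
    define Box where "Box = {- kb..kb} \<times> {\<lfloor>X / h\<rfloor>..\<lfloor>(X + 1) / h\<rfloor>} \<times> {\<lfloor>- pi / h\<rfloor>..\<lfloor>pi / h\<rfloor>}"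
    have im: "(\<lambda>x. (k x, \<lfloor>Re (z x) / (\<eta> / 2)\<rfloor>, \<lfloor>Im (z x) / (\<eta> / 2)\<rfloor>)) ` ?S \<subseteq> Box"
    proof (rule image_subsetI)
      fix x assume "x \<in> ?S"
      then have x: "x \<in> F -` {q}" and Re: "X \<le> Re_cyl x" "Re_cyl x < X + 1" by auto
      note zx = zk[OF x]
      have Rz: "Re_cyl x = Re (z x)" using zx by (metis Re_cyl_to_cyl)
      have "\<bar>Im (f (z x))\<bar> \<le> \<bar>Im C\<bar> + real l * \<bar>Im (z x)\<bar> + \<bar>Im (exp (z x))\<bar>"
        using abs_triangle_ineq4[of "Im C + real l * Im (z x)" "Im (exp (z x))"] abs_triangle_ineq[of "Im C" "real l * Im (z x)"]
        by (simp add: f_eq abs_mult)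
      moreover have "\<bar>Im C\<bar> \<le> cmod C" "\<bar>Im (exp (z x))\<bar> \<le> exp (Re (z x))" using abs_Im_le_cmod[of C] abs_Im_le_cmod[of "exp (z x)"] by auto
      moreover have "exp (Re (z x)) \<le> exp (X + 1)" using Re Rz by simp
      moreover have "real l * \<bar>Im (z x)\<bar> \<le> real l * pi" using zx by (intro mult_left_mono) auto
      ultimately have "\<bar>2 * pi * real_of_int (k x)\<bar> \<le> C0 + exp (X + 1)" using zx unfolding C0_def by linarith
      moreover have "1 * \<bar>real_of_int (k x)\<bar> \<le> (2 * pi) * \<bar>real_of_int (k x)\<bar>" using pi_ge_two by (intro mult_right_mono) auto
      ultimately have kx: "\<bar>real_of_int (k x)\<bar> \<le> C0 + exp (X + 1)" by (simp add: abs_mult)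
      then have "\<bar>k x\<bar> \<le> kb" unfolding kb_def by (simp add: le_floor_iff)
      moreover have "\<lfloor>X / h\<rfloor> \<le> \<lfloor>Re (z x) / h\<rfloor>" "\<lfloor>Re (z x) / h\<rfloor> \<le> \<lfloor>(X + 1) / h\<rfloor>" using Re Rz h by (auto intro!: floor_mono divide_right_mono)
      moreover have "- pi \<le> Im (z x)" "Im (z x) \<le> pi" using zx by (auto simp: abs_le_iff)
      then have "- pi / h \<le> Im (z x) / h" "Im (z x) / h \<le> pi / h" using h divide_right_mono[of "- pi" "Im (z x)" h] divide_right_mono[of "Im (z x)" pi h] by simp_all
      then have "\<lfloor>- pi / h\<rfloor> \<le> \<lfloor>Im (z x) / h\<rfloor>" "\<lfloor>Im (z x) / h\<rfloor> \<le> \<lfloor>pi / h\<rfloor>" by (simp_all only: floor_mono)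
      ultimately show "(k x, \<lfloor>Re (z x) / (\<eta> / 2)\<rfloor>, \<lfloor>Im (z x) / (\<eta> / 2)\<rfloor>) \<in> Box" by (auto simp: Box_def h_def)
    qed
    have finB: "finite Box" by (simp add: Box_def)
    have injS: "inj_on (\<lambda>x. (k x, \<lfloor>Re (z x) / (\<eta> / 2)\<rfloor>, \<lfloor>Im (z x) / (\<eta> / 2)\<rfloor>)) ?S" by (rule inj_on_subset[OF inj]) auto
    have fin: "finite ?S" using inj_on_finite[OF injS im finB] .
    have "real (card ?S) \<le> real (card Box)" using card_inj_on_le[OF injS im finB] by simp
    also have "\<dots> = real (card {- kb..kb}) * real (card {\<lfloor>X / h\<rfloor>..\<lfloor>(X + 1) / h\<rfloor>}) * real (card {\<lfloor>- pi / h\<rfloor>..\<lfloor>pi / h\<rfloor>})"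
      by (simp add: Box_def card_cartesian_product)
    also have "\<dots> \<le> (((2 * C0 + 1) * exp (M + 2) + 2 * exp 1) * exp X) * (1 / h + 2) * (2 * pi / h + 2)"
    proof (intro mult_mono)
      have "real_of_int kb \<le> C0 + exp (X + 1)" "kb \<ge> 0" using C0 by (auto simp: kb_def add_nonneg_nonneg)
      then have "real (card {- kb..kb}) \<le> 2 * C0 + 1 + 2 * exp (X + 1)" by simp
      \<comment> \<open>Constants become multiples of \<open>exp X\<close> by
        \<open>X \<ge> - M - 2\<close>.\<close>
      also have "2 * C0 + 1 \<le> (2 * C0 + 1) * (exp (M + 2) * exp X)"
        using C0 X by (simp add: exp_add[symmetric])
      finally show "real (card {- kb..kb}) \<le> ((2 * C0 + 1) * exp (M + 2) + 2 * exp 1) * exp X"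
        by (simp add: algebra_simps exp_add)
      have le: "\<lfloor>X / h\<rfloor> \<le> \<lfloor>(X + 1) / h\<rfloor>" using h by (intro floor_mono divide_right_mono) auto
      have "real (card {\<lfloor>X / h\<rfloor>..\<lfloor>(X + 1) / h\<rfloor>}) = real_of_int \<lfloor>(X + 1) / h\<rfloor> - real_of_int \<lfloor>X / h\<rfloor> + 1" using le by simp
      also have "\<dots> \<le> (X + 1) / h - (X / h - 1) + 1" by linarith
      finally show "real (card {\<lfloor>X / h\<rfloor>..\<lfloor>(X + 1) / h\<rfloor>}) \<le> 1 / h + 2" by (simp add: add_divide_distrib)
      have le: "\<lfloor>- pi / h\<rfloor> \<le> \<lfloor>pi / h\<rfloor>" using h by (intro floor_mono divide_right_mono) auto
      have "real (card {\<lfloor>- pi / h\<rfloor>..\<lfloor>pi / h\<rfloor>}) = real_of_int \<lfloor>pi / h\<rfloor> - real_of_int \<lfloor>- pi / h\<rfloor> + 1" using le by simp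
      also have "\<dots> \<le> pi / h - (- pi / h - 1) + 1" by linarith
      finally show "real (card {\<lfloor>- pi / h\<rfloor>..\<lfloor>pi / h\<rfloor>}) \<le> 2 * pi / h + 2" by simp
    qed (use h C0 in auto)
    also have "\<dots> = C' * exp X" by (simp add: C'_def mult_ac)
    finally show ?thesis using fin by blast
  qed
  moreover have "C' > 0" unfolding C'_def using h C0 by (intro mult_pos_pos add_pos_pos add_nonneg_pos) (auto intro: mult_nonneg_nonneg)
  ultimately show ?thesis by blast
qed

text \<open>To the right \<open>exp\<close> dominates \<open>l\<close>; elsewhere the derivative is
  at least \<open>\<delta>\<close> while \<open>exp (Re_cyl x)\<close> is bounded.\<close>

lemma dn_1_ge: "\<exists>c'>0. \<forall>x\<in>Kset. c' * exp (Re_cyl x) \<le> dn 1 x"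
proof -
  define c' where "c' = min (1 / 2) (\<delta> / (2 * real l))"
  have l0: "real l > 0" using l2 by simp
  have "c' * exp (Re_cyl x) \<le> dn 1 x" if x: "x \<in> Kset" for x
  proof -
    obtain z where z: "to_cyl z = x" using to_cyl_surj by blast
    have dz: "dn 1 x = cmod (of_nat l - exp z)" using F_deriv_norm_1[of l c z] z by simp
    show ?thesis
    proof (cases "exp (Re z) \<ge> 2 * real l")
      case True
      have "c' * exp (Re z) \<le> 1 / 2 * exp (Re z)" by (intro mult_right_mono) (auto simp: c'_def)
      also have "\<dots> \<le> exp (Re z) - real l" using True by simp
      also have "\<dots> \<le> dn 1 x" using dz norm_triangle_ineq2[of "exp z" "of_nat l"] by (simp add: norm_minus_commute)
      finally show ?thesis using z by auto
    next
      case False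
      have "c' * exp (Re z) \<le> \<delta> / (2 * real l) * (2 * real l)" using False \<delta>_pos l0 by (intro mult_mono) (auto simp: c'_def)
      also have "\<dots> = \<delta>" using l0 by simp
      also have "\<dots> \<le> dn 1 x" using K_\<delta>[of z] x z dz by simp
      finally show ?thesis using z by auto
    qed
  qed
  moreover have "c' > 0" using \<delta>_pos l0 by (simp add: c'_def)
  ultimately show ?thesis by blast
qed

text \<open>Summation over slabs of width 1: a number of order \<open>exp X\<close> times a weight
  of order \<open>exp (- t * X)\<close>, hence a geometric series with ratio
  \<open>exp (1 - t) < 1\<close>.\<close>

lemma preimage_tail:
  assumes t: "t > 1"
  shows "\<exists>B>0. \<forall>q\<in>Kset. \<forall>X\<ge>- M - 2. (\<Sum>\<^sub>\<infinity>x\<in>{x \<in> F -` {q}. X \<le> Re_cyl x}. wt t 1 x) \<le> ennreal (B * exp ((1 - t) * X))"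
proof -
  obtain C' where C': "C' > 0" "\<And>q X. q \<in> Kset \<Longrightarrow> X \<ge> - M - 2 \<Longrightarrow> finite {x \<in> F -` {q}. X \<le> Re_cyl x \<and> Re_cyl x < X + 1} \<and>
     real (card {x \<in> F -` {q}. X \<le> Re_cyl x \<and> Re_cyl x < X + 1}) \<le> C' * exp X" using preimage_cell_count by blast
  obtain c' where c': "c' > 0" "\<And>x. x \<in> Kset \<Longrightarrow> c' * exp (Re_cyl x) \<le> dn 1 x" using dn_1_ge by blast
  define \<beta> where "\<beta> = exp (1 - t)"
  have \<beta>: "0 < \<beta>" "\<beta> < 1" using t by (auto simp: \<beta>_def)
  define B where "B = C' * c' powr (- t) / (1 - \<beta>)"
  have "(\<Sum>\<^sub>\<infinity>x\<in>{x \<in> F -` {q}. X \<le> Re_cyl x}. wt t 1 x) \<le> ennreal (B * exp ((1 - t) * X))" if q: "q \<in> Kset" and X: "X \<ge> - M - 2" for q X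
  proof -
    let ?S = "\<lambda>n::nat. {x \<in> F -` {q}. X + real n \<le> Re_cyl x \<and> Re_cyl x < X + real n + 1}"
    have S: "finite (?S n)" "real (card (?S n)) \<le> C' * exp (X + real n)" for n using C'(2)[OF q, of "X + real n"] X by auto
    have cell: "infsum (wt t 1) (?S n) \<le> ennreal (C' * c' powr (- t) * exp ((1 - t) * X) * \<beta> ^ n)" for n
    proof -
      have "dn 1 x powr (- t) \<le> c' powr (- t) * exp (- t * (X + real n))" if x: "x \<in> ?S n" for x
      proof -
        have "x \<in> Kset" using x q F_Kset_iff[of x] by simp
        moreover have "c' * exp (X + real n) \<le> c' * exp (Re_cyl x)" using x c'(1) by simp
        ultimately have "c' * exp (X + real n) \<le> dn 1 x" using c'(2) by (meson order_trans)
        then have "dn 1 x powr (- t) \<le> (c' * exp (X + real n)) powr (- t)" using t c'(1) by (intro powr_mono2') auto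
        also have "\<dots> = c' powr (- t) * exp (X + real n) powr (- t)" by (rule powr_mult)
        also have "exp (X + real n) powr (- t) = exp (- t * (X + real n))" by (simp add: powr_def)
        finally show ?thesis .
      qed
      then have "(\<Sum>x\<in>?S n. wt t 1 x) \<le> (\<Sum>x\<in>?S n. ennreal (c' powr (- t) * exp (- t * (X + real n))))"
        by (intro sum_mono ennreal_leI) auto
      also have "\<dots> = ennreal (real (card (?S n)) * (c' powr (- t) * exp (- t * (X + real n))))"
        by (simp add: ennreal_mult ennreal_of_nat_eq_real_of_nat)
      also have "\<dots> \<le> ennreal ((C' * exp (X + real n)) * (c' powr (- t) * exp (- t * (X + real n))))"
        using S(2)[of n] by (intro ennreal_leI mult_right_mono) auto
      also have "(C' * exp (X + real n)) * (c' powr (- t) * exp (- t * (X + real n))) = C' * c' powr (- t) * exp ((X + real n) + (- t * (X + real n)))"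
        by (simp only: exp_add mult_ac)
      also have "(X + real n) + (- t * (X + real n)) = (1 - t) * X + real n * (1 - t)" by (simp add: algebra_simps)
      also have "exp \<dots> = exp ((1 - t) * X) * \<beta> ^ n" by (simp add: exp_add \<beta>_def exp_of_nat_mult)
      finally show ?thesis using S(1)[of n] by (simp add: mult_ac)
    qed
    have "{x \<in> F -` {q}. X \<le> Re_cyl x} \<subseteq> (\<Union>n\<in>UNIV. ?S n)"
    proof
      fix x assume x: "x \<in> {x \<in> F -` {q}. X \<le> Re_cyl x}"
      define n where "n = nat \<lfloor>Re_cyl x - X\<rfloor>"
      have "real n = real_of_int \<lfloor>Re_cyl x - X\<rfloor>" using x by (simp add: n_def)
      then have "real n \<le> Re_cyl x - X" "Re_cyl x - X < real n + 1" by linarith+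
      then show "x \<in> (\<Union>n\<in>UNIV. ?S n)" using x by (intro UN_I[of n]) auto
    qed
    then have "(\<Sum>\<^sub>\<infinity>x\<in>{x \<in> F -` {q}. X \<le> Re_cyl x}. wt t 1 x) \<le> infsum (\<lambda>n. infsum (wt t 1) (?S n)) UNIV"
      by (rule infsum_ennreal_UN_le)
    also have "\<dots> \<le> infsum (\<lambda>n. ennreal (C' * c' powr (- t) * exp ((1 - t) * X) * \<beta> ^ n)) UNIV"
      by (intro infsum_ennreal_mono cell) auto
    also have "\<dots> = (\<Sum>n. ennreal (C' * c' powr (- t) * exp ((1 - t) * X) * \<beta> ^ n))" by (rule infsum_ennreal_nat)
    also have "\<dots> = ennreal (\<Sum>n. C' * c' powr (- t) * exp ((1 - t) * X) * \<beta> ^ n)"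
      by (rule suminf_ennreal2) (use C'(1) \<beta> in \<open>auto intro!: summable_mult summable_geometric\<close>)
    also have "(\<Sum>n. C' * c' powr (- t) * exp ((1 - t) * X) * \<beta> ^ n) = C' * c' powr (- t) * exp ((1 - t) * X) * (1 / (1 - \<beta>))"
      using \<beta> by (subst suminf_mult) (auto simp: suminf_geometric intro: summable_geometric)
    also have "\<dots> = B * exp ((1 - t) * X)" by (simp add: B_def)
    finally show ?thesis .
  qed
  moreover have "B > 0" using C'(1) c'(1) \<beta> by (simp add: B_def)
  ultimately show ?thesis by blast
qed

end

section \<open>The pressure\<close>

lemma sum_inverse_ge_ln:
  assumes "1 \<le> a" "a \<le> b"
  shows "ln ((real b + 1) / real a) \<le> (\<Sum>k\<in>{a..b}. 1 / real k)"
  using assms(2)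
proof (induction b rule: dec_induct)
  case base
  have "ln ((real a + 1) / real a) = ln (1 + 1 / real a)" using assms(1) by (simp add: add_divide_distrib add.commute)
  also have "\<dots> \<le> 1 / real a" by (rule ln_add_one_self_le_self) simp
  finally show ?case by simp
next
  case (step b)
  have "(real (Suc b) + 1) / real a = (real b + 1) / real a * (1 + 1 / (real b + 1))"
  proof -
    have "(\<beta> + 1) = \<beta> * (1 + 1 / \<beta>)" if "\<beta> > 0" for \<beta> :: real using that by (simp add: distrib_left)
    from this[of "real b + 1"] have "real (Suc b) + 1 = (real b + 1) * (1 + 1 / (real b + 1))" by simp
    then show ?thesis by (metis times_divide_eq_left)
  qed
  moreover have "ln ((real b + 1) / real a * (1 + 1 / (real b + 1))) = ln ((real b + 1) / real a) + ln (1 + 1 / (real b + 1))"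
  proof (rule ln_mult_pos)
    show "0 < (real b + 1) / real a" using assms(1) by (intro divide_pos_pos) auto
    show "0 < 1 + 1 / (real b + 1)" by (intro add_pos_nonneg) auto
  qed
  ultimately have "ln ((real (Suc b) + 1) / real a) = ln ((real b + 1) / real a) + ln (1 + 1 / (real b + 1))"
    by (simp only:)
  also have "\<dots> \<le> (\<Sum>k\<in>{a..b}. 1 / real k) + 1 / (real b + 1)"
    using step.IH by (intro add_mono ln_add_one_self_le_self) auto
  also have "\<dots> = (\<Sum>k\<in>{a..Suc b}. 1 / real k)" using step by (simp add: add.commute)
  finally show ?case .
qed

context fatou_expanding
begin

definition P0 where "P0 = to_cyl p0"
definition b :: "real \<Rightarrow> nat \<Rightarrow> real" where "b t n = enn2real (Z t n P0)"

lemma b_nonneg [simp]: "b t n \<ge> 0"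
  by (simp add: b_def)

lemma P0_K: "P0 \<in> Kset"
  using p0(2) by (simp add: P0_def)

lemma F_pow_P0: "(F ^^ n) P0 = P0"
  using F_p0 by (simp add: P0_def)

lemma Z_ge_single: "q \<in> Kset \<Longrightarrow> (F ^^ n) x = q \<Longrightarrow> wt t n x * Z t m x \<le> Z t (m + n) q"
  using infsum_ennreal_ge_finite[of "{x}" "(F ^^ n) -` {q}" "\<lambda>x. wt t n x * Z t m x"] Z_add[of q t m n] by simp

lemma Z_add_le:
  assumes "q \<in> Kset" "\<And>x. x \<in> Kset \<Longrightarrow> Z t m x \<le> a"
  shows "Z t (m + n) q \<le> a * Z t n q"
proof -
  have "Z t (m + n) q \<le> (\<Sum>\<^sub>\<infinity>x\<in>(F ^^ n) -` {q}. a * wt t n x)"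
    unfolding Z_add[OF assms(1)]
  proof (rule infsum_ennreal_mono)
    fix x assume "x \<in> (F ^^ n) -` {q}"
    then have "Z t m x \<le> a" using assms(2) Kset_preimage[OF assms(1)] by blast
    from mult_right_mono[OF this, of "wt t n x"] show "wt t n x * Z t m x \<le> a * wt t n x" by (simp add: mult.commute)
  qed auto
  then show ?thesis by (simp add: infsum_ennreal_cmult Z_eq[OF assms(1)])
qed

lemma Z_le_power:
  assumes "t > 1"
  obtains S where "S \<ge> 1" "\<And>q n. q \<in> Kset \<Longrightarrow> Z t n q \<le> ennreal (S ^ n)"
proof -
  obtain B where B: "B > 0" "\<And>q X. q \<in> Kset \<Longrightarrow> X \<ge> - M - 2 \<Longrightarrow>
      (\<Sum>\<^sub>\<infinity>x\<in>{x \<in> F -` {q}. X \<le> Re_cyl x}. wt t 1 x) \<le> ennreal (B * exp ((1 - t) * X))"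
    using preimage_tail[OF assms] by blast
  \<comment> \<open>All of \<open>Kset\<close> lies to the right of \<open>- M - 2\<close>, so the
    tail from there is the whole sum.\<close>
  define S where "S = max 1 (B * exp ((1 - t) * (- M - 2)))"
  have 1: "Z t 1 q \<le> ennreal S" if q: "q \<in> Kset" for q
  proof -
    have "- M - 2 \<le> Re_cyl x" if "x \<in> F -` {q}" for x
    proof -
      obtain z where z: "to_cyl z = x" using to_cyl_surj by blast
      then have "z \<in> K" using that q F_Kset_iff[of x] by simp
      then show ?thesis using K_Re[of z] z by auto
    qed
    then have "{x \<in> F -` {q}. - M - 2 \<le> Re_cyl x} = F -` {q}" by blast
    then have "Z t 1 q \<le> ennreal (B * exp ((1 - t) * (- M - 2)))"
      using B(2)[OF q, of "- M - 2"] by (simp add: Z_eq[OF q])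
    also have "\<dots> \<le> ennreal S" by (intro ennreal_leI) (simp add: S_def)
    finally show ?thesis .
  qed
  have "Z t n q \<le> ennreal (S ^ n)" if "q \<in> Kset" for n q
    using that
  proof (induction n arbitrary: q)
    case (Suc n)
    have "Z t (n + 1) q \<le> ennreal (S ^ n) * Z t 1 q" by (rule Z_add_le[OF Suc.prems Suc.IH])
    also have "\<dots> \<le> ennreal (S ^ n) * ennreal S" by (intro mult_left_mono 1[OF Suc.prems]) auto
    finally show ?case by (simp add: ennreal_mult[symmetric] S_def mult.commute)
  qed (simp add: Z_0)
  moreover have "S \<ge> 1" by (simp add: S_def)
  ultimately show thesis using that by blast
qed

lemma Z_P0: "t > 1 \<Longrightarrow> Z t n P0 = ennreal (b t n)"
proof -
  assume "t > 1"
  then obtain S where "Z t n P0 \<le> ennreal (S ^ n)" using Z_le_power P0_K by metis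
  then have "Z t n P0 < top" by (rule order.strict_trans1) simp
  then show ?thesis by (simp add: b_def ennreal_enn2real)
qed

definition q0 :: "real \<Rightarrow> real" where "q0 t = dn 1 P0 powr (- t)"

lemma q0_pos: "q0 t > 0"
  using dn_pos[OF P0_K, of 1] by (simp add: q0_def)

text \<open>Among the preimages of \<open>P0\<close> is \<open>P0\<close> itself; only its term is
  kept.\<close>

lemma b_Suc: "t > 1 \<Longrightarrow> q0 t * b t n \<le> b t (Suc n)"
proof -
  assume t: "t > 1"
  have "wt t 1 P0 * Z t n P0 \<le> Z t (n + 1) P0" using Z_ge_single[OF P0_K, of 1 P0] F_pow_P0 by blast
  then have "ennreal (q0 t) * ennreal (b t n) \<le> ennreal (b t (Suc n))" using Z_P0[OF t] by (simp add: q0_def)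
  then show ?thesis using q0_pos[of t]
    by (simp add: ennreal_mult'[symmetric] b_def ennreal_le_iff)
qed

lemma b_0: "b t 0 = 1"
  by (simp add: b_def Z_0[OF P0_K])

lemma b_ge: "t > 1 \<Longrightarrow> q0 t ^ n \<le> b t n"
proof (induction n)
  case (Suc n)
  have "q0 t ^ Suc n \<le> q0 t * b t n" using Suc q0_pos[of t] by simp
  then show ?case using b_Suc[OF Suc.prems, of n] by simp
qed (simp add: b_0)

lemma b_pos: "t > 1 \<Longrightarrow> b t n > 0"
  using b_ge[of t n] q0_pos[of t] by (meson less_le_trans zero_less_power)

section \<open>Comparison of partition sums at different base points\<close>

text \<open>The sum at \<open>r\<close> is compared by distortion with the one at the near point
  \<open>x\<close>. The sum of order \<open>n + N\<close> at \<open>q\<close> is then split in two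
  ways: from below by the single branch through \<open>x\<close>, from above by the crude bound
  \<open>S ^ N\<close>.\<close>

lemma near_preimage_bound:
  assumes t: "t > 1" and q: "q \<in> Kset" and x: "(F ^^ N) x = q" and r: "r \<in> Kset" "dist r x < r0"
    and D: "0 < D" "dn N x \<le> D" and S: "S \<ge> 1" "\<And>q n. q \<in> Kset \<Longrightarrow> Z t n q \<le> ennreal (S ^ n)"
  shows "Z t n r \<le> ennreal (Dc powr t * D powr t * S ^ N) * Z t n q"
proof -
  have xK: "x \<in> Kset" using x q F_pow_Kset_iff by blast
  have "D powr (- t) \<le> dn N x powr (- t)" using D dn_pos[OF xK] t by (intro powr_mono2') auto
  then have "ennreal (D powr (- t)) * Z t n x \<le> wt t N x * Z t n x" by (intro mult_right_mono ennreal_leI) auto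
  also have "\<dots> \<le> Z t (n + N) q" by (rule Z_ge_single[OF q x])
  also have "n + N = N + n" by simp
  also have "Z t (N + n) q \<le> ennreal (S ^ N) * Z t n q" by (rule Z_add_le[OF q S(2)])
  finally have a: "ennreal (D powr (- t)) * Z t n x \<le> ennreal (S ^ N) * Z t n q" .
  have "Z t n r \<le> ennreal (Dc powr t) * Z t n x" using t by (intro Z_distortion r xK) auto
  also have "\<dots> = ennreal (Dc powr t * D powr t) * (ennreal (D powr (- t)) * Z t n x)"
  proof -
    have "Dc powr t * D powr t * D powr (- t) = Dc powr t" using D(1) by (simp add: powr_minus)
    then have "ennreal (Dc powr t * D powr t) * ennreal (D powr (- t)) = ennreal (Dc powr t)"
      by (simp add: ennreal_mult[symmetric])
    then show ?thesis by (simp add: mult.assoc[symmetric])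
  qed
  also have "\<dots> \<le> ennreal (Dc powr t * D powr t) * (ennreal (S ^ N) * Z t n q)" by (intro mult_left_mono a) auto
  also have "\<dots> = ennreal (Dc powr t * D powr t * S ^ N) * Z t n q"
    using S(1) by (simp add: mult.assoc[symmetric] ennreal_mult)
  finally show ?thesis .
qed

lemma small_tail:
  assumes t: "t > 1" and e: "e > 0"
  shows "\<exists>X. \<forall>q\<in>Kset. (\<Sum>\<^sub>\<infinity>x\<in>{x \<in> F -` {q}. X \<le> Re_cyl x}. wt t 1 x) \<le> ennreal e"
proof -
  obtain B where B: "B > 0" "\<And>q X. q \<in> Kset \<Longrightarrow> X \<ge> - M - 2 \<Longrightarrow>
      (\<Sum>\<^sub>\<infinity>x\<in>{x \<in> F -` {q}. X \<le> Re_cyl x}. wt t 1 x) \<le> ennreal (B * exp ((1 - t) * X))"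
    using preimage_tail[OF t] by blast
  define X where "X = max (- M - 2) (ln (e / B) / (1 - t))"
  have X: "X \<ge> - M - 2" by (simp add: X_def)
  have tail: "B * exp ((1 - t) * X) \<le> e"
  proof -
    have "(1 - t) * X \<le> (1 - t) * (ln (e / B) / (1 - t))" using t by (intro mult_left_mono_neg) (auto simp: X_def)
    also have "\<dots> = ln (e / B)" using t by simp
    finally have "exp ((1 - t) * X) \<le> exp (ln (e / B))" by simp
    also have "\<dots> = e / B" using e B(1) by simp
    finally show ?thesis using B(1) by (simp add: field_simps)
  qed
  show ?thesis using order_trans[OF B(2)[OF _ X] ennreal_leI[OF tail]] by blast
qed

text \<open>Comparison with \<open>P0\<close> is uniform only for bounded real part. Preimages
  beyond \<open>X\<close> are handled by induction: their total weight is at most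
  \<open>q0 t / 2\<close>, half of what \<open>b t (Suc n) \<ge> q0 t * b t n\<close>
  returns.\<close>

lemma Z_upper:
  assumes t: "t > 1"
  obtains a where "a \<ge> 1" "\<And>n q. q \<in> Kset \<Longrightarrow> Z t n q \<le> ennreal (a * b t n)"
proof -
  obtain S where S: "S \<ge> 1" "\<And>q n. q \<in> Kset \<Longrightarrow> Z t n q \<le> ennreal (S ^ n)" using Z_le_power[OF t] by metis
  obtain X where X: "\<And>q. q \<in> Kset \<Longrightarrow> (\<Sum>\<^sub>\<infinity>x\<in>{x \<in> F -` {q}. X \<le> Re_cyl x}. wt t 1 x) \<le> ennreal (q0 t / 2)"
    using small_tail[OF t, of "q0 t / 2"] q0_pos[of t] by auto
  obtain N where N: "\<And>z. z \<in> K \<Longrightarrow> \<exists>x. cmod (x - z) < r0 \<and> (F ^^ N) (to_cyl x) = to_cyl p0"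
    using preimages_of_p0_dense[OF r0_pos] by blast
  obtain D where D: "D > 0" "\<And>x. x \<in> Kset \<Longrightarrow> Re_cyl x \<le> X + r0 \<Longrightarrow> dn N x \<le> D" using dn_bounded by blast
  define CX where "CX = Dc powr t * D powr t * S ^ N"
  have CX: "CX \<ge> 0" using S(1) by (simp add: CX_def)
  have low: "Z t n q \<le> ennreal (CX * b t n)" if q: "q \<in> Kset" "Re_cyl q \<le> X" for n q
  proof -
    obtain z where z: "to_cyl z = q" using to_cyl_surj by blast
    then obtain x where x: "cmod (x - z) < r0" "(F ^^ N) (to_cyl x) = P0" using N[of z] q by (auto simp: P0_def)
    have xK: "to_cyl x \<in> Kset" using F_pow_Kset_iff[of N "to_cyl x"] x(2) P0_K by simp
    have d: "dist q (to_cyl x) < r0" using dist_to_cyl_le[of z x] x(1) z by (simp add: norm_minus_commute)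
    have "dn N (to_cyl x) \<le> D" using D(2)[OF xK] Re_cyl_diff_le[of q "to_cyl x"] d q(2) by simp
    from near_preimage_bound[OF t P0_K x(2) q(1) d D(1) this S]
    show ?thesis using CX by (simp add: CX_def[symmetric] Z_P0[OF t] ennreal_mult[symmetric])
  qed
  \<comment> \<open>Makes the bounded part fit into the other half,
    \<open>q0 t / 2 * a * b t n\<close>.\<close>
  define a where "a = max 1 (2 * S * CX / q0 t)"
  have a: "a \<ge> 1" "S * CX \<le> q0 t / 2 * a"
  proof -
    have "2 * S * CX / q0 t \<le> a" by (simp add: a_def)
    then have "2 * S * CX \<le> a * q0 t" using q0_pos[of t] by (simp add: divide_le_eq)
    then show "a \<ge> 1" "S * CX \<le> q0 t / 2 * a" by (auto simp: a_def mult.commute)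
  qed
  have "Z t n q \<le> ennreal (a * b t n)" if "q \<in> Kset" for n q
    using that
  proof (induction n arbitrary: q)
    case 0
    then show ?case using a(1) by (simp add: Z_0 b_0)
  next
    case (Suc n)
    let ?R = "{x \<in> F -` {q}. X \<le> Re_cyl x}" and ?L = "{x \<in> F -` {q}. \<not> X \<le> Re_cyl x}"
    have bn: "b t n \<ge> 0" by (simp add: b_def)
    have xK: "x \<in> Kset" if "x \<in> F -` {q}" for x using that Suc.prems F_Kset_iff[of x] by simp
    have "(\<Sum>\<^sub>\<infinity>x\<in>?L. wt t 1 x * Z t n x) \<le> (\<Sum>\<^sub>\<infinity>x\<in>F -` {q}. ennreal (CX * b t n) * wt t 1 x)"
    proof (rule infsum_ennreal_mono)
      fix x assume "x \<in> ?L"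
      then show "wt t 1 x * Z t n x \<le> ennreal (CX * b t n) * wt t 1 x"
        using mult_right_mono[OF low[of x n], of "wt t 1 x"] xK[of x] by (simp add: mult.commute)
    qed auto
    also have "\<dots> = ennreal (CX * b t n) * Z t 1 q" by (simp add: infsum_ennreal_cmult Z_eq[OF Suc.prems])
    also have "\<dots> \<le> ennreal (CX * b t n) * ennreal S" using S(2)[OF Suc.prems, of 1] by (intro mult_left_mono) auto
    finally have sL: "(\<Sum>\<^sub>\<infinity>x\<in>?L. wt t 1 x * Z t n x) \<le> ennreal (CX * b t n) * ennreal S" .
    have "(\<Sum>\<^sub>\<infinity>x\<in>?R. wt t 1 x * Z t n x) \<le> (\<Sum>\<^sub>\<infinity>x\<in>?R. ennreal (a * b t n) * wt t 1 x)"
    proof (rule infsum_ennreal_mono)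
      fix x assume "x \<in> ?R"
      then have "Z t n x \<le> ennreal (a * b t n)" using Suc.IH xK by blast
      from mult_right_mono[OF this, of "wt t 1 x"] show "wt t 1 x * Z t n x \<le> ennreal (a * b t n) * wt t 1 x"
        by (simp add: mult.commute)
    qed auto
    also have "\<dots> = ennreal (a * b t n) * (\<Sum>\<^sub>\<infinity>x\<in>?R. wt t 1 x)" by (rule infsum_ennreal_cmult)
    also have "\<dots> \<le> ennreal (a * b t n) * ennreal (q0 t / 2)"
      using X[OF Suc.prems] by (intro mult_left_mono) auto
    finally have sR: "(\<Sum>\<^sub>\<infinity>x\<in>?R. wt t 1 x * Z t n x) \<le> ennreal (a * b t n) * ennreal (q0 t / 2)" .
    have "Z t (Suc n) q = (\<Sum>\<^sub>\<infinity>x\<in>F -` {q}. wt t 1 x * Z t n x)" using Z_add[OF Suc.prems, of t n 1] by simp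
    also have "F -` {q} = ?L \<union> ?R" by auto
    also have "(\<Sum>\<^sub>\<infinity>x\<in>?L \<union> ?R. wt t 1 x * Z t n x) = (\<Sum>\<^sub>\<infinity>x\<in>?L. wt t 1 x * Z t n x) + (\<Sum>\<^sub>\<infinity>x\<in>?R. wt t 1 x * Z t n x)"
      by (rule infsum_Un_disjoint) auto
    also have "\<dots> \<le> ennreal (CX * b t n) * ennreal S + ennreal (a * b t n) * ennreal (q0 t / 2)"
      by (rule add_mono[OF sL sR])
    also have "\<dots> = ennreal ((S * CX + a * q0 t / 2) * b t n)"
      using CX bn S(1) a(1) q0_pos[of t]
      by (simp add: ennreal_mult[symmetric] ennreal_plus[symmetric] algebra_simps del: ennreal_plus)
    also have "\<dots> \<le> ennreal (a * b t (Suc n))"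
    proof (rule ennreal_leI)
      have "(S * CX + a * q0 t / 2) * b t n \<le> (a * q0 t) * b t n"
      proof (rule mult_right_mono[OF _ bn])
        have "q0 t / 2 * a = a * q0 t / 2" by simp
        then show "S * CX + a * q0 t / 2 \<le> a * q0 t" using a(2) by linarith
      qed
      also have "\<dots> = a * (q0 t * b t n)" by simp
      also have "\<dots> \<le> a * b t (Suc n)" using a(1) b_Suc[OF t, of n] by (intro mult_left_mono) auto
      finally show "(S * CX + a * q0 t / 2) * b t n \<le> a * b t (Suc n)" .
    qed
    finally show ?case .
  qed
  then show thesis using that a(1) by blast
qed

text \<open>The constant depends on \<open>q\<close> through the derivative of one branch that leads
  from near \<open>p0\<close> to \<open>q\<close>; its logarithm divided by \<open>n\<close>
  vanishes in the limit.\<close>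

lemma Z_lower:
  assumes t: "t > 1" and q: "q \<in> Kset"
  obtains a where "a > 0" "\<And>n. ennreal (a * b t n) \<le> Z t n q"
proof -
  obtain S where S: "S \<ge> 1" "\<And>q n. q \<in> Kset \<Longrightarrow> Z t n q \<le> ennreal (S ^ n)" using Z_le_power[OF t] by metis
  obtain z where z: "to_cyl z = q" using to_cyl_surj by blast
  obtain N where "\<And>y. y \<in> K \<Longrightarrow> Re y \<le> Re z \<Longrightarrow> \<exists>x. cmod (x - p0) < r0 \<and> (F ^^ N) (to_cyl x) = to_cyl y"
    using reach_from_p0[OF r0_pos] by blast
  then obtain x where x: "cmod (x - p0) < r0" "(F ^^ N) (to_cyl x) = q" using z q by blast
  have xK: "to_cyl x \<in> Kset" using F_pow_Kset_iff[of N "to_cyl x"] x(2) q by simp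
  have d: "dist P0 (to_cyl x) < r0" using dist_to_cyl_le[of p0 x] x(1) by (simp add: P0_def norm_minus_commute)
  define D where "D = dn N (to_cyl x)"
  have D: "D > 0" using dn_pos[OF xK] by (simp add: D_def)
  define E where "E = Dc powr t * D powr t * S ^ N"
  have E: "E > 0" using S(1) D Dc_pos by (simp add: E_def)
  have "ennreal (1 / E * b t n) \<le> Z t n q" for n
  proof -
    have "ennreal (b t n) \<le> ennreal E * Z t n q"
      using near_preimage_bound[OF t q x(2) P0_K d D _ S] by (simp add: E_def D_def Z_P0[OF t])
    then have "ennreal (1 / E) * ennreal (b t n) \<le> ennreal (1 / E) * (ennreal E * Z t n q)" by (intro mult_left_mono) auto
    also have "\<dots> = Z t n q" using E by (simp add: mult.assoc[symmetric] ennreal_mult[symmetric])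
    finally show ?thesis using E by (simp add: ennreal_mult'[symmetric])
  qed
  then show thesis using that[of "1 / E"] E by simp
qed

lemma b_submult:
  assumes "t > 1"
  obtains a where "a \<ge> 1" "\<And>m n. b t (m + n) \<le> a * b t m * b t n"
proof -
  obtain a where a: "a \<ge> 1" "\<And>n q. q \<in> Kset \<Longrightarrow> Z t n q \<le> ennreal (a * b t n)" using Z_upper[OF assms] by metis
  have "b t (m + n) \<le> a * b t m * b t n" for m n
  proof -
    have "Z t (m + n) P0 \<le> ennreal (a * b t m) * Z t n P0" by (rule Z_add_le[OF P0_K a(2)])
    then have "ennreal (b t (m + n)) \<le> ennreal (a * b t m * b t n)"
      using a(1) by (simp add: Z_P0[OF assms] ennreal_mult[symmetric])
    then show ?thesis using a(1) by (simp add: ennreal_le_iff)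
  qed
  then show thesis using that a(1) by blast
qed

section \<open>Existence, monotonicity and convexity of the pressure\<close>

definition Pr :: "real \<Rightarrow> real" where "Pr t = lim (\<lambda>n. ln (b t n) / real n)"

lemma tendsto_Pr:
  assumes t: "t > 1"
  shows "(\<lambda>n. ln (b t n) / real n) \<longlonglongrightarrow> Pr t"
proof -
  obtain a where a: "a \<ge> 1" "\<And>m n. b t (m + n) \<le> a * b t m * b t n" using b_submult[OF t] by metis
  \<comment> \<open>The factor \<open>a\<close> turns submultiplicativity up to a constant into
    exact submultiplicativity, as Fekete's lemma requires.\<close>
  define u where "u n = ln (a * b t n)" for n
  have "u (m + n) \<le> u m + u n" for m n
  proof -
    have "ln (a * b t (m + n)) \<le> ln ((a * b t m) * (a * b t n))"
      using a(1) a(2)[of m n] b_pos[OF t] by (intro ln_mono) (auto simp: mult_ac intro!: mult_pos_pos)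
    also have "\<dots> = u m + u n" using a(1) b_pos[OF t] by (simp add: u_def ln_mult_pos)
    finally show ?thesis by (simp add: u_def)
  qed
  moreover have "- \<bar>ln (q0 t)\<bar> * real n \<le> u n" for n
  proof -
    have "q0 t ^ n \<le> 1 * b t n" using b_ge[OF t] by simp
    also have "\<dots> \<le> a * b t n" using a(1) b_pos[OF t, of n] by (intro mult_right_mono) auto
    finally have "ln (q0 t ^ n) \<le> u n" using q0_pos[of t] unfolding u_def by (intro ln_mono) auto
    moreover have "ln (q0 t ^ n) = real n * ln (q0 t)" using q0_pos[of t] by (simp add: ln_realpow)
    moreover have "real n * - \<bar>ln (q0 t)\<bar> \<le> real n * ln (q0 t)" by (intro mult_left_mono) auto
    ultimately show ?thesis by (simp add: mult.commute)
  qed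
  ultimately obtain L where L: "(\<lambda>n. u n / real n) \<longlonglongrightarrow> L" using subadditive_convergent[of u "\<bar>ln (q0 t)\<bar>"] by blast
  have "(\<lambda>n. u n / real n - ln a / real n) \<longlonglongrightarrow> L - 0"
    by (intro tendsto_diff L lim_const_over_n)
  moreover have "u n / real n - ln a / real n = ln (b t n) / real n" for n
    using a(1) b_pos[OF t, of n] by (simp add: u_def ln_mult_pos add_divide_distrib)
  ultimately have "(\<lambda>n. ln (b t n) / real n) \<longlonglongrightarrow> L" by simp
  then show ?thesis unfolding Pr_def by (simp add: limI)
qed

lemma pressure_limit:
  assumes t: "t > 1" and q: "q \<in> Kset"
  shows "(\<lambda>n. ln_ennreal (Z t n q) / ereal (real n)) \<longlonglongrightarrow> ereal (Pr t)"
proof -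
  obtain a where a: "a \<ge> 1" "\<And>n. Z t n q \<le> ennreal (a * b t n)" using Z_upper[OF t] q by metis
  obtain a' where a': "a' > 0" "\<And>n. ennreal (a' * b t n) \<le> Z t n q" using Z_lower[OF t q] by metis
  define r where "r n = enn2real (Z t n q)" for n
  have Zr: "Z t n q = ennreal (r n)" for n
    using a(2)[of n] unfolding r_def by (metis ennreal_enn2real ennreal_less_top order.strict_trans1)
  have bp: "b t n > 0" for n by (rule b_pos[OF t])
  have r: "a' * b t n \<le> r n" "r n \<le> a * b t n" for n
  proof -
    have "0 \<le> r n" "0 \<le> a * b t n" using a(1) bp[of n] by (simp_all add: r_def)
    then show "a' * b t n \<le> r n" "r n \<le> a * b t n"
      using a(2)[of n] a'(2)[of n] unfolding Zr by (simp_all only: ennreal_le_iff)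
  qed
  have rp: "r n > 0" for n using r(1)[of n] a'(1) bp[of n] by (meson less_le_trans mult_pos_pos)
  have "(\<lambda>n. ln (r n) / real n) \<longlonglongrightarrow> Pr t"
  proof (rule tendsto_sandwich[of "\<lambda>n. ln a' / real n + ln (b t n) / real n" _ _ "\<lambda>n. ln a / real n + ln (b t n) / real n"])
    have "(\<lambda>n. ln a' / real n + ln (b t n) / real n) \<longlonglongrightarrow> 0 + Pr t" by (intro tendsto_add lim_const_over_n tendsto_Pr[OF t])
    then show "(\<lambda>n. ln a' / real n + ln (b t n) / real n) \<longlonglongrightarrow> Pr t" by simp
    have "(\<lambda>n. ln a / real n + ln (b t n) / real n) \<longlonglongrightarrow> 0 + Pr t" by (intro tendsto_add lim_const_over_n tendsto_Pr[OF t])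
    then show "(\<lambda>n. ln a / real n + ln (b t n) / real n) \<longlonglongrightarrow> Pr t" by simp
    have "ln a' + ln (b t n) \<le> ln (r n)" "ln (r n) \<le> ln a + ln (b t n)" for n
      using r[of n] rp[of n] a'(1) a(1) bp[of n] by (auto simp: ln_mult_pos[symmetric] intro!: ln_mono)
    then show "\<forall>\<^sub>F n in sequentially. ln a' / real n + ln (b t n) / real n \<le> ln (r n) / real n"
      "\<forall>\<^sub>F n in sequentially. ln (r n) / real n \<le> ln a / real n + ln (b t n) / real n"
      by (auto simp: add_divide_distrib[symmetric] intro!: always_eventually divide_right_mono)
  qed
  then have lim: "(\<lambda>n. ereal (ln (r n) / real n)) \<longlonglongrightarrow> ereal (Pr t)" by (simp add: lim_ereal)
  have "eventually (\<lambda>n. ereal (ln (r n) / real n) = ln_ennreal (Z t n q) / ereal (real n)) sequentially"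
    using eventually_gt_at_top[of 0]
  proof eventually_elim
    case (elim n)
    then show ?case using rp[of n] by (simp add: Zr ln_ennreal_def)
  qed
  then show ?thesis by (rule Lim_transform_eventually[OF lim])
qed

lemma pressure_eq:
  assumes t: "t > 1"
  shows "pressure l c t = ereal (Pr t)"
  unfolding pressure_def julia_F_eq
proof (rule the_equality)
  show "\<forall>z\<in>Kset. (\<lambda>n. ln_ennreal (Z t n z) / ereal (real n)) \<longlonglongrightarrow> ereal (Pr t)"
    using pressure_limit[OF t] by blast
  fix p assume "\<forall>z\<in>Kset. (\<lambda>n. ln_ennreal (Z t n z) / ereal (real n)) \<longlonglongrightarrow> p"
  then have "(\<lambda>n. ln_ennreal (Z t n P0) / ereal (real n)) \<longlonglongrightarrow> p" using P0_K by blast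
  then show "p = ereal (Pr t)" using pressure_limit[OF t P0_K] by (rule LIMSEQ_unique)
qed

text \<open>Derivatives of order \<open>n\<close> are at least
  \<open>\<epsilon> / T * \<mu> ^ n\<close>, so raising the exponent by \<open>d\<close> costs at
  least this to the power \<open>d\<close>. The explicit slope gives both strictness and an exponent
  at which the pressure is no longer positive.\<close>

lemma Pr_decreasing:
  assumes t: "1 < t" "t \<le> t'"
  shows "Pr t' \<le> Pr t - (t' - t) * ln \<mu>"
proof -
  define d where "d = t' - t"
  have t': "1 < t'" using t by simp
  have step: "ln (b t' n) \<le> ln (b t n) - d * (ln (\<epsilon> / T) + real n * ln \<mu>)" for n
  proof -
    have eT: "\<epsilon> / T > 0" "\<epsilon> / T * \<mu> ^ n > 0" using \<epsilon>(1) T_pos \<mu> by auto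
    have "Z t' n P0 \<le> (\<Sum>\<^sub>\<infinity>x\<in>(F ^^ n) -` {P0}. ennreal ((\<epsilon> / T * \<mu> ^ n) powr (- d)) * wt t n x)"
      unfolding Z_eq[OF P0_K]
    proof (rule infsum_ennreal_mono)
      fix x assume "x \<in> (F ^^ n) -` {P0}"
      then have x: "x \<in> Kset" by (rule Kset_preimage[OF P0_K])
      have "dn n x powr (- t') = dn n x powr (- d) * dn n x powr (- t)"
        by (simp add: powr_add[symmetric] d_def)
      also have "\<dots> \<le> (\<epsilon> / T * \<mu> ^ n) powr (- d) * dn n x powr (- t)"
        using dn_expand[OF x, of n] eT t by (intro mult_right_mono powr_mono2') (auto simp: d_def)
      finally show "wt t' n x \<le> ennreal ((\<epsilon> / T * \<mu> ^ n) powr (- d)) * wt t n x"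
        by (simp add: ennreal_mult[symmetric] ennreal_leI)
    qed auto
    then have "ennreal (b t' n) \<le> ennreal ((\<epsilon> / T * \<mu> ^ n) powr (- d)) * ennreal (b t n)"
      by (simp add: infsum_ennreal_cmult Z_eq[OF P0_K, symmetric] Z_P0[OF t(1)] Z_P0[OF t'])
    then have "b t' n \<le> (\<epsilon> / T * \<mu> ^ n) powr (- d) * b t n"
      using b_pos[OF t(1), of n] by (simp add: ennreal_mult[symmetric] ennreal_le_iff)
    then have "ln (b t' n) \<le> ln ((\<epsilon> / T * \<mu> ^ n) powr (- d) * b t n)"
      using b_pos[OF t', of n] by (intro ln_mono) auto
    also have "\<dots> = ln ((\<epsilon> / T * \<mu> ^ n) powr (- d)) + ln (b t n)"
    proof (rule ln_mult_pos)
      show "0 < (\<epsilon> / T * \<mu> ^ n) powr (- d)" unfolding powr_gt_zero using eT(2) by (rule less_imp_neq[THEN not_sym])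
    qed (rule b_pos[OF t(1)])
    also have "ln ((\<epsilon> / T * \<mu> ^ n) powr (- d)) = - d * ln (\<epsilon> / T * \<mu> ^ n)" using eT by (simp add: ln_powr)
    also have "ln (\<epsilon> / T * \<mu> ^ n) = ln (\<epsilon> / T) + real n * ln \<mu>" using eT \<mu> by (subst ln_mult_pos) (auto simp: ln_realpow)
    finally show ?thesis by simp
  qed
  have "Pr t' \<le> Pr t - d * (0 + ln \<mu>)"
  proof (rule LIMSEQ_le[OF tendsto_Pr[OF t']])
    show "(\<lambda>n. ln (b t n) / real n - d * (ln (\<epsilon> / T) / real n + ln \<mu>)) \<longlonglongrightarrow> Pr t - d * (0 + ln \<mu>)"
      by (intro tendsto_diff tendsto_mult tendsto_add lim_const_over_n tendsto_Pr[OF t(1)] tendsto_const)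
    have "ln (b t' n) / real n \<le> ln (b t n) / real n - d * (ln (\<epsilon> / T) / real n + ln \<mu>)" if "n \<ge> 1" for n
    proof -
      have "ln (b t' n) / real n \<le> (ln (b t n) - d * (ln (\<epsilon> / T) + real n * ln \<mu>)) / real n" using step[of n] by (intro divide_right_mono) auto
      also have "\<dots> = ln (b t n) / real n - d * (ln (\<epsilon> / T) / real n + ln \<mu>)" using that by (simp add: field_simps)
      finally show ?thesis .
    qed
    then show "\<exists>N. \<forall>n\<ge>N. ln (b t' n) / real n \<le> ln (b t n) / real n - d * (ln (\<epsilon> / T) / real n + ln \<mu>)" by blast
  qed
  then show ?thesis by (simp add: d_def)
qed

text \<open>Hoelder's inequality for the partition sums, in the form of Young's inequality for normalised summands.\<close>

lemma Pr_convex: "convex_on {1<..} Pr"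
proof (rule convex_onI)
  fix u t t' :: real assume u: "0 < u" "u < 1" and t: "t \<in> {1<..}" "t' \<in> {1<..}"
  define s' where "s' = (1 - u) * t + u * t'"
  have t1: "1 < t" "1 < t'" using t by auto
  have "0 < (1 - u) * (t - 1) + u * (t' - 1)" using u t1 by (intro add_pos_pos mult_pos_pos) auto
  then have s1: "1 < s'" by (simp add: s'_def algebra_simps)
  have step: "ln (b s' n) \<le> (1 - u) * ln (b t n) + u * ln (b t' n)" for n
  proof -
    define A B where "A = b t n" and "B = b t' n"
    have AB: "A > 0" "B > 0" using b_pos t1 by (auto simp: A_def B_def)
    \<comment> \<open>The geometric mean of the two sums. Divided by \<open>A\<close> and
      \<open>B\<close>, the summands have total 1 each, and Young's inequality adds up to
      \<open>(1 - u) + u = 1\<close>.\<close>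
    define k where "k = A powr (1 - u) * B powr u"
    have "Z s' n P0 \<le> (\<Sum>\<^sub>\<infinity>x\<in>(F ^^ n) -` {P0}. ennreal (k * (1 - u) / A) * wt t n x + ennreal (k * u / B) * wt t' n x)"
      unfolding Z_eq[OF P0_K]
    proof (rule infsum_ennreal_mono)
      fix x assume "x \<in> (F ^^ n) -` {P0}"
      then have d: "dn n x > 0" using dn_pos Kset_preimage[OF P0_K] by blast
      define y where "y = dn n x"
      have "y powr (- s') = y powr (- t * (1 - u)) * y powr (- t' * u)" by (simp add: s'_def powr_add[symmetric] algebra_simps)
      also have "\<dots> = (y powr (- t)) powr (1 - u) * (y powr (- t')) powr u" by (simp add: powr_powr)
      also have "\<dots> = k * ((y powr (- t) / A) powr (1 - u) * (y powr (- t') / B) powr u)"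
        using AB by (simp add: k_def powr_divide)
      also have "\<dots> \<le> k * ((1 - u) * (y powr (- t) / A) + u * (y powr (- t') / B))"
        using u AB d by (intro mult_left_mono Youngs_inequality_0) (auto simp: k_def y_def)
      also have "\<dots> = k * (1 - u) / A * y powr (- t) + k * u / B * y powr (- t')" by (simp add: algebra_simps)
      finally show "wt s' n x \<le> ennreal (k * (1 - u) / A) * wt t n x + ennreal (k * u / B) * wt t' n x"
        using u AB by (simp add: y_def k_def ennreal_mult[symmetric] ennreal_plus[symmetric] ennreal_leI del: ennreal_plus)
    qed auto
    also have "\<dots> = (\<Sum>\<^sub>\<infinity>x\<in>(F ^^ n) -` {P0}. ennreal (k * (1 - u) / A) * wt t n x) + (\<Sum>\<^sub>\<infinity>x\<in>(F ^^ n) -` {P0}. ennreal (k * u / B) * wt t' n x)"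
      by (rule infsum_add) auto
    also have "\<dots> = ennreal (k * (1 - u) / A) * ennreal A + ennreal (k * u / B) * ennreal B"
      by (simp add: infsum_ennreal_cmult Z_eq[OF P0_K, symmetric] Z_P0 t1 A_def B_def)
    also have "\<dots> = ennreal k"
    proof -
      have k0: "k > 0" using AB by (simp add: k_def)
      have "ennreal (k * (1 - u) / A) * ennreal A = ennreal (k * (1 - u))" "ennreal (k * u / B) * ennreal B = ennreal (k * u)"
        using u AB k0 by (simp_all add: ennreal_mult[symmetric])
      moreover have "ennreal (k * (1 - u)) + ennreal (k * u) = ennreal (k * (1 - u) + k * u)"
        using u k0 by (intro ennreal_plus[symmetric]) auto
      ultimately show ?thesis by (simp add: algebra_simps)
    qed
    finally have "b s' n \<le> k" using b_pos[OF s1, of n] AB by (simp add: Z_P0[OF s1] ennreal_le_iff k_def)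
    then have "ln (b s' n) \<le> ln k" using b_pos[OF s1, of n] by (intro ln_mono) auto
    also have "ln k = (1 - u) * ln A + u * ln B" using AB by (simp add: k_def ln_mult_pos ln_powr)
    finally show ?thesis by (simp add: A_def B_def)
  qed
  have "Pr s' \<le> (1 - u) * Pr t + u * Pr t'"
  proof (rule LIMSEQ_le[OF tendsto_Pr[OF s1]])
    show "(\<lambda>n. (1 - u) * (ln (b t n) / real n) + u * (ln (b t' n) / real n)) \<longlonglongrightarrow> (1 - u) * Pr t + u * Pr t'"
      by (intro tendsto_intros tendsto_Pr t1)
    have "ln (b s' n) / real n \<le> (1 - u) * (ln (b t n) / real n) + u * (ln (b t' n) / real n)" for n
      using divide_right_mono[OF step[of n], of "real n"] by (simp add: add_divide_distrib)
    then show "\<exists>N. \<forall>n\<ge>N. ln (b s' n) / real n \<le> (1 - u) * (ln (b t n) / real n) + u * (ln (b t' n) / real n)" by blast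
  qed
  then show "Pr ((1 - u) *\<^sub>R t + u *\<^sub>R t') \<le> (1 - u) * Pr t + u * Pr t'" unfolding s'_def real_scaleR_def .
qed (rule convex_real_interval)

section \<open>Positive pressure for some exponent above 1\<close>

text \<open>The preimage for \<open>k\<close> is found near the \<open>y\<close> with
  \<open>exp y = - \<i> * of_real (2 * pi * real k)\<close>: there the exponential supplies exactly
  \<open>per (int k)\<close>. The remaining error is \<open>Re q\<close> plus terms logarithmic in
  \<open>k\<close>, against a covered disc of size about \<open>k\<close>. The lower limit
  \<open>X\<^sup>2\<close> on \<open>k\<close> makes \<open>Re q\<close> negligible, the upper one
  keeps the preimage within \<open>Re_cyl x \<le> X\<close>.\<close>

lemma restricted_preimages:
  "\<exists>X0\<ge>1. \<forall>X\<ge>X0. \<forall>q\<in>Kset. Re_cyl q \<le> X \<longrightarrow> (\<exists>x :: nat \<Rightarrow> cylinder.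
     inj_on x {nat \<lceil>X\<^sup>2\<rceil>..nat \<lfloor>exp X / 20\<rfloor>} \<and>
     (\<forall>k\<in>{nat \<lceil>X\<^sup>2\<rceil>..nat \<lfloor>exp X / 20\<rfloor>}. x k \<in> F -` {q} \<and> Re_cyl (x k) \<le> X \<and> dn 1 (x k) \<le> 10 * real k))"
proof -
  \<comment> \<open>\<open>M + 1\<close> comes from \<open>Re z\<close>, 4 bounds \<open>pi\<close>,
    and \<open>5 * real l\<close> covers \<open>l\<close> times the constant 4.5 in the bound on
    \<open>cmod y\<close>.\<close>
  define c0 where "c0 = M + 1 + 4 + cmod C + 5 * real l"
  have "eventually (\<lambda>r::real. c0 + sqrt r + real l * ln r < r / 6) at_top" by real_asymp
  then obtain r1 where r1: "\<And>r. r \<ge> r1 \<Longrightarrow> c0 + sqrt r + real l * ln r < r / 6" unfolding eventually_at_top_linorder by blast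
  define X0 where "X0 = max (max 1 r1) (real l + 1)"
  have ex: "\<exists>x :: nat \<Rightarrow> cylinder.
     inj_on x {nat \<lceil>X\<^sup>2\<rceil>..nat \<lfloor>exp X / 20\<rfloor>} \<and>
     (\<forall>k\<in>{nat \<lceil>X\<^sup>2\<rceil>..nat \<lfloor>exp X / 20\<rfloor>}. x k \<in> F -` {q} \<and> Re_cyl (x k) \<le> X \<and> dn 1 (x k) \<le> 10 * real k)"
    if X: "X \<ge> X0" and q: "q \<in> Kset" "Re_cyl q \<le> X" for X q
  proof -
    have X1: "X \<ge> 1" "X \<ge> r1" "X \<ge> real l + 1" using X by (auto simp: X0_def)
    obtain z where z: "to_cyl z = q" "\<bar>Im z\<bar> \<le> pi" using lift_strip by blast
    have "z \<in> K" "Re z \<le> X" using z(1) q by auto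
    then have zRe: "\<bar>Re z\<bar> \<le> X + M + 1" using K_Re[of z] X1(1) norm_ge_zero[of C] unfolding M_def by linarith
    have pi4: "pi < 4" by (rule pi_less_4)
    have "\<exists>u y. exp y = - \<i> * of_real (2 * pi * real k) \<and> Im y = - (pi / 2) \<and> cmod (u - y) < 1 / 12 \<and> f u = z + per (int k)
        \<and> Re u \<le> X \<and> cmod (of_nat l - exp u) \<le> 10 * real k"
      if k: "k \<in> {nat \<lceil>X\<^sup>2\<rceil>..nat \<lfloor>exp X / 20\<rfloor>}" for k
    proof -
      have "X\<^sup>2 \<le> real k" using k by (simp add: nat_le_iff ceiling_le_iff)
      have X2: "X \<le> X\<^sup>2" using X1(1) by (simp add: power2_eq_square)
      have kX: "X \<le> real k" "real k \<ge> 1" using X2 \<open>X\<^sup>2 \<le> real k\<close> X1(1) by linarith+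
      have sq: "X \<le> sqrt (real k)" using \<open>X\<^sup>2 \<le> real k\<close> by (rule real_le_rsqrt)
      have "0 \<le> \<lfloor>exp X / 20\<rfloor>" by simp
      moreover have "k \<le> nat \<lfloor>exp X / 20\<rfloor>" using k by simp
      ultimately have ke: "real k \<le> exp X / 20" by linarith
      define w where "w = 2 * pi * real k"
      have w: "w > 0" "4 * real k \<le> w" "w \<le> 8 * real k" using kX pi_ge_two pi4 by (auto simp: w_def)
      define y where "y = Complex (ln w) (- (pi / 2))"
      have ey: "exp y = - \<i> * of_real w" using w(1) by (simp add: y_def exp_eq_polar cis.ctr complex_eq_iff Re_exp Im_exp)
      have fy: "f y = C + of_nat l * y + per (int k)" by (simp add: f_eq ey w_def)
      have "ln w \<le> ln (8 * real k)" using w by simp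
      also have "\<dots> = ln 8 + ln (real k)" using kX by (simp add: ln_mult)
      also have "ln 8 \<le> (2.5 :: real)"
      proof -
        have "ln (8::real) = 3 * ln 2" using ln_realpow[of 2 3] by simp
        also have "\<dots> \<le> 3 * (25/36)" using ln_2_less_1 ln2_le_25_over_36 by (intro mult_left_mono) auto
        finally show ?thesis by simp
      qed
      finally have lnw: "ln w \<le> 2.5 + ln (real k)" by simp
      have lnw0: "ln w \<ge> 0" using w kX by simp
      have "cmod y \<le> \<bar>Re y\<bar> + \<bar>Im y\<bar>" by (rule cmod_le)
      also have "\<dots> \<le> (2.5 + ln (real k)) + 2" using lnw lnw0 pi4 by (simp add: y_def)
      finally have cy: "cmod y \<le> 4.5 + ln (real k)" by simp
      have "cmod z \<le> X + M + 1 + 4" using cmod_le[of z] zRe z(2) pi4 by linarith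
      have bound: "cmod ((z + per (int k)) - (f y - 0 * y)) < 1 / 12 * exp (Re y) / 2"
      proof -
        have "(z + per (int k)) - (f y - 0 * y) = z - (C + of_nat l * y)" by (simp add: fy)
        also have "cmod \<dots> \<le> cmod z + (cmod C + real l * cmod y)"
          using norm_triangle_ineq4[of z "C + of_nat l * y"] norm_triangle_ineq[of C "of_nat l * y"] by (simp add: norm_mult)
        also have "\<dots> \<le> (X + M + 1 + 4) + (cmod C + real l * (4.5 + ln (real k)))"
          using \<open>cmod z \<le> _\<close> cy by (intro add_mono mult_left_mono) auto
        also have "\<dots> \<le> c0 + sqrt (real k) + real l * ln (real k)"
          using sq by (simp add: c0_def algebra_simps)
        also have "\<dots> < real k / 6" using r1 X1(2) kX(1) by simp
        also have "\<dots> \<le> 1 / 12 * exp (Re y) / 2" using w by (simp add: y_def)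
        finally show ?thesis .
      qed
      have "4 * (real l + 1) \<le> exp (Re y)" using w kX X1(3) by (simp add: y_def)
      then obtain u where u: "cmod (u - y) < 1 / 12" "f u - 0 * u = z + per (int k)"
        using far_cover[of y 0 "1/12" "z + per (int k)"] bound by auto
      have e12: "exp (1 / 12) \<le> (12 / 11 :: real)"
      proof -
        have "1 + (- 1 / 12) \<le> exp (- 1 / 12 :: real)" by (rule exp_ge_add_one_self)
        then have "11 / 12 * exp (1 / 12) \<le> exp (- 1 / 12) * exp (1 / 12 :: real)" by (intro mult_right_mono) auto
        also have "\<dots> = 1" by (simp add: exp_add[symmetric])
        finally show ?thesis by simp
      qed
      have Reu: "Re u \<le> ln w + 1 / 12" using abs_Re_le_cmod[of "u - y"] u(1) by (simp add: y_def)
      then have "exp (Re u) \<le> exp (ln w + 1 / 12)" by simp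
      also have "\<dots> = w * exp (1 / 12)" using w by (simp add: exp_add)
      also have "\<dots> \<le> w * (12 / 11)" using w e12 by (intro mult_left_mono) auto
      finally have eu: "exp (Re u) \<le> 9 * real k" using w kX by simp
      have "exp (Re u) \<le> exp X" using eu ke exp_gt_zero[of X] by linarith
      then have "Re u \<le> X" by simp
      moreover have "cmod (of_nat l - exp u) \<le> real l + exp (Re u)" using norm_triangle_ineq4[of "of_nat l" "exp u"] by simp
      then have "cmod (of_nat l - exp u) \<le> 10 * real k" using eu kX(1) X1(3) by linarith
      ultimately show ?thesis using u ey by (intro exI[of _ u] exI[of _ y]) (auto simp: w_def y_def)
    qed
    then obtain u y where uy: "\<And>k. k \<in> {nat \<lceil>X\<^sup>2\<rceil>..nat \<lfloor>exp X / 20\<rfloor>} \<Longrightarrow>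
        Im (y k) = - (pi / 2) \<and> cmod (u k - y k) < 1 / 12 \<and> f (u k) = z + per (int k) \<and> Re (u k) \<le> X \<and> cmod (of_nat l - exp (u k)) \<le> 10 * real k"
      by metis
    show ?thesis
    proof (intro exI[of _ "\<lambda>k. to_cyl (u k)"] conjI ballI)
      show "inj_on (\<lambda>k. to_cyl (u k)) {nat \<lceil>X\<^sup>2\<rceil>..nat \<lfloor>exp X / 20\<rfloor>}"
      proof (rule inj_onI)
        fix k k' assume k: "k \<in> {nat \<lceil>X\<^sup>2\<rceil>..nat \<lfloor>exp X / 20\<rfloor>}" "k' \<in> {nat \<lceil>X\<^sup>2\<rceil>..nat \<lfloor>exp X / 20\<rfloor>}" and eq: "to_cyl (u k) = to_cyl (u k')"
        obtain j where j: "u k = u k' + per j" using eq to_cyl_eqE by blast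
        have "\<bar>Im (u k - y k)\<bar> < 1 / 12" "\<bar>Im (u k' - y k')\<bar> < 1 / 12"
          using uy[OF k(1)] uy[OF k(2)] abs_Im_le_cmod le_less_trans by blast+
        moreover have "Im (y k) = - (pi / 2)" "Im (y k') = - (pi / 2)" using uy[OF k(1)] uy[OF k(2)] by auto
        ultimately have "\<bar>Im (u k) - Im (u k')\<bar> < 1 / 6" by (simp only: minus_complex.sel)
        then have "\<bar>2 * pi * real_of_int j\<bar> < 1 / 6" by (simp add: j)
        moreover have "1 * \<bar>real_of_int j\<bar> \<le> 2 * pi * \<bar>real_of_int j\<bar>" using pi_ge_two by (intro mult_right_mono) auto
        ultimately have "\<bar>real_of_int j\<bar> < 1" by (simp add: abs_mult)
        then have "j = 0" by linarith
        then have "f (u k) = f (u k')" using j by simp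
        then have "per (int k) = per (int k')" using uy[OF k(1)] uy[OF k(2)] by simp
        then show "k = k'" by simp
      qed
      fix k assume k: "k \<in> {nat \<lceil>X\<^sup>2\<rceil>..nat \<lfloor>exp X / 20\<rfloor>}"
      show "to_cyl (u k) \<in> F -` {q}" 
      proof -
        have "to_cyl (f (u k)) = to_cyl (z + per (int k))" using uy[OF k] by (intro arg_cong[where f = to_cyl]) blast
        then show ?thesis unfolding to_cyl_per by (simp add: F_map_to_cyl z(1))
      qed
      show "Re_cyl (to_cyl (u k)) \<le> X" using uy[OF k] by simp
      show "dn 1 (to_cyl (u k)) \<le> 10 * real k" using uy[OF k] F_deriv_norm_1[of l c "u k"] by simp
    qed
  qed
  then show ?thesis by (intro exI[of _ X0]) (auto simp: X0_def)
qed

text \<open>The weights dominate a multiple of \<open>1 / k\<close>, and over the admissible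
  \<open>k\<close> the harmonic sum exceeds 20 once \<open>X\<close> is large. Derivatives at most
  \<open>10 * k\<close> and the loss \<open>3 / 4\<close> due to the exponent \<open>t\<close> leave
  \<open>20 * (3 / 40) = 3 / 2\<close>.\<close>

lemma restricted_growth:
  "\<exists>X t. Re p0 \<le> X \<and> t > 1 \<and> (\<forall>q\<in>Kset. Re_cyl q \<le> X \<longrightarrow> ennreal (3 / 2) \<le> (\<Sum>\<^sub>\<infinity>x\<in>{x \<in> F -` {q}. Re_cyl x \<le> X}. wt t 1 x))"
proof -
  obtain X0 where X0: "X0 \<ge> 1" "\<And>X q. X \<ge> X0 \<Longrightarrow> q \<in> Kset \<Longrightarrow> Re_cyl q \<le> X \<Longrightarrow> (\<exists>x :: nat \<Rightarrow> cylinder.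
     inj_on x {nat \<lceil>X\<^sup>2\<rceil>..nat \<lfloor>exp X / 20\<rfloor>} \<and>
     (\<forall>k\<in>{nat \<lceil>X\<^sup>2\<rceil>..nat \<lfloor>exp X / 20\<rfloor>}. x k \<in> F -` {q} \<and> Re_cyl (x k) \<le> X \<and> dn 1 (x k) \<le> 10 * real k))"
    using restricted_preimages by blast
  have "eventually (\<lambda>X::real. exp 20 * (X\<^sup>2 + 1) < exp X / 20) at_top" by real_asymp
  then obtain X1 :: real where X1: "\<And>X. X \<ge> X1 \<Longrightarrow> exp 20 * (X\<^sup>2 + 1) < exp X / 20" unfolding eventually_at_top_linorder by blast
  define X where "X = max (max X0 X1) (Re p0)"
  have X: "X \<ge> X0" "X \<ge> X1" "X \<ge> Re p0" "X \<ge> 1" using X0(1) by (auto simp: X_def)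
  define a d where "a = nat \<lceil>X\<^sup>2\<rceil>" and "d = nat \<lfloor>exp X / 20\<rfloor>"
  have a: "real a \<le> X\<^sup>2 + 1" "1 \<le> a"
  proof -
    have "X\<^sup>2 \<ge> 1" using X(4) by simp
    then show "real a \<le> X\<^sup>2 + 1" "1 \<le> a" unfolding a_def by linarith+
  qed
  have d: "exp X / 20 < real d + 1" "real d \<le> exp X / 20"
  proof -
    have "real d = real_of_int \<lfloor>exp X / 20\<rfloor>" by (simp add: d_def)
    then show "exp X / 20 < real d + 1" "real d \<le> exp X / 20" by linarith+
  qed
  have big: "exp 20 * real a \<le> real d + 1"
  proof -
    have "exp 20 * real a \<le> exp 20 * (X\<^sup>2 + 1)" using a by (intro mult_left_mono) auto
    then show ?thesis using X1[OF X(2)] d by linarith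
  qed
  have ad: "a \<le> d"
  proof -
    have "1 + (20::real) \<le> exp 20" by (rule exp_ge_add_one_self)
    then have "21 * real a \<le> exp 20 * real a" by (intro mult_right_mono) auto
    then have "21 * real a \<le> real d + 1" using big by linarith
    then show ?thesis using a(2) by linarith
  qed
  have "20 = ln (exp (20::real))" by simp
  also have "\<dots> \<le> ln ((real d + 1) / real a)" using big a by (intro ln_mono) (auto simp: field_simps)
  also have "\<dots> \<le> (\<Sum>k\<in>{a..d}. 1 / real k)" by (rule sum_inverse_ge_ln[OF a(2) ad])
  finally have harm: "20 \<le> (\<Sum>k\<in>{a..d}. 1 / real k)" .
  \<comment> \<open>Derivatives are at most \<open>exp X\<close>, so the excess \<open>t - 1\<close>
    of the exponent costs at most the factor \<open>3 / 4\<close>.\<close>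
  define t where "t = 1 + ln (4 / 3) / X"
  have t: "t > 1" using X(4) by (simp add: t_def)
  have "ennreal (3 / 2) \<le> (\<Sum>\<^sub>\<infinity>x\<in>{x \<in> F -` {q}. Re_cyl x \<le> X}. wt t 1 x)" if q: "q \<in> Kset" "Re_cyl q \<le> X" for q
  proof -
    obtain x :: "nat \<Rightarrow> cylinder" where x: "inj_on x {a..d}"
      "\<And>k. k \<in> {a..d} \<Longrightarrow> x k \<in> F -` {q} \<and> Re_cyl (x k) \<le> X \<and> dn 1 (x k) \<le> 10 * real k"
      using X0(2)[OF X(1) q] unfolding a_def[symmetric] d_def[symmetric] by blast
    have wk: "ennreal (3 / 40 * (1 / real k)) \<le> wt t 1 (x k)" if k: "k \<in> {a..d}" for k
    proof -
      have "x k \<in> Kset" using x(2)[OF k] q F_Kset_iff[of "x k"] by auto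
      then have dp: "dn 1 (x k) > 0" by (rule dn_pos)
      have kp: "real k \<ge> 1" "real k \<le> real d" using k a by auto
      have "dn 1 (x k) \<le> exp X" using x(2)[OF k] d(2) kp exp_gt_zero[of X] by linarith
      then have "(exp X) powr (- (t - 1)) \<le> dn 1 (x k) powr (- (t - 1))" using dp t by (intro powr_mono2') auto
      moreover have "(exp X) powr (- (t - 1)) = 3 / 4"
      proof -
        have "(exp X) powr (- (t - 1)) = exp (- ln (4 / 3))" using X(4) by (simp add: powr_def t_def)
        also have "\<dots> = 3 / 4" by (simp add: exp_minus)
        finally show ?thesis .
      qed
      moreover have "1 / (10 * real k) \<le> 1 / dn 1 (x k)" using x(2)[OF k] dp by (intro divide_left_mono) auto
      ultimately have "1 / (10 * real k) * (3 / 4) \<le> 1 / dn 1 (x k) * dn 1 (x k) powr (- (t - 1))"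
        using dp by (intro mult_mono) auto
      also have "\<dots> = dn 1 (x k) powr (-1) * dn 1 (x k) powr (- (t - 1))" using dp by (simp add: powr_minus_divide)
      also have "\<dots> = dn 1 (x k) powr (- t)" by (subst powr_add[symmetric]) simp
      finally show ?thesis by (intro ennreal_leI) simp
    qed
    have "ennreal (3 / 2) \<le> ennreal (\<Sum>k\<in>{a..d}. 3 / 40 * (1 / real k))"
      using harm by (intro ennreal_leI) (simp only: sum_distrib_left[symmetric])
    also have "\<dots> = (\<Sum>k\<in>{a..d}. ennreal (3 / 40 * (1 / real k)))" by (rule sum_ennreal[symmetric]) auto
    also have "\<dots> = (\<Sum>\<^sub>\<infinity>k\<in>{a..d}. ennreal (3 / 40 * (1 / real k)))" by simp
    also have "\<dots> \<le> (\<Sum>\<^sub>\<infinity>x\<in>{x \<in> F -` {q}. Re_cyl x \<le> X}. wt t 1 x)"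
      by (rule infsum_ennreal_inj_le[OF x(1)]) (use x(2) wk in auto)
    finally show ?thesis .
  qed
  then show ?thesis using X(3) t by blast
qed

text \<open>In the subtree of preimages that stay within \<open>Re_cyl x \<le> X\<close> every
  generation multiplies the sum by at least \<open>3 / 2\<close>.\<close>

lemma Pr_pos: "\<exists>t>1. Pr t > 0"
proof -
  obtain X t where Xt: "Re p0 \<le> X" "t > 1"
    "\<And>q. q \<in> Kset \<Longrightarrow> Re_cyl q \<le> X \<Longrightarrow> ennreal (3 / 2) \<le> (\<Sum>\<^sub>\<infinity>x\<in>{x \<in> F -` {q}. Re_cyl x \<le> X}. wt t 1 x)"
    using restricted_growth by blast
  have grow: "ennreal ((3 / 2) ^ n) \<le> Z t n q" if "q \<in> Kset" "Re_cyl q \<le> X" for n q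
    using that
  proof (induction n arbitrary: q)
    case (Suc n)
    have "ennreal ((3 / 2) ^ Suc n) = ennreal ((3 / 2) ^ n) * ennreal (3 / 2)" by (simp add: ennreal_mult[symmetric] mult.commute)
    also have "\<dots> \<le> ennreal ((3 / 2) ^ n) * (\<Sum>\<^sub>\<infinity>x\<in>{x \<in> F -` {q}. Re_cyl x \<le> X}. wt t 1 x)"
      by (intro mult_left_mono Xt(3)[OF Suc.prems]) auto
    also have "\<dots> = (\<Sum>\<^sub>\<infinity>x\<in>{x \<in> F -` {q}. Re_cyl x \<le> X}. ennreal ((3 / 2) ^ n) * wt t 1 x)"
      by (rule infsum_ennreal_cmult[symmetric])
    also have "\<dots> \<le> (\<Sum>\<^sub>\<infinity>x\<in>F -` {q}. wt t 1 x * Z t n x)"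
    proof (rule infsum_ennreal_mono)
      fix x assume x: "x \<in> {x \<in> F -` {q}. Re_cyl x \<le> X}"
      then have "x \<in> Kset" using Suc.prems(1) F_Kset_iff[of x] by auto
      then have "ennreal ((3 / 2) ^ n) \<le> Z t n x" using Suc.IH x by blast
      from mult_right_mono[OF this, of "wt t 1 x"] show "ennreal ((3 / 2) ^ n) * wt t 1 x \<le> wt t 1 x * Z t n x"
        by (simp add: mult.commute)
    qed auto
    also have "\<dots> = Z t (Suc n) q" using Z_add[OF Suc.prems(1), of t n 1] by simp
    finally show ?case .
  qed (simp add: Z_0)
  have "(3 / 2) ^ n \<le> b t n" for n
    using grow[OF P0_K, of n] Xt(1) b_pos[OF Xt(2), of n] by (simp add: Z_P0[OF Xt(2)] P0_def[symmetric] ennreal_le_iff) (simp add: P0_def ennreal_le_iff)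
  then have "real n * ln (3 / 2) \<le> ln (b t n)" for n
    using ln_mono[of "(3/2) ^ n" "b t n"] by (simp add: ln_realpow)
  then have "ln (3 / 2) \<le> ln (b t n) / real n" if "n \<ge> 1" for n using that by (simp add: field_simps)
  then have "ln (3 / 2) \<le> Pr t" by (intro LIMSEQ_le_const[OF tendsto_Pr[OF Xt(2)]]) blast
  moreover have "ln (3 / 2 :: real) > 0" by simp
  ultimately show ?thesis using Xt(2) by (intro exI[of _ t]) linarith
qed

lemma Pr_zero: "\<exists>h>1. Pr h = 0"
proof -
  obtain t where t: "t > 1" "Pr t > 0" using Pr_pos by blast
  \<comment> \<open>The line of slope \<open>- ln \<mu>\<close> through the value at
    \<open>t\<close> vanishes here.\<close>
  define t' where "t' = t + Pr t / ln \<mu>"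
  have ln\<mu>: "ln \<mu> > 0" using \<mu> by simp
  have tt: "t \<le> t'" using t ln\<mu> by (simp add: t'_def)
  have "Pr t' \<le> Pr t - (t' - t) * ln \<mu>" by (rule Pr_decreasing[OF t(1) tt])
  also have "\<dots> = 0" using ln\<mu> by (simp add: t'_def)
  finally have neg: "Pr t' \<le> 0" .
  \<comment> \<open>A convex function is continuous on an open interval.\<close>
  have "continuous_on {1<..} Pr" by (rule convex_on_continuous[OF _ Pr_convex]) auto
  then have "continuous_on {t..t'} Pr" by (rule continuous_on_subset) (use t in auto)
  then obtain h where "t \<le> h" "h \<le> t'" "Pr h = 0" using IVT2'[of Pr t' 0 t] neg t tt by auto
  then show ?thesis using t(1) by (intro exI[of _ h]) auto
qed

lemma Pr_strict: "1 < t \<Longrightarrow> t < t' \<Longrightarrow> Pr t' < Pr t"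
proof -
  assume a: "1 < t" "t < t'"
  have "(t' - t) * ln \<mu> > 0" using a \<mu> by simp
  then show ?thesis using Pr_decreasing[of t t'] a by linarith
qed

section \<open>Hausdorff dimension\<close>

lemma dim_upper:
  assumes t: "t > 1" and neg: "Pr t < 0"
  shows "hausdorff_measure t (radial_julia_F l c) = 0"
proof -
  \<comment> \<open>Orbits that return infinitely often to the left of \<open>X\<close>; a point
    that does not escape lies in one of these sets.\<close>
  define G where "G X = {q \<in> radial_julia_F l c. \<forall>m. \<exists>n\<ge>m. Re_cyl ((F ^^ n) q) \<le> real X}" for X
  have radK: "q \<in> Kset" if "q \<in> radial_julia_F l c" for q using that by (simp add: radial_julia_F_def julia_F_eq)
  have cover: "radial_julia_F l c = (\<Union>X. G X)"
  proof (intro equalityI subsetI)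
    fix q assume q: "q \<in> radial_julia_F l c"
    then have "\<not> filterlim (\<lambda>n. Re_cyl ((F ^^ n) q)) at_top sequentially"
      by (auto simp: radial_julia_F_def escaping_F_def)
    then obtain B where B: "\<And>m. \<exists>n\<ge>m. Re_cyl ((F ^^ n) q) < B"
      unfolding filterlim_at_top eventually_sequentially by (meson not_le)
    have "\<exists>n\<ge>m. Re_cyl ((F ^^ n) q) \<le> real (nat \<lceil>B\<rceil>)" for m
    proof -
      obtain n where "n \<ge> m" "Re_cyl ((F ^^ n) q) < B" using B by blast
      then show ?thesis using real_nat_ceiling_ge[of B] by (intro exI[of _ n]) linarith
    qed
    then show "q \<in> (\<Union>X. G X)" using q by (auto simp: G_def)
  qed (auto simp: G_def)
  have summable_b: "summable (b t)"
  proof -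
    have "eventually (\<lambda>n. ln (b t n) / real n < Pr t / 2) sequentially"
      using tendsto_Pr[OF t] by (rule order_tendstoD) (use neg in simp)
    then have "eventually (\<lambda>n. norm (b t n) \<le> exp (Pr t / 2) ^ n) sequentially"
      using eventually_gt_at_top[of 0]
    proof eventually_elim
      case (elim n)
      then have "ln (b t n) < real n * (Pr t / 2)" by (simp add: divide_less_eq mult.commute)
      then have "exp (ln (b t n)) \<le> exp (real n * (Pr t / 2))" by simp
      then show ?case using b_pos[OF t, of n] by (simp add: exp_of_nat_mult[symmetric])
    qed
    moreover have "summable (\<lambda>n. exp (Pr t / 2) ^ n)" using neg by (intro summable_geometric) simp
    ultimately show ?thesis by (rule summable_comparison_test_ev)
  qed
  obtain N where N: "\<And>z. z \<in> K \<Longrightarrow> \<exists>x. cmod (x - z) < r0 \<and> (F ^^ N) (to_cyl x) = to_cyl p0"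
    using preimages_of_p0_dense[OF r0_pos] by blast
  have "hausdorff_measure t (G X) = 0" for X
  proof -
    obtain D where D: "D > 0" "\<And>x. x \<in> Kset \<Longrightarrow> Re_cyl x \<le> real X + r0 \<Longrightarrow> dn N x \<le> D" using dn_bounded by blast
    \<comment> \<open>\<open>Dc * r0\<close> bounds the distance to the shadowing preimage times the
      derivative of order \<open>n\<close> at the centre; \<open>D * Dc\<close> bounds the
      derivative of order \<open>N + n\<close> at the preimage in terms of the former.\<close>
    define Cst where "Cst = Dc * r0 * (D * Dc)"
    have Cst: "Cst > 0" using Dc_pos r0_pos D(1) by (simp add: Cst_def)
    have dpos: "dn n y > 0" if "y \<in> (F ^^ n) -` {P0}" for n y using dn_pos Kset_preimage[OF P0_K that] by blast
    show ?thesis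
    proof (rule hausdorff_measure_0_limsup_cballs[where S = "\<lambda>n. (F ^^ n) -` {P0}" and R = "\<lambda>n y. Cst / dn n y" and a = "\<lambda>n. Cst powr t * b t n"])
      show "countable ((F ^^ n) -` {P0})" for n by (rule countable_preimages[OF P0_K])
      show "0 \<le> Cst / dn n y" if "y \<in> (F ^^ n) -` {P0}" for n y
        using dpos[OF that] Cst by simp
      show "(\<Sum>\<^sub>\<infinity>y\<in>(F ^^ n) -` {P0}. ennreal ((Cst / dn n y) powr t)) \<le> ennreal (Cst powr t * b t n)" for n
      proof -
        have "(\<Sum>\<^sub>\<infinity>y\<in>(F ^^ n) -` {P0}. ennreal ((Cst / dn n y) powr t)) = (\<Sum>\<^sub>\<infinity>y\<in>(F ^^ n) -` {P0}. ennreal (Cst powr t) * wt t n y)"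
        proof (rule infsum_cong)
          fix y assume "y \<in> (F ^^ n) -` {P0}"
          then have "(Cst / dn n y) powr t = Cst powr t * dn n y powr (- t)"
            using dpos Cst by (simp add: powr_divide powr_minus_divide)
          then show "ennreal ((Cst / dn n y) powr t) = ennreal (Cst powr t) * wt t n y" by (simp add: ennreal_mult)
        qed
        also have "\<dots> = ennreal (Cst powr t * b t n)"
          by (simp add: infsum_ennreal_cmult Z_eq[OF P0_K, symmetric] Z_P0[OF t] ennreal_mult)
        finally show ?thesis by simp
      qed
      show "summable (\<lambda>n. Cst powr t * b t n)" by (rule summable_mult[OF summable_b])
      show "\<exists>n\<ge>m. \<exists>y\<in>(F ^^ n) -` {P0}. q \<in> cball y (Cst / dn n y)" if q: "q \<in> G X" for q m
      proof -
        obtain n where n: "n \<ge> m" "Re_cyl ((F ^^ n) q) \<le> real X" using q by (auto simp: G_def)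
        obtain z where z: "to_cyl z = q" using to_cyl_surj by blast
        have zK: "z \<in> K" using q radK z by (auto simp: G_def)
        have fK: "(f ^^ n) z \<in> K" using zK F_pow_Kset_iff[of n q] z by (simp add: F_pow_to_cyl[symmetric])
        obtain x where x: "cmod (x - (f ^^ n) z) < r0" "(F ^^ N) (to_cyl x) = P0" using N[OF fK] by (auto simp: P0_def)
        obtain y where y: "(f ^^ n) y = x" "shadows n z y" using shadow_ex[OF zK, of x n] x(1) by auto
        have xK: "to_cyl x \<in> Kset" using F_pow_Kset_iff[of N "to_cyl x"] x(2) P0_K by simp
        have "Re_cyl (to_cyl x) \<le> real X + r0"
          using Re_cyl_diff_le[of "to_cyl x" "to_cyl ((f ^^ n) z)"] dist_to_cyl_le[of x "(f ^^ n) z"] x(1) n(2)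
          by (simp add: z[symmetric] F_pow_to_cyl)
        then have DN: "dn N (to_cyl x) \<le> D" by (rule D(2)[OF xK])
        have yS: "(F ^^ (N + n)) (to_cyl y) = P0" using x(2) y(1) by (simp add: funpow_add F_pow_to_cyl)
        define d where "d = cmod (deriv (f ^^ n) z)"
        have "d > 0" using dn_pos[of q n] zK z by (auto simp: d_def dn_to_cyl[symmetric])
        have dy: "dn n (to_cyl y) \<le> Dc * d" using shadow_deriv_bounds(1)[OF zK y(2)] by (simp add: dn_to_cyl d_def)
        have "dn (N + n) (to_cyl y) = dn N (to_cyl x) * dn n (to_cyl y)" using y(1) by (simp add: dn_add F_pow_to_cyl)
        also have "\<dots> \<le> D * (Dc * d)" using DN dy D(1) by (intro mult_mono) (auto simp: dn_nonneg)
        finally have dNn: "dn (N + n) (to_cyl y) \<le> D * (Dc * d)" .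
        have dp: "dn (N + n) (to_cyl y) > 0" using dpos yS by simp
        have "d * cmod (y - z) \<le> Dc * cmod (x - (f ^^ n) z)"
          using shadow_dist_bounds(2)[OF zK y(2) shadows_refl] y(1) by (simp add: d_def)
        also have "\<dots> \<le> Dc * r0" using x(1) Dc_pos by (intro mult_left_mono) auto
        finally have dd: "d * cmod (y - z) \<le> Dc * r0" .
        have "dn (N + n) (to_cyl y) * cmod (y - z) \<le> D * (Dc * d) * cmod (y - z)" using dNn by (intro mult_right_mono) auto
        also have "\<dots> = (D * Dc) * (d * cmod (y - z))" by (simp only: mult_ac)
        also have "\<dots> \<le> (D * Dc) * (Dc * r0)" using dd D(1) Dc_pos by (intro mult_left_mono) auto
        also have "\<dots> = Cst" by (simp only: Cst_def mult_ac)
        finally have "cmod (y - z) \<le> Cst / dn (N + n) (to_cyl y)" using dp by (simp add: le_divide_eq mult.commute)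
        then have "q \<in> cball (to_cyl y) (Cst / dn (N + n) (to_cyl y))" using dist_to_cyl_le[of y z] z by simp
        then show ?thesis using n(1) yS by (intro exI[of _ "N + n"]) auto
      qed
    qed (use t Cst in auto)
  qed
  then show ?thesis unfolding cover by (rule hausdorff_measure_0_UN)
qed

section \<open>Lower bound for the dimension\<close>

text \<open>Distinct translates are at least \<open>2 * pi\<close> apart, so lifts at distance at
  most 1 are already the closest ones.\<close>

lemma to_cyl_isometric: "cmod (u - v) \<le> 1 \<Longrightarrow> dist (to_cyl u) (to_cyl v) = cmod (u - v)"
proof (rule antisym[OF dist_to_cyl_le])
  assume uv: "cmod (u - v) \<le> 1"
  show "cmod (u - v) \<le> dist (to_cyl u) (to_cyl v)"
  proof (rule ccontr)
    assume "\<not> ?thesis"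
    then have "dist (to_cyl u) (to_cyl v) < cmod (u - v)" by simp
    then obtain v' where v': "to_cyl v = to_cyl v'" "cmod (u - v') < cmod (u - v)" by (rule to_cyl_lift_near)
    obtain k where k: "v' = v + per k" using v'(1) to_cyl_eqE[of v' v] by auto
    have "k \<noteq> 0" using v'(2) k by auto
    have "cmod (per k) = cmod ((u - v) - (u - v'))" using k by simp
    also have "\<dots> \<le> cmod (u - v) + cmod (u - v')" by (rule norm_triangle_ineq4)
    finally have "cmod (per k) < 2" using uv v'(2) by simp
    moreover have "cmod (per k) = 2 * pi * \<bar>real_of_int k\<bar>" by (simp add: norm_mult)
    moreover have "2 * pi * 1 \<le> 2 * pi * \<bar>real_of_int k\<bar>" using \<open>k \<noteq> 0\<close> by (intro mult_left_mono) auto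
    ultimately show False using pi_ge_two by linarith
  qed
qed

text \<open>Preimages of order \<open>n\<close> beyond \<open>X\<close> form one-step tails over the
  preimages of order \<open>n - 1\<close>, with sum at most
  \<open>q0 t / 2 * b t (n - 1) \<le> b t n / 2\<close>. The bound on the real part makes
  \<open>reach_from_p0\<close> applicable with one time \<open>N\<close>.\<close>

lemma restricted_sum_lower:
  assumes t: "t > 1"
  shows "\<exists>X. \<forall>n\<ge>1. ennreal (b t n / 2) \<le> (\<Sum>\<^sub>\<infinity>y\<in>{y \<in> (F ^^ n) -` {P0}. Re_cyl y \<le> X}. wt t n y)"
proof -
  obtain X where X: "\<And>q. q \<in> Kset \<Longrightarrow> (\<Sum>\<^sub>\<infinity>x\<in>{x \<in> F -` {q}. X \<le> Re_cyl x}. wt t 1 x) \<le> ennreal (q0 t / 2)"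
    using small_tail[OF t, of "q0 t / 2"] q0_pos[of t] by auto
  have "ennreal (b t n / 2) \<le> (\<Sum>\<^sub>\<infinity>y\<in>{y \<in> (F ^^ n) -` {P0}. Re_cyl y \<le> X}. wt t n y)" if n: "n \<ge> 1" for n
  proof -
    obtain j where j: "n = Suc j" using n by (cases n) auto
    let ?S = "{y \<in> (F ^^ n) -` {P0}. Re_cyl y \<le> X}" and ?L = "{y \<in> (F ^^ n) -` {P0}. X < Re_cyl y}"
    let ?T = "SIGMA x:(F ^^ j) -` {P0}. {y \<in> F -` {x}. X \<le> Re_cyl y}"
    have F_n: "(F ^^ n) y = (F ^^ j) (F y)" for y unfolding j by (simp add: funpow_swap1)
    have "infsum (wt t n) ?L \<le> infsum (\<lambda>(x, y). wt t j x * wt t 1 y) ?T"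
    proof (rule infsum_ennreal_inj_le[where \<phi> = "\<lambda>y. (F y, y)"])
      show "wt t n y \<le> (\<lambda>(x, y). wt t j x * wt t 1 y) (F y, y)" for y
        using dn_add[of j 1 y] by (simp add: j powr_mult ennreal_mult[symmetric] dn_nonneg)
    qed (auto simp: F_n inj_on_def)
    also have "\<dots> = (\<Sum>\<^sub>\<infinity>x\<in>(F ^^ j) -` {P0}. wt t j x * (\<Sum>\<^sub>\<infinity>y\<in>{y \<in> F -` {x}. X \<le> Re_cyl y}. wt t 1 y))"
      unfolding infsum_ennreal_Sigma by (simp add: infsum_ennreal_cmult)
    also have "\<dots> \<le> (\<Sum>\<^sub>\<infinity>x\<in>(F ^^ j) -` {P0}. ennreal (q0 t / 2) * wt t j x)"
    proof (rule infsum_ennreal_mono)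
      fix x assume "x \<in> (F ^^ j) -` {P0}"
      then have "x \<in> Kset" by (rule Kset_preimage[OF P0_K])
      from mult_right_mono[OF X[OF this], of "wt t j x"]
      show "wt t j x * (\<Sum>\<^sub>\<infinity>y\<in>{y \<in> F -` {x}. X \<le> Re_cyl y}. wt t 1 y) \<le> ennreal (q0 t / 2) * wt t j x"
        by (simp add: mult.commute)
    qed auto
    also have "\<dots> = ennreal (q0 t / 2) * ennreal (b t j)"
      by (simp add: infsum_ennreal_cmult Z_eq[OF P0_K, symmetric] Z_P0[OF t])
    also have "\<dots> = ennreal (q0 t / 2 * b t j)" using q0_pos[of t] by (intro ennreal_mult[symmetric]) auto
    also have "\<dots> \<le> ennreal (b t n / 2)" using b_Suc[OF t, of j] by (intro ennreal_leI) (simp add: j)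
    finally have L: "infsum (wt t n) ?L \<le> ennreal (b t n / 2)" .
    have "ennreal (b t n) = infsum (wt t n) ((F ^^ n) -` {P0})" using Z_P0[OF t] Z_eq[OF P0_K] by metis
    also have "(F ^^ n) -` {P0} = ?S \<union> ?L" by auto
    also have "infsum (wt t n) (?S \<union> ?L) = infsum (wt t n) ?S + infsum (wt t n) ?L"
      by (rule infsum_Un_disjoint) auto
    also have "\<dots> \<le> infsum (wt t n) ?S + ennreal (b t n / 2)" using L by (rule add_left_mono)
    finally have le: "ennreal (b t n) \<le> infsum (wt t n) ?S + ennreal (b t n / 2)" .
    show ?thesis
    proof (cases "infsum (wt t n) ?S")
      case (real y)
      have "b t n \<le> y + b t n / 2"
        using le unfolding real(2) by (subst (asm) ennreal_plus[symmetric]) (use real(1) in \<open>auto simp: ennreal_le_iff simp del: ennreal_plus\<close>)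
      then show ?thesis unfolding real(2) by (intro ennreal_leI) simp
    qed simp
  qed
  then show ?thesis by blast
qed

lemma inverse_branch:
  assumes "x \<in> K" "(f ^^ m) x = p0 + per k" "r \<le> r0"
  shows "\<exists>h. \<forall>u\<in>cball p0 r. (f ^^ m) (h u) = u + per k \<and> shadows m x (h u)"
proof -
  have "\<exists>y. (f ^^ m) y = u + per k \<and> shadows m x y" if "u \<in> cball p0 r" for u
  proof -
    have "cmod (u + per k - (f ^^ m) x) \<le> r0" using that assms(2,3) by (simp add: dist_norm norm_minus_commute)
    then show ?thesis using shadow_ex[OF assms(1)] by blast
  qed
  then show ?thesis by (intro bchoice) blast
qed

text \<open>\<open>A\<close> is forward invariant, so one visit would exclude all later returns near
  \<open>p0\<close>; hence the orbit is never trapped. The returns also prevent escape.\<close>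

lemma returning_in_radial:
  assumes m: "m \<ge> 1" and ret: "\<And>n. \<exists>w. cmod (w - p0) \<le> r \<and> (F ^^ (m * n)) q = to_cyl w" and r: "r < \<epsilon>"
  shows "q \<in> radial_julia_F l c"
proof -
  have notA: "to_cyl w \<notin> A" if "cmod (w - p0) \<le> r" for w
    using K_margin[OF p0(2), of w] that r by (simp add: U_def norm_minus_commute)
  have "(F ^^ j) q \<notin> A" for j
  proof
    assume a: "(F ^^ j) q \<in> A"
    have "(F ^^ (i + j)) q \<in> A" for i by (induction i) (use a F_A in auto)
    moreover have "m * j = (m * j - j) + j" using m by simp
    ultimately have "(F ^^ (m * j)) q \<in> A" by metis
    then show False using ret[of j] notA by metis
  qed
  then have "q \<in> julia_F l c" by (simp add: julia_F_eq Kset_def)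
  moreover have "\<not> filterlim (\<lambda>n. Re_cyl ((F ^^ n) q)) at_top sequentially"
  proof
    assume "filterlim (\<lambda>n. Re_cyl ((F ^^ n) q)) at_top sequentially"
    then obtain j where j: "\<And>n. n \<ge> j \<Longrightarrow> Re p0 + r + 1 \<le> Re_cyl ((F ^^ n) q)"
      unfolding filterlim_at_top eventually_sequentially by blast
    obtain w where w: "cmod (w - p0) \<le> r" "(F ^^ (m * j)) q = to_cyl w" using ret by blast
    have "Re p0 + r + 1 \<le> Re w" using j[of "m * j"] m w(2) by simp
    then show False using abs_Re_le_cmod[of "w - p0"] w(1) by simp
  qed
  ultimately show ?thesis by (simp add: radial_julia_F_def escaping_F_def)
qed

lemma dim_lower:
  assumes t: "t > 1" and pos: "Pr t > 0"
  shows "hausdorff_measure t (radial_julia_F l c) \<noteq> 0"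
proof
  assume null: "hausdorff_measure t (radial_julia_F l c) = 0"
  \<comment> \<open>The bounds serve shadowing, the distance from \<open>A\<close>, and the isometry
    of \<open>to_cyl\<close> on the disc.\<close>
  define r where "r = min (min r0 (\<epsilon> / 2)) (1 / 4)"
  have r: "r > 0" "r \<le> r0" "r < \<epsilon>" "r \<le> 1 / 4" using r0_pos \<epsilon>(1) by (auto simp: r_def)
  let ?X = "cball p0 r"
  obtain X where X: "\<And>n. n \<ge> 1 \<Longrightarrow> ennreal (b t n / 2) \<le> (\<Sum>\<^sub>\<infinity>y\<in>{y \<in> (F ^^ n) -` {P0}. Re_cyl y \<le> X}. wt t n y)"
    using restricted_sum_lower[OF t] by blast
  obtain N where N: "\<And>y. y \<in> K \<Longrightarrow> Re y \<le> X \<Longrightarrow> \<exists>x. cmod (x - p0) < r / 2 \<and> (F ^^ N) (to_cyl x) = to_cyl y"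
    using reach_from_p0[of "r / 2" X] r(1) by auto
  obtain D where D: "D > 0" "\<And>x. x \<in> Kset \<Longrightarrow> Re_cyl x \<le> Re p0 + 1 \<Longrightarrow> dn N x \<le> D" using dn_bounded by blast
  \<comment> \<open>What is lost by distortion and by the \<open>N\<close> steps that lead from near
    \<open>p0\<close> to a preimage.\<close>
  define B where "B = (Dc * D) powr t"
  have "B > 0" using Dc_pos D(1) by (simp add: B_def)
  \<comment> \<open>The last three conditions yield a power sum of at least 1, ratios below 1, and
    images of the disc that stay inside it.\<close>
  have "eventually (\<lambda>n. n \<ge> 1 \<and> 2 * B < b t n \<and> 1 < \<epsilon> / T * \<mu> ^ n \<and> \<eta> / 4 * \<theta> ^ n < r / 2) sequentially"
  proof (intro eventually_conj)
    show "eventually (\<lambda>n. n \<ge> (1::nat)) sequentially" by (rule eventually_ge_at_top)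
    have "eventually (\<lambda>n. Pr t / 2 < ln (b t n) / real n) sequentially"
      using tendsto_Pr[OF t] by (rule order_tendstoD) (use pos in simp)
    moreover have "eventually (\<lambda>n. ln (2 * B) / (Pr t / 2) \<le> real n) sequentially"
      using filterlim_real_sequentially unfolding filterlim_at_top by blast
    ultimately show "eventually (\<lambda>n. 2 * B < b t n) sequentially"
      using eventually_gt_at_top[of 0]
    proof eventually_elim
      case (elim n)
      then have "ln (2 * B) \<le> real n * (Pr t / 2)" using pos by (simp add: divide_le_eq)
      also have "\<dots> < ln (b t n)" using elim by (simp add: less_divide_eq mult.commute)
      finally show ?case using \<open>B > 0\<close> b_pos[OF t, of n] by (simp add: ln_less_cancel_iff)
    qed
    obtain n0 where n0: "T / \<epsilon> < \<mu> ^ n0" using real_arch_pow[OF \<mu>] by blast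
    show "eventually (\<lambda>n. 1 < \<epsilon> / T * \<mu> ^ n) sequentially"
    proof (rule eventually_sequentiallyI[of n0])
      fix n assume "n0 \<le> n"
      then have "\<mu> ^ n0 \<le> \<mu> ^ n" using \<mu> by (intro power_increasing) auto
      then have "T / \<epsilon> < \<mu> ^ n" using n0 by simp
      have "1 = \<epsilon> / T * (T / \<epsilon>)" using T_pos \<epsilon>(1) by simp
      also have "\<dots> < \<epsilon> / T * \<mu> ^ n" using \<open>T / \<epsilon> < \<mu> ^ n\<close> T_pos \<epsilon>(1) by (intro mult_strict_left_mono) auto
      finally show "1 < \<epsilon> / T * \<mu> ^ n" .
    qed
    have "(\<lambda>n. \<eta> / 4 * \<theta> ^ n) \<longlonglongrightarrow> \<eta> / 4 * 0" using \<theta> by (intro tendsto_mult tendsto_const LIMSEQ_realpow_zero) auto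
    then show "eventually (\<lambda>n. \<eta> / 4 * \<theta> ^ n < r / 2) sequentially" by (rule order_tendstoD) (use r in simp)
  qed
  then obtain n where n: "n \<ge> 1" "2 * B < b t n" "1 < \<epsilon> / T * \<mu> ^ n" "\<eta> / 4 * \<theta> ^ n < r / 2"
    unfolding eventually_sequentially by blast
  \<comment> \<open>A branch starts near \<open>p0\<close>, reaches the preimage after
    \<open>N\<close> steps and \<open>P0\<close> after \<open>n\<close> more.\<close>
  define m where "m = n + N"
  define Y where "Y = {y \<in> (F ^^ n) -` {P0}. Re_cyl y \<le> X}"
  have "ennreal B < ennreal (b t n / 2)" using n(2) \<open>B > 0\<close> by (intro ennreal_lessI) auto
  also have "\<dots> \<le> infsum (wt t n) Y" using X[OF n(1)] by (simp add: Y_def)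
  also have "\<dots> = (SUP I\<in>{I. finite I \<and> I \<subseteq> Y}. sum (wt t n) I)" by (rule nonneg_infsum_complete) simp
  finally obtain I where I: "finite I" "I \<subseteq> Y" "ennreal B < sum (wt t n) I" unfolding less_SUP_iff by blast
  have IB: "B \<le> (\<Sum>i\<in>I. dn n i powr (- t))"
  proof -
    have "sum (wt t n) I = ennreal (\<Sum>i\<in>I. dn n i powr (- t))" by (rule sum_ennreal) simp
    then show ?thesis using I(3) \<open>B > 0\<close> by (auto simp: ennreal_less_iff)
  qed
  define Q where "Q i x k h \<longleftrightarrow> x \<in> K \<and> cmod (x - p0) < r / 2 \<and> (F ^^ N) (to_cyl x) = i \<and> (f ^^ m) x = p0 + per k \<and>
      (\<forall>u\<in>?X. (f ^^ m) (h u) = u + per k \<and> shadows m x (h u))" for i x k h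
  have "\<exists>x k h. Q i x k h" if i: "i \<in> I" for i
  proof -
    obtain z where z: "to_cyl z = i" using to_cyl_surj by blast
    have iY: "(F ^^ n) i = P0" "Re_cyl i \<le> X" using i I(2) by (auto simp: Y_def)
    have iK: "i \<in> Kset" using F_pow_Kset_iff[of n i] iY(1) P0_K by simp
    then obtain x where x: "cmod (x - p0) < r / 2" "(F ^^ N) (to_cyl x) = i" using N[of z] iY(2) z by auto
    have xK: "x \<in> K" using F_pow_Kset_iff[of N "to_cyl x"] x(2) iK by simp
    have "to_cyl ((f ^^ m) x) = (F ^^ n) ((F ^^ N) (to_cyl x))" by (simp add: m_def F_pow_to_cyl[symmetric] funpow_add)
    then have "to_cyl ((f ^^ m) x) = to_cyl p0" using iY(1) x(2) by (simp add: P0_def)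
    then obtain k where k: "(f ^^ m) x = p0 + per k" using to_cyl_eqE by blast
    obtain h where "\<forall>u\<in>?X. (f ^^ m) (h u) = u + per k \<and> shadows m x (h u)" using inverse_branch[OF xK k r(2)] by blast
    then show ?thesis using xK x k unfolding Q_def by blast
  qed
  then obtain x k h where xkh: "\<And>i. i \<in> I \<Longrightarrow> Q i (x i) (k i) (h i)" by metis
  have xK: "x i \<in> K" and xp: "cmod (x i - p0) < r / 2" and FN: "(F ^^ N) (to_cyl (x i)) = i" and fx: "(f ^^ m) (x i) = p0 + per (k i)"
    if "i \<in> I" for i using xkh[OF that] unfolding Q_def by blast+
  have fh: "(f ^^ m) (h i u) = u + per (k i)" and sh: "shadows m (x i) (h i u)" if "i \<in> I" "u \<in> ?X" for i u
    using xkh[OF that(1)] that(2) unfolding Q_def by blast+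
  define d where "d i = dn m (to_cyl (x i))" for i
  define \<rho> where "\<rho> i = 1 / (Dc * d i)" for i
  have d1: "d i > 1" if "i \<in> I" for i
  proof -
    have "\<mu> ^ n \<le> \<mu> ^ m" using \<mu> by (intro power_increasing) (auto simp: m_def)
    then have "\<epsilon> / T * \<mu> ^ n \<le> \<epsilon> / T * \<mu> ^ m" using T_pos \<epsilon>(1) by (intro mult_left_mono) auto
    then show ?thesis using n(3) dn_expand[of "to_cyl (x i)" m] xK[OF that] by (simp add: d_def)
  qed
  have dcm: "cmod (deriv (f ^^ m) (x i)) = d i" for i by (simp add: d_def dn_to_cyl)
  have hdiff: "(f ^^ m) (h i u) - (f ^^ m) (h i v) = u - v" if "i \<in> I" "u \<in> ?X" "v \<in> ?X" for i u v
    using fh that by simp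
  have hX: "h i ` ?X \<subseteq> ?X" if i: "i \<in> I" for i
  proof
    fix v assume "v \<in> h i ` ?X"
    then obtain u where u: "u \<in> ?X" "v = h i u" by blast
    have "cmod ((f ^^ 0) v - (f ^^ 0) (x i)) \<le> \<eta> / 4 * \<theta> ^ (m - 0)" using sh[OF i u(1)] u(2) unfolding shadows_def by blast
    also have "\<theta> ^ (m - 0) \<le> \<theta> ^ n" using \<theta> by (intro power_decreasing) (auto simp: m_def)
    finally have "cmod (v - x i) \<le> \<eta> / 4 * \<theta> ^ n" using \<eta>(1) by simp
    then have "cmod (v - x i) < r / 2" using n(4) by (rule le_less_trans)
    then have "cmod (v - p0) \<le> r" using norm_triangle_ineq[of "v - x i" "x i - p0"] xp[OF i] by simp
    then show "v \<in> ?X" by (simp add: dist_norm norm_minus_commute)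
  qed
  obtain \<kappa>0 where \<kappa>0: "\<kappa>0 > 0"
    "\<And>V :: nat \<Rightarrow> complex set. ifs_limit I h ?X \<subseteq> (\<Union>i. V i) \<Longrightarrow> (\<And>i. bounded (V i)) \<Longrightarrow>
        ennreal \<kappa>0 \<le> (\<Sum>i. ennreal (diameter (V i) powr t))"
  proof (rule ifs_cover_lower_bound[of I ?X h \<rho> t])
    show "finite I" by (rule I(1))
    show "compact ?X" by simp
    show "?X \<noteq> {}" using r(1) by simp
    show "h i ` ?X \<subseteq> ?X" if "i \<in> I" for i by (rule hX[OF that])
    show "continuous_on ?X (h i)" if i: "i \<in> I" for i
    proof (rule lipschitz_on_continuous_on[OF lipschitz_onI])
      fix u v assume uv: "u \<in> ?X" "v \<in> ?X"
      have "d i * cmod (h i u - h i v) \<le> Dc * cmod (u - v)"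
        using shadow_dist_bounds(2)[OF xK[OF i] sh[OF i uv(1)] sh[OF i uv(2)]] unfolding hdiff[OF i uv] dcm .
      moreover have "1 * cmod (h i u - h i v) \<le> d i * cmod (h i u - h i v)" using d1[OF i] by (intro mult_right_mono) auto
      ultimately show "dist (h i u) (h i v) \<le> Dc * dist u v" by (simp add: dist_norm)
    qed (use Dc_pos in simp)
    show "\<rho> i * dist u v \<le> dist (h i u) (h i v)" if i: "i \<in> I" and uv: "u \<in> ?X" "v \<in> ?X" for i u v
    proof -
      have "cmod (u - v) \<le> Dc * d i * cmod (h i u - h i v)"
        using shadow_dist_bounds(1)[OF xK[OF i] sh[OF i uv(1)] sh[OF i uv(2)]] unfolding hdiff[OF i uv] dcm .
      moreover have "Dc * d i > 0" using Dc_pos d1[OF i] by simp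
      ultimately show ?thesis by (simp add: \<rho>_def dist_norm divide_le_eq mult.commute)
    qed
    show "h i ` ?X \<inter> h j ` ?X = {}" if ij: "i \<in> I" "j \<in> I" "i \<noteq> j" for i j
    proof (rule ccontr)
      assume "\<not> ?thesis"
      then obtain u v where uv: "u \<in> ?X" "v \<in> ?X" "h i u = h j v" by blast
      have "u + per (k i) = v + per (k j)" using fh[OF ij(1) uv(1)] fh[OF ij(2) uv(2)] uv(3) by simp
      then have "to_cyl u = to_cyl v" by (metis to_cyl_per)
      moreover have "cmod (u - v) \<le> 1"
        using uv(1,2) r(4) norm_triangle_ineq4[of "u - p0" "v - p0"] by (simp add: dist_norm norm_minus_commute)
      ultimately have "u = v" using to_cyl_isometric[of u v] by simp
      \<comment> \<open>As \<open>u = v\<close>, both translations agree, so \<open>x i\<close> and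
        \<open>x j\<close> have the same image and are shadowed by the same point.\<close>
      then have "(f ^^ m) (x i) = (f ^^ m) (x j)" using fx[OF ij(1)] fx[OF ij(2)] \<open>u + per (k i) = v + per (k j)\<close> by simp
      then have "x i = x j" using shadows_unique[OF xK[OF ij(1)] sh[OF ij(1) uv(1)], of "x j"] sh[OF ij(2) uv(2)] uv(3) by simp
      then show False using FN[OF ij(1)] FN[OF ij(2)] ij(3) by simp
    qed
    show "0 < \<rho> i" "\<rho> i < 1" if "i \<in> I" for i
    proof -
      have "1 * 1 < Dc * d i" using Dc_ge d1[OF that] by (intro mult_le_less_imp_less) auto
      then show "0 < \<rho> i" "\<rho> i < 1" by (auto simp: \<rho>_def)
    qed
    show "0 < t" using t by simp
    show "1 \<le> (\<Sum>i\<in>I. \<rho> i powr t)"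
    proof -
      have "dn n i powr (- t) / B \<le> \<rho> i powr t" if i: "i \<in> I" for i
      proof -
        have xKs: "to_cyl (x i) \<in> Kset" using xK[OF i] by simp
        have "\<bar>Re (x i - p0)\<bar> \<le> cmod (x i - p0)" by (rule abs_Re_le_cmod)
        then have "Re_cyl (to_cyl (x i)) \<le> Re p0 + 1" using xp[OF i] r(4) by simp
        then have "dn N (to_cyl (x i)) \<le> D" using D(2)[OF xKs] by blast
        moreover have "d i = dn n i * dn N (to_cyl (x i))" using FN[OF i] by (simp add: d_def m_def dn_add)
        ultimately have "d i \<le> dn n i * D" using dn_nonneg[of n i] by (simp add: mult_left_mono)
        then have "Dc * d i \<le> Dc * D * dn n i" using Dc_pos by (simp add: mult_ac)
        moreover have "0 < Dc * d i" using Dc_pos d1[OF i] by simp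
        ultimately have "(Dc * D * dn n i) powr (- t) \<le> (Dc * d i) powr (- t)" using t by (intro powr_mono2') auto
        moreover have "(Dc * D * dn n i) powr (- t) = dn n i powr (- t) / B"
          using Dc_pos D(1) dn_nonneg[of n i] by (simp add: B_def powr_mult powr_minus_divide)
        moreover have "(Dc * d i) powr (- t) = \<rho> i powr t"
          using \<open>0 < Dc * d i\<close> by (simp add: \<rho>_def powr_minus_divide powr_divide)
        ultimately show ?thesis by simp
      qed
      then have "(\<Sum>i\<in>I. dn n i powr (- t) / B) \<le> (\<Sum>i\<in>I. \<rho> i powr t)" by (rule sum_mono)
      moreover have "1 \<le> (\<Sum>i\<in>I. dn n i powr (- t)) / B" using IB \<open>B > 0\<close> by simp
      ultimately show ?thesis by (simp add: sum_divide_distrib)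
    qed
    fix \<kappa>1 :: real assume "\<kappa>1 > 0" "\<And>V :: nat \<Rightarrow> complex set. ifs_limit I h ?X \<subseteq> (\<Union>i. V i) \<Longrightarrow> (\<And>i. bounded (V i)) \<Longrightarrow>
        ennreal \<kappa>1 \<le> (\<Sum>i. ennreal (diameter (V i) powr t))"
    then show thesis by (rule that)
  qed
  \<comment> \<open>Each letter is undone by \<open>m\<close> steps of \<open>F\<close>, so a coded
    point visits the disc at every multiple of \<open>m\<close>.\<close>
  have return: "(F ^^ (m * j)) (to_cyl (word_map h \<xi> j w)) = to_cyl w" if "\<And>i. \<xi> i \<in> I" "w \<in> ?X" for \<xi> j w
    using that(2)
  proof (induction j arbitrary: w)
    case (Suc j)
    have hw: "h (\<xi> j) w \<in> ?X" using hX[OF that(1)[of j]] Suc.prems by blast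
    have "(F ^^ (m * Suc j)) (to_cyl (word_map h \<xi> (Suc j) w)) = (F ^^ m) (to_cyl (h (\<xi> j) w))"
      using Suc.IH[OF hw] by (simp add: funpow_add)
    also have "\<dots> = to_cyl w" using fh[OF that(1)[of j] Suc.prems] by (simp add: F_pow_to_cyl)
    finally show ?case .
  qed simp
  have limit: "to_cyl u \<in> radial_julia_F l c" if u: "u \<in> ifs_limit I h ?X" for u
  proof (rule returning_in_radial[where m = m and r = r])
    obtain \<xi> where \<xi>: "\<And>i. \<xi> i \<in> I" "\<And>j. u \<in> word_map h \<xi> j ` ?X" using u by (auto simp: ifs_limit_def)
    show "\<exists>w. cmod (w - p0) \<le> r \<and> (F ^^ (m * j)) (to_cyl u) = to_cyl w" for j
    proof -
      obtain w where "w \<in> ?X" "u = word_map h \<xi> j w" using \<xi>(2) by blast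
      then show ?thesis using return[OF \<xi>(1)] by (intro exI[of _ w]) (auto simp: dist_norm norm_minus_commute)
    qed
  qed (use r n(1) in \<open>auto simp: m_def\<close>)
  have limX: "ifs_limit I h ?X \<subseteq> ?X"
  proof
    fix u assume "u \<in> ifs_limit I h ?X"
    then obtain \<xi> where "u \<in> word_map h \<xi> 0 ` ?X" unfolding ifs_limit_def by blast
    then show "u \<in> ?X" by simp
  qed
  obtain W where W: "radial_julia_F l c \<subseteq> (\<Union>i::nat. W i)" "\<And>i. bounded (W i)"
    "(\<Sum>i. ennreal (diameter (W i) powr t)) < ennreal \<kappa>0"
    using hausdorff_measure_0D[OF null zero_less_one \<kappa>0(1)] by blast
  \<comment> \<open>The cover is pulled back to the plane; \<open>to_cyl\<close> is isometric on the
    disc, so diameters do not grow.\<close>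
  define V where "V i = {u \<in> ?X. to_cyl u \<in> W i}" for i
  have "ennreal \<kappa>0 \<le> (\<Sum>i. ennreal (diameter (V i) powr t))"
  proof (rule \<kappa>0(2))
    show "ifs_limit I h ?X \<subseteq> (\<Union>i. V i)" using limX limit W(1) by (fastforce simp: V_def)
    show "bounded (V i)" for i by (rule bounded_subset[OF bounded_cball[of p0 r]]) (auto simp: V_def)
  qed
  also have "\<dots> \<le> (\<Sum>i. ennreal (diameter (W i) powr t))"
  proof (intro suminf_le summableI ennreal_leI powr_mono2)
    fix i
    show "diameter (V i) \<le> diameter (W i)"
    proof (rule diameter_le)
      show "V i \<noteq> {} \<or> 0 \<le> diameter (W i)" using diameter_ge_0[OF W(2)] by blast
      fix u v assume uv: "u \<in> V i" "v \<in> V i"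
      have "cmod (u - v) \<le> 1"
        using uv r(4) norm_triangle_ineq4[of "u - p0" "v - p0"] by (simp add: V_def dist_norm norm_minus_commute)
      then have "norm (u - v) = dist (to_cyl u) (to_cyl v)" by (rule to_cyl_isometric[symmetric])
      also have "\<dots> \<le> diameter (W i)" using uv by (intro diameter_bounded_bound W(2)) (auto simp: V_def)
      finally show "norm (u - v) \<le> diameter (W i)" .
    qed
    show "0 \<le> diameter (V i)" by (rule diameter_ge_0[OF bounded_subset[OF bounded_cball[of p0 r]]]) (auto simp: V_def)
  qed (use t in auto)
  finally show False using W(3) by simp
qed

lemma radial_dimension:
  assumes h: "1 < h" "Pr h = 0"
  shows "hausdorff_dim (radial_julia_F l c) = ereal h"
  unfolding hausdorff_dim_def
proof (rule antisym)
  show "Inf {ereal s |s. 0 < s \<and> hausdorff_measure s (radial_julia_F l c) = 0} \<le> ereal h"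
  proof (rule ereal_le_epsilon2)
    fix e :: real assume e: "0 < e"
    have "Pr (h + e) < 0" using Pr_strict[of h "h + e"] h e by simp
    then have "hausdorff_measure (h + e) (radial_julia_F l c) = 0" using h e by (intro dim_upper) auto
    then have "ereal (h + e) \<in> {ereal s |s. 0 < s \<and> hausdorff_measure s (radial_julia_F l c) = 0}" using h e by auto
    from Inf_lower[OF this] show "Inf {ereal s |s. 0 < s \<and> hausdorff_measure s (radial_julia_F l c) = 0} \<le> ereal h + ereal e" by simp
  qed
  show "ereal h \<le> Inf {ereal s |s. 0 < s \<and> hausdorff_measure s (radial_julia_F l c) = 0}"
  proof (rule Inf_greatest)
    fix x assume "x \<in> {ereal s |s. 0 < s \<and> hausdorff_measure s (radial_julia_F l c) = 0}"
    then obtain a where a: "x = ereal a" "hausdorff_measure a (radial_julia_F l c) = 0" by blast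
    have "h \<le> a"
    proof (rule ccontr)
      assume "\<not> h \<le> a"
      \<comment> \<open>\<open>a\<close> may be at most 1, where \<open>dim_lower\<close> does not
        apply; null measure passes on to the larger exponent \<open>t\<close> between 1 and
        \<open>h\<close>.\<close>
      then have "max a 1 < h" using h by simp
      then obtain t where t: "max a 1 < t" "t < h" using dense by blast
      have "Pr t > 0" using Pr_strict[of t h] t h by simp
      moreover have "hausdorff_measure t (radial_julia_F l c) = 0" using t by (intro hausdorff_measure_0_mono[OF a(2)]) simp
      ultimately show False using dim_lower[of t] t by simp
    qed
    then show "ereal h \<le> x" by (simp add: a(1))
  qed
qed

end

theorem theorem8:
  fixes l :: nat and c :: complex
  assumes "2 \<le> l" and "c \<in> ball (of_nat l) 1"
  shows "\<exists>h::real. hausdorff_dim (radial_julia_F l c) = ereal h \<and>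
           1 < h \<and> pressure l c h = 0 \<and>
           (\<forall>t>1. pressure l c t = 0 \<longrightarrow> t = h)"
proof -
  interpret fatou_map l c by (rule fatou_map.intro) (use assms in auto)
  obtain \<delta> where \<delta>: "\<delta> > 0" "\<forall>x\<in>K. \<delta> \<le> cmod (of_nat l - exp x)" using K_far_from_crit by blast
  obtain \<mu> T \<sigma> where e: "1 < \<mu>"
    "\<forall>x\<in>K. \<epsilon> \<le> \<sigma> x \<and> \<sigma> x \<le> T \<and> \<mu> * \<sigma> (f x) \<le> cmod (of_nat l - exp x) * \<sigma> x"
    using expanding_metric_ex by blast
  \<comment> \<open>The maximum secures \<open>T_ge\<close> and preserves the bounds on
    \<open>\<sigma>\<close>.\<close>
  interpret fatou_expanding l c \<delta> \<mu> "max T \<epsilon>" \<sigma>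
    by unfold_locales (use \<delta> e in \<open>auto simp: le_max_iff_disj\<close>)
  obtain h where h: "1 < h" "Pr h = 0" using Pr_zero by blast
  have "t = h" if "t > 1" "pressure l c t = 0" for t
  proof (rule linorder_cases[of t h])
    have "Pr t = 0" using pressure_eq[OF that(1)] that(2) by simp
    then show "t < h \<Longrightarrow> t = h" "h < t \<Longrightarrow> t = h" using Pr_strict[of t h] Pr_strict[of h t] that(1) h by auto
  qed
  moreover have "pressure l c h = 0" using pressure_eq[OF h(1)] h(2) by simp
  ultimately show ?thesis using radial_dimension[OF h] h(1) by blast
qed

end
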